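(* Consider the following two schemes. (GLe) Find $U_h\in Q_h^{p_t}(Q_T)$ such that $U_h(\cdot,0)=U_{0,h_x}$ in $\Omega$ and $$-(\partial_tU_h,\partial_tW_h)_{L^2(Q_T)}+(c^2\nabla_xU_h,\nabla_xW_h)_{\mathrm{GLe}}+(g(U_h),W_h)_{\mathrm{GLe}}=(F,W_h)_{\mathrm{GLe}}+(V_{0,h_x},W_h(\cdot,0))_{L^2(\Omega)}$$ for all $W_h\in Q_{h,\bullet,0}^{p_t}(Q_T)$. (GLo) Find $U_h\in Q_h^{p_t}(Q_T)$ such that $U_h(\cdot,0)=U_{0,h_x}$ in $\Omega$ and $$-(\partial_tU_h,\partial_tW_h)_{L^2(Q_T)}+(c^2\nabla_xU_h,\nabla_xW_h)_{\mathrm{GLo}}+(g(U_h),W_h)_{\mathrm{GLo}}=(F,W_h)_{\mathrm{GLo}}+(V_{0,h_x},W_h(\cdot,0))_{L^2(\Omega)}$$ for all $W_h\in Q_{h,\bullet,0}^{p_t}(Q_T)$. Then (GLe) and (GLo) are equivalent, respectively, to the Gauss–Legendre and the pair Lobatto IIIA/IIIB Runge–Kutta time discretizations applied to the first-order-in-time formulation of the semilinear wave equation, semi-discretized in space with $S_{h_x}(\Omega)$. Therefore, both schemes are symplectic.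
   Context: Setting. $\Omega\subset\mathbb R^d$ ($d=1,2,3$) is a polytopal Lipschitz domain, $T>0$ is a finite time, $Q_T=\Omega\times(0,T)$, $c\in C(\overline\Omega)$ with $c(x)\ge c_0>0$ for all $x\in\Omega$, $U_0\in H^1_0(\Omega)$, $V_0\in L^2(\Omega)$, $F\in C([0,T];L^2(\Omega))$, and $g:\mathbb R\to\mathbb R$ is a nonlinear term with $g(0)=0$. The semilinear wave equation is $\partial_t^2U-\mathrm{div}_x(c^2\nabla_xU)+g(U)=F$ in $Q_T$, $U=0$ on $\partial\Omega\times(0,T)$, $U(\cdot,0)=U_0$, $\partial_tU(\cdot,0)=V_0$ in $\Omega$. Its first-order-in-time formulation is $\partial_tU-V=0$, $\partial_tV-\mathrm{div}_x(c^2\nabla_xU)+g(U)=F$ in $Q_T$, $U=0$ on $\partial\Omega\times(0,T)$, $U(\cdot,0)=U_0$, $V(\cdot,0)=V_0$ in $\Omega$. Spaces. $S_{h_x}(\Omega)\subset H^1_0(\Omega)$ is a space of piecewise polynomial functions of degree at most $p_x\ge1$ on a shape-regular, conforming simplicial mesh of $\Omega$ with mesh size $h_x$. For nodes $0=t_0<\dots<t_{N_t}=T$ and an integer $p_t\ge1$, $S_{h_t}^{p_t}(0,T)$ is the space of continuous piecewise polynomials of degree $p_t$ on this mesh (i.e. of degree at most $p_t$ on each $[t_{n-1},t_n]$), and $S_{h_t,\bullet,0}^{p_t}(0,T)$ is its subspace of functions vanishing at $T$. $Q_h^{p_t}(Q_T)=S_{h_x}(\Omega)\otimes S_{h_t}^{p_t}(0,T)$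 and $Q_{h,\bullet,0}^{p_t}(Q_T)=S_{h_x}(\Omega)\otimes S_{h_t,\bullet,0}^{p_t}(0,T)$. The functions $U_{0,h_x},V_{0,h_x}\in S_{h_x}(\Omega)$ satisfy $(c^2\nabla_xU_{0,h_x},\nabla_xW)_{L^2(\Omega)}=(c^2\nabla_xU_0,\nabla_xW)_{L^2(\Omega)}$ and $(V_{0,h_x},W)_{L^2(\Omega)}=(V_0,W)_{L^2(\Omega)}$ for all $W\in S_{h_x}(\Omega)$. Quadrature. $(\cdot,\cdot)_{\mathrm{GLe}}$ (resp. $(\cdot,\cdot)_{\mathrm{GLo}}$) denotes the $L^2(Q_T)$ inner product computed by means of the quadrature rule in time with $p_t$ Gauss–Legendre nodes (resp. $p_t+1$ Gauss–Lobatto nodes) in each time slab $[t_{n-1},t_n]$. Space semi-discretization. The first-order system semi-discretized in space is: $u(t),v(t)\in S_{h_x}(\Omega)$, $\dot u=v$, $(\dot v,\lambda)_{L^2(\Omega)}+(c^2\nabla_xu,\nabla_x\lambda)_{L^2(\Omega)}+(g(u),\lambda)_{L^2(\Omega)}=(F(\cdot,t),\lambda)_{L^2(\Omega)}$ for all $\lambda\in S_{h_x}(\Omega)$, $u(0)=U_{0,h_x}$, $v(0)=V_{0,h_x}$. Runge–Kutta methods. Let $h_t^{(n)}=t_n-t_{n-1}$. The Gauss–Legendre Runge–Kutta method with $m$ points for $\dot y=\Phi(t,y)$ is: given $y_{n-1}$, seek a polynomial $q_n$ (with vector coefficients) of degree $m$ with $q_n(t_{n-1})=y_{n-1}$ and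 $\dot q_n(t_{n-1}+c_jh_t^{(n)})=\Phi(t_{n-1}+c_jh_t^{(n)},q_n(t_{n-1}+c_jh_t^{(n)}))$, $j=1,\dots,m$, where $c_j$ are the nodes of the $m$-point Gauss–Legendre quadrature on $[0,1]$; then set $y_n=q_n(t_n)$. The Lobatto IIIA/IIIB pair for a partitioned system $\dot y=f(z,t)$, $\dot z=k(y,t)$, in discontinuous collocation form, is: let $c_0,\dots,c_{p_t}$ and $\omega_0,\dots,\omega_{p_t}$ be the Gauss–Lobatto nodes and weights on $[0,1]$ and $t_n^i=t_{n-1}+c_ih_t^{(n)}$; given $y^{n-1},z^{n-1}$, find polynomials $u$ of degree at most $p_t+1$ and $v$ of degree at most $p_t-1$ on $[t_{n-1},t_n]$ such that $u(t_{n-1})=y^{n-1}$; $\dot u(t_n^i)=f(v(t_n^i),t_n^i)$ for $i=0,\dots,p_t$; $v(t_{n-1})=z^{n-1}-h_t^{(n)}\omega_0\big(\dot v(t_{n-1})-k(u(t_{n-1}),t_{n-1})\big)$; $\dot v(t_n^i)=k(u(t_n^i),t_n^i)$ for $i=1,\dots,p_t-1$; and set $y^n=u(t_n)$, $z^n=v(t_n)-h_t^{(n)}\omega_{p_t}\big(\dot v(t_n)-k(u(t_n),t_n)\big)$.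
   Formalization: The formal theorem assumes g(w) is in L²(Ω) for all w in the discrete space, and claims symplecticity only for continuously differentiable g; for g(u)=|u|, say, the one-step map is not differentiable, so symplecticity has no meaning there. *)

theory Defs
  imports "HOL-Analysis.Analysis" "HOL-Computational_Algebra.Polynomial"
begin

section \<open>Function spaces on the domain\<close>

definition L2_inner :: "'a::euclidean_space set \<Rightarrow> ('a \<Rightarrow> 'b::real_inner) \<Rightarrow> ('a \<Rightarrow> 'b) \<Rightarrow> real" where
  "L2_inner A f h = (LINT x:A|lebesgue. f x \<bullet> h x)"

definition in_L2 :: "'a::euclidean_space set \<Rightarrow> ('a \<Rightarrow> 'b::euclidean_space) \<Rightarrow> bool" where
  "in_L2 A f \<longleftrightarrow> set_borel_measurable lebesgue A f \<and> set_integrable lebesgue A (\<lambda>x. (norm (f x))\<^sup>2)"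

text \<open>Near each boundary point the domain is, in suitable orthogonal coordinates, the strict
  epigraph in direction \<open>e\<close> of a Lipschitz function of the orthogonal coordinates.\<close>

definition lipschitz_boundary :: "'a::euclidean_space set \<Rightarrow> bool" where
  "lipschitz_boundary \<Omega> \<longleftrightarrow>
    (\<forall>x\<in>frontier \<Omega>. \<exists>e \<rho> L \<gamma>. norm e = 1 \<and> \<rho> > 0 \<and> lipschitz_on L {z. z \<bullet> e = 0} \<gamma> \<and>
      (\<forall>y\<in>ball x \<rho>. y \<in> \<Omega> \<longleftrightarrow> \<gamma> (y - (y \<bullet> e) *\<^sub>R e) < y \<bullet> e))"

definition polytopal_lipschitz_domain :: "'a::euclidean_space set \<Rightarrow> bool" where
  "polytopal_lipschitz_domain \<Omega> \<longleftrightarrow>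
    open \<Omega> \<and> connected \<Omega> \<and> bounded \<Omega> \<and> \<Omega> \<noteq> {} \<and> lipschitz_boundary \<Omega> \<and>
    (\<exists>\<P>. finite \<P> \<and> (\<forall>P\<in>\<P>. polytope P) \<and> closure \<Omega> = \<Union>\<P>)"

primrec C_k :: "nat \<Rightarrow> ('a::euclidean_space \<Rightarrow> real) \<Rightarrow> bool" where
  "C_k 0 \<phi> \<longleftrightarrow> continuous_on UNIV \<phi>"
| "C_k (Suc k) \<phi> \<longleftrightarrow> (\<forall>x. \<phi> differentiable (at x)) \<and>
     (\<forall>b\<in>Basis. C_k k (\<lambda>x. frechet_derivative \<phi> (at x) b))"

definition test_function :: "'a::euclidean_space set \<Rightarrow> ('a \<Rightarrow> real) \<Rightarrow> bool" where
  "test_function \<Omega> \<phi> \<longleftrightarrow> (\<forall>k. C_k k \<phi>) \<and>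
    compact (closure {x. \<phi> x \<noteq> 0}) \<and> closure {x. \<phi> x \<noteq> 0} \<subseteq> \<Omega>"

definition classical_grad :: "('a::euclidean_space \<Rightarrow> real) \<Rightarrow> 'a \<Rightarrow> 'a" where
  "classical_grad \<phi> x = (\<Sum>b\<in>Basis. frechet_derivative \<phi> (at x) b *\<^sub>R b)"

definition has_weak_grad :: "'a::euclidean_space set \<Rightarrow> ('a \<Rightarrow> real) \<Rightarrow> ('a \<Rightarrow> 'a) \<Rightarrow> bool" where
  "has_weak_grad \<Omega> u G \<longleftrightarrow> in_L2 \<Omega> G \<and>
    (\<forall>\<phi>. test_function \<Omega> \<phi> \<longrightarrow> (\<forall>b\<in>Basis.
      (LINT x:\<Omega>|lebesgue. u x * frechet_derivative \<phi> (at x) b) =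
      - (LINT x:\<Omega>|lebesgue. (G x \<bullet> b) * \<phi> x)))"

text \<open>The weak gradient is determined almost everywhere only; the choice of the
  representative does not affect the integrals in which it is used.\<close>

definition weak_grad :: "'a::euclidean_space set \<Rightarrow> ('a \<Rightarrow> real) \<Rightarrow> 'a \<Rightarrow> 'a" where
  "weak_grad \<Omega> u = (SOME G. has_weak_grad \<Omega> u G)"

text \<open>The closure of the test functions in the $H^1$ norm.\<close>

definition H1_0 :: "'a::euclidean_space set \<Rightarrow> ('a \<Rightarrow> real) set" where
  "H1_0 \<Omega> = {u. in_L2 \<Omega> u \<and> (\<exists>G. has_weak_grad \<Omega> u G \<and>
     (\<exists>\<phi>. (\<forall>n::nat. test_function \<Omega> (\<phi> n)) \<and>
       (\<lambda>n. (LINT x:\<Omega>|lebesgue. (u x - \<phi> n x)\<^sup>2) +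
            (LINT x:\<Omega>|lebesgue. (norm (G x - classical_grad (\<phi> n) x))\<^sup>2)) \<longlonglongrightarrow> 0))}"

section \<open>Discrete spaces\<close>

definition conforming_simplicial_mesh :: "'a::euclidean_space set \<Rightarrow> 'a set set \<Rightarrow> bool" where
  "conforming_simplicial_mesh \<Omega> \<T> \<longleftrightarrow>
    triangulation \<T> \<and> (\<forall>K\<in>\<T>. int DIM('a) simplex K) \<and> \<Union>\<T> = closure \<Omega>"

definition shape_regular :: "real \<Rightarrow> 'a::euclidean_space set set \<Rightarrow> bool" where
  "shape_regular \<sigma> \<T> \<longleftrightarrow>
    (\<forall>K\<in>\<T>. \<exists>x r. r > 0 \<and> cball x r \<subseteq> K \<and> diameter K \<le> \<sigma> * r)"

definition polys_le :: "nat \<Rightarrow> ('a::euclidean_space \<Rightarrow> real) set" where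
  "polys_le p = {P. \<exists>a. \<forall>x. P x =
     (\<Sum>\<alpha>\<in>{\<alpha> \<in> Basis \<rightarrow>\<^sub>E {..p}. (\<Sum>b\<in>Basis. \<alpha> b) \<le> p}. a \<alpha> * (\<Prod>b\<in>Basis. (x \<bullet> b) ^ \<alpha> b))}"

text \<open>Piecewise polynomial functions in $H^1_0$ have a continuous representative that vanishes on
  the boundary. Its extension by zero is a bounded continuous function on the whole space, and
  this is how finite element functions are represented here. Equality in \<open>\<Omega>\<close> thereby becomes
  equality.\<close>

definition pw_polynomials :: "'a::euclidean_space set \<Rightarrow> 'a set set \<Rightarrow> nat \<Rightarrow> ('a \<Rightarrow>\<^sub>C real) set" where
  "pw_polynomials \<Omega> \<T> p = {w. (\<forall>x. x \<notin> \<Omega> \<longrightarrow> apply_bcontfun w x = 0) \<and>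
     (\<forall>K\<in>\<T>. \<exists>P\<in>polys_le p. \<forall>x\<in>K. apply_bcontfun w x = P x)}"

definition time_mesh :: "real \<Rightarrow> nat \<Rightarrow> (nat \<Rightarrow> real) \<Rightarrow> bool" where
  "time_mesh T N t \<longleftrightarrow> t 0 = 0 \<and> t N = T \<and> (\<forall>n<N. t n < t (Suc n))"

text \<open>Only the values on $[0,T]$ of functions of time are relevant.\<close>

definition time_space :: "nat \<Rightarrow> (nat \<Rightarrow> real) \<Rightarrow> nat \<Rightarrow> (real \<Rightarrow> real) set" where
  "time_space N t p = {\<theta>. continuous_on {t 0..t N} \<theta> \<and>
     (\<forall>n\<in>{1..N}. \<exists>P::real poly. degree P \<le> p \<and> (\<forall>s\<in>{t (n-1)..t n}. \<theta> s = poly P s))}"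

definition time_space0 :: "nat \<Rightarrow> (nat \<Rightarrow> real) \<Rightarrow> nat \<Rightarrow> (real \<Rightarrow> real) set" where
  "time_space0 N t p = {\<theta> \<in> time_space N t p. \<theta> (t N) = 0}"

definition tensor :: "real \<Rightarrow> 'v::real_vector set \<Rightarrow> (real \<Rightarrow> real) set \<Rightarrow> (real \<Rightarrow> 'v) set" where
  "tensor T S \<Theta> = {U. \<exists>(m::nat) w \<theta>. (\<forall>i<m. w i \<in> S \<and> \<theta> i \<in> \<Theta>) \<and>
     (\<forall>s\<in>{0..T}. U s = (\<Sum>i<m. \<theta> i s *\<^sub>R w i))}"

section \<open>Quadrature in time\<close>

text \<open>Rodrigues' formula on $[0,1]$, without the normalisation factor.\<close>

definition legendre01 :: "nat \<Rightarrow> real poly" where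
  "legendre01 m = (pderiv ^^ m) (([:0, 1:] * [:-1, 1:]) ^ m)"

text \<open>Nodes in increasing order: \<open>gauss_node m j\<close> for $1 \le j \le m$ and
  \<open>lobatto_node p i\<close> for $0 \le i \le p$.\<close>

definition gauss_node :: "nat \<Rightarrow> nat \<Rightarrow> real" where
  "gauss_node m j = sorted_list_of_set {x. poly (legendre01 m) x = 0} ! (j - 1)"

definition lobatto_node :: "nat \<Rightarrow> nat \<Rightarrow> real" where
  "lobatto_node p i =
    sorted_list_of_set ({0, 1} \<union> {x. poly (pderiv (legendre01 p)) x = 0}) ! i"

definition quad_weight :: "nat set \<Rightarrow> (nat \<Rightarrow> real) \<Rightarrow> nat \<Rightarrow> real" where
  "quad_weight I c j = integral {0..1} (\<lambda>x. \<Prod>i\<in>I - {j}. (x - c i) / (c j - c i))"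

definition quad_inner :: "'a::euclidean_space set \<Rightarrow> nat \<Rightarrow> (nat \<Rightarrow> real) \<Rightarrow> nat set \<Rightarrow> (nat \<Rightarrow> real) \<Rightarrow>
    (real \<Rightarrow> 'a \<Rightarrow> 'b::real_inner) \<Rightarrow> (real \<Rightarrow> 'a \<Rightarrow> 'b) \<Rightarrow> real" where
  "quad_inner \<Omega> N t I c f h = (\<Sum>n\<in>{1..N}. (t n - t (n-1)) *
     (\<Sum>j\<in>I. quad_weight I c j *
        L2_inner \<Omega> (f (t (n-1) + c j * (t n - t (n-1)))) (h (t (n-1) + c j * (t n - t (n-1))))))"

section \<open>The space-time schemes\<close>

definition spacetime_scheme :: "'a::euclidean_space set \<Rightarrow> ('a \<Rightarrow> real) \<Rightarrow> (real \<Rightarrow> real) \<Rightarrow>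
    (real \<Rightarrow> 'a \<Rightarrow> real) \<Rightarrow> ('a \<Rightarrow>\<^sub>C real) set \<Rightarrow> nat \<Rightarrow> (nat \<Rightarrow> real) \<Rightarrow> nat \<Rightarrow>
    ('a \<Rightarrow>\<^sub>C real) \<Rightarrow> ('a \<Rightarrow>\<^sub>C real) \<Rightarrow> nat set \<Rightarrow> (nat \<Rightarrow> real) \<Rightarrow> (real \<Rightarrow> 'a \<Rightarrow>\<^sub>C real) \<Rightarrow> bool" where
  "spacetime_scheme \<Omega> c g F S N t p U0h V0h I nodes U \<longleftrightarrow>
    U \<in> tensor (t N) S (time_space N t p) \<and> U 0 = U0h \<and>
    (\<forall>W \<in> tensor (t N) S (time_space0 N t p).
      - L2_inner (\<Omega> \<times> {0<..<t N})
          (\<lambda>(x, s). apply_bcontfun (vector_derivative U (at s)) x)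
          (\<lambda>(x, s). apply_bcontfun (vector_derivative W (at s)) x)
      + quad_inner \<Omega> N t I nodes (\<lambda>s x. (c x)\<^sup>2 *\<^sub>R weak_grad \<Omega> (U s) x) (\<lambda>s. weak_grad \<Omega> (W s))
      + quad_inner \<Omega> N t I nodes (\<lambda>s x. g (apply_bcontfun (U s) x)) (\<lambda>s. apply_bcontfun (W s))
      = quad_inner \<Omega> N t I nodes F (\<lambda>s. apply_bcontfun (W s))
      + L2_inner \<Omega> (apply_bcontfun V0h) (apply_bcontfun (W 0)))"

definition GLe_scheme where
  "GLe_scheme \<Omega> c g F S N t p U0h V0h U \<longleftrightarrow>
    spacetime_scheme \<Omega> c g F S N t p U0h V0h {1..p} (gauss_node p) U"

definition GLo_scheme where
  "GLo_scheme \<Omega> c g F S N t p U0h V0h U \<longleftrightarrow>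
    spacetime_scheme \<Omega> c g F S N t p U0h V0h {0..p} (lobatto_node p) U"

section \<open>Runge--Kutta methods\<close>

definition vec_poly :: "'v::real_vector set \<Rightarrow> nat \<Rightarrow> (real \<Rightarrow> 'v) \<Rightarrow> bool" where
  "vec_poly Y m q \<longleftrightarrow> (\<exists>a. (\<forall>i\<le>m. a i \<in> Y) \<and> (\<forall>s. q s = (\<Sum>i\<le>m. s ^ i *\<^sub>R a i)))"

text \<open>One step from time \<open>s0\<close> to \<open>s1\<close>, for an ODE with state space \<open>Y\<close>. Besides the values \<open>y0\<close>
  and \<open>y1\<close> before and after the step, the relations have the collocation polynomial \<open>q\<close> as an
  argument; the method is implicit, so a step need neither exist nor be unique.\<close>

definition gauss_rk_step :: "'v::real_normed_vector set \<Rightarrow> nat \<Rightarrow> (real \<Rightarrow> 'v \<Rightarrow> 'v) \<Rightarrow>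
    real \<Rightarrow> real \<Rightarrow> 'v \<Rightarrow> (real \<Rightarrow> 'v) \<Rightarrow> 'v \<Rightarrow> bool" where
  "gauss_rk_step Y m \<Phi> s0 s1 y0 q y1 \<longleftrightarrow> vec_poly Y m q \<and> q s0 = y0 \<and>
     (\<forall>j\<in>{1..m}. let \<tau> = s0 + gauss_node m j * (s1 - s0)
        in (q has_vector_derivative \<Phi> \<tau> (q \<tau>)) (at \<tau>)) \<and>
     y1 = q s1"

text \<open>The pair for $\dot y = f(z,t)$, $\dot z = k(y,t)$, with \<open>q\<close> consisting of both collocation
  polynomials.\<close>

definition lobatto_pair_step :: "'y::real_normed_vector set \<Rightarrow> 'z::real_normed_vector set \<Rightarrow> nat \<Rightarrow>
    ('z \<Rightarrow> real \<Rightarrow> 'y) \<Rightarrow> ('y \<Rightarrow> real \<Rightarrow> 'z) \<Rightarrow>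
    real \<Rightarrow> real \<Rightarrow> 'y \<times> 'z \<Rightarrow> (real \<Rightarrow> 'y \<times> 'z) \<Rightarrow> 'y \<times> 'z \<Rightarrow> bool" where
  "lobatto_pair_step Y Z p f k s0 s1 yz0 q yz1 \<longleftrightarrow>
    (let u = (\<lambda>s. fst (q s)); v = (\<lambda>s. snd (q s)); h = s1 - s0;
         \<tau> = (\<lambda>i. s0 + lobatto_node p i * h);
         \<omega> = quad_weight {0..p} (lobatto_node p)
     in vec_poly Y (p + 1) u \<and> vec_poly Z (p - 1) v \<and>
        u s0 = fst yz0 \<and>
        (\<forall>i\<in>{0..p}. (u has_vector_derivative f (v (\<tau> i)) (\<tau> i)) (at (\<tau> i))) \<and>
        v s0 = snd yz0 - (h * \<omega> 0) *\<^sub>R (vector_derivative v (at s0) - k (u s0) s0) \<and>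
        (\<forall>i\<in>{1..<p}. (v has_vector_derivative k (u (\<tau> i)) (\<tau> i)) (at (\<tau> i))) \<and>
        fst yz1 = u s1 \<and>
        snd yz1 = v s1 - (h * \<omega> p) *\<^sub>R (vector_derivative v (at s1) - k (u s1) s1))"

definition time_stepping :: "(real \<Rightarrow> real \<Rightarrow> 'v \<Rightarrow> (real \<Rightarrow> 'v) \<Rightarrow> 'v \<Rightarrow> bool) \<Rightarrow>
    nat \<Rightarrow> (nat \<Rightarrow> real) \<Rightarrow> 'v \<Rightarrow> (nat \<Rightarrow> 'v) \<Rightarrow> (nat \<Rightarrow> real \<Rightarrow> 'v) \<Rightarrow> bool" where
  "time_stepping step N t yinit y q \<longleftrightarrow> y 0 = yinit \<and>
     (\<forall>n\<in>{1..N}. step (t (n-1)) (t n) (y (n-1)) (q n) (y n))"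

section \<open>The semi-discrete first-order system\<close>

text \<open>The semi-discrete system reads $\dot u = v$, $\dot v = a(u,s)$, where \<open>a\<close> is the element
  \<open>semidisc_acc\<close> of \<open>S\<close> obtained by solving the second equation for $\dot v$.\<close>

definition semidisc_acc :: "'a::euclidean_space set \<Rightarrow> ('a \<Rightarrow> real) \<Rightarrow> (real \<Rightarrow> real) \<Rightarrow>
    (real \<Rightarrow> 'a \<Rightarrow> real) \<Rightarrow> ('a \<Rightarrow>\<^sub>C real) set \<Rightarrow> ('a \<Rightarrow>\<^sub>C real) \<Rightarrow> real \<Rightarrow> ('a \<Rightarrow>\<^sub>C real)" where
  "semidisc_acc \<Omega> c g F S u s = (THE a. a \<in> S \<and> (\<forall>w\<in>S.
     L2_inner \<Omega> (apply_bcontfun a) (apply_bcontfun w)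
     + L2_inner \<Omega> (\<lambda>x. (c x)\<^sup>2 *\<^sub>R weak_grad \<Omega> u x) (weak_grad \<Omega> w)
     + L2_inner \<Omega> (\<lambda>x. g (apply_bcontfun u x)) (apply_bcontfun w)
     = L2_inner \<Omega> (F s) (apply_bcontfun w)))"

definition semidisc_gauss_step where
  "semidisc_gauss_step \<Omega> c g F S p =
     gauss_rk_step (S \<times> S) p (\<lambda>s (u, v). (v, semidisc_acc \<Omega> c g F S u s))"

definition semidisc_lobatto_step where
  "semidisc_lobatto_step \<Omega> c g F S p =
     lobatto_pair_step S S p (\<lambda>v s. v) (semidisc_acc \<Omega> c g F S)"

section \<open>Symplecticity\<close>

definition symplectic_form :: "'a::euclidean_space set \<Rightarrow>
    ('a \<Rightarrow>\<^sub>C real) \<times> ('a \<Rightarrow>\<^sub>C real) \<Rightarrow> ('a \<Rightarrow>\<^sub>C real) \<times> ('a \<Rightarrow>\<^sub>C real) \<Rightarrow> real" where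
  "symplectic_form \<Omega> \<xi> \<eta> =
     L2_inner \<Omega> (apply_bcontfun (fst \<xi>)) (apply_bcontfun (snd \<eta>)) -
     L2_inner \<Omega> (apply_bcontfun (snd \<xi>)) (apply_bcontfun (fst \<eta>))"

definition symplectic_map :: "'a::euclidean_space set \<Rightarrow>
    (('a \<Rightarrow>\<^sub>C real) \<times> ('a \<Rightarrow>\<^sub>C real)) set \<Rightarrow> (('a \<Rightarrow>\<^sub>C real) \<times> ('a \<Rightarrow>\<^sub>C real)) set \<Rightarrow>
    (('a \<Rightarrow>\<^sub>C real) \<times> ('a \<Rightarrow>\<^sub>C real) \<Rightarrow> ('a \<Rightarrow>\<^sub>C real) \<times> ('a \<Rightarrow>\<^sub>C real)) \<Rightarrow> bool" where
  "symplectic_map \<Omega> Y D \<Psi> \<longleftrightarrow> (\<forall>y\<in>D. \<Psi> y \<in> Y \<and> (\<exists>\<Psi>'. (\<Psi> has_derivative \<Psi>') (at y within Y) \<and>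
     (\<forall>\<xi>\<in>Y. \<forall>\<eta>\<in>Y. symplectic_form \<Omega> (\<Psi>' \<xi>) (\<Psi>' \<eta>) = symplectic_form \<Omega> \<xi> \<eta>)))"

text \<open>\<open>\<Psi>\<close> is a one-step map of the implicit method \<open>R\<close> on the relatively open subset \<open>D\<close> of the
  state space \<open>Y\<close>: the step can be solved with internal polynomial \<open>Q y\<close> depending differentiably
  on the initial value \<open>y\<close>.\<close>

definition one_step_map :: "'v::real_normed_vector set \<Rightarrow> ('v \<Rightarrow> (real \<Rightarrow> 'v) \<Rightarrow> 'v \<Rightarrow> bool) \<Rightarrow>
    'v set \<Rightarrow> ('v \<Rightarrow> real \<Rightarrow> 'v) \<Rightarrow> ('v \<Rightarrow> 'v) \<Rightarrow> bool" where
  "one_step_map Y R D Q \<Psi> \<longleftrightarrow> openin (top_of_set Y) D \<and>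
     (\<forall>y\<in>D. R y (Q y) (\<Psi> y) \<and> (\<forall>\<tau>. (\<lambda>y'. Q y' \<tau>) differentiable (at y within Y)))"

text \<open>A method with steps \<open>R s0 s1\<close> on $[0,T]$ is symplectic if for small step sizes it has a
  one-step map around every state, and if all its one-step maps, for whatever step size,
  are symplectic.\<close>

definition symplectic_method :: "'a::euclidean_space set \<Rightarrow>
    (('a \<Rightarrow>\<^sub>C real) \<times> ('a \<Rightarrow>\<^sub>C real)) set \<Rightarrow> real \<Rightarrow>
    (real \<Rightarrow> real \<Rightarrow> ('a \<Rightarrow>\<^sub>C real) \<times> ('a \<Rightarrow>\<^sub>C real) \<Rightarrow>
      (real \<Rightarrow> ('a \<Rightarrow>\<^sub>C real) \<times> ('a \<Rightarrow>\<^sub>C real)) \<Rightarrow> ('a \<Rightarrow>\<^sub>C real) \<times> ('a \<Rightarrow>\<^sub>C real) \<Rightarrow> bool) \<Rightarrow> bool" where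
  "symplectic_method \<Omega> Y T R \<longleftrightarrow>
     (\<forall>y\<in>Y. \<exists>h>0. \<exists>D. y \<in> D \<and> (\<forall>s0 s1. 0 \<le> s0 \<and> s0 < s1 \<and> s1 \<le> T \<and> s1 - s0 < h \<longrightarrow>
        (\<exists>Q \<Psi>. one_step_map Y (R s0 s1) D Q \<Psi>))) \<and>
     (\<forall>s0 s1 D Q \<Psi>. 0 \<le> s0 \<and> s0 < s1 \<and> s1 \<le> T \<and> one_step_map Y (R s0 s1) D Q \<Psi> \<longrightarrow>
        symplectic_map \<Omega> Y D \<Psi>)"

end

theory Submission
  imports Defs
begin

text \<open>The velocity does not occur in the space-time schemes; the proof recovers it from the
  equations. On the finite-dimensional space \<open>S\<close> the $L^2$ product \<open>M\<close> is an inner product, so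
  the terms with $c^2\nabla u$, $g(u)$ and $F$ are represented by one vector $k(u,s)$, the
  semi-discrete acceleration. Trial and test functions are piecewise polynomial in time with
  values in \<open>S\<close>, and by Fubini's theorem a scheme reads
  $\sum_n \big(\int M(\dot u_n,\dot w_n) + Q_n M(k(u_n),w_n)\big) + M(v_0,W(0)) = 0$ with the
  quadrature rules $Q_n$ (\<open>spacetime_scheme_iff\<close>). Test functions that are constant before one
  slab and vanish after it decouple this sum: it holds iff there are end velocities $z_n$ in \<open>S\<close>
  such that the $n$-th summand equals $M(z_n,w(t_n)) - M(z_{n-1},w(t_{n-1}))$ for all polynomials
  \<open>w\<close> of degree \<open>p\<close> (\<open>scheme_iff_weak_steps\<close>).

  Both rules integrate polynomials of degree $2p-1$ exactly, because the node polynomials are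
  Legendre's polynomial $L_p$ and $x(x-1)L_p'$, which are orthogonal to all polynomials of degree
  less than $p$ and $p-1$, respectively. Hence, if \<open>v\<close> has degree at most \<open>p\<close> and agrees with $\dot u$ at the
  nodes, then $\int M(\dot u,\dot w)$ is $M(v,w)$ between the ends of the slab minus
  $Q\,M(\dot v,w)$ (\<open>slab_integration_by_parts\<close>), and the weak step is a statement about the
  residuals $\dot v - k(u)$ at the nodes. In the Gauss case \<open>v\<close> interpolates $\dot u$ at the \<open>p\<close>
  interior nodes and $z_{n-1}$ at the left end. All weights are nonzero, so the residuals vanish,
  and $(u,v)$ is the collocation polynomial. In the Lobatto case \<open>v\<close> is $\dot u$. The residuals
  vanish at the interior nodes, while those at the two ends, which are nodes as well, enter the
  balance of the boundary terms; this is the discontinuous collocation of the pair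
  (\<open>weak_step_gauss_iff\<close>, \<open>weak_step_lobatto_iff\<close>).

  For the symplecticity, the derivative of a step with respect to the initial value satisfies the
  linearised collocation equations. The derivative of \<open>k\<close> is symmetric with respect to \<open>M\<close>, as the
  stiffness form and the multiplication by $g'(u)$ are. So along two variations the time
  derivative of the symplectic form vanishes at the Gauss nodes, and the quadrature rule, which is
  exact for this derivative, shows that the form does not change; in the Lobatto case what is left
  at the ends is compensated by the modified end values (\<open>gauss_sform_invariant\<close>,
  \<open>lobatto_sform_invariant\<close>). One-step maps exist for small steps because the stage equations are
  a contraction that depends differentiably on the initial value (\<open>parametrized_fixed_point\<close>).

  What remains is analysis in space. Weak gradients are unique almost everywhere, by the
  fundamental lemma of the calculus of variations, and hence the stiffness form is bilinear. The
  composition with a continuously differentiable \<open>g\<close> is a differentiable and locally Lipschitz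
  operator on bounded continuous functions, and the representatives of $F(\cdot,s)$ in \<open>S\<close> are
  bounded uniformly in \<open>s\<close> by compactness of the time interval.\<close>

section \<open>Legendre polynomials on the unit interval\<close>

lemma poly_rolle_many:
  fixes p :: "real poly"
  assumes "finite A" "A \<noteq> {}" "\<And>x. x \<in> A \<Longrightarrow> poly p x = 0"
  shows "\<exists>B. finite B \<and> card B = card A - 1 \<and> B \<subseteq> {Min A<..<Max A} \<and> (\<forall>x\<in>B. poly (pderiv p) x = 0)"
  using assms
proof (induction A rule: finite_linorder_max_induct)
  case empty
  then show ?case by simp
next
  case (insert b A)
  show ?case
  proof (cases "A = {}")
    case True
    then show ?thesis by (intro exI[of _ "{}"]) auto
  next
    case False
    then obtain B where B: "finite B" "card B = card A - 1" "B \<subseteq> {Min A<..<Max A}"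
      "\<forall>x\<in>B. poly (pderiv p) x = 0"
      using insert by auto
    have mx: "Max A \<in> A" "Max A < b" "Min A \<le> Max A" using insert False by auto
    obtain x where x: "Max A < x" "x < b" "poly p b - poly p (Max A) = (b - Max A) * poly (pderiv p) x"
      using poly_MVT[OF mx(2), of p] by blast
    have "poly (pderiv p) x = 0" using x mx insert.prems by auto
    moreover have "Max (insert b A) = b" using insert mx by (intro Max_eqI) auto
    moreover have "Min (insert b A) = Min A"
      using insert mx False by (subst Min_insert) (auto intro!: min_absorb2 simp: less_imp_le)
    moreover have "x \<notin> B" using B(3) x(1) by auto
    moreover have "card A > 0" using False insert by (simp add: card_gt_0_iff)
    moreover have "Min A < x" using mx x by simp
    moreover have "B \<subseteq> {Min A<..<b}" using B(3) mx by auto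
    ultimately show ?thesis
      using B x insert by (intro exI[of _ "insert x B"]) (auto simp: card_insert_if)
  qed
qed

lemma pderiv_linear_power_dvd:
  fixes p :: "real poly"
  assumes "[:-a, 1:] ^ Suc n dvd p"
  shows "[:-a, 1:] ^ n dvd pderiv p"
proof -
  obtain q where q: "p = [:-a, 1:] ^ Suc n * q" using assms by (auto elim: dvdE)
  have "pderiv p = [:-a, 1:] ^ n * ([:-a, 1:] * pderiv q + smult (of_nat (Suc n)) (q * pderiv [:-a, 1:]))"
    unfolding q pderiv_mult pderiv_power_Suc
    by (simp only: power_Suc distrib_left mult_smult_left mult_smult_right mult_ac)
  then show ?thesis by (rule dvdI)
qed

text \<open>Each differentiation lowers the multiplicity of a root by at most one.\<close>
lemma pderiv_iter_root:
  fixes p :: "real poly"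
  assumes "[:-a, 1:] ^ m dvd p" "k < m"
  shows "poly ((pderiv ^^ k) p) a = 0"
proof -
  have "[:-a, 1:] ^ (m - k) dvd (pderiv ^^ k) p" if "k \<le> m" for k
    using that
  proof (induction k)
    case 0
    then show ?case using assms by simp
  next
    case (Suc k)
    then have "[:-a, 1:] ^ Suc (m - Suc k) dvd (pderiv ^^ k) p"
      by (simp add: Suc_diff_Suc)
    from pderiv_linear_power_dvd[OF this] show ?case by simp
  qed
  then have "[:-a, 1:] ^ (m - k) dvd (pderiv ^^ k) p" using assms by simp
  moreover have "[:-a, 1:] dvd [:-a, 1:] ^ (m - k)" using assms by (simp add: dvd_power)
  ultimately show ?thesis by (metis dvd_trans poly_eq_0_iff_dvd)
qed

definition bubble_power :: "nat \<Rightarrow> real poly" where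
  "bubble_power m = ([:0, 1:] * [:-1, 1:]) ^ m"

lemma legendre01_eq: "legendre01 m = (pderiv ^^ m) (bubble_power m)"
  by (simp only: legendre01_def bubble_power_def)

lemma degree_bubble_power: "degree (bubble_power m) = 2 * m"
  unfolding bubble_power_def by (simp add: degree_power_eq)

lemma bubble_power_root:
  assumes "k < m" "a \<in> {0, 1}"
  shows "poly ((pderiv ^^ k) (bubble_power m)) a = 0"
proof (rule pderiv_iter_root[OF _ assms(1)])
  have "[:-a, 1:] dvd [:0, 1:] * [:-1, 1:]" using assms(2) by (subst poly_eq_0_iff_dvd[symmetric]) auto
  then show "[:-a, 1:] ^ m dvd bubble_power m" unfolding bubble_power_def by (rule dvd_power_same)
qed

lemma degree_pderiv_iter: "degree ((pderiv ^^ k) (p :: real poly)) = degree p - k"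
  by (induction k) (auto simp: degree_pderiv)

lemma degree_legendre01: "degree (legendre01 m) = m"
  unfolding legendre01_eq degree_pderiv_iter degree_bubble_power by simp

lemma legendre01_nonzero: "legendre01 m \<noteq> 0"
proof (cases m)
  case 0
  then show ?thesis by (simp add: legendre01_def)
next
  case (Suc k)
  then show ?thesis using degree_legendre01[of m] by auto
qed

text \<open>By Rolle's theorem each differentiation produces one more interior root, since the end points
  remain roots until the last step.\<close>
lemma bubble_power_deriv_roots:
  assumes "k \<le> m"
  shows "\<exists>B. finite B \<and> card B = k \<and> B \<subseteq> {0<..<1} \<and> (\<forall>x\<in>B. poly ((pderiv ^^ k) (bubble_power m)) x = 0)"
  using assms
proof (induction k)
  case 0
  then show ?case by (intro exI[of _ "{}"]) auto
next
  case (Suc k)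
  then obtain B where B: "finite B" "card B = k" "B \<subseteq> {0<..<1}"
    "\<forall>x\<in>B. poly ((pderiv ^^ k) (bubble_power m)) x = 0" by auto
  let ?A = "{0, 1} \<union> B"
  have c: "card ?A = k + 2" using B by (subst card_Un_disjoint) auto
  have "Min ?A = 0" by (rule Min_eqI) (use B in \<open>auto simp: less_imp_le subset_iff\<close>)
  moreover have "Max ?A = 1" by (rule Max_eqI) (use B in \<open>auto simp: less_imp_le subset_iff\<close>)
  moreover have "\<And>x. x \<in> ?A \<Longrightarrow> poly ((pderiv ^^ k) (bubble_power m)) x = 0"
    using B bubble_power_root Suc by auto
  ultimately show ?case using poly_rolle_many[of ?A "(pderiv ^^ k) (bubble_power m)"] B c by auto
qed

lemma poly_roots_eqI:
  fixes p :: "real poly"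
  assumes "p \<noteq> 0" "card B = degree p" "\<And>x. x \<in> B \<Longrightarrow> poly p x = 0"
  shows "{x. poly p x = 0} = B"
  using assms by (metis (mono_tags, lifting) card_poly_roots_bound card_seteq mem_Collect_eq poly_roots_finite subsetI)

lemma legendre01_roots:
  "card {x. poly (legendre01 m) x = 0} = m" "{x. poly (legendre01 m) x = 0} \<subseteq> {0<..<1}"
proof -
  obtain B where B: "card B = m" "B \<subseteq> {0<..<1}" "\<forall>x\<in>B. poly (legendre01 m) x = 0"
    using bubble_power_deriv_roots[of m m] by (auto simp: legendre01_eq)
  then have "{x. poly (legendre01 m) x = 0} = B"
    by (intro poly_roots_eqI) (auto simp: legendre01_nonzero degree_legendre01)
  with B show "card {x. poly (legendre01 m) x = 0} = m" "{x. poly (legendre01 m) x = 0} \<subseteq> {0<..<1}"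
    by auto
qed

lemma pderiv_legendre01_roots:
  assumes "m \<ge> 1"
  shows "card {x. poly (pderiv (legendre01 m)) x = 0} = m - 1"
    "{x. poly (pderiv (legendre01 m)) x = 0} \<subseteq> {0<..<1}" "pderiv (legendre01 m) \<noteq> 0"
proof -
  show nz: "pderiv (legendre01 m) \<noteq> 0" using assms by (simp add: pderiv_eq_0_iff degree_legendre01)
  let ?R = "{x. poly (legendre01 m) x = 0}"
  have fin: "finite ?R" by (simp add: poly_roots_finite legendre01_nonzero)
  have ne: "?R \<noteq> {}" using legendre01_roots(1)[of m] assms by (metis card.empty not_one_le_zero)
  obtain B where B: "card B = m - 1" "B \<subseteq> {Min ?R<..<Max ?R}" "\<forall>x\<in>B. poly (pderiv (legendre01 m)) x = 0"
    using poly_rolle_many[OF fin ne, of "legendre01 m"] legendre01_roots(1)[of m] by auto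
  have "Min ?R \<in> ?R" "Max ?R \<in> ?R" using Min_in[OF fin ne] Max_in[OF fin ne] by blast+
  then have "0 < Min ?R" "Max ?R < 1" using legendre01_roots(2)[of m] by (meson greaterThanLessThan_iff subsetD)+
  then have "B \<subseteq> {0<..<1}" using B(2) by (auto simp: subset_iff)
  moreover have "{x. poly (pderiv (legendre01 m)) x = 0} = B"
    using B nz by (intro poly_roots_eqI) (auto simp: degree_pderiv degree_legendre01)
  ultimately show "card {x. poly (pderiv (legendre01 m)) x = 0} = m - 1"
    "{x. poly (pderiv (legendre01 m)) x = 0} \<subseteq> {0<..<1}" using B by auto
qed

section \<open>Interpolatory quadrature\<close>

lemma poly_has_integral_pderiv:
  fixes p :: "real poly"
  assumes "a \<le> b"
  shows "(poly (pderiv p) has_integral poly p b - poly p a) {a..b}"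
  using assms by (intro fundamental_theorem_of_calculus)
    (auto intro!: has_field_derivative_at_within poly_DERIV simp flip: has_real_derivative_iff_has_vector_derivative)

lemma integral_poly_pderiv: "integral {0..1} (poly (pderiv p)) = poly p 1 - poly p (0::real)"
  using poly_has_integral_pderiv[of 0 1 p] by (simp add: integral_unique)

lemma poly_integrable: "poly p integrable_on {a..b::real}"
  by (intro integrable_continuous_real continuous_intros)

lemma integral_poly_add:
  "integral {0..1::real} (poly (p + q)) = integral {0..1} (poly p) + integral {0..1} (poly q)"
  unfolding poly_add using poly_integrable by (intro integral_add)

lemma integral_poly_smult: "integral {0..1::real} (poly (smult a p)) = a * integral {0..1} (poly p)"
  unfolding poly_smult by (rule integral_mult_right)

lemma poly_integrate_by_parts:
  fixes p q :: "real poly"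
  shows "integral {0..1} (poly (pderiv p * q)) = poly (p * q) 1 - poly (p * q) 0 - integral {0..1} (poly (p * pderiv q))"
  using integral_poly_pderiv[of "p * q"] by (simp add: pderiv_mult integral_poly_add algebra_simps)

text \<open>Repeated integration by parts moves the derivatives to \<open>q\<close>, until they annihilate it; the
  boundary terms vanish because the end points are roots.\<close>
lemma bubble_power_orthogonal:
  assumes "k \<le> m" "q = 0 \<or> degree q < k"
  shows "integral {0..1} (poly ((pderiv ^^ k) (bubble_power m) * q)) = 0"
  using assms
proof (induction k arbitrary: q)
  case 0
  then show ?case by simp
next
  case (Suc k)
  have "pderiv q = 0 \<or> degree (pderiv q) < k"
    using Suc.prems by (auto simp: degree_pderiv pderiv_eq_0_iff)
  then have "integral {0..1} (poly ((pderiv ^^ k) (bubble_power m) * pderiv q)) = 0"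
    using Suc.prems(1) by (intro Suc.IH) auto
  then show ?case using Suc.prems(1) by (simp add: poly_integrate_by_parts bubble_power_root del: poly_mult) (simp add: bubble_power_root)
qed

lemma legendre01_orthogonal:
  assumes "degree q < m"
  shows "integral {0..1} (poly (legendre01 m * q)) = 0"
  using bubble_power_orthogonal[of m m q] assms by (simp add: legendre01_eq)

text \<open>One integration by parts reduces the orthogonality of $x(x-1)L_m'$ to that of $L_m$.\<close>
lemma lobatto_orthogonal:
  assumes "m \<ge> 1" "q = 0 \<or> degree q + 2 \<le> m"
  shows "integral {0..1} (poly ([:0, 1:] * [:-1, 1:] * pderiv (legendre01 m) * q)) = 0"
proof (cases "q = 0")
  case False
  let ?b = "[:0, 1:] * [:-1, 1:] * q"
  have b: "degree ([:0, 1:] * [:-1, 1:] :: real poly) = 2" "[:0, 1:] * [:-1, 1:] \<noteq> (0 :: real poly)" by simp_all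
  have "degree ?b = degree q + 2"
    using False by (simp only: degree_mult_eq[OF b(2) False] b(1) add.commute)
  then have "degree (pderiv ?b) < m" using False assms by (simp add: degree_pderiv del: mult_pCons_left mult_pCons_right)
  then have "integral {0..1} (poly (legendre01 m * pderiv ?b)) = 0"
    by (rule legendre01_orthogonal)
  moreover have "poly (legendre01 m * ?b) 1 = 0" "poly (legendre01 m * ?b) 0 = 0" by auto
  ultimately have "integral {0..1} (poly (pderiv (legendre01 m) * ?b)) = 0"
    by (simp only: poly_integrate_by_parts)
  then show ?thesis by (simp only: mult_ac)
qed (simp add: poly_0[abs_def])

definition lagrange_poly :: "nat set \<Rightarrow> (nat \<Rightarrow> real) \<Rightarrow> nat \<Rightarrow> real poly" where
  "lagrange_poly I c j = (\<Prod>i\<in>I - {j}. smult (1 / (c j - c i)) [:- c i, 1:])"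

lemma poly_lagrange_poly: "poly (lagrange_poly I c j) x = (\<Prod>i\<in>I - {j}. (x - c i) / (c j - c i))"
  unfolding lagrange_poly_def poly_prod by (simp add: diff_divide_distrib)

lemma degree_lagrange_poly:
  assumes "finite I" "j \<in> I"
  shows "degree (lagrange_poly I c j) \<le> card I - 1"
proof -
  have "degree (lagrange_poly I c j) \<le> (\<Sum>i\<in>I - {j}. degree (smult (1 / (c j - c i)) [:- c i, 1:]))"
    unfolding lagrange_poly_def using assms
      degree_prod_sum_le[of "I - {j}" "\<lambda>i. smult (1 / (c j - c i)) [:- c i, 1:]"] by (simp only: o_def finite_Diff)
  also have "\<dots> \<le> (\<Sum>i\<in>I - {j}. 1)" by (intro sum_mono) auto
  also have "\<dots> = card I - 1" using assms by simp
  finally show ?thesis .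
qed

lemma lagrange_poly_node:
  assumes "finite I" "inj_on c I" "i \<in> I" "j \<in> I"
  shows "poly (lagrange_poly I c j) (c i) = (if i = j then 1 else 0)"
proof (cases "i = j")
  case True
  have "c j - c l \<noteq> 0" if "l \<in> I - {j}" for l using that assms by (auto simp: inj_on_def)
  then show ?thesis using True by (simp add: poly_lagrange_poly)
next
  case False
  then show ?thesis using assms by (auto simp: poly_lagrange_poly intro!: prod_zero)
qed

lemma quad_weight_eq: "quad_weight I c j = integral {0..1} (poly (lagrange_poly I c j))"
  unfolding quad_weight_def by (simp add: poly_lagrange_poly[abs_def])

lemma poly_eq_lagrange:
  assumes I: "finite I" "inj_on c I" "I \<noteq> {}" and f: "degree f < card I"
  shows "f = (\<Sum>j\<in>I. smult (poly f (c j)) (lagrange_poly I c j))"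
proof (rule poly_eqI_degree[of "c ` I"])
  show "card (c ` I) > degree f" using assms by (simp add: card_image)
  have "degree (\<Sum>j\<in>I. smult (poly f (c j)) (lagrange_poly I c j)) \<le> card I - 1"
    using degree_lagrange_poly[OF I(1)] by (intro degree_sum_le I) (auto intro: order_trans[OF degree_smult_le])
  then show "card (c ` I) > degree (\<Sum>j\<in>I. smult (poly f (c j)) (lagrange_poly I c j))"
    using assms by (simp add: card_image)
  fix x assume "x \<in> c ` I"
  then obtain i where i: "x = c i" "i \<in> I" by auto
  show "poly f x = poly (\<Sum>j\<in>I. smult (poly f (c j)) (lagrange_poly I c j)) x"
    using i I by (simp add: poly_sum lagrange_poly_node sum.delta if_distrib cong: if_cong)
qed

definition quadrature_exact :: "nat set \<Rightarrow> (nat \<Rightarrow> real) \<Rightarrow> nat \<Rightarrow> bool" where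
  "quadrature_exact I c r \<longleftrightarrow> (\<forall>f. degree f \<le> r \<longrightarrow>
     integral {0..1} (poly f) = (\<Sum>j\<in>I. quad_weight I c j * poly f (c j)))"

text \<open>Division by the node polynomial splits \<open>f\<close> into a multiple of it, whose integral and whose
  quadrature sum vanish, and a remainder that is equal to its interpolant at the nodes.\<close>
lemma quadrature_exactI:
  assumes I: "finite I" "inj_on c I" "I \<noteq> {}"
    and orth: "\<And>q. q = 0 \<or> degree q + card I \<le> r \<Longrightarrow> integral {0..1} (poly ((\<Prod>i\<in>I. [:- c i, 1:]) * q)) = 0"
  shows "quadrature_exact I c r"
  unfolding quadrature_exact_def
proof (intro allI impI)
  fix f :: "real poly" assume f: "degree f \<le> r"
  define \<pi> where "\<pi> = (\<Prod>i\<in>I. [:- c i, 1:])"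
  have \<pi>: "degree \<pi> = card I" "\<pi> \<noteq> 0" unfolding \<pi>_def using I
    by (auto simp: degree_prod_sum_eq)
  define q g where "q = f div \<pi>" and "g = f mod \<pi>"
  have fq: "f = \<pi> * q + g" by (simp add: q_def g_def)
  have g: "degree g < card I"
    using degree_mod_less[of \<pi> f] \<pi> I by (auto simp: g_def card_gt_0_iff)
  have "q = 0 \<or> degree q + card I \<le> r"
  proof (cases "q = 0")
    case False
    have "degree q + card I = degree (f - g)" using \<pi> False by (simp add: fq degree_mult_eq)
    also have "\<dots> \<le> max (degree f) (degree g)" by (rule degree_diff_le_max)
    finally show ?thesis using f g by auto
  qed simp
  then have iq: "integral {0..1} (poly (\<pi> * q)) = 0" unfolding \<pi>_def by (rule orth)
  have pn: "poly \<pi> (c j) = 0" if "j \<in> I" for j using that I by (auto simp: \<pi>_def poly_prod intro!: prod_zero)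
  have "integral {0..1} (poly f) = integral {0..1} (poly g)" unfolding fq using iq by (simp add: integral_poly_add del: poly_mult)
  also have "\<dots> = integral {0..1} (\<lambda>x. \<Sum>j\<in>I. poly g (c j) * poly (lagrange_poly I c j) x)"
    by (subst poly_eq_lagrange[OF I g]) (simp add: poly_sum[abs_def])
  also have "\<dots> = (\<Sum>j\<in>I. poly g (c j) * quad_weight I c j)"
    using I by (subst integral_sum) (auto simp: quad_weight_eq intro!: integrable_on_mult_right poly_integrable)
  also have "\<dots> = (\<Sum>j\<in>I. quad_weight I c j * poly f (c j))"
    by (intro sum.cong) (auto simp: fq pn)
  finally show "integral {0..1} (poly f) = (\<Sum>j\<in>I. quad_weight I c j * poly f (c j))" .
qed

lemma pderiv_sum': "pderiv (sum f A) = (\<Sum>i\<in>A. pderiv (f i :: real poly))"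
  by (induction A rule: infinite_finite_induct) (auto simp: pderiv_add)

lemma poly_antiderivative: "\<exists>F :: real poly. pderiv F = f"
proof -
  let ?F = "\<Sum>i\<le>degree f. monom (coeff f i / real (Suc i)) (Suc i)"
  have "pderiv ?F = (\<Sum>i\<le>degree f. monom (coeff f i) i)"
    unfolding pderiv_sum' by (simp add: pderiv_monom del: of_nat_Suc)
  also have "\<dots> = f" by (rule poly_as_sum_of_monoms)
  finally show ?thesis by blast
qed

text \<open>The form in which exactness is used on a slab: integrals are differences of an
  antiderivative, and no sign of \<open>s1 - s0\<close> is involved.\<close>
lemma quadrature_exact_increment:
  assumes ex: "quadrature_exact I c r" and F: "degree F \<le> Suc r"
  shows "poly F s1 - poly F s0 = (s1 - s0) * (\<Sum>j\<in>I. quad_weight I c j * poly (pderiv F) (s0 + c j * (s1 - s0)))"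
proof -
  define G where "G = pcompose F [:s0, s1 - s0:]"
  have pG: "poly (pderiv G) x = (s1 - s0) * poly (pderiv F) (s0 + x * (s1 - s0))" for x
    by (simp add: G_def pderiv_pcompose poly_pcompose pderiv_pCons algebra_simps)
  have "degree G \<le> Suc r" unfolding G_def using F
    by (intro order_trans[OF degree_pcompose_le]) (auto intro: order_trans mult_le_mono2)
  then have "integral {0..1} (poly (pderiv G)) = (\<Sum>j\<in>I. quad_weight I c j * poly (pderiv G) (c j))"
    using ex unfolding quadrature_exact_def by (simp add: degree_pderiv)
  moreover have "poly G 1 - poly G 0 = poly F s1 - poly F s0" by (simp add: G_def poly_pcompose)
  ultimately show ?thesis unfolding integral_poly_pderiv pG by (simp add: sum_distrib_left algebra_simps)
qed

lemma quadrature_exact_integral: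
  assumes ex: "quadrature_exact I c r" and f: "degree f \<le> r" and le: "s0 \<le> s1"
  shows "integral {s0..s1} (poly f) = (s1 - s0) * (\<Sum>j\<in>I. quad_weight I c j * poly f (s0 + c j * (s1 - s0)))"
proof -
  obtain F where F: "pderiv F = f" using poly_antiderivative by blast
  then have "degree F \<le> Suc r" using f by (auto simp: degree_pderiv)
  from quadrature_exact_increment[OF ex this, of s1 s0] show ?thesis
    using poly_has_integral_pderiv[OF le, of F] by (simp add: F integral_unique)
qed

text \<open>If the weight of one node were zero, a nonnegative nonzero polynomial that is integrated
  exactly and vanishes at all other nodes would have integral zero.\<close>
lemma quad_weight_nonzero:
  assumes I: "finite I" "inj_on c I" "j \<in> I" and ex: "quadrature_exact I c r"
    and f: "degree f \<le> r" "\<And>x. x \<in> {0..1} \<Longrightarrow> poly f x \<ge> 0" "f \<noteq> 0" "\<And>i. i \<in> I - {j} \<Longrightarrow> poly f (c i) = 0"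
  shows "quad_weight I c j \<noteq> 0"
proof
  assume 0: "quad_weight I c j = 0"
  have "(\<Sum>i\<in>I. quad_weight I c i * poly f (c i)) = 0"
    using 0 f(4) I by (intro sum.neutral) auto
  then have "integral {0..1} (poly f) = 0" using ex f(1) unfolding quadrature_exact_def by auto
  then have "\<forall>x\<in>{0..1}. poly f x = 0"
    using f(2) integral_eq_0_iff[of 0 1 "poly f"] continuous_on_poly[OF continuous_on_id, of "{0..1}" f] by auto
  then have "{0..1} \<subseteq> {x. poly f x = 0}" by auto
  then have "finite {0..1::real}" using poly_roots_finite[OF f(3)] finite_subset by blast
  then show False by (simp add: infinite_Icc)
qed

section \<open>Gauss and Lobatto nodes\<close>

lemma bij_betw_gauss_node: "bij_betw (gauss_node m) {1..m} {x. poly (legendre01 m) x = 0}"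
proof -
  let ?R = "{x. poly (legendre01 m) x = 0}"
  have fin: "finite ?R" by (simp add: poly_roots_finite legendre01_nonzero)
  have "bij_betw ((!) (sorted_list_of_set ?R)) {..<m} ?R"
    using fin legendre01_roots(1)[of m] by (intro bij_betw_nth) auto
  moreover have "bij_betw (\<lambda>j. j - 1) {1..m} {..<m}"
    by (rule bij_betw_byWitness[where f' = Suc]) auto
  ultimately have "bij_betw ((!) (sorted_list_of_set ?R) \<circ> (\<lambda>j. j - 1)) {1..m} ?R"
    by (rule bij_betw_trans[rotated])
  then show ?thesis by (simp add: o_def gauss_node_def[abs_def])
qed

lemma inj_on_gauss_node: "inj_on (gauss_node m) {1..m}"
  using bij_betw_gauss_node by (rule bij_betw_imp_inj_on)

lemma gauss_node_bounds: "j \<in> {1..m} \<Longrightarrow> 0 < gauss_node m j \<and> gauss_node m j < 1"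
  using bij_betwE[OF bij_betw_gauss_node, of m] legendre01_roots(2)[of m]
  by (meson greaterThanLessThan_iff subsetD)

lemma prod_roots_dvd_eq:
  fixes p :: "real poly"
  assumes "finite R" "card R = degree p" "\<And>x. x \<in> R \<Longrightarrow> poly p x = 0"
  shows "p = smult (lead_coeff p) (\<Prod>x\<in>R. [:- x, 1:])"
proof (cases "p = 0")
  case False
  let ?q = "smult (lead_coeff p) (\<Prod>x\<in>R. [:- x, 1:])"
  have d: "degree ?q = degree p" using assms False by (simp add: degree_prod_sum_eq)
  show ?thesis
  proof (rule poly_eqI_degree_lead_coeff[where A = R])
    show "coeff p (degree p) = coeff ?q (degree p)"
    proof -
      have "lead_coeff (\<Prod>x\<in>R. [:- x, 1:]) = 1" by (simp add: lead_coeff_prod)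
      moreover have "degree (\<Prod>x\<in>R. [:- x, 1:]) = degree p" using assms by (simp add: degree_prod_sum_eq)
      ultimately show ?thesis by simp
    qed
    show "\<And>z. z \<in> R \<Longrightarrow> poly p z = poly ?q z"
      using assms by (auto simp: poly_prod intro!: prod_zero)
  qed (use assms d in auto)
qed simp

lemma gauss_exact:
  assumes "m \<ge> 1"
  shows "quadrature_exact {1..m} (gauss_node m) (2 * m - 1)"
proof (rule quadrature_exactI)
  let ?R = "{x. poly (legendre01 m) x = 0}"
  have fin: "finite ?R" by (simp add: poly_roots_finite legendre01_nonzero)
  have "(\<Prod>i\<in>{1..m}. [:- gauss_node m i, 1:]) = (\<Prod>x\<in>?R. [:- x, 1:])"
    using bij_betw_gauss_node[of m] by (rule prod.reindex_bij_betw)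
  moreover have "legendre01 m = smult (lead_coeff (legendre01 m)) (\<Prod>x\<in>?R. [:- x, 1:])"
    using fin legendre01_roots(1)[of m] degree_legendre01[of m] by (intro prod_roots_dvd_eq) auto
  ultimately have L: "legendre01 m = smult (lead_coeff (legendre01 m)) (\<Prod>i\<in>{1..m}. [:- gauss_node m i, 1:])"
    by simp
  fix q :: "real poly" assume q: "q = 0 \<or> degree q + card {1..m} \<le> 2 * m - 1"
  let ?g = "(\<Prod>i\<in>{1..m}. [:- gauss_node m i, 1:]) * q"
  have "degree q < m" using q assms by auto
  then have "integral {0..1} (poly (legendre01 m * q)) = 0" by (rule legendre01_orthogonal)
  then have "integral {0..1} (poly (smult (lead_coeff (legendre01 m)) ?g)) = 0"
    using L by (metis mult_smult_left)
  then have "lead_coeff (legendre01 m) * integral {0..1} (poly ?g) = 0"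
    by (simp only: integral_poly_smult)
  then show "integral {0..1} (poly ?g) = 0" using legendre01_nonzero by simp
qed (use assms inj_on_gauss_node in auto)

text \<open>Here the polynomial is the squared product over the other nodes, of degree $2m-2$.\<close>
lemma gauss_weight_nonzero:
  assumes "j \<in> {1..m}"
  shows "quad_weight {1..m} (gauss_node m) j \<noteq> 0"
proof (rule quad_weight_nonzero)
  let ?f = "(\<Prod>i\<in>{1..m} - {j}. [:- gauss_node m i, 1:]) ^ 2"
  show "quadrature_exact {1..m} (gauss_node m) (2 * m - 1)" using assms by (intro gauss_exact) auto
  show "degree ?f \<le> 2 * m - 1" using assms by (simp add: degree_power_eq degree_prod_sum_eq)
  show "\<And>i. i \<in> {1..m} - {j} \<Longrightarrow> poly ?f (gauss_node m i) = 0"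
    by (auto simp: poly_prod intro!: prod_zero)
qed (use assms inj_on_gauss_node in auto)

lemma
  assumes "p \<ge> 1"
  shows bij_betw_lobatto_node: "bij_betw (lobatto_node p) {0..p} ({0, 1} \<union> {x. poly (pderiv (legendre01 p)) x = 0})"
    and lobatto_node_0: "lobatto_node p 0 = 0"
    and lobatto_node_p: "lobatto_node p p = 1"
proof -
  let ?R = "{x. poly (pderiv (legendre01 p)) x = 0}"
  define A where "A = {0, 1} \<union> ?R"
  define xs where "xs = sorted_list_of_set A"
  have node: "lobatto_node p i = xs ! i" for i by (simp add: lobatto_node_def xs_def A_def)
  have fin: "finite ?R" using pderiv_legendre01_roots[OF assms] by (simp add: poly_roots_finite)
  have disj: "{0, 1} \<inter> ?R = {}" using pderiv_legendre01_roots(2)[OF assms] by auto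
  have cA: "card A = p + 1"
    unfolding A_def using fin disj pderiv_legendre01_roots(1)[OF assms] assms by (subst card_Un_disjoint) auto
  have finA: "finite A" using fin by (simp add: A_def)
  then have setA: "set xs = A" by (simp add: xs_def)
  have len: "length xs = p + 1" using cA by (simp add: xs_def)
  have "bij_betw ((!) xs) {0..p} A"
    by (rule bij_betw_nth) (use setA len in \<open>auto simp: xs_def\<close>)
  then show "bij_betw (lobatto_node p) {0..p} ({0, 1} \<union> ?R)" by (simp add: node[abs_def] A_def)
  have A: "A \<subseteq> {0..1}" using pderiv_legendre01_roots(2)[OF assms] by (auto simp: A_def subset_iff less_imp_le)
  have n: "i \<le> p \<Longrightarrow> lobatto_node p i \<in> A" for i
    using len setA nth_mem[of i xs] unfolding node by simp
  have "0 \<in> set xs" "1 \<in> set xs" unfolding setA by (auto simp: A_def)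
  then obtain i k where i: "i \<le> p" "lobatto_node p i = 0" and k: "k \<le> p" "lobatto_node p k = 1"
    using len unfolding in_set_conv_nth node by (metis Suc_eq_plus1 less_Suc_eq_le)
  have mono: "i \<le> k \<Longrightarrow> k \<le> p \<Longrightarrow> lobatto_node p i \<le> lobatto_node p k" for i k
    unfolding node using len by (intro sorted_nth_mono) (auto simp: xs_def)
  have r: "j \<le> p \<Longrightarrow> lobatto_node p j \<in> {0..1}" for j using n A by (meson subsetD)
  show "lobatto_node p 0 = 0" using mono[of 0 i] i r[of 0] by auto
  show "lobatto_node p p = 1" using mono[of k p] k r[of p] by auto
qed

lemma inj_on_lobatto_node: "p \<ge> 1 \<Longrightarrow> inj_on (lobatto_node p) {0..p}"
  using bij_betw_lobatto_node by (rule bij_betw_imp_inj_on)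

lemma lobatto_node_bounds:
  assumes "p \<ge> 1" "i \<in> {0..p}"
  shows "0 \<le> lobatto_node p i \<and> lobatto_node p i \<le> 1"
proof -
  have "{0, 1} \<union> {x. poly (pderiv (legendre01 p)) x = 0} \<subseteq> {0..1::real}"
    using pderiv_legendre01_roots(2)[OF assms(1)] by (auto simp: subset_iff less_imp_le)
  moreover have "lobatto_node p i \<in> {0, 1} \<union> {x. poly (pderiv (legendre01 p)) x = 0}"
    using bij_betwE[OF bij_betw_lobatto_node[OF assms(1)]] assms(2) by blast
  ultimately have "lobatto_node p i \<in> {0..1}" by (rule subsetD)
  then show ?thesis by simp
qed

lemma lobatto_exact:
  assumes "p \<ge> 1"
  shows "quadrature_exact {0..p} (lobatto_node p) (2 * p - 1)"
proof (rule quadrature_exactI)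
  let ?R = "{x. poly (pderiv (legendre01 p)) x = 0}"
  have fin: "finite ?R" using pderiv_legendre01_roots[OF assms] by (simp add: poly_roots_finite)
  have disj: "{0, 1} \<inter> ?R = {}" using pderiv_legendre01_roots(2)[OF assms] by auto
  have "(\<Prod>i\<in>{0..p}. [:- lobatto_node p i, 1:]) = (\<Prod>x\<in>{0, 1} \<union> ?R. [:- x, 1:])"
    using bij_betw_lobatto_node[OF assms] by (rule prod.reindex_bij_betw)
  also have "\<dots> = (\<Prod>x\<in>{0, 1}. [:- x, 1:]) * (\<Prod>x\<in>?R. [:- x, 1:])"
    using fin disj by (subst prod.union_disjoint) auto
  also have "(\<Prod>x\<in>{0, 1::real}. [:- x, 1:]) = [:0, 1:] * [:-1, 1:]" by simp
  finally have P: "(\<Prod>i\<in>{0..p}. [:- lobatto_node p i, 1:]) = [:0, 1:] * [:-1, 1:] * (\<Prod>x\<in>?R. [:- x, 1:])" .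
  let ?l = "lead_coeff (pderiv (legendre01 p))"
  have L: "pderiv (legendre01 p) = smult ?l (\<Prod>x\<in>?R. [:- x, 1:])"
    using fin pderiv_legendre01_roots[OF assms] degree_legendre01[of p]
    by (intro prod_roots_dvd_eq) (auto simp: degree_pderiv)
  fix q :: "real poly" assume q: "q = 0 \<or> degree q + card {0..p} \<le> 2 * p - 1"
  let ?g = "(\<Prod>i\<in>{0..p}. [:- lobatto_node p i, 1:]) * q"
  have "integral {0..1} (poly ([:0, 1:] * [:-1, 1:] * pderiv (legendre01 p) * q)) = 0"
    using assms q by (intro lobatto_orthogonal) auto
  moreover have "[:0, 1:] * [:-1, 1:] * pderiv (legendre01 p) * q = smult ?l ?g"
    unfolding P by (subst L) (simp only: mult_smult_left mult_smult_right mult_ac)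
  ultimately have "?l * integral {0..1} (poly ?g) = 0"
    by (simp only: integral_poly_smult)
  then show "integral {0..1} (poly ?g) = 0" using pderiv_legendre01_roots(3)[OF assms] by simp
qed (use assms inj_on_lobatto_node in auto)

text \<open>For an interior node the polynomial is $x(1-x)$ times the squared product over the other
  interior nodes, which has degree $2p-2$.\<close>
lemma lobatto_weight_nonzero:
  assumes "j \<in> {1..<p}"
  shows "quad_weight {0..p} (lobatto_node p) j \<noteq> 0"
proof (rule quad_weight_nonzero)
  let ?q = "(\<Prod>i\<in>{1..<p} - {j}. [:- lobatto_node p i, 1:]) ^ 2"
  let ?f = "[:0, 1:] * [:1, -1:] * ?q"
  show "quadrature_exact {0..p} (lobatto_node p) (2 * p - 1)" using assms by (intro lobatto_exact) auto
  have "degree (\<Prod>i\<in>{1..<p} - {j}. [:- lobatto_node p i, 1:]) = p - 2"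
    using assms by (simp add: degree_prod_sum_eq)
  then have dq: "degree ?q = 2 * (p - 2)" by (subst degree_power_eq) auto
  have nz: "?q \<noteq> 0" by auto
  then have "degree ?f = 2 + 2 * (p - 2)" using dq by (subst degree_mult_eq) auto
  moreover have "p \<ge> 2" using assms by simp
  ultimately show "degree ?f \<le> 2 * p - 1" by linarith
  show "?f \<noteq> 0" using nz by (simp only: no_zero_divisors mult_eq_0_iff) simp
  show "poly ?f x \<ge> 0" if "x \<in> {0..1}" for x
  proof -
    have "poly ?f x = x * (1 - x) * (poly (\<Prod>i\<in>{1..<p} - {j}. [:- lobatto_node p i, 1:]) x)\<^sup>2"
      by (simp add: algebra_simps)
    then show ?thesis using that by (simp only: mult_nonneg_nonneg zero_le_power2) (simp add: zero_le_mult_iff)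
  qed
  have p: "1 \<le> p" using assms by auto
  show "poly ?f (lobatto_node p i) = 0" if "i \<in> {0..p} - {j}" for i
  proof -
    consider "i = 0" | "i = p" | "i \<in> {1..<p} - {j}" using \<open>i \<in> {0..p} - {j}\<close> by force
    then show ?thesis
    proof cases
      case 3
      then show ?thesis by (auto simp: poly_prod intro!: prod_zero)
    qed (auto simp: lobatto_node_0[OF p] lobatto_node_p[OF p])
  qed
qed (use assms inj_on_lobatto_node in auto)

section \<open>Vector-valued polynomials\<close>

lemma vec_poly_mem: "subspace Y \<Longrightarrow> vec_poly Y m q \<Longrightarrow> q s \<in> Y"
  unfolding vec_poly_def by (auto intro!: subspace_sum subspace_scale)

lemma vec_poly_mono:
  assumes "subspace Y" "vec_poly Y m q" "m \<le> k"
  shows "vec_poly Y k q"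
proof -
  obtain a where a: "\<forall>i\<le>m. a i \<in> Y" "\<forall>s. q s = (\<Sum>i\<le>m. s ^ i *\<^sub>R a i)"
    using assms unfolding vec_poly_def by auto
  have "q s = (\<Sum>i\<le>k. s ^ i *\<^sub>R (if i \<le> m then a i else 0))" for s
    unfolding a(2)[rule_format] using \<open>m \<le> k\<close> by (intro sum.mono_neutral_cong_left) auto
  then show ?thesis unfolding vec_poly_def using a subspace_0[OF assms(1)]
    by (intro exI[of _ "\<lambda>i. if i \<le> m then a i else 0"]) auto
qed

lemma vec_poly_add:
  assumes "subspace Y" "vec_poly Y m q" "vec_poly Y m r"
  shows "vec_poly Y m (\<lambda>s. q s + r s)"
proof -
  obtain a b where "\<forall>i\<le>m. a i \<in> Y" "\<forall>s. q s = (\<Sum>i\<le>m. s ^ i *\<^sub>R a i)"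
    "\<forall>i\<le>m. b i \<in> Y" "\<forall>s. r s = (\<Sum>i\<le>m. s ^ i *\<^sub>R b i)"
    using assms unfolding vec_poly_def by auto
  then show ?thesis unfolding vec_poly_def using assms(1)
    by (intro exI[of _ "\<lambda>i. a i + b i"]) (auto simp: scaleR_right_distrib sum.distrib subspace_add)
qed

lemma vec_poly_scaleR:
  assumes "w \<in> Y" "subspace Y" "degree P \<le> m"
  shows "vec_poly Y m (\<lambda>s. poly P s *\<^sub>R w)"
proof -
  have "poly P s *\<^sub>R w = (\<Sum>i\<le>m. s ^ i *\<^sub>R (coeff P i *\<^sub>R w))" for s
  proof -
    have "poly P s = (\<Sum>i\<le>m. coeff P i * s ^ i)"
      unfolding poly_altdef using assms(3) by (intro sum.mono_neutral_left) (auto simp: coeff_eq_0)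
    then show ?thesis by (simp add: scaleR_sum_left mult.commute)
  qed
  then show ?thesis unfolding vec_poly_def using assms
    by (intro exI[of _ "\<lambda>i. coeff P i *\<^sub>R w"]) (auto simp: subspace_scale)
qed

lemma vec_poly_const: "w \<in> Y \<Longrightarrow> subspace Y \<Longrightarrow> vec_poly Y m (\<lambda>s. w)"
  using vec_poly_scaleR[of w Y 1 m] by simp

lemma vec_poly_sum:
  assumes "subspace Y" "\<And>i. i \<in> I \<Longrightarrow> vec_poly Y m (q i)"
  shows "vec_poly Y m (\<lambda>s. \<Sum>i\<in>I. q i s)"
  using assms(2)
  by (induction I rule: infinite_finite_induct)
    (auto intro!: vec_poly_add[OF assms(1)] vec_poly_const[OF subspace_0[OF assms(1)] assms(1)])

lemma vec_poly_diff:
  assumes "subspace Y" "vec_poly Y m q" "vec_poly Y m r"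
  shows "vec_poly Y m (\<lambda>s. q s - r s)"
proof -
  obtain a b where "\<forall>i\<le>m. a i \<in> Y" "\<forall>s. q s = (\<Sum>i\<le>m. s ^ i *\<^sub>R a i)"
    "\<forall>i\<le>m. b i \<in> Y" "\<forall>s. r s = (\<Sum>i\<le>m. s ^ i *\<^sub>R b i)"
    using assms unfolding vec_poly_def by auto
  then show ?thesis unfolding vec_poly_def using assms(1)
    by (intro exI[of _ "\<lambda>i. a i - b i"]) (auto simp: scaleR_right_diff_distrib sum_subtractf subspace_diff)
qed

lemma vec_poly_Times:
  assumes "0 \<in> Y" "0 \<in> Z"
  shows "vec_poly (Y \<times> Z) m q \<longleftrightarrow> vec_poly Y m (\<lambda>s. fst (q s)) \<and> vec_poly Z m (\<lambda>s. snd (q s))"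
proof
  assume "vec_poly (Y \<times> Z) m q"
  then obtain a where "\<forall>i\<le>m. a i \<in> Y \<times> Z" "\<forall>s. q s = (\<Sum>i\<le>m. s ^ i *\<^sub>R a i)"
    unfolding vec_poly_def by auto
  then show "vec_poly Y m (\<lambda>s. fst (q s)) \<and> vec_poly Z m (\<lambda>s. snd (q s))"
    unfolding vec_poly_def
    by (intro conjI exI[of _ "\<lambda>i. fst (a i)"] exI[of _ "\<lambda>i. snd (a i)"]) (auto simp: fst_sum snd_sum mem_Times_iff)
next
  assume "vec_poly Y m (\<lambda>s. fst (q s)) \<and> vec_poly Z m (\<lambda>s. snd (q s))"
  then obtain a b where "\<forall>i\<le>m. a i \<in> Y" "\<forall>s. fst (q s) = (\<Sum>i\<le>m. s ^ i *\<^sub>R a i)"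
    "\<forall>i\<le>m. b i \<in> Z" "\<forall>s. snd (q s) = (\<Sum>i\<le>m. s ^ i *\<^sub>R b i)"
    unfolding vec_poly_def by auto
  then show "vec_poly (Y \<times> Z) m q"
    unfolding vec_poly_def
    by (intro exI[of _ "\<lambda>i. (a i, b i)"]) (auto simp: prod_eq_iff fst_sum snd_sum)
qed

lemma vec_poly_deriv:
  fixes q :: "real \<Rightarrow> 'v::real_normed_vector"
  assumes Y: "subspace Y" and q: "vec_poly Y m q"
  shows "vec_poly Y (m - 1) (\<lambda>s. vector_derivative q (at s))"
    and "(q has_vector_derivative vector_derivative q (at s)) (at s)"
proof -
  obtain a where a: "\<And>i. i \<le> m \<Longrightarrow> a i \<in> Y" and qa: "q = (\<lambda>s. \<Sum>i\<le>m. s ^ i *\<^sub>R a i)"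
    using q unfolding vec_poly_def by auto
  have d: "(q has_vector_derivative (\<Sum>i\<le>m. (real i * s ^ (i - 1)) *\<^sub>R a i)) (at s)" for s
    unfolding qa by (rule has_vector_derivative_sum)
      (auto intro!: derivative_eq_intros simp flip: has_real_derivative_iff_has_vector_derivative)
  then have vd: "vector_derivative q (at s) = (\<Sum>i\<le>m. (real i * s ^ (i - 1)) *\<^sub>R a i)" for s
    by (rule vector_derivative_at)
  show "(q has_vector_derivative vector_derivative q (at s)) (at s)" using d vd by simp
  show "vec_poly Y (m - 1) (\<lambda>s. vector_derivative q (at s))"
  proof (cases m)
    case 0
    then show ?thesis unfolding vd using vec_poly_const[OF subspace_0[OF Y] Y] by simp
  next
    case (Suc k)
    have "vector_derivative q (at s) = (\<Sum>i\<le>k. s ^ i *\<^sub>R (real (Suc i) *\<^sub>R a (Suc i)))" for s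
      unfolding vd Suc sum.atMost_Suc_shift by (simp add: mult.commute)
    then show ?thesis unfolding vec_poly_def using Suc a Y
      by (intro exI[of _ "\<lambda>i. real (Suc i) *\<^sub>R a (Suc i)"]) (auto simp: subspace_scale)
  qed
qed

lemma vec_poly_lagrange:
  assumes "vec_poly Y m q" "finite I" "inj_on c I" "m < card I"
  shows "q s = (\<Sum>j\<in>I. poly (lagrange_poly I c j) s *\<^sub>R q (c j))"
proof -
  obtain a where a: "\<And>s. q s = (\<Sum>i\<le>m. s ^ i *\<^sub>R a i)"
    using assms unfolding vec_poly_def by auto
  have "s ^ i = (\<Sum>j\<in>I. c j ^ i * poly (lagrange_poly I c j) s)" if "i \<le> m" for i
  proof -
    have "monom 1 i = (\<Sum>j\<in>I. smult (poly (monom 1 i) (c j)) (lagrange_poly I c j))"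
      using assms that by (intro poly_eq_lagrange) (auto simp: degree_monom_eq)
    from arg_cong[OF this, of "\<lambda>f. poly f s"] show ?thesis by (simp add: poly_sum poly_monom)
  qed
  then have "q s = (\<Sum>i\<le>m. \<Sum>j\<in>I. poly (lagrange_poly I c j) s *\<^sub>R (c j ^ i *\<^sub>R a i))"
    unfolding a by (intro sum.cong refl) (simp add: scaleR_sum_left mult.commute)
  also have "\<dots> = (\<Sum>j\<in>I. poly (lagrange_poly I c j) s *\<^sub>R q (c j))"
    unfolding a scaleR_sum_right by (rule sum.swap)
  finally show ?thesis .
qed

lemma vec_poly_eqI:
  assumes "vec_poly Y m q" "vec_poly Y m r" "finite I" "inj_on c I" "m < card (I :: nat set)"
    "\<And>j. j \<in> I \<Longrightarrow> q (c j) = r (c j)"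
  shows "q = r"
proof
  fix s show "q s = r s"
    using vec_poly_lagrange[OF assms(1,3-5), of s] vec_poly_lagrange[OF assms(2,3-5), of s] assms(6) by simp
qed

lemma vec_poly_interpolation:
  assumes "subspace Y" "finite I" "inj_on c I" "I \<noteq> {}" "card (I :: nat set) \<le> Suc m" "\<And>j. j \<in> I \<Longrightarrow> f j \<in> Y"
  shows "\<exists>q. vec_poly Y m q \<and> (\<forall>j\<in>I. q (c j) = f j)"
proof (intro exI conjI ballI)
  let ?q = "\<lambda>s. \<Sum>j\<in>I. poly (lagrange_poly I c j) s *\<^sub>R f j"
  show "vec_poly Y m ?q"
  proof (intro vec_poly_sum vec_poly_scaleR)
    show "degree (lagrange_poly I c j) \<le> m" if "j \<in> I" for j
      using degree_lagrange_poly[OF assms(2) that, of c] assms(5) by simp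
  qed (use assms in auto)
  show "?q (c i) = f i" if "i \<in> I" for i
    using assms that by (simp add: lagrange_poly_node if_distrib[of "\<lambda>x. x *\<^sub>R _"] sum.delta cong: if_cong)
qed

text \<open>The coefficientwise antiderivative of \<open>v\<close> differs from \<open>u\<close> by a constant, which lies in \<open>Y\<close>
  because the value at \<open>s0\<close> does.\<close>
lemma vec_poly_antideriv:
  fixes u :: "real \<Rightarrow> 'v::real_normed_vector"
  assumes Y: "subspace Y" and v: "vec_poly Y k v" and u: "\<And>s. (u has_vector_derivative v s) (at s)" "u s0 \<in> Y"
  shows "vec_poly Y (Suc k) u"
proof -
  obtain a where a: "\<And>i. i \<le> k \<Longrightarrow> a i \<in> Y" and va: "\<And>s. v s = (\<Sum>i\<le>k. s ^ i *\<^sub>R a i)"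
    using v unfolding vec_poly_def by auto
  define V where "V s = (\<Sum>i\<le>k. poly (monom (1 / Suc i) (Suc i)) s *\<^sub>R a i)" for s
  have V: "vec_poly Y (Suc k) V"
    unfolding V_def using a Y
    by (intro vec_poly_sum vec_poly_scaleR) (auto intro: order_trans[OF degree_monom_le])
  have m: "((\<lambda>s. 1 / real (Suc i) * s ^ Suc i) has_real_derivative s ^ i) (at s)" for i s
    using DERIV_cmult[OF DERIV_pow[of "Suc i" s], of "1 / real (Suc i)"] by (simp add: field_simps del: of_nat_Suc)
  have "(V has_vector_derivative v s) (at s)" for s
    unfolding V_def[abs_def] va poly_monom
  proof (rule has_vector_derivative_sum)
    show "((\<lambda>s. (1 / real (Suc i) * s ^ Suc i) *\<^sub>R a i) has_vector_derivative s ^ i *\<^sub>R a i) (at s)" for i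
      using has_vector_derivative_scaleR[OF m[of i s], OF has_vector_derivative_const[of "a i"]]
      by (simp del: of_nat_Suc)
  qed
  then have "((\<lambda>s. u s - V s) has_vector_derivative 0) (at s)" for s
    using has_vector_derivative_diff[OF u(1)[of s], of V "v s"] by simp
  then obtain d where "\<And>s. s \<in> UNIV \<Longrightarrow> u s - V s = d"
    using has_vector_derivative_zero_constant[of UNIV "\<lambda>s. u s - V s"] by (metis convex_UNIV)
  then have d: "u s = V s + d" for s by (metis UNIV_I add.commute diff_add_cancel)
  have "d \<in> Y" using d[of s0] u(2) vec_poly_mem[OF Y V, of s0] subspace_diff[OF Y] by (metis add_diff_cancel_left')
  then show ?thesis using vec_poly_add[OF Y V vec_poly_const[of d]] Y by (simp add: d[abs_def])
qed

section \<open>Time meshes\<close>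

lemma time_mesh_mono:
  assumes "time_mesh T N t" "m \<le> n" "n \<le> N"
  shows "t m \<le> t n"
  using assms(2,3)
proof (induction n rule: dec_induct)
  case (step n)
  then show ?case using assms(1) unfolding time_mesh_def by (meson Suc_leD Suc_le_lessD less_imp_le order_trans)
qed simp

lemma time_mesh_step: "time_mesh T N t \<Longrightarrow> n \<in> {1..N} \<Longrightarrow> t (n - 1) < t n"
  unfolding time_mesh_def by (cases n) auto

lemma time_mesh_slab:
  assumes "time_mesh T N t" "n \<in> {1..N}"
  shows "0 \<le> t (n - 1)" "t n \<le> T"
  using time_mesh_mono[OF assms(1), of 0 "n - 1"] time_mesh_mono[OF assms(1), of n N] assms
  unfolding time_mesh_def by auto

lemma time_mesh_cover:
  assumes "time_mesh T N t" "T > 0" "s \<in> {0..T}"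
  obtains n where "n \<in> {1..N}" "s \<in> {t (n - 1)..t n}"
proof -
  have t0: "t 0 = 0" "t N = T" using assms unfolding time_mesh_def by auto
  then have N: "N \<ge> 1" using assms(2) by (cases N) auto
  show thesis
  proof (cases "s = 0")
    case True
    then show thesis using that[of 1] N t0 time_mesh_step[OF assms(1), of 1] by auto
  next
    case False
    define n where "n = (LEAST n. s \<le> t n)"
    have sn: "s \<le> t n" unfolding n_def by (rule LeastI[of _ N]) (use assms t0 in auto)
    have nN: "n \<le> N" unfolding n_def by (rule Least_le) (use assms t0 in auto)
    have n0: "n \<noteq> 0" using sn t0 False assms(3) by (cases n) auto
    then have "\<not> s \<le> t (n - 1)" unfolding n_def by (intro not_less_Least) auto
    then show thesis using that[of n] sn nN n0 by auto
  qed
qed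

lemma slab_node_mem:
  assumes "s0 < s1" "0 \<le> c" "c \<le> (1::real)"
  shows "s0 + c * (s1 - s0) \<in> {s0..s1}"
proof -
  have "c * (s1 - s0) \<le> 1 * (s1 - s0)" by (rule mult_right_mono) (use assms in auto)
  then have "s0 + c * (s1 - s0) \<le> s1" by simp
  moreover have "0 \<le> c * (s1 - s0)" by (rule mult_nonneg_nonneg) (use assms in auto)
  ultimately show ?thesis by simp
qed

lemma inj_on_slab_nodes:
  "inj_on c I \<Longrightarrow> s0 < s1 \<Longrightarrow> inj_on (\<lambda>j. s0 + c j * (s1 - s0)) (I::nat set)" for s0 :: real
  by (auto simp: inj_on_def)

lemma inj_on_extra_node:
  assumes "inj_on \<tau> {1..p}" "x \<notin> \<tau> ` {1..p}"
  shows "inj_on (\<lambda>j::nat. if j = 0 then x else \<tau> j) {0..p}"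
proof (rule inj_onI)
  fix i j assume ij: "i \<in> {0..p}" "j \<in> {0..p}" "(if i = 0 then x else \<tau> i) = (if j = 0 then x else \<tau> j)"
  have "\<tau> l \<noteq> x" if "l \<in> {0..p}" "l \<noteq> 0" for l using assms(2) that by force
  then show "i = j" using ij inj_onD[OF assms(1), of i j] by (auto split: if_splits)
qed

section \<open>Finite-dimensional Galerkin spaces\<close>

text \<open>The dimension of \<open>S\<close> is not fixed, so \<open>S\<close> is a subset of a normed space rather than a type.
  The expansion, which every finite orthonormal basis \<open>E\<close> has, expresses both the finite dimension
  and the nondegeneracy of \<open>M\<close> on \<open>S\<close>.\<close>
locale galerkin_space =
  fixes S :: "'v::real_normed_vector set" and M :: "'v \<Rightarrow> 'v \<Rightarrow> real" and E :: "'v set"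
  assumes subspace: "subspace S" and bilinear: "bounded_bilinear M" and M_sym: "M x y = M y x"
    and finite_E: "finite E" and E_subset: "E \<subseteq> S"
    and expansion: "x \<in> S \<Longrightarrow> x = (\<Sum>e\<in>E. M x e *\<^sub>R e)"
begin

lemmas M_simps = bounded_bilinear.add_left[OF bilinear] bounded_bilinear.add_right[OF bilinear]
  bounded_bilinear.diff_left[OF bilinear] bounded_bilinear.diff_right[OF bilinear]
  bounded_bilinear.zero_left[OF bilinear] bounded_bilinear.zero_right[OF bilinear]
  bounded_bilinear.scaleR_left[OF bilinear] bounded_bilinear.scaleR_right[OF bilinear]
  bounded_bilinear.sum_left[OF bilinear] bounded_bilinear.sum_right[OF bilinear]

lemmas S_mem = vec_poly_mem[OF subspace]

lemma M_nondegenerate: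
  assumes "x \<in> S" "\<And>w. w \<in> S \<Longrightarrow> M x w = 0"
  shows "x = 0"
  using expansion[OF assms(1)] assms(2) E_subset by (simp add: subset_iff)

lemma riesz:
  assumes add: "\<And>x y. x \<in> S \<Longrightarrow> y \<in> S \<Longrightarrow> l (x + y) = l x + l y"
    and scale: "\<And>a x. x \<in> S \<Longrightarrow> l (a *\<^sub>R x) = a * (l x :: real)"
  defines "z \<equiv> \<Sum>e\<in>E. l e *\<^sub>R e"
  shows "z \<in> S" "w \<in> S \<Longrightarrow> M z w = l w"
proof -
  show "z \<in> S" unfolding z_def using subspace E_subset by (auto intro!: subspace_sum subspace_scale)
  have l0: "l 0 = 0" using scale[of 0 0] subspace_0[OF subspace] by simp
  have ls: "l (\<Sum>e\<in>A. b e *\<^sub>R e) = (\<Sum>e\<in>A. b e * l e)" if "finite A" "A \<subseteq> S" for A b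
    using that
  proof (induction A)
    case (insert x A)
    then have "(\<Sum>e\<in>A. b e *\<^sub>R e) \<in> S" "b x *\<^sub>R x \<in> S"
      using subspace by (auto intro!: subspace_sum subspace_scale)
    then show ?case using insert by (simp add: add scale)
  qed (simp add: l0)
  assume w: "w \<in> S"
  have "M z w = (\<Sum>e\<in>E. M w e * l e)" unfolding z_def by (simp add: M_simps M_sym[of _ w] mult.commute)
  also have "\<dots> = l (\<Sum>e\<in>E. M w e *\<^sub>R e)" using ls[OF finite_E E_subset] by simp
  also have "\<dots> = l w" using expansion[OF w] by simp
  finally show "M z w = l w" .
qed

lemma M_vec_poly:
  assumes q: "vec_poly S m q" and r: "vec_poly S k r"
  shows "\<exists>P. degree P \<le> m + k \<and> (\<forall>s. M (q s) (r s) = poly P s) \<and>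
    (\<forall>s. M (vector_derivative q (at s)) (r s) + M (q s) (vector_derivative r (at s)) = poly (pderiv P) s)"
proof -
  obtain a b where a: "\<And>s. q s = (\<Sum>i\<le>m. s ^ i *\<^sub>R a i)" and b: "\<And>s. r s = (\<Sum>i\<le>k. s ^ i *\<^sub>R b i)"
    using q r unfolding vec_poly_def by auto
  define P where "P = (\<Sum>i\<le>m. \<Sum>j\<le>k. monom (M (a i) (b j)) (i + j))"
  have "degree P \<le> m + k" unfolding P_def
    by (intro degree_sum_le finite_atMost) (auto intro: order_trans[OF degree_monom_le])
  moreover have P: "M (q s) (r s) = poly P s" for s
    unfolding a b P_def M_simps(10) M_simps(9) M_simps(7) M_simps(8) poly_sum poly_monom
    by (subst sum.swap) (simp add: power_add mult_ac sum_distrib_left)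
  moreover have "M (vector_derivative q (at s)) (r s) + M (q s) (vector_derivative r (at s)) = poly (pderiv P) s" for s
  proof -
    have "((\<lambda>s. M (q s) (r s)) has_vector_derivative
        M (q s) (vector_derivative r (at s)) + M (vector_derivative q (at s)) (r s)) (at s)"
      by (rule bounded_bilinear.has_vector_derivative[OF bilinear])
        (use vec_poly_deriv(2)[OF subspace q] vec_poly_deriv(2)[OF subspace r] in auto)
    moreover have "(poly P has_vector_derivative poly (pderiv P) s) (at s)"
      by (simp add: poly_DERIV flip: has_real_derivative_iff_has_vector_derivative)
    ultimately show ?thesis unfolding P[abs_def, symmetric]
      by (metis add.commute vector_derivative_unique_at)
  qed
  ultimately show ?thesis by blast
qed

lemma M_integral_quadrature:
  assumes q: "vec_poly S m q" and r: "vec_poly S k r" and ex: "quadrature_exact I c (m + k)" and le: "s0 \<le> s1"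
  shows "integral {s0..s1} (\<lambda>s. M (q s) (r s)) =
    (s1 - s0) * (\<Sum>j\<in>I. quad_weight I c j * M (q (s0 + c j * (s1 - s0))) (r (s0 + c j * (s1 - s0))))"
proof -
  obtain P where "degree P \<le> m + k" "\<And>s. M (q s) (r s) = poly P s" using M_vec_poly[OF q r] by auto
  then show ?thesis using quadrature_exact_integral[OF ex _ le, of P] by simp
qed

lemma M_increment_quadrature:
  assumes q: "vec_poly S m q" and r: "vec_poly S k r" and ex: "quadrature_exact I c d" and d: "m + k \<le> Suc d"
  shows "M (q s1) (r s1) - M (q s0) (r s0) =
    (s1 - s0) * (\<Sum>j\<in>I. quad_weight I c j *
      (M (vector_derivative q (at (s0 + c j * (s1 - s0)))) (r (s0 + c j * (s1 - s0))) +
       M (q (s0 + c j * (s1 - s0))) (vector_derivative r (at (s0 + c j * (s1 - s0))))))"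
proof -
  obtain P where "degree P \<le> m + k" "\<And>s. M (q s) (r s) = poly P s"
    "\<And>s. M (vector_derivative q (at s)) (r s) + M (q s) (vector_derivative r (at s)) = poly (pderiv P) s"
    using M_vec_poly[OF q r] by auto
  then show ?thesis using quadrature_exact_increment[OF ex, of P s1 s0] d by simp
qed

text \<open>The product of $\dot u$ and $\dot w$ has degree at most $2p-2$. It is integrated exactly, and
  at the nodes $\dot u$ may be replaced by \<open>v\<close>. The derivative of $M(v,w)$ has degree at most
  $2p-1$ and is integrated exactly as well.\<close>
lemma slab_integration_by_parts:
  assumes p: "p \<ge> 1" and u: "vec_poly S p u" and v: "vec_poly S p v" and w: "vec_poly S p w"
    and ex: "quadrature_exact I c (2 * p - 1)" and le: "s0 \<le> s1"
    and uv: "\<And>j. j \<in> I \<Longrightarrow> vector_derivative u (at (s0 + c j * (s1 - s0))) = v (s0 + c j * (s1 - s0))"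
  shows "integral {s0..s1} (\<lambda>s. M (vector_derivative u (at s)) (vector_derivative w (at s))) =
    M (v s1) (w s1) - M (v s0) (w s0) - (s1 - s0) * (\<Sum>j\<in>I. quad_weight I c j *
      M (vector_derivative v (at (s0 + c j * (s1 - s0)))) (w (s0 + c j * (s1 - s0))))"
proof -
  have "quadrature_exact I c ((p - 1) + (p - 1))"
    using ex unfolding quadrature_exact_def by (simp add: mult_2)
  from M_integral_quadrature[OF vec_poly_deriv(1)[OF subspace u] vec_poly_deriv(1)[OF subspace w] this le]
  have 1: "integral {s0..s1} (\<lambda>s. M (vector_derivative u (at s)) (vector_derivative w (at s))) =
    (s1 - s0) * (\<Sum>j\<in>I. quad_weight I c j *
      M (v (s0 + c j * (s1 - s0))) (vector_derivative w (at (s0 + c j * (s1 - s0)))))"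
    using uv by simp
  show ?thesis unfolding 1 using M_increment_quadrature[OF v w ex, of s1 s0] p
    by (simp add: distrib_left sum.distrib)
qed

section \<open>Tensor products as piecewise polynomials\<close>

text \<open>From right to left, the coefficients with respect to the basis \<open>E\<close> are the scalar factors;
  they are continuous because adjacent pieces agree with \<open>U\<close> at the common node.\<close>
lemma tensor_time_space_iff:
  assumes mesh: "time_mesh T N t" and T: "T > 0"
  shows "U \<in> tensor T S (time_space N t p) \<longleftrightarrow>
    (\<exists>u. \<forall>n\<in>{1..N}. vec_poly S p (u n) \<and> (\<forall>s\<in>{t (n-1)..t n}. U s = u n s))" (is "?L \<longleftrightarrow> ?R")
proof
  assume L: ?L
  obtain m w \<theta> where mw: "\<forall>i<(m::nat). w i \<in> S \<and> \<theta> i \<in> time_space N t p"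
    "\<forall>s\<in>{0..T}. U s = (\<Sum>i<m. \<theta> i s *\<^sub>R w i)"
    using L unfolding tensor_def mem_Collect_eq by blast
  note w = mw(1)[rule_format, THEN conjunct1] and \<theta> = mw(1)[rule_format, THEN conjunct2]
    and U = mw(2)[rule_format]
  have "\<forall>i\<in>{..<m}. \<forall>n\<in>{1..N}. \<exists>P. degree P \<le> p \<and> (\<forall>s\<in>{t (n-1)..t n}. \<theta> i s = poly P s)"
    using \<theta> unfolding time_space_def by simp
  then obtain P where P: "\<And>i n. i < m \<Longrightarrow> n \<in> {1..N} \<Longrightarrow> degree (P i n) \<le> p"
    "\<And>i n s. i < m \<Longrightarrow> n \<in> {1..N} \<Longrightarrow> s \<in> {t (n-1)..t n} \<Longrightarrow> \<theta> i s = poly (P i n) s"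
    by (metis lessThan_iff)
  show ?R
  proof (intro exI[of _ "\<lambda>n s. \<Sum>i<m. poly (P i n) s *\<^sub>R w i"] ballI conjI)
    fix n assume n: "n \<in> {1..N}"
    show "vec_poly S p (\<lambda>s. \<Sum>i<m. poly (P i n) s *\<^sub>R w i)"
      using P(1) n w subspace by (intro vec_poly_sum vec_poly_scaleR) auto
    fix s assume s: "s \<in> {t (n-1)..t n}"
    then have "s \<in> {0..T}" using time_mesh_slab[OF mesh n] by auto
    then show "U s = (\<Sum>i<m. poly (P i n) s *\<^sub>R w i)" using U P(2) n s by simp
  qed
next
  assume ?R
  then obtain u where u': "\<forall>n\<in>{1..N}. vec_poly S p (u n) \<and> (\<forall>s\<in>{t (n-1)..t n}. U s = u n s)" by blast
  have u: "\<And>n. n \<in> {1..N} \<Longrightarrow> vec_poly S p (u n)"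
    "\<And>n s. n \<in> {1..N} \<Longrightarrow> s \<in> {t (n-1)..t n} \<Longrightarrow> U s = u n s" using u' by blast+
  have US: "U s \<in> S" if "s \<in> {0..T}" for s
    using time_mesh_cover[OF mesh T that] u S_mem by metis
  obtain e where e: "bij_betw e {..<card E} E"
    using finite_E bij_betw_from_nat_into_finite by blast
  have te: "(\<lambda>s. M (U s) x) \<in> time_space N t p" if "x \<in> S" for x
  proof -
    have P: "\<exists>P. degree P \<le> p \<and> (\<forall>s\<in>{t (n-1)..t n}. M (U s) x = poly P s)" if n: "n \<in> {1..N}" for n
      using M_vec_poly[OF u(1)[OF n] vec_poly_const[OF \<open>x \<in> S\<close> subspace, of 0]] u(2)[OF n] by auto
    have "{t 0..t N} = (\<Union>n\<in>{1..N}. {t (n-1)..t n})"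
    proof (intro equalityI subsetI)
      fix s assume "s \<in> {t 0..t N}"
      then have "s \<in> {0..T}" using mesh unfolding time_mesh_def by auto
      then show "s \<in> (\<Union>n\<in>{1..N}. {t (n-1)..t n})" using time_mesh_cover[OF mesh T] by blast
    next
      fix s assume "s \<in> (\<Union>n\<in>{1..N}. {t (n-1)..t n})"
      then obtain n where n: "n \<in> {1..N}" "s \<in> {t (n-1)..t n}" by blast
      then show "s \<in> {t 0..t N}" using time_mesh_slab[OF mesh n(1)] mesh unfolding time_mesh_def by auto
    qed
    moreover have "continuous_on (\<Union>n\<in>{1..N}. {t (n-1)..t n}) (\<lambda>s. M (U s) x)"
    proof (rule continuous_on_closed_Union)
      fix n assume "n \<in> {1..N}"
      from P[OF this] obtain P where "\<forall>s\<in>{t (n-1)..t n}. M (U s) x = poly P s" by auto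
      moreover have "continuous_on {t (n-1)..t n} (\<lambda>s. poly P s)" by (intro continuous_intros)
      ultimately show "continuous_on {t (n-1)..t n} (\<lambda>s. M (U s) x)" by (simp cong: continuous_on_cong_simp)
    qed auto
    ultimately show ?thesis unfolding time_space_def using P by simp
  qed
  have "U s = (\<Sum>i<card E. M (U s) (e i) *\<^sub>R e i)" if "s \<in> {0..T}" for s
    using expansion[OF US[OF that]] sum.reindex_bij_betw[OF e, of "\<lambda>x. M (U s) x *\<^sub>R x"] by simp
  moreover have "e i \<in> S" if "i < card E" for i using e E_subset that by (auto simp: bij_betw_def)
  ultimately show ?L unfolding tensor_def mem_Collect_eq using te
    by (intro exI[of _ "card E"] exI[of _ e] exI[of _ "\<lambda>i s. M (U s) (e i)"] conjI allI impI ballI) auto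
qed

lemma tensor_time_space0_iff:
  assumes mesh: "time_mesh T N t" and T: "T > 0"
  shows "U \<in> tensor T S (time_space0 N t p) \<longleftrightarrow> U T = 0 \<and>
    (\<exists>u. \<forall>n\<in>{1..N}. vec_poly S p (u n) \<and> (\<forall>s\<in>{t (n-1)..t n}. U s = u n s))" (is "?L \<longleftrightarrow> ?R")
proof
  assume L: ?L
  obtain m w \<theta> where mw: "\<forall>i<(m::nat). w i \<in> S \<and> \<theta> i \<in> time_space0 N t p"
    "\<forall>s\<in>{0..T}. U s = (\<Sum>i<m. \<theta> i s *\<^sub>R w i)"
    using L unfolding tensor_def mem_Collect_eq by blast
  note w = mw(1)[rule_format] and U = mw(2)[rule_format]
  have "\<theta> i \<in> time_space N t p \<and> \<theta> i T = 0" if "i < m" for i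
    using w[OF that] mesh unfolding time_space0_def time_mesh_def by simp
  then have "U T = 0" and "U \<in> tensor T S (time_space N t p)"
    using U[of T] T w U unfolding tensor_def mem_Collect_eq
    by (simp, intro exI[of _ m] exI[of _ w] exI[of _ \<theta>] conjI allI impI ballI) auto
  moreover note \<open>U T = 0\<close>
  ultimately show ?R using tensor_time_space_iff[OF mesh T] by simp
next
  assume R: ?R
  then have L: "U \<in> tensor T S (time_space N t p)" using tensor_time_space_iff[OF mesh T] by simp
  obtain m w \<theta> where mw: "\<forall>i<(m::nat). w i \<in> S \<and> \<theta> i \<in> time_space N t p"
    "\<forall>s\<in>{0..T}. U s = (\<Sum>i<m. \<theta> i s *\<^sub>R w i)"
    using L unfolding tensor_def mem_Collect_eq by blast
  note w = mw(1)[rule_format, THEN conjunct1] and \<theta> = mw(1)[rule_format, THEN conjunct2]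
    and U = mw(2)[rule_format]
  have "U T = (\<Sum>i<m. \<theta> i T *\<^sub>R w i)" using U T by simp
  then have z: "(\<Sum>i<m. \<theta> i T *\<^sub>R w i) = 0" using R by simp
  \<comment> \<open>subtracting the end values from the scalar factors does not change the sum\<close>
  have "U s = (\<Sum>i<m. (\<theta> i s - \<theta> i T) *\<^sub>R w i)" if "s \<in> {0..T}" for s
    using U[OF that] z by (simp add: scaleR_left_diff_distrib sum_subtractf)
  moreover have "(\<lambda>s. \<theta> i s - \<theta> i T) \<in> time_space0 N t p" if "i < m" for i
  proof -
    have "\<exists>P. degree P \<le> p \<and> (\<forall>s\<in>{t (n-1)..t n}. \<theta> i s - \<theta> i T = poly P s)" if n: "n \<in> {1..N}" for n
    proof -
      obtain P where "degree P \<le> p" "\<forall>s\<in>{t (n-1)..t n}. \<theta> i s = poly P s"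
        using \<theta>[OF \<open>i < m\<close>] n unfolding time_space_def by blast
      then show ?thesis by (intro exI[of _ "P - [:\<theta> i T:]"]) (auto intro: degree_diff_le)
    qed
    then show ?thesis using \<theta>[OF that] mesh unfolding time_space0_def time_space_def time_mesh_def
      by (auto intro!: continuous_intros)
  qed
  ultimately show ?L unfolding tensor_def mem_Collect_eq using w
    by (intro exI[of _ m] exI[of _ w] exI[of _ "\<lambda>i s. \<theta> i s - \<theta> i T"] conjI allI impI ballI) auto
qed

section \<open>Decoupling of the scheme into weak steps\<close>

text \<open>The contribution of one slab to the scheme, with the sign reversed and with stiffness,
  nonlinearity and load collected in the acceleration \<open>k\<close>.\<close>
definition weak_form :: "('v \<Rightarrow> real \<Rightarrow> 'v) \<Rightarrow> nat set \<Rightarrow> (nat \<Rightarrow> real) \<Rightarrow> real \<Rightarrow> real \<Rightarrow>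
    (real \<Rightarrow> 'v) \<Rightarrow> (real \<Rightarrow> 'v) \<Rightarrow> real" where
  "weak_form k I c s0 s1 u w =
     integral {s0..s1} (\<lambda>s. M (vector_derivative u (at s)) (vector_derivative w (at s))) +
     (s1 - s0) * (\<Sum>j\<in>I. quad_weight I c j *
       M (k (u (s0 + c j * (s1 - s0))) (s0 + c j * (s1 - s0))) (w (s0 + c j * (s1 - s0))))"

text \<open>The weak form of $\ddot u = k(u)$ on one slab, with initial velocity \<open>z0\<close> and end velocity
  \<open>z1\<close>.\<close>
definition weak_step :: "('v \<Rightarrow> real \<Rightarrow> 'v) \<Rightarrow> nat \<Rightarrow> nat set \<Rightarrow> (nat \<Rightarrow> real) \<Rightarrow> real \<Rightarrow> real \<Rightarrow>
    (real \<Rightarrow> 'v) \<Rightarrow> 'v \<Rightarrow> 'v \<Rightarrow> bool" where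
  "weak_step k p I c s0 s1 u z0 z1 \<longleftrightarrow> (\<forall>w. vec_poly S p w \<longrightarrow>
     weak_form k I c s0 s1 u w = M z1 (w s1) - M z0 (w s0))"

lemma M_integrable:
  assumes "vec_poly S m q" "vec_poly S k r"
  shows "(\<lambda>s. M (q s) (r s)) integrable_on {a..b}"
proof -
  obtain P where "\<And>s. M (q s) (r s) = poly P s" using M_vec_poly[OF assms] by auto
  then show ?thesis using poly_integrable[of P a b] by simp
qed

lemma weak_form_add:
  assumes "vec_poly S p u" "vec_poly S p w" "vec_poly S p w'"
  shows "weak_form k I c s0 s1 u (\<lambda>s. w s + w' s) = weak_form k I c s0 s1 u w + weak_form k I c s0 s1 u w'"
proof -
  have vd: "vector_derivative (\<lambda>s. w s + w' s) (at s) = vector_derivative w (at s) + vector_derivative w' (at s)" for s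
    using vec_poly_deriv(2)[OF subspace assms(2)] vec_poly_deriv(2)[OF subspace assms(3)]
    by (intro vector_derivative_at has_vector_derivative_add)
  note d = vec_poly_deriv(1)[OF subspace assms(1)] vec_poly_deriv(1)[OF subspace assms(2)]
    vec_poly_deriv(1)[OF subspace assms(3)]
  show ?thesis unfolding weak_form_def vd M_simps
    using integral_add[OF M_integrable[OF d(1,2)] M_integrable[OF d(1,3)]]
    by (simp add: sum.distrib distrib_left)
qed

lemma weak_form_const:
  "weak_form k I c s0 s1 u (\<lambda>s. x) =
     (s1 - s0) * (\<Sum>j\<in>I. quad_weight I c j * M (k (u (s0 + c j * (s1 - s0))) (s0 + c j * (s1 - s0))) x)"
  unfolding weak_form_def by (simp add: M_simps)

text \<open>Under the assumption, the weak form plus $M(z_0,w(s_0))$ depends on the value of \<open>w\<close> at \<open>s1\<close>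
  only. It is therefore determined by constant test functions, on which it is a linear functional,
  and \<open>z1\<close> is its Riesz representative.\<close>
lemma weak_step_exists:
  assumes u: "vec_poly S p u"
    and end_value: "\<And>w. vec_poly S p w \<Longrightarrow> w s1 = 0 \<Longrightarrow> weak_form k I c s0 s1 u w + M z0 (w s0) = 0"
  obtains z1 where "z1 \<in> S" "weak_step k p I c s0 s1 u z0 z1"
proof -
  define l where "l x = weak_form k I c s0 s1 u (\<lambda>s. x) + M z0 x" for x
  define z1 where "z1 = (\<Sum>e\<in>E. l e *\<^sub>R e)"
  have "l (x + y) = l x + l y" "l (a *\<^sub>R x) = a * l x" for x y a
    unfolding l_def weak_form_const by (simp_all add: M_simps sum.distrib distrib_left sum_distrib_left mult_ac)
  then have z: "z1 \<in> S" "\<And>w. w \<in> S \<Longrightarrow> M z1 w = l w" using riesz[of l] unfolding z1_def by auto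
  moreover have "weak_step k p I c s0 s1 u z0 z1" unfolding weak_step_def
  proof (intro allI impI)
    fix w assume w: "vec_poly S p w"
    note cs = vec_poly_const[OF S_mem[OF w, of s1] subspace, of p]
    have "weak_form k I c s0 s1 u (\<lambda>s. (w s - w s1) + w s1) =
        weak_form k I c s0 s1 u (\<lambda>s. w s - w s1) + weak_form k I c s0 s1 u (\<lambda>s. w s1)"
      using vec_poly_diff[OF subspace w cs] cs by (rule weak_form_add[OF u])
    moreover have "weak_form k I c s0 s1 u (\<lambda>s. w s - w s1) + M z0 (w s0 - w s1) = 0"
      using vec_poly_diff[OF subspace w cs] by (intro end_value) auto
    ultimately show "weak_form k I c s0 s1 u w = M z1 (w s1) - M z0 (w s0)"
      using z(2)[OF S_mem[OF w]] by (simp add: l_def M_simps)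
  qed
  ultimately show thesis using that by blast
qed

lemma sum_telescope_slabs:
  fixes f :: "nat \<Rightarrow> real"
  shows "(\<Sum>n\<in>{1..m}. f n - f (n - 1)) = f m - f 0"
  by (induction m) auto

text \<open>Given the end velocities, the boundary terms telescope. Conversely, the end velocities are
  found one after the other: a test function on slab $m+1$ that vanishes at its right end extends
  to a global test function, and the slabs before it contribute a telescoping sum as the weak steps
  are already known there.\<close>
lemma scheme_iff_weak_steps:
  assumes mesh: "time_mesh T N t" and T: "T > 0" and v0: "v0 \<in> S"
    and u: "\<And>n. n \<in> {1..N} \<Longrightarrow> vec_poly S p (u n)"
  shows "(\<forall>W w. W T = 0 \<longrightarrow> (\<forall>n\<in>{1..N}. vec_poly S p (w n) \<and> (\<forall>s\<in>{t (n-1)..t n}. W s = w n s)) \<longrightarrow>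
      (\<Sum>n\<in>{1..N}. weak_form k I c (t (n-1)) (t n) (u n) (w n)) + M v0 (W 0) = 0) \<longleftrightarrow>
    (\<exists>z. z 0 = v0 \<and> (\<forall>n\<le>N. z n \<in> S) \<and>
      (\<forall>n\<in>{1..N}. weak_step k p I c (t (n-1)) (t n) (u n) (z (n-1)) (z n)))" (is "?L \<longleftrightarrow> ?R")
proof
  assume ?R
  then obtain z where z: "z 0 = v0" "\<And>n. n \<in> {1..N} \<Longrightarrow> weak_step k p I c (t (n-1)) (t n) (u n) (z (n-1)) (z n)"
    by blast
  show ?L
  proof (intro allI impI)
    fix W w assume W: "W T = 0" "\<forall>n\<in>{1..N}. vec_poly S p (w n) \<and> (\<forall>s\<in>{t (n-1)..t n}. W s = w n s)"
    have "weak_form k I c (t (n-1)) (t n) (u n) (w n) = M (z n) (W (t n)) - M (z (n-1)) (W (t (n-1)))"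
      if n: "n \<in> {1..N}" for n
    proof -
      have "W (t n) = w n (t n)" "W (t (n-1)) = w n (t (n-1))" "vec_poly S p (w n)"
        using W(2) n time_mesh_step[OF mesh n] by auto
      then show ?thesis using z(2)[OF n] unfolding weak_step_def by simp
    qed
    then have "(\<Sum>n\<in>{1..N}. weak_form k I c (t (n-1)) (t n) (u n) (w n)) = M (z N) (W (t N)) - M (z 0) (W (t 0))"
      using sum_telescope_slabs[of "\<lambda>n. M (z n) (W (t n))" N] by simp
    then show "(\<Sum>n\<in>{1..N}. weak_form k I c (t (n-1)) (t n) (u n) (w n)) + M v0 (W 0) = 0"
      using W(1) z(1) mesh by (simp add: time_mesh_def M_simps)
  qed
next
  assume L: ?L
  have "\<exists>z. z 0 = v0 \<and> (\<forall>n\<le>m. z n \<in> S) \<and>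
      (\<forall>n\<in>{1..m}. weak_step k p I c (t (n-1)) (t n) (u n) (z (n-1)) (z n))" if "m \<le> N" for m
    using that
  proof (induction m)
    case 0
    then show ?case using v0 by (intro exI[of _ "\<lambda>_. v0"]) auto
  next
    case (Suc m)
    then obtain z where z: "z 0 = v0" "\<And>n. n \<le> m \<Longrightarrow> z n \<in> S"
      "\<And>n. n \<in> {1..m} \<Longrightarrow> weak_step k p I c (t (n-1)) (t n) (u n) (z (n-1)) (z n)"
      by auto
    have "weak_form k I c (t m) (t (Suc m)) (u (Suc m)) w + M (z m) (w (t m)) = 0"
      if w: "vec_poly S p w" "w (t (Suc m)) = 0" for w
    proof -
      \<comment> \<open>\<open>w\<close> is continued by a constant to the left and by zero to the right\<close>
      let ?x = "w (t m)"
      define ws where "ws n = (if n \<le> m then (\<lambda>s. ?x) else if n = Suc m then w else (\<lambda>s. 0))" for n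
      define W where "W s = (if s \<le> t m then ?x else if s \<le> t (Suc m) then w s else 0)" for s
      have x: "?x \<in> S" using S_mem[OF w(1)] .
      have ws: "vec_poly S p (ws n)" for n
        unfolding ws_def using w(1) vec_poly_const[OF x subspace] vec_poly_const[OF subspace_0[OF subspace] subspace]
        by auto
      have m: "t m < t (Suc m)" using time_mesh_step[OF mesh, of "Suc m"] Suc.prems by simp
      have Ww: "W s = ws n s" if n: "n \<in> {1..N}" and s: "s \<in> {t (n-1)..t n}" for n s
      proof -
        consider "n \<le> m" | "n = Suc m" | "Suc m \<le> n - 1" "n > Suc m" by fastforce
        then show ?thesis
        proof cases
          case 1
          then have "t n \<le> t m" using time_mesh_mono[OF mesh, of n m] Suc.prems by simp
          then show ?thesis using s 1 by (auto simp: W_def ws_def)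
        next
          case 2
          then show ?thesis using s m by (auto simp: W_def ws_def)
        next
          case 3
          then have "t (Suc m) \<le> t (n - 1)" using time_mesh_mono[OF mesh, of "Suc m" "n - 1"] n by simp
          then have "s \<noteq> t m" "\<not> s < t m" "s \<le> t (Suc m) \<Longrightarrow> s = t (Suc m)" using s m by auto
          then show ?thesis using 3 w(2) by (auto simp: W_def ws_def)
        qed
      qed
      have TN: "t N = T" "t 0 = 0" using mesh by (auto simp: time_mesh_def)
      have "t (Suc m) \<le> T" using time_mesh_mono[OF mesh, of "Suc m" N] Suc.prems TN by simp
      then have WT: "W T = 0" using m w(2) by (auto simp: W_def)
      have "0 \<le> t m" using time_mesh_mono[OF mesh, of 0 m] Suc.prems TN by simp
      then have W0: "W 0 = ?x" by (simp add: W_def)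
      have "(\<Sum>n\<in>{1..N}. weak_form k I c (t (n-1)) (t n) (u n) (ws n)) + M v0 (W 0) = 0"
        using L WT ws Ww by blast
      moreover have "(\<Sum>n\<in>{1..N}. weak_form k I c (t (n-1)) (t n) (u n) (ws n)) =
          (\<Sum>n\<in>{1..Suc m}. weak_form k I c (t (n-1)) (t n) (u n) (ws n))"
      proof (rule sum.mono_neutral_right)
        show "\<forall>n\<in>{1..N} - {1..Suc m}. weak_form k I c (t (n-1)) (t n) (u n) (ws n) = 0"
          by (auto simp: ws_def weak_form_const M_simps)
      qed (use Suc.prems in auto)
      moreover have "(\<Sum>n\<in>{1..m}. weak_form k I c (t (n-1)) (t n) (u n) (ws n)) = (\<Sum>n\<in>{1..m}. M (z n) ?x - M (z (n - 1)) ?x)"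
      proof (rule sum.cong[OF refl])
        fix n assume n: "n \<in> {1..m}"
        then show "weak_form k I c (t (n-1)) (t n) (u n) (ws n) = M (z n) ?x - M (z (n - 1)) ?x"
          using z(3)[OF n] vec_poly_const[OF x subspace, of p] unfolding weak_step_def by (simp add: ws_def)
      qed
      ultimately show ?thesis using W0 z(1) sum_telescope_slabs[of "\<lambda>n. M (z n) ?x" m] by (simp add: ws_def)
    qed
    then obtain z1 where z1: "z1 \<in> S" "weak_step k p I c (t m) (t (Suc m)) (u (Suc m)) (z m) z1"
      using weak_step_exists[OF u[of "Suc m"], of "t (Suc m)" k I c "t m" "z m"] Suc.prems by auto
    have "weak_step k p I c (t (n-1)) (t n) (u n) ((z(Suc m := z1)) (n-1)) ((z(Suc m := z1)) n)"
      if n: "n \<in> {1..Suc m}" for n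
      using z(3)[of n] z1(2) n by (cases "n = Suc m") auto
    then show ?case using z z1(1) by (intro exI[of _ "z(Suc m := z1)"]) auto
  qed
  then show ?R by blast
qed

section \<open>Weak steps as Runge--Kutta steps\<close>

text \<open>The velocity \<open>v\<close> is determined by \<open>z0\<close> and by the derivative of \<open>u\<close> at the \<open>p\<close> nodes. Test
  functions that vanish at \<open>s1\<close> and at all nodes but one isolate the residual at this node. Once
  all residuals vanish, constant test functions give the end value \<open>z1\<close>.\<close>
lemma weak_step_gauss_iff:
  assumes p: "p \<ge> 1" and u: "vec_poly S p u" and z: "z0 \<in> S" "z1 \<in> S" and s: "s0 < s1"
    and k: "\<And>x s. x \<in> S \<Longrightarrow> s \<in> {s0..s1} \<Longrightarrow> k x s \<in> S"
  defines "\<tau> \<equiv> \<lambda>j. s0 + gauss_node p j * (s1 - s0)"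
  shows "weak_step k p {1..p} (gauss_node p) s0 s1 u z0 z1 \<longleftrightarrow>
    (\<exists>v. vec_poly S p v \<and> v s0 = z0 \<and> v s1 = z1 \<and>
      (\<forall>j\<in>{1..p}. vector_derivative u (at (\<tau> j)) = v (\<tau> j) \<and>
        vector_derivative v (at (\<tau> j)) = k (u (\<tau> j)) (\<tau> j)))"
proof -
  let ?I = "{1..p}" and ?c = "gauss_node p"
  have ex: "quadrature_exact ?I ?c (2 * p - 1)" using gauss_exact[OF p] .
  have inj: "inj_on \<tau> ?I" unfolding \<tau>_def using inj_on_gauss_node s by (rule inj_on_slab_nodes)
  have \<tau>: "s0 < \<tau> j" "\<tau> j < s1" if "j \<in> ?I" for j
  proof -
    have "?c j * (s1 - s0) < 1 * (s1 - s0)" "0 < ?c j * (s1 - s0)"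
      using gauss_node_bounds[OF that] s by (auto intro!: mult_strict_right_mono mult_pos_pos)
    then show "s0 < \<tau> j" "\<tau> j < s1" by (auto simp: \<tau>_def)
  qed
  have form: "weak_form k ?I ?c s0 s1 u w = M (v s1) (w s1) - M (v s0) (w s0) -
      (s1 - s0) * (\<Sum>j\<in>?I. quad_weight ?I ?c j * M (vector_derivative v (at (\<tau> j)) - k (u (\<tau> j)) (\<tau> j)) (w (\<tau> j)))"
    if v: "vec_poly S p v" "\<And>j. j \<in> ?I \<Longrightarrow> vector_derivative u (at (\<tau> j)) = v (\<tau> j)" and w: "vec_poly S p w" for v w
    using slab_integration_by_parts[OF p u v(1) w ex, of s0 s1] v(2) s
    unfolding weak_form_def \<tau>_def by (simp add: M_simps right_diff_distrib sum_subtractf)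
  show ?thesis
  proof
    assume ws: "weak_step k p ?I ?c s0 s1 u z0 z1"
    \<comment> \<open>the Gauss nodes have the indices \<open>1, \<dots>, p\<close>, and the index \<open>0\<close> stands for an end point of the slab\<close>
    define c' where "c' j = (if j = 0 then s0 else \<tau> j)" for j :: nat
    have inj': "inj_on c' {0..p}"
      unfolding c'_def using inj by (rule inj_on_extra_node) (use \<tau> in fastforce)
    have udS: "vector_derivative u (at s) \<in> S" for s
      using S_mem[OF vec_poly_deriv(1)[OF subspace u]] .
    have "\<exists>v. vec_poly S p v \<and> (\<forall>j\<in>{0..p}. v (c' j) = (if j = 0 then z0 else vector_derivative u (at (\<tau> j))))"
      using z udS by (intro vec_poly_interpolation[OF subspace _ inj']) auto
    then obtain v where v: "vec_poly S p v" "\<forall>j\<in>{0..p}. v (c' j) = (if j = 0 then z0 else vector_derivative u (at (\<tau> j)))"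
      by blast
    have v0: "v s0 = z0" using bspec[OF v(2), of 0] by (simp add: c'_def)
    have uv: "vector_derivative u (at (\<tau> j)) = v (\<tau> j)" if "j \<in> ?I" for j
      using bspec[OF v(2), of j] that by (auto simp: c'_def)
    let ?r = "\<lambda>j. vector_derivative v (at (\<tau> j)) - k (u (\<tau> j)) (\<tau> j)"
    have rS: "?r j \<in> S" if "j \<in> ?I" for j
      using k[OF S_mem[OF u]] \<tau>[OF that] S_mem[OF vec_poly_deriv(1)[OF subspace v(1)]] subspace
      by (intro subspace_diff) auto
    have eq: "M (v s1 - z1) (w s1) = (s1 - s0) * (\<Sum>j\<in>?I. quad_weight ?I ?c j * M (?r j) (w (\<tau> j)))"
      if "vec_poly S p w" for w
      using form[OF v(1) uv that] ws that v0 unfolding weak_step_def by (simp add: M_simps)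
    have r0: "?r i = 0" if i: "i \<in> ?I" for i
    proof (rule M_nondegenerate[OF rS[OF i]])
      fix x assume x: "x \<in> S"
      define c1 where "c1 j = (if j = 0 then s1 else \<tau> j)" for j :: nat
      have inj1: "inj_on c1 {0..p}"
        unfolding c1_def using inj by (rule inj_on_extra_node) (use \<tau> in fastforce)
      have "\<exists>w. vec_poly S p w \<and> (\<forall>j\<in>{0..p}. w (c1 j) = (if j = i then x else 0))"
        using x subspace_0[OF subspace] by (intro vec_poly_interpolation[OF subspace _ inj1]) auto
      then obtain w where w: "vec_poly S p w" "\<forall>j\<in>{0..p}. w (c1 j) = (if j = i then x else 0)" by blast
      have w1: "w s1 = 0" using bspec[OF w(2), of 0] i by (auto simp: c1_def)
      have wj: "w (\<tau> j) = (if j = i then x else 0)" if "j \<in> ?I" for j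
        using bspec[OF w(2), of j] that by (auto simp: c1_def)
      have "(\<Sum>j\<in>?I. quad_weight ?I ?c j * M (?r j) (w (\<tau> j))) = (\<Sum>j\<in>?I. if j = i then quad_weight ?I ?c i * M (?r i) x else 0)"
        by (rule sum.cong) (auto simp: wj M_simps)
      then have "0 = (s1 - s0) * (quad_weight ?I ?c i * M (?r i) x)"
        using eq[OF w(1)] w1 i by (simp add: M_simps)
      then show "M (?r i) x = 0" using gauss_weight_nonzero[OF i] s by simp
    qed
    have "v s1 - z1 = 0"
    proof (rule M_nondegenerate)
      show "v s1 - z1 \<in> S" using S_mem[OF v(1)] z subspace by (intro subspace_diff) auto
      show "M (v s1 - z1) x = 0" if "x \<in> S" for x
        using eq[OF vec_poly_const[OF that subspace]] r0 by (simp add: M_simps)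
    qed
    then show "\<exists>v. vec_poly S p v \<and> v s0 = z0 \<and> v s1 = z1 \<and>
      (\<forall>j\<in>?I. vector_derivative u (at (\<tau> j)) = v (\<tau> j) \<and> vector_derivative v (at (\<tau> j)) = k (u (\<tau> j)) (\<tau> j))"
      using v(1) v0 uv r0 by (intro exI[of _ v]) auto
  next
    assume "\<exists>v. vec_poly S p v \<and> v s0 = z0 \<and> v s1 = z1 \<and>
      (\<forall>j\<in>?I. vector_derivative u (at (\<tau> j)) = v (\<tau> j) \<and> vector_derivative v (at (\<tau> j)) = k (u (\<tau> j)) (\<tau> j))"
    then obtain v where v: "vec_poly S p v" "v s0 = z0" "v s1 = z1"
      "\<And>j. j \<in> ?I \<Longrightarrow> vector_derivative u (at (\<tau> j)) = v (\<tau> j)"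
      "\<And>j. j \<in> ?I \<Longrightarrow> vector_derivative v (at (\<tau> j)) = k (u (\<tau> j)) (\<tau> j)" by auto
    show "weak_step k p ?I ?c s0 s1 u z0 z1" unfolding weak_step_def
      using form[OF v(1,4)] v(2,3,5) by (simp add: M_simps)
  qed
qed

text \<open>The end points are nodes, so the residuals there combine with the boundary terms to the two
  modified end values. The values of \<open>w\<close> at the \<open>p + 1\<close> nodes are arbitrary, and so each of the
  three kinds of conditions can be isolated by a test function.\<close>
lemma weak_step_lobatto_iff:
  assumes p: "p \<ge> 1" and u: "vec_poly S p u" and z: "z0 \<in> S" "z1 \<in> S" and s: "s0 < s1"
    and k: "\<And>x s. x \<in> S \<Longrightarrow> s \<in> {s0..s1} \<Longrightarrow> k x s \<in> S"
  defines "\<tau> \<equiv> \<lambda>j. s0 + lobatto_node p j * (s1 - s0)"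
    and "\<omega> \<equiv> quad_weight {0..p} (lobatto_node p)"
    and "v \<equiv> \<lambda>s. vector_derivative u (at s)"
  shows "weak_step k p {0..p} (lobatto_node p) s0 s1 u z0 z1 \<longleftrightarrow>
    v s0 = z0 - ((s1 - s0) * \<omega> 0) *\<^sub>R (vector_derivative v (at s0) - k (u s0) s0) \<and>
    (\<forall>j\<in>{1..<p}. vector_derivative v (at (\<tau> j)) = k (u (\<tau> j)) (\<tau> j)) \<and>
    z1 = v s1 - ((s1 - s0) * \<omega> p) *\<^sub>R (vector_derivative v (at s1) - k (u s1) s1)"
proof -
  let ?I = "{0..p}" and ?c = "lobatto_node p"
  let ?h = "s1 - s0"
  let ?r = "\<lambda>j. vector_derivative v (at (\<tau> j)) - k (u (\<tau> j)) (\<tau> j)"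
  have ex: "quadrature_exact ?I ?c (2 * p - 1)" using lobatto_exact[OF p] .
  have inj: "inj_on \<tau> ?I" unfolding \<tau>_def using inj_on_lobatto_node[OF p] s by (rule inj_on_slab_nodes)
  have \<tau>: "\<tau> j \<in> {s0..s1}" if "j \<in> ?I" for j
    unfolding \<tau>_def using lobatto_node_bounds[OF p that] s by (intro slab_node_mem) auto
  have \<tau>0: "\<tau> 0 = s0" and \<tau>p: "\<tau> p = s1" by (auto simp: \<tau>_def lobatto_node_0[OF p] lobatto_node_p[OF p])
  have v': "vec_poly S (p - 1) v" unfolding v_def using vec_poly_deriv(1)[OF subspace u] .
  then have v: "vec_poly S p v" by (rule vec_poly_mono[OF subspace]) simp
  have rS: "?r j \<in> S" if "j \<in> ?I" for j
    using k[OF S_mem[OF u] \<tau>[OF that]] S_mem[OF vec_poly_deriv(1)[OF subspace v]] subspace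
    by (intro subspace_diff) auto
  have form: "weak_form k ?I ?c s0 s1 u w = M (v s1) (w s1) - M (v s0) (w s0) -
      ?h * (\<Sum>j\<in>?I. \<omega> j * M (?r j) (w (\<tau> j)))"
    if w: "vec_poly S p w" for w
    using slab_integration_by_parts[OF p u v w ex, of s0 s1] s
    unfolding weak_form_def \<tau>_def v_def \<omega>_def by (simp add: M_simps right_diff_distrib sum_subtractf)
  have split: "(\<Sum>j\<in>?I. f j) = f 0 + (\<Sum>j\<in>{1..<p}. f j) + f p" for f :: "nat \<Rightarrow> real"
  proof -
    have "?I = insert 0 (insert p {1..<p})" using p by auto
    then show ?thesis using p by (simp add: add_ac)
  qed
  \<comment> \<open>the balance that remains after collecting the contributions of each node\<close>
  have iff: "weak_step k p ?I ?c s0 s1 u z0 z1 \<longleftrightarrow> (\<forall>w. vec_poly S p w \<longrightarrow>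
      M (v s1 - (?h * \<omega> p) *\<^sub>R ?r p - z1) (w s1) + M (z0 - (?h * \<omega> 0) *\<^sub>R ?r 0 - v s0) (w s0)
      - ?h * (\<Sum>j\<in>{1..<p}. \<omega> j * M (?r j) (w (\<tau> j))) = 0)"
    unfolding weak_step_def
  proof (intro all_cong1 imp_cong refl)
    fix w assume w: "vec_poly S p w"
    define a where "a = (\<Sum>j\<in>{1..<p}. \<omega> j * M (?r j) (w (\<tau> j)))"
    have f: "weak_form k ?I ?c s0 s1 u w = M (v s1) (w s1) - M (v s0) (w s0) -
        ?h * (\<omega> 0 * M (?r 0) (w s0) + a + \<omega> p * M (?r p) (w s1))"
      unfolding form[OF w] split a_def using \<tau>0 \<tau>p by simp
    define r0 rp where "r0 = ?r 0" and "rp = ?r p"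
    show "(weak_form k ?I ?c s0 s1 u w = M z1 (w s1) - M z0 (w s0)) \<longleftrightarrow>
      (M (v s1 - (?h * \<omega> p) *\<^sub>R ?r p - z1) (w s1) + M (z0 - (?h * \<omega> 0) *\<^sub>R ?r 0 - v s0) (w s0)
      - ?h * (\<Sum>j\<in>{1..<p}. \<omega> j * M (?r j) (w (\<tau> j))) = 0)"
      unfolding f
      unfolding a_def[symmetric] r0_def[symmetric] rp_def[symmetric]
      unfolding M_simps(3) M_simps(7)
      by (simp add: algebra_simps)
  qed
  have goal: "(v s0 = z0 - (?h * \<omega> 0) *\<^sub>R (vector_derivative v (at s0) - k (u s0) s0)) \<longleftrightarrow>
      z0 - (?h * \<omega> 0) *\<^sub>R ?r 0 - v s0 = 0"
    "(z1 = v s1 - (?h * \<omega> p) *\<^sub>R (vector_derivative v (at s1) - k (u s1) s1)) \<longleftrightarrow>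
      v s1 - (?h * \<omega> p) *\<^sub>R ?r p - z1 = 0"
    by (auto simp: \<tau>0 \<tau>p algebra_simps)
  show ?thesis unfolding goal
  proof
    assume "weak_step k p ?I ?c s0 s1 u z0 z1"
    then have eq: "M (v s1 - (?h * \<omega> p) *\<^sub>R ?r p - z1) (w s1) + M (z0 - (?h * \<omega> 0) *\<^sub>R ?r 0 - v s0) (w s0)
      - ?h * (\<Sum>j\<in>{1..<p}. \<omega> j * M (?r j) (w (\<tau> j))) = 0" if "vec_poly S p w" for w
      using iff that by blast
    have test: "\<exists>w. vec_poly S p w \<and> (\<forall>j\<in>?I. w (\<tau> j) = (if j = i then x else 0))" if "x \<in> S" for x i
      using that subspace_0[OF subspace] by (intro vec_poly_interpolation[OF subspace _ inj]) auto
    have "M (z0 - (?h * \<omega> 0) *\<^sub>R ?r 0 - v s0) x = 0" if x: "x \<in> S" for x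
    proof -
      obtain w where w: "vec_poly S p w" "\<And>j. j \<in> ?I \<Longrightarrow> w (\<tau> j) = (if j = 0 then x else 0)"
        using test[OF x, of 0] by auto
      have "w s0 = x" "w s1 = 0" using w(2)[of 0] w(2)[of p] \<tau>0 \<tau>p p by auto
      then show ?thesis using eq[OF w(1)] w(2) by (simp add: M_simps)
    qed
    then have 0: "z0 - (?h * \<omega> 0) *\<^sub>R ?r 0 - v s0 = 0"
      using rS[of 0] z S_mem[OF v] subspace by (intro M_nondegenerate) (auto intro!: subspace_diff subspace_scale)
    have "M (v s1 - (?h * \<omega> p) *\<^sub>R ?r p - z1) x = 0" if x: "x \<in> S" for x
    proof -
      obtain w where w: "vec_poly S p w" "\<And>j. j \<in> ?I \<Longrightarrow> w (\<tau> j) = (if j = p then x else 0)"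
        using test[OF x, of p] by auto
      have "w s0 = 0" "w s1 = x" using w(2)[of 0] w(2)[of p] \<tau>0 \<tau>p p by auto
      then show ?thesis using eq[OF w(1)] w(2) by (simp add: M_simps)
    qed
    then have 1: "v s1 - (?h * \<omega> p) *\<^sub>R ?r p - z1 = 0"
      using rS[of p] z S_mem[OF v] subspace by (intro M_nondegenerate) (auto intro!: subspace_diff subspace_scale)
    have 2: "?r i = 0" if i: "i \<in> {1..<p}" for i
    proof (rule M_nondegenerate)
      show "?r i \<in> S" using rS i by auto
      fix x assume x: "x \<in> S"
      obtain w where w: "vec_poly S p w" "\<And>j. j \<in> ?I \<Longrightarrow> w (\<tau> j) = (if j = i then x else 0)"
        using test[OF x, of i] by auto
      have "w s0 = 0" "w s1 = 0" using w(2)[of 0] w(2)[of p] \<tau>0 \<tau>p i by auto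
      moreover have "(\<Sum>j\<in>{1..<p}. \<omega> j * M (?r j) (w (\<tau> j))) = (\<Sum>j\<in>{1..<p}. if j = i then \<omega> i * M (?r i) x else 0)"
        using w(2) by (intro sum.cong) (auto simp: M_simps)
      ultimately have "?h * (\<omega> i * M (?r i) x) = 0" using eq[OF w(1)] i by (simp add: M_simps)
      then show "M (?r i) x = 0" using lobatto_weight_nonzero[OF i] s by (simp add: \<omega>_def)
    qed
    show "z0 - (?h * \<omega> 0) *\<^sub>R ?r 0 - v s0 = 0 \<and>
      (\<forall>j\<in>{1..<p}. vector_derivative v (at (\<tau> j)) = k (u (\<tau> j)) (\<tau> j)) \<and>
      v s1 - (?h * \<omega> p) *\<^sub>R ?r p - z1 = 0" using 0 1 2 by simp
  next
    assume "z0 - (?h * \<omega> 0) *\<^sub>R ?r 0 - v s0 = 0 \<and>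
      (\<forall>j\<in>{1..<p}. vector_derivative v (at (\<tau> j)) = k (u (\<tau> j)) (\<tau> j)) \<and>
      v s1 - (?h * \<omega> p) *\<^sub>R ?r p - z1 = 0"
    then show "weak_step k p ?I ?c s0 s1 u z0 z1" unfolding iff by (simp add: M_simps)
  qed
qed

section \<open>The schemes as time stepping\<close>

definition pieces :: "nat \<Rightarrow> (nat \<Rightarrow> real) \<Rightarrow> nat \<Rightarrow> (real \<Rightarrow> 'v) \<Rightarrow> (nat \<Rightarrow> real \<Rightarrow> 'v) \<Rightarrow> bool" where
  "pieces N t p U u \<longleftrightarrow> (\<forall>n\<in>{1..N}. vec_poly S p (u n) \<and> (\<forall>s\<in>{t (n-1)..t n}. U s = u n s))"

text \<open>The pieces of the test function are quantified together with it, because the forms on the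
  slabs need derivatives of polynomials and not one-sided derivatives at the mesh nodes.\<close>
definition galerkin_scheme :: "('v \<Rightarrow> real \<Rightarrow> 'v) \<Rightarrow> nat \<Rightarrow> nat set \<Rightarrow> (nat \<Rightarrow> real) \<Rightarrow> nat \<Rightarrow> (nat \<Rightarrow> real) \<Rightarrow>
    'v \<Rightarrow> 'v \<Rightarrow> (real \<Rightarrow> 'v) \<Rightarrow> bool" where
  "galerkin_scheme k p I c N t u0 v0 U \<longleftrightarrow> (\<exists>u. pieces N t p U u \<and> U 0 = u0 \<and>
     (\<forall>W w. W (t N) = 0 \<longrightarrow> pieces N t p W w \<longrightarrow>
        (\<Sum>n\<in>{1..N}. weak_form k I c (t (n-1)) (t n) (u n) (w n)) + M v0 (W 0) = 0))"

lemma galerkin_scheme_iff: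
  assumes mesh: "time_mesh T N t" and T: "T > 0" and v0: "v0 \<in> S"
  shows "galerkin_scheme k p I c N t u0 v0 U \<longleftrightarrow> (\<exists>u z. pieces N t p U u \<and> U 0 = u0 \<and> z 0 = v0 \<and>
    (\<forall>n\<le>N. z n \<in> S) \<and> (\<forall>n\<in>{1..N}. weak_step k p I c (t (n-1)) (t n) (u n) (z (n-1)) (z n)))"
proof -
  have "t N = T" using mesh by (simp add: time_mesh_def)
  then have "(\<forall>W w. W (t N) = 0 \<longrightarrow> pieces N t p W w \<longrightarrow>
        (\<Sum>n\<in>{1..N}. weak_form k I c (t (n-1)) (t n) (u n) (w n)) + M v0 (W 0) = 0) \<longleftrightarrow>
      (\<exists>z. z 0 = v0 \<and> (\<forall>n\<le>N. z n \<in> S) \<and>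
      (\<forall>n\<in>{1..N}. weak_step k p I c (t (n-1)) (t n) (u n) (z (n-1)) (z n)))"
    if "pieces N t p U u" for u
    using scheme_iff_weak_steps[OF mesh T v0, of p u k I c] that unfolding pieces_def by blast
  then show ?thesis unfolding galerkin_scheme_def by blast
qed

lemma time_mesh_nonempty:
  assumes "time_mesh T N t" "T > 0"
  shows "1 \<in> {1..N}"
  using assms by (cases N) (auto simp: time_mesh_def)

lemma step_chain_start:
  assumes mesh: "time_mesh T N t" and T: "T > 0"
    and U: "\<forall>n\<in>{1..N}. \<forall>s\<in>{t (n-1)..t n}. U s = u n s"
    and u: "\<And>n. n \<in> {1..N} \<Longrightarrow> u n (t (n-1)) = y (n-1)"
  shows "U 0 = y 0"
proof -
  have 1: "1 \<in> {1..N}" using time_mesh_nonempty[OF mesh T] .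
  have "t 0 = 0" using mesh by (simp add: time_mesh_def)
  moreover have "t 0 < t 1" using time_mesh_step[OF mesh 1] by simp
  ultimately show ?thesis using bspec[OF U 1] u[OF 1] by simp
qed

lemma gauss_stepD:
  assumes q: "gauss_rk_step (S \<times> S) p (\<lambda>s (u, v). (v, k u s)) s0 s1 y0 q y1"
  defines "u \<equiv> \<lambda>s. fst (q s)" and "v \<equiv> \<lambda>s. snd (q s)" and "\<tau> \<equiv> \<lambda>j. s0 + gauss_node p j * (s1 - s0)"
  shows "vec_poly S p u" "vec_poly S p v" "q s0 = y0" "y1 = q s1"
    "j \<in> {1..p} \<Longrightarrow> vector_derivative u (at (\<tau> j)) = v (\<tau> j)"
    "j \<in> {1..p} \<Longrightarrow> vector_derivative v (at (\<tau> j)) = k (u (\<tau> j)) (\<tau> j)"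
proof -
  show "vec_poly S p u" "vec_poly S p v" "q s0 = y0" "y1 = q s1"
    using q subspace_0[OF subspace] by (auto simp: gauss_rk_step_def vec_poly_Times u_def v_def)
  assume j: "j \<in> {1..p}"
  have "(q has_vector_derivative (v (\<tau> j), k (u (\<tau> j)) (\<tau> j))) (at (\<tau> j))"
    using q j unfolding gauss_rk_step_def by (simp add: Let_def split_beta v_def u_def \<tau>_def)
  from bounded_linear.has_vector_derivative[OF bounded_linear_fst this]
    bounded_linear.has_vector_derivative[OF bounded_linear_snd this]
  show "vector_derivative u (at (\<tau> j)) = v (\<tau> j)" "vector_derivative v (at (\<tau> j)) = k (u (\<tau> j)) (\<tau> j)"
    unfolding u_def v_def by (auto intro: vector_derivative_at)
qed

text \<open>The derivative of \<open>u\<close> and \<open>v\<close> have degree at most \<open>p\<close> and agree at \<open>p + 1\<close> nodes. So they are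
  equal, and \<open>u\<close>, which is sought with degree \<open>p + 1\<close>, has at most degree \<open>p\<close>.\<close>
lemma lobatto_velocity:
  assumes p: "p \<ge> 1" and s: "s0 < s1" and u: "vec_poly S (p + 1) u" and v: "vec_poly S (p - 1) v"
    and ud: "\<And>i. i \<in> {0..p} \<Longrightarrow> vector_derivative u (at (s0 + lobatto_node p i * (s1 - s0))) = v (s0 + lobatto_node p i * (s1 - s0))"
  shows "vector_derivative u (at s) = v s" "vec_poly S p u"
proof -
  have "(\<lambda>s. vector_derivative u (at s)) = v"
  proof (rule vec_poly_eqI)
    show "vec_poly S p (\<lambda>s. vector_derivative u (at s))" using vec_poly_deriv(1)[OF subspace u] by simp
    show "vec_poly S p v" using vec_poly_mono[OF subspace v] by simp
    show "inj_on (\<lambda>i. s0 + lobatto_node p i * (s1 - s0)) {0..p}"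
      using inj_on_lobatto_node[OF p] s by (rule inj_on_slab_nodes)
  qed (use ud in auto)
  then show uv: "vector_derivative u (at s) = v s" for s by metis
  show "vec_poly S p u"
    using vec_poly_antideriv[OF subspace v, of u 0] vec_poly_deriv(2)[OF subspace u] S_mem[OF u] p by (auto simp: uv)
qed

lemma lobatto_stepD:
  assumes p: "p \<ge> 1" and s: "s0 < s1" and q: "lobatto_pair_step S S p (\<lambda>v s. v) k s0 s1 y0 q y1"
  defines "u \<equiv> \<lambda>s. fst (q s)" and "v \<equiv> \<lambda>s. snd (q s)" and "\<tau> \<equiv> \<lambda>j. s0 + lobatto_node p j * (s1 - s0)"
    and "\<omega> \<equiv> quad_weight {0..p} (lobatto_node p)"
  shows "vec_poly S p u" "vec_poly S (p - 1) v" "u s0 = fst y0" "fst y1 = u s1"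
    "vector_derivative u (at s) = v s"
    "v s0 = snd y0 - ((s1 - s0) * \<omega> 0) *\<^sub>R (vector_derivative v (at s0) - k (u s0) s0)"
    "snd y1 = v s1 - ((s1 - s0) * \<omega> p) *\<^sub>R (vector_derivative v (at s1) - k (u s1) s1)"
    "j \<in> {1..<p} \<Longrightarrow> vector_derivative v (at (\<tau> j)) = k (u (\<tau> j)) (\<tau> j)"
proof -
  have up: "vec_poly S (p + 1) u" and ud: "\<And>i. i \<in> {0..p} \<Longrightarrow> (u has_vector_derivative v (\<tau> i)) (at (\<tau> i))"
    and vd: "\<And>i. i \<in> {1..<p} \<Longrightarrow> (v has_vector_derivative k (u (\<tau> i)) (\<tau> i)) (at (\<tau> i))"
    using q unfolding lobatto_pair_step_def Let_def u_def v_def \<tau>_def by auto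
  show vp: "vec_poly S (p - 1) v" and "u s0 = fst y0" "fst y1 = u s1"
    "v s0 = snd y0 - ((s1 - s0) * \<omega> 0) *\<^sub>R (vector_derivative v (at s0) - k (u s0) s0)"
    "snd y1 = v s1 - ((s1 - s0) * \<omega> p) *\<^sub>R (vector_derivative v (at s1) - k (u s1) s1)"
    using q unfolding lobatto_pair_step_def Let_def u_def v_def \<omega>_def by auto
  have udv: "vector_derivative u (at (s0 + lobatto_node p i * (s1 - s0))) = v (s0 + lobatto_node p i * (s1 - s0))"
    if "i \<in> {0..p}" for i
    using vector_derivative_at[OF ud[OF that]] by (simp add: \<tau>_def)
  show "vec_poly S p u" by (rule lobatto_velocity(2)[OF p s up vp udv])
  show "vector_derivative u (at s) = v s" by (rule lobatto_velocity(1)[OF p s up vp udv])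
  show "vector_derivative v (at (\<tau> j)) = k (u (\<tau> j)) (\<tau> j)" if "j \<in> {1..<p}"
    using vd[OF that] by (rule vector_derivative_at)
qed

lemma gauss_step_iff:
  assumes p: "p \<ge> 1" and s: "s0 < s1" and y0: "snd y0 \<in> S" and y1: "snd y1 \<in> S"
    and k: "\<And>x s. x \<in> S \<Longrightarrow> s \<in> {s0..s1} \<Longrightarrow> k x s \<in> S"
  shows "(\<exists>q. gauss_rk_step (S \<times> S) p (\<lambda>s (u, v). (v, k u s)) s0 s1 y0 q y1 \<and> (\<lambda>s. fst (q s)) = u) \<longleftrightarrow>
    vec_poly S p u \<and> u s0 = fst y0 \<and> u s1 = fst y1 \<and> weak_step k p {1..p} (gauss_node p) s0 s1 u (snd y0) (snd y1)"
    (is "?L \<longleftrightarrow> ?R")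
proof
  assume ?L
  then obtain q where q: "gauss_rk_step (S \<times> S) p (\<lambda>s (u, v). (v, k u s)) s0 s1 y0 q y1" and qu: "u = (\<lambda>s. fst (q s))"
    by auto
  define v where "v = (\<lambda>s. snd (q s))"
  have "fst (q s) = u s" "snd (q s) = v s" for s by (simp_all add: qu v_def)
  note st = gauss_stepD[OF q, unfolded this]
  have "weak_step k p {1..p} (gauss_node p) s0 s1 u (snd y0) (snd y1)"
    by (rule weak_step_gauss_iff[OF p st(1) y0 y1 s, THEN iffD2])
      (use k in blast, use st in \<open>intro exI[of _ v], auto simp: v_def\<close>)
  then show ?R using st by (auto simp: qu)
next
  assume R: ?R
  then obtain v where v: "vec_poly S p v" "v s0 = snd y0" "v s1 = snd y1"
    "\<forall>j\<in>{1..p}. vector_derivative u (at (s0 + gauss_node p j * (s1 - s0))) = v (s0 + gauss_node p j * (s1 - s0)) \<and>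
     vector_derivative v (at (s0 + gauss_node p j * (s1 - s0))) = k (u (s0 + gauss_node p j * (s1 - s0))) (s0 + gauss_node p j * (s1 - s0))"
    using weak_step_gauss_iff[OF p _ y0 y1 s, of u k] k by blast
  have vu: "vec_poly S p u" using R by simp
  have "gauss_rk_step (S \<times> S) p (\<lambda>s (u, v). (v, k u s)) s0 s1 y0 (\<lambda>s. (u s, v s)) y1"
    unfolding gauss_rk_step_def Let_def
  proof (intro conjI ballI)
    fix j assume j: "j \<in> {1..p}"
    let ?\<tau> = "s0 + gauss_node p j * (s1 - s0)"
    have "((\<lambda>s. (u s, v s)) has_vector_derivative (vector_derivative u (at ?\<tau>), vector_derivative v (at ?\<tau>))) (at ?\<tau>)"
      using vec_poly_deriv(2)[OF subspace vu] vec_poly_deriv(2)[OF subspace v(1)]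
      by (intro has_vector_derivative_Pair)
    then show "((\<lambda>s. (u s, v s)) has_vector_derivative (case (u ?\<tau>, v ?\<tau>) of (u, v) \<Rightarrow> (v, k u ?\<tau>))) (at ?\<tau>)"
      using bspec[OF v(4) j] by simp
  qed (use R v vec_poly_Times[OF subspace_0[OF subspace] subspace_0[OF subspace]] in \<open>auto simp: prod_eq_iff\<close>)
  then show ?L by (intro exI[of _ "\<lambda>s. (u s, v s)"]) simp
qed

lemma lobatto_step_iff:
  assumes p: "p \<ge> 1" and s: "s0 < s1" and y0: "y0 \<in> S \<times> S" and y1: "snd y1 \<in> S"
    and k: "\<And>x s. x \<in> S \<Longrightarrow> s \<in> {s0..s1} \<Longrightarrow> k x s \<in> S"
  shows "(\<exists>q. lobatto_pair_step S S p (\<lambda>v s. v) k s0 s1 y0 q y1 \<and> (\<lambda>s. fst (q s)) = u) \<longleftrightarrow>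
    vec_poly S p u \<and> u s0 = fst y0 \<and> u s1 = fst y1 \<and> weak_step k p {0..p} (lobatto_node p) s0 s1 u (snd y0) (snd y1)"
    (is "?L \<longleftrightarrow> ?R")
proof -
  define \<tau> where "\<tau> j = s0 + lobatto_node p j * (s1 - s0)" for j
  define \<omega> where "\<omega> = quad_weight {0..p} (lobatto_node p)"
  have y0': "snd y0 \<in> S" using y0 by auto
  show ?thesis
  proof
    assume ?L
    then obtain q where q: "lobatto_pair_step S S p (\<lambda>v s. v) k s0 s1 y0 q y1" and qu: "u = (\<lambda>s. fst (q s))"
      by auto
    define v where "v = (\<lambda>s. snd (q s))"
    have "fst (q s) = u s" "snd (q s) = v s" for s by (simp_all add: qu v_def)
    note st = lobatto_stepD[OF p s q, unfolded this]
    have "weak_step k p {0..p} (lobatto_node p) s0 s1 u (snd y0) (snd y1)"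
    proof (rule weak_step_lobatto_iff[OF p st(1) y0' y1 s, THEN iffD2])
      show "vector_derivative u (at s0) = snd y0 - ((s1 - s0) * quad_weight {0..p} (lobatto_node p) 0) *\<^sub>R
          (vector_derivative (\<lambda>s. vector_derivative u (at s)) (at s0) - k (u s0) s0) \<and>
        (\<forall>j\<in>{1..<p}. vector_derivative (\<lambda>s. vector_derivative u (at s)) (at (s0 + lobatto_node p j * (s1 - s0))) =
          k (u (s0 + lobatto_node p j * (s1 - s0))) (s0 + lobatto_node p j * (s1 - s0))) \<and>
        snd y1 = vector_derivative u (at s1) - ((s1 - s0) * quad_weight {0..p} (lobatto_node p) p) *\<^sub>R
          (vector_derivative (\<lambda>s. vector_derivative u (at s)) (at s1) - k (u s1) s1)"
        unfolding st(5) using st(6,7,8) by auto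
    qed (rule k)
    then show ?R using st(1,3,4) by simp
  next
    assume R: ?R
    define v where "v = (\<lambda>s. vector_derivative u (at s))"
    have up: "vec_poly S p u" using R by simp
    have v: "v s0 = snd y0 - ((s1 - s0) * \<omega> 0) *\<^sub>R (vector_derivative v (at s0) - k (u s0) s0)"
      "\<forall>j\<in>{1..<p}. vector_derivative v (at (\<tau> j)) = k (u (\<tau> j)) (\<tau> j)"
      "snd y1 = v s1 - ((s1 - s0) * \<omega> p) *\<^sub>R (vector_derivative v (at s1) - k (u s1) s1)"
      using R weak_step_lobatto_iff[OF p up y0' y1 s, of k] k unfolding v_def \<tau>_def \<omega>_def by blast+
    have vp: "vec_poly S (p - 1) v" unfolding v_def by (rule vec_poly_deriv(1)[OF subspace up])
    have "lobatto_pair_step S S p (\<lambda>v s. v) k s0 s1 y0 (\<lambda>s. (u s, v s)) y1"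
      unfolding lobatto_pair_step_def Let_def fst_conv snd_conv
    proof (intro conjI ballI)
      show "vec_poly S (p + 1) u" using vec_poly_mono[OF subspace up] by simp
      show "(u has_vector_derivative v (s0 + lobatto_node p i * (s1 - s0))) (at (s0 + lobatto_node p i * (s1 - s0)))" for i
        unfolding v_def by (rule vec_poly_deriv(2)[OF subspace up])
      show "(v has_vector_derivative k (u (s0 + lobatto_node p i * (s1 - s0))) (s0 + lobatto_node p i * (s1 - s0)))
         (at (s0 + lobatto_node p i * (s1 - s0)))" if "i \<in> {1..<p}" for i
        using vec_poly_deriv(2)[OF subspace vp, of "\<tau> i"] bspec[OF v(2) that] unfolding \<tau>_def by simp
    qed (use R v vp in \<open>auto simp: \<omega>_def\<close>)
    then show ?L by (intro exI[of _ "\<lambda>s. (u s, v s)"]) simp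
  qed
qed

text \<open>What both methods have in common: a step with displacement polynomial \<open>u\<close> exists iff \<open>u\<close> joins
  the two displacements and is a weak step between the two velocities. The states \<open>y\<close> are then the
  values of \<open>U\<close> at the mesh nodes, paired with the end velocities.\<close>
lemma time_stepping_iff:
  assumes mesh: "time_mesh T N t" and T: "T > 0" and u0: "u0 \<in> S" and v0: "v0 \<in> S"
    and step: "\<And>n u y0 y1. n \<in> {1..N} \<Longrightarrow> y0 \<in> S \<times> S \<Longrightarrow> snd y1 \<in> S \<Longrightarrow>
      (\<exists>q. R (t (n-1)) (t n) y0 q y1 \<and> (\<lambda>s. fst (q s)) = u) \<longleftrightarrow>
      vec_poly S p u \<and> u (t (n-1)) = fst y0 \<and> u (t n) = fst y1 \<and>
      weak_step k p I c (t (n-1)) (t n) u (snd y0) (snd y1)"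
    and closed: "\<And>n y0 q y1. n \<in> {1..N} \<Longrightarrow> y0 \<in> S \<times> S \<Longrightarrow> R (t (n-1)) (t n) y0 q y1 \<Longrightarrow> y1 \<in> S \<times> S"
  shows "galerkin_scheme k p I c N t u0 v0 U \<longleftrightarrow>
    (\<exists>y q. time_stepping R N t (u0, v0) y q \<and> (\<forall>n\<in>{1..N}. \<forall>s\<in>{t (n-1)..t n}. U s = fst (q n s)))"
  unfolding galerkin_scheme_iff[OF mesh T v0]
proof
  assume "\<exists>u z. pieces N t p U u \<and> U 0 = u0 \<and> z 0 = v0 \<and>
    (\<forall>n\<le>N. z n \<in> S) \<and> (\<forall>n\<in>{1..N}. weak_step k p I c (t (n-1)) (t n) (u n) (z (n-1)) (z n))"
  then obtain u z where u: "pieces N t p U u" and U0: "U 0 = u0" and z: "z 0 = v0" "\<And>n. n \<le> N \<Longrightarrow> z n \<in> S"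
    "\<And>n. n \<in> {1..N} \<Longrightarrow> weak_step k p I c (t (n-1)) (t n) (u n) (z (n-1)) (z n)" by blast
  define y where "y n = (U (t n), z n)" for n
  have t0: "t 0 = 0" using mesh by (simp add: time_mesh_def)
  have un: "u n (t (n-1)) = U (t (n-1))" "u n (t n) = U (t n)" "vec_poly S p (u n)" if "n \<in> {1..N}" for n
    using u that time_mesh_step[OF mesh that] unfolding pieces_def by auto
  have "y n \<in> S \<times> S" if "n \<le> N" for n
  proof (cases n)
    case 0
    then show ?thesis using U0 u0 v0 z(1) t0 by (simp add: y_def)
  next
    case (Suc m)
    then have "U (t n) \<in> S" using un[of n] S_mem[of p "u n" "t n"] that by simp
    then show ?thesis using z(2)[OF that] by (simp add: y_def)
  qed
  note yS = this
  have "\<exists>q. R (t (n-1)) (t n) (y (n-1)) q (y n) \<and> (\<lambda>s. fst (q s)) = u n" if n: "n \<in> {1..N}" for n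
  proof -
    have "y (n-1) \<in> S \<times> S" "snd (y n) \<in> S" using yS[of "n-1"] yS[of n] n by auto
    then show ?thesis using step[OF n, of "y (n-1)" "y n" "u n"] un[OF n] z(3)[OF n] by (simp add: y_def)
  qed
  then obtain q where q: "\<And>n. n \<in> {1..N} \<Longrightarrow> R (t (n-1)) (t n) (y (n-1)) (q n) (y n) \<and> (\<lambda>s. fst (q n s)) = u n"
    by metis
  have "time_stepping R N t (u0, v0) y q"
    unfolding time_stepping_def using q U0 z(1) t0 by (auto simp: y_def)
  moreover have "U s = fst (q n s)" if "n \<in> {1..N}" "s \<in> {t (n-1)..t n}" for n s
    using conjunct2[OF q[OF that(1)], THEN fun_cong, of s] u that unfolding pieces_def by simp
  ultimately show "\<exists>y q. time_stepping R N t (u0, v0) y q \<and> (\<forall>n\<in>{1..N}. \<forall>s\<in>{t (n-1)..t n}. U s = fst (q n s))"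
    by blast
next
  assume "\<exists>y q. time_stepping R N t (u0, v0) y q \<and> (\<forall>n\<in>{1..N}. \<forall>s\<in>{t (n-1)..t n}. U s = fst (q n s))"
  then obtain y q where y0: "y 0 = (u0, v0)" and R: "\<And>n. n \<in> {1..N} \<Longrightarrow> R (t (n-1)) (t n) (y (n-1)) (q n) (y n)"
    and U: "\<forall>n\<in>{1..N}. \<forall>s\<in>{t (n-1)..t n}. U s = fst (q n s)"
    unfolding time_stepping_def by blast
  have yS: "y n \<in> S \<times> S" if "n \<le> N" for n
    using that
  proof (induction n)
    case (Suc n)
    then show ?case using closed[of "Suc n" "y n" "q (Suc n)" "y (Suc n)"] R[of "Suc n"] by auto
  qed (use y0 u0 v0 in simp)
  define u where "u n = (\<lambda>s. fst (q n s))" for n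
  have st: "vec_poly S p (u n) \<and> u n (t (n-1)) = fst (y (n-1)) \<and> u n (t n) = fst (y n) \<and>
      weak_step k p I c (t (n-1)) (t n) (u n) (snd (y (n-1))) (snd (y n))" if n: "n \<in> {1..N}" for n
  proof -
    have m: "y (n-1) \<in> S \<times> S" "snd (y n) \<in> S" using yS[of "n-1"] yS[of n] n by auto
    have "\<exists>q. R (t (n-1)) (t n) (y (n-1)) q (y n) \<and> (\<lambda>s. fst (q s)) = u n"
      using R[OF n] unfolding u_def by blast
    then show ?thesis unfolding step[OF n m] .
  qed
  have "U 0 = fst (y 0)"
    using step_chain_start[OF mesh T, of U u "\<lambda>n. fst (y n)"] U st unfolding u_def by blast
  moreover have "pieces N t p U u" unfolding pieces_def using st U unfolding u_def by blast
  ultimately show "\<exists>u z. pieces N t p U u \<and> U 0 = u0 \<and> z 0 = v0 \<and>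
    (\<forall>n\<le>N. z n \<in> S) \<and> (\<forall>n\<in>{1..N}. weak_step k p I c (t (n-1)) (t n) (u n) (z (n-1)) (z n))"
    using y0 yS st by (intro exI[of _ u] exI[of _ "\<lambda>n. snd (y n)"]) (auto simp: mem_Times_iff)
qed

lemma gauss_step_closed:
  assumes "gauss_rk_step (S \<times> S) p \<Phi> s0 s1 y0 q y1"
  shows "y1 \<in> S \<times> S"
  using assms vec_poly_mem[OF subspace_Times[OF subspace subspace]] unfolding gauss_rk_step_def by blast

lemma lobatto_step_closed:
  assumes "lobatto_pair_step S S p (\<lambda>v s. v) k s0 s1 y0 q y1"
    and k: "\<And>x. x \<in> S \<Longrightarrow> k x s1 \<in> S"
  shows "y1 \<in> S \<times> S"
proof -
  have u: "vec_poly S (p + 1) (\<lambda>s. fst (q s))" and v: "vec_poly S (p - 1) (\<lambda>s. snd (q s))"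
    and "fst y1 = fst (q s1)"
    and v1: "snd y1 = snd (q s1) - ((s1 - s0) * quad_weight {0..p} (lobatto_node p) p) *\<^sub>R
      (vector_derivative (\<lambda>s. snd (q s)) (at s1) - k (fst (q s1)) s1)"
    using assms(1) unfolding lobatto_pair_step_def Let_def by auto
  moreover have "snd y1 \<in> S" unfolding v1
    using S_mem[OF v] S_mem[OF vec_poly_deriv(1)[OF subspace v]] S_mem[OF u] k subspace
    by (intro subspace_diff subspace_scale) auto
  ultimately show ?thesis using S_mem[OF u, of s1] by (auto simp: mem_Times_iff)
qed

theorem gauss_scheme_iff_time_stepping:
  assumes mesh: "time_mesh T N t" and T: "T > 0" and "u0 \<in> S" "v0 \<in> S" and p: "p \<ge> 1"
    and k: "\<And>x s. x \<in> S \<Longrightarrow> s \<in> {0..T} \<Longrightarrow> k x s \<in> S"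
  shows "galerkin_scheme k p {1..p} (gauss_node p) N t u0 v0 U \<longleftrightarrow>
    (\<exists>y q. time_stepping (gauss_rk_step (S \<times> S) p (\<lambda>s (u, v). (v, k u s))) N t (u0, v0) y q \<and>
      (\<forall>n\<in>{1..N}. \<forall>s\<in>{t (n-1)..t n}. U s = fst (q n s)))"
proof (rule time_stepping_iff[OF mesh T assms(3,4)])
  fix n u and y0 y1 :: "'v \<times> 'v" assume n: "n \<in> {1..N}" and y: "y0 \<in> S \<times> S" "snd y1 \<in> S"
  show "(\<exists>q. gauss_rk_step (S \<times> S) p (\<lambda>s (u, v). (v, k u s)) (t (n-1)) (t n) y0 q y1 \<and> (\<lambda>s. fst (q s)) = u) \<longleftrightarrow>
      vec_poly S p u \<and> u (t (n-1)) = fst y0 \<and> u (t n) = fst y1 \<and>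
      weak_step k p {1..p} (gauss_node p) (t (n-1)) (t n) u (snd y0) (snd y1)"
    using y time_mesh_slab[OF mesh n] k by (intro gauss_step_iff p time_mesh_step[OF mesh n]) auto
qed (rule gauss_step_closed)

theorem lobatto_scheme_iff_time_stepping:
  assumes mesh: "time_mesh T N t" and T: "T > 0" and "u0 \<in> S" "v0 \<in> S" and p: "p \<ge> 1"
    and k: "\<And>x s. x \<in> S \<Longrightarrow> s \<in> {0..T} \<Longrightarrow> k x s \<in> S"
  shows "galerkin_scheme k p {0..p} (lobatto_node p) N t u0 v0 U \<longleftrightarrow>
    (\<exists>y q. time_stepping (lobatto_pair_step S S p (\<lambda>v s. v) k) N t (u0, v0) y q \<and>
      (\<forall>n\<in>{1..N}. \<forall>s\<in>{t (n-1)..t n}. U s = fst (q n s)))"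
proof (rule time_stepping_iff[OF mesh T assms(3,4)])
  fix n u and y0 y1 :: "'v \<times> 'v" assume n: "n \<in> {1..N}" and y: "y0 \<in> S \<times> S" "snd y1 \<in> S"
  show "(\<exists>q. lobatto_pair_step S S p (\<lambda>v s. v) k (t (n-1)) (t n) y0 q y1 \<and> (\<lambda>s. fst (q s)) = u) \<longleftrightarrow>
      vec_poly S p u \<and> u (t (n-1)) = fst y0 \<and> u (t n) = fst y1 \<and>
      weak_step k p {0..p} (lobatto_node p) (t (n-1)) (t n) u (snd y0) (snd y1)"
    using y time_mesh_slab[OF mesh n] k by (intro lobatto_step_iff p time_mesh_step[OF mesh n]) auto
next
  fix n q and y0 y1 :: "'v \<times> 'v"
  assume n: "n \<in> {1..N}" and "lobatto_pair_step S S p (\<lambda>v s. v) k (t (n-1)) (t n) y0 q y1"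
  moreover have "k x (t n) \<in> S" if "x \<in> S" for x
    using time_mesh_slab[OF mesh n] time_mesh_step[OF mesh n] that by (intro k) auto
  ultimately show "y1 \<in> S \<times> S" using lobatto_step_closed by blast
qed

end

section \<open>Derivatives with respect to the initial value\<close>

lemma has_vector_derivative_along_curve:
  assumes x: "(x has_vector_derivative x') (at (0::real))" and r: "r > 0" "\<And>\<epsilon>. \<bar>\<epsilon>\<bar> < r \<Longrightarrow> x \<epsilon> \<in> D"
    and f: "(f has_derivative f') (at (x 0) within D)"
  shows "((\<lambda>\<epsilon>. f (x \<epsilon>)) has_vector_derivative f' x') (at 0)"
proof -
  have x0: "(x has_derivative (\<lambda>\<epsilon>. \<epsilon> *\<^sub>R x')) (at 0 within ball 0 r)"
    using x unfolding has_vector_derivative_def by (rule has_derivative_at_withinI)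
  have "x ` ball 0 r \<subseteq> D" using r by (auto simp: dist_real_def)
  from has_derivative_in_compose[OF x0 has_derivative_subset[OF f this]]
  have "((\<lambda>\<epsilon>. f (x \<epsilon>)) has_derivative (\<lambda>\<epsilon>. f' (\<epsilon> *\<^sub>R x'))) (at 0 within ball 0 r)" .
  moreover have "at (0::real) within ball 0 r = at 0" using r by (intro at_within_open) auto
  moreover have "f' (\<epsilon> *\<^sub>R x') = \<epsilon> *\<^sub>R f' x'" for \<epsilon>
    using linear_scale[OF bounded_linear.linear[OF has_derivative_bounded_linear[OF f]]] by blast
  ultimately show ?thesis unfolding has_vector_derivative_def by simp
qed

lemma has_vector_derivative_eventually_eq:
  assumes "(f has_vector_derivative f') (at (0::real))" "r > 0" "\<And>\<epsilon>. \<bar>\<epsilon>\<bar> < r \<Longrightarrow> f \<epsilon> = g \<epsilon>"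
  shows "(g has_vector_derivative f') (at 0)"
  using assms by (intro has_vector_derivative_transform_within[OF assms(1,2)]) (auto simp: dist_real_def)

lemma vector_derivative_lagrange:
  fixes q :: "real \<Rightarrow> 'v::real_normed_vector"
  assumes "vec_poly Y m q" "finite I" "inj_on c I" "m < card I"
  shows "vector_derivative q (at s) = (\<Sum>j\<in>I. poly (pderiv (lagrange_poly I c j)) s *\<^sub>R q (c j))"
proof -
  have "((\<lambda>s. \<Sum>j\<in>I. poly (lagrange_poly I c j) s *\<^sub>R q (c j)) has_vector_derivative
      (\<Sum>j\<in>I. poly (pderiv (lagrange_poly I c j)) s *\<^sub>R q (c j))) (at s)"
  proof (rule has_vector_derivative_sum)
    show "((\<lambda>s. poly (lagrange_poly I c j) s *\<^sub>R q (c j)) has_vector_derivative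
      poly (pderiv (lagrange_poly I c j)) s *\<^sub>R q (c j)) (at s)" for j
      using has_vector_derivative_scaleR[OF poly_DERIV[of "lagrange_poly I c j" s] has_vector_derivative_const[of "q (c j)"]]
      by simp
  qed
  then show ?thesis using vec_poly_lagrange[OF assms] by (metis (no_types, lifting) ext vector_derivative_at)
qed

lemma at_within_openin:
  assumes "openin (top_of_set Y) D" "y \<in> D"
  shows "at y within D = at y within Y"
proof -
  obtain O' where "open O'" "D = Y \<inter> O'" using assms(1) by (auto simp: openin_open)
  then show ?thesis using assms(2) by (intro at_within_nhd[of _ O']) auto
qed

lemma openin_curve:
  fixes y \<xi> :: "'v::real_normed_vector"
  assumes "openin (top_of_set Y) D" "y \<in> D" "subspace Y" "\<xi> \<in> Y"
  obtains r where "r > 0" "\<And>\<epsilon>. \<bar>\<epsilon>\<bar> < r \<Longrightarrow> y + \<epsilon> *\<^sub>R \<xi> \<in> D"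
proof -
  obtain e where e: "e > 0" "ball y e \<inter> Y \<subseteq> D" using assms(1,2) by (auto simp: openin_contains_ball)
  have yY: "y \<in> Y" using assms(1,2) by (auto simp: openin_open)
  show thesis
  proof
    show "e / (norm \<xi> + 1) > 0" using e by (simp add: add_nonneg_pos)
    show "y + \<epsilon> *\<^sub>R \<xi> \<in> D" if "\<bar>\<epsilon>\<bar> < e / (norm \<xi> + 1)" for \<epsilon>
    proof -
      have "\<bar>\<epsilon>\<bar> * norm \<xi> \<le> \<bar>\<epsilon>\<bar> * (norm \<xi> + 1)" by (intro mult_left_mono) auto
      also have "\<dots> < e" using that by (simp add: pos_less_divide_eq add_nonneg_pos)
      finally have "y + \<epsilon> *\<^sub>R \<xi> \<in> ball y e" by (simp add: dist_norm)
      moreover have "y + \<epsilon> *\<^sub>R \<xi> \<in> Y" using yY assms(3,4) by (intro subspace_add subspace_scale)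
      ultimately show ?thesis using e by blast
    qed
  qed
qed

context galerkin_space
begin

text \<open>The expansion in the basis is continuous and so passes to the derivative.\<close>
lemma variation_mem:
  assumes "(x has_vector_derivative x') (at (0::real))" "r > 0" "\<And>\<epsilon>. \<bar>\<epsilon>\<bar> < r \<Longrightarrow> x \<epsilon> \<in> S"
  shows "x' \<in> S"
proof -
  have "((\<lambda>\<epsilon>. \<Sum>e\<in>E. M (x \<epsilon>) e *\<^sub>R e) has_vector_derivative (\<Sum>e\<in>E. M x' e *\<^sub>R e)) (at 0)"
  proof (rule has_vector_derivative_sum)
    fix e
    have "((\<lambda>\<epsilon>. M (x \<epsilon>) e) has_vector_derivative M (x 0) 0 + M x' e) (at 0)"
      by (rule bounded_bilinear.has_vector_derivative[OF bilinear assms(1)]) simp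
    then have "((\<lambda>\<epsilon>. M (x \<epsilon>) e) has_real_derivative M x' e) (at 0)"
      by (simp add: M_simps has_real_derivative_iff_has_vector_derivative)
    from has_vector_derivative_scaleR[OF this has_vector_derivative_const[of e]]
    show "((\<lambda>\<epsilon>. M (x \<epsilon>) e *\<^sub>R e) has_vector_derivative M x' e *\<^sub>R e) (at 0)" by simp
  qed
  moreover have "((\<lambda>\<epsilon>. \<Sum>e\<in>E. M (x \<epsilon>) e *\<^sub>R e) has_vector_derivative x') (at 0)"
    by (rule has_vector_derivative_eventually_eq[OF assms(1,2)]) (rule expansion[OF assms(3)])
  ultimately have "x' = (\<Sum>e\<in>E. M x' e *\<^sub>R e)" by (rule vector_derivative_unique_at[rotated])
  also have "\<dots> \<in> S" using subspace E_subset by (intro subspace_sum subspace_scale) auto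
  finally show ?thesis .
qed

text \<open>A polynomial is a fixed linear combination of its values at \<open>0, \<dots>, m\<close>, and so is its time
  derivative. Hence differentiation in the parameter preserves the degree and commutes with
  differentiation in time.\<close>
lemma variation_vec_poly:
  assumes r: "r > 0" and q: "\<And>\<epsilon>. \<bar>\<epsilon>\<bar> < r \<Longrightarrow> vec_poly S m (q \<epsilon>)"
    and d: "\<And>s. ((\<lambda>\<epsilon>. q \<epsilon> s) has_vector_derivative \<delta> s) (at (0::real))"
  shows "vec_poly S m \<delta>"
    and "((\<lambda>\<epsilon>. vector_derivative (q \<epsilon>) (at s)) has_vector_derivative vector_derivative \<delta> (at s)) (at 0)"
proof -
  let ?l = "lagrange_poly {0..m} real"
  have I: "finite {0..m}" "inj_on real {0..m}" "m < card {0..m}" by auto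
  have \<delta>S: "\<delta> s \<in> S" for s using variation_mem[OF d r] S_mem[OF q] by blast
  have \<delta>: "\<delta> s = (\<Sum>j\<in>{0..m}. poly (?l j) s *\<^sub>R \<delta> (real j))" for s
  proof -
    have "((\<lambda>\<epsilon>. \<Sum>j\<in>{0..m}. poly (?l j) s *\<^sub>R q \<epsilon> (real j)) has_vector_derivative
        (\<Sum>j\<in>{0..m}. poly (?l j) s *\<^sub>R \<delta> (real j))) (at 0)"
      by (intro has_vector_derivative_sum bounded_linear.has_vector_derivative[OF bounded_linear_scaleR_right] d)
    moreover have "((\<lambda>\<epsilon>. \<Sum>j\<in>{0..m}. poly (?l j) s *\<^sub>R q \<epsilon> (real j)) has_vector_derivative \<delta> s) (at 0)"
      by (rule has_vector_derivative_eventually_eq[OF d[of s] r]) (rule vec_poly_lagrange[OF q I])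
    ultimately show ?thesis by (rule vector_derivative_unique_at[rotated])
  qed
  have "vec_poly S m (\<lambda>s. \<Sum>j\<in>{0..m}. poly (?l j) s *\<^sub>R \<delta> (real j))"
    using degree_lagrange_poly[OF I(1), of _ real] \<delta>S by (intro vec_poly_sum vec_poly_scaleR subspace) auto
  then show v\<delta>: "vec_poly S m \<delta>" using \<delta> by (metis (no_types, lifting) ext)
  have "((\<lambda>\<epsilon>. \<Sum>j\<in>{0..m}. poly (pderiv (?l j)) s *\<^sub>R q \<epsilon> (real j)) has_vector_derivative
        (\<Sum>j\<in>{0..m}. poly (pderiv (?l j)) s *\<^sub>R \<delta> (real j))) (at 0)"
    by (intro has_vector_derivative_sum bounded_linear.has_vector_derivative[OF bounded_linear_scaleR_right] d)
  from has_vector_derivative_eventually_eq[OF this r, of "\<lambda>\<epsilon>. vector_derivative (q \<epsilon>) (at s)"]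
  show "((\<lambda>\<epsilon>. vector_derivative (q \<epsilon>) (at s)) has_vector_derivative vector_derivative \<delta> (at s)) (at 0)"
    using vector_derivative_lagrange[OF q I] vector_derivative_lagrange[OF v\<delta> I] by simp
qed

section \<open>Quadratic invariants\<close>

text \<open>The symplectic form of the abstract setting.\<close>
definition sform :: "'v \<times> 'v \<Rightarrow> 'v \<times> 'v \<Rightarrow> real" where
  "sform \<xi> \<eta> = M (fst \<xi>) (snd \<eta>) - M (snd \<xi>) (fst \<eta>)"

lemma sform_increment:
  assumes u: "vec_poly S m u1" "vec_poly S m u2" and v: "vec_poly S l v1" "vec_poly S l v2"
    and ex: "quadrature_exact I c d" and d: "m + l \<le> Suc d"
  shows "sform (u1 s1, v1 s1) (u2 s1, v2 s1) - sform (u1 s0, v1 s0) (u2 s0, v2 s0) =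
    (s1 - s0) * (\<Sum>j\<in>I. quad_weight I c j *
      (let \<tau> = s0 + c j * (s1 - s0) in
       sform (vector_derivative u1 (at \<tau>), vector_derivative v1 (at \<tau>)) (u2 \<tau>, v2 \<tau>) +
       sform (u1 \<tau>, v1 \<tau>) (vector_derivative u2 (at \<tau>), vector_derivative v2 (at \<tau>))))"
proof -
  have d': "l + m \<le> Suc d" using d by simp
  show ?thesis
    using M_increment_quadrature[OF u(1) v(2) ex d, of s1 s0] M_increment_quadrature[OF v(1) u(2) ex d', of s1 s0]
    unfolding sform_def Let_def
    by (simp add: right_diff_distrib distrib_left sum.distrib sum_subtractf)
qed

text \<open>At each node the derivative of $M(u_1,v_2) - M(v_1,u_2)$ is
  $M(v_1,v_2) + M(u_1,Au_2) - M(Au_1,u_2) - M(v_1,v_2)$, which vanishes by the symmetry of \<open>A\<close>. The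
  form has degree $2p$ in time, so the quadrature of its derivative is exact.\<close>
lemma gauss_sform_invariant:
  assumes p: "p \<ge> 1"
    and u: "vec_poly S p u1" "vec_poly S p u2" and v: "vec_poly S p v1" "vec_poly S p v2"
    and ud: "\<And>j. j \<in> {1..p} \<Longrightarrow> vector_derivative u1 (at (\<tau> j)) = v1 (\<tau> j) \<and> vector_derivative u2 (at (\<tau> j)) = v2 (\<tau> j)"
    and vd: "\<And>j. j \<in> {1..p} \<Longrightarrow> vector_derivative v1 (at (\<tau> j)) = A j (u1 (\<tau> j)) \<and> vector_derivative v2 (at (\<tau> j)) = A j (u2 (\<tau> j))"
    and A: "\<And>j a b. j \<in> {1..p} \<Longrightarrow> a \<in> S \<Longrightarrow> b \<in> S \<Longrightarrow> M (A j a) b = M a (A j b)"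
    and \<tau>: "\<tau> = (\<lambda>j. s0 + gauss_node p j * (s1 - s0))"
  shows "sform (u1 s1, v1 s1) (u2 s1, v2 s1) = sform (u1 s0, v1 s0) (u2 s0, v2 s0)"
proof -
  have "sform (u1 s1, v1 s1) (u2 s1, v2 s1) - sform (u1 s0, v1 s0) (u2 s0, v2 s0) =
    (s1 - s0) * (\<Sum>j\<in>{1..p}. quad_weight {1..p} (gauss_node p) j *
      (let \<tau> = \<tau> j in
       sform (vector_derivative u1 (at \<tau>), vector_derivative v1 (at \<tau>)) (u2 \<tau>, v2 \<tau>) +
       sform (u1 \<tau>, v1 \<tau>) (vector_derivative u2 (at \<tau>), vector_derivative v2 (at \<tau>))))"
    unfolding \<tau> by (rule sform_increment[OF u v gauss_exact[OF p]]) (use p in simp)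
  also have "\<dots> = (s1 - s0) * (\<Sum>j\<in>{1..p}. 0)"
    using ud vd A S_mem[OF u(1)] S_mem[OF u(2)] by (intro arg_cong2[of _ _ _ _ "(*)"] sum.cong refl) (auto simp: sform_def)
  finally show ?thesis by simp
qed

text \<open>The terms $M(v_1,v_2)$ cancel everywhere and the others at the interior nodes, by the symmetry
  of \<open>A\<close>. The quadrature sum therefore reduces to its terms at the end nodes, and these are the
  changes of the form caused by the two corrections of the velocities.\<close>
lemma lobatto_sform_invariant:
  assumes p: "p \<ge> 1"
    and u: "vec_poly S p u1" "vec_poly S p u2" and v: "vec_poly S (p - 1) v1" "vec_poly S (p - 1) v2"
    and ud: "\<And>s. vector_derivative u1 (at s) = v1 s" "\<And>s. vector_derivative u2 (at s) = v2 s"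
    and vd: "\<And>j. j \<in> {1..<p} \<Longrightarrow> vector_derivative v1 (at (\<tau> j)) = A j (u1 (\<tau> j)) \<and> vector_derivative v2 (at (\<tau> j)) = A j (u2 (\<tau> j))"
    and A: "\<And>j a b. j \<in> {0..p} \<Longrightarrow> a \<in> S \<Longrightarrow> b \<in> S \<Longrightarrow> M (A j a) b = M a (A j b)"
    and \<tau>: "\<tau> = (\<lambda>j. s0 + lobatto_node p j * (s1 - s0))"
    and \<omega>: "\<omega> = quad_weight {0..p} (lobatto_node p)"
    and y: "v1 s0 = snd \<xi> - ((s1 - s0) * \<omega> 0) *\<^sub>R (vector_derivative v1 (at s0) - A 0 (u1 s0))" "u1 s0 = fst \<xi>"
      "v2 s0 = snd \<eta> - ((s1 - s0) * \<omega> 0) *\<^sub>R (vector_derivative v2 (at s0) - A 0 (u2 s0))" "u2 s0 = fst \<eta>"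
  shows "sform (u1 s1, v1 s1 - ((s1 - s0) * \<omega> p) *\<^sub>R (vector_derivative v1 (at s1) - A p (u1 s1)))
      (u2 s1, v2 s1 - ((s1 - s0) * \<omega> p) *\<^sub>R (vector_derivative v2 (at s1) - A p (u2 s1))) = sform \<xi> \<eta>"
proof -
  define B where "B s = M (u1 s) (vector_derivative v2 (at s)) - M (vector_derivative v1 (at s)) (u2 s)" for s
  have \<tau>0: "\<tau> 0 = s0" and \<tau>p: "\<tau> p = s1" by (auto simp: \<tau> lobatto_node_0[OF p] lobatto_node_p[OF p])
  have "sform (u1 s1, v1 s1) (u2 s1, v2 s1) - sform (u1 s0, v1 s0) (u2 s0, v2 s0) =
    (s1 - s0) * (\<Sum>j\<in>{0..p}. \<omega> j *
      (let \<tau> = \<tau> j in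
       sform (vector_derivative u1 (at \<tau>), vector_derivative v1 (at \<tau>)) (u2 \<tau>, v2 \<tau>) +
       sform (u1 \<tau>, v1 \<tau>) (vector_derivative u2 (at \<tau>), vector_derivative v2 (at \<tau>))))"
    unfolding \<tau> \<omega> by (rule sform_increment[OF u v lobatto_exact[OF p]]) (use p in simp)
  also have "\<dots> = (s1 - s0) * (\<Sum>j\<in>{0..p}. \<omega> j * B (\<tau> j))"
    using ud by (simp add: sform_def B_def Let_def)
  also have "(\<Sum>j\<in>{0..p}. \<omega> j * B (\<tau> j)) = (\<Sum>j\<in>{0, p}. \<omega> j * B (\<tau> j))"
  proof (rule sum.mono_neutral_right)
    show "\<forall>i\<in>{0..p} - {0, p}. \<omega> i * B (\<tau> i) = 0"
      using vd A S_mem[OF u(1)] S_mem[OF u(2)] by (auto simp: B_def)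
  qed auto
  also have "\<dots> = \<omega> 0 * B s0 + \<omega> p * B s1" using p \<tau>0 \<tau>p by simp
  finally have main: "sform (u1 s1, v1 s1) (u2 s1, v2 s1) - sform (u1 s0, v1 s0) (u2 s0, v2 s0) =
    (s1 - s0) * (\<omega> 0 * B s0 + \<omega> p * B s1)" .
  have A': "M (A j (u1 s)) (u2 s) = M (u1 s) (A j (u2 s))" if "j \<in> {0..p}" for j s
    using A[OF that] S_mem[OF u(1)] S_mem[OF u(2)] by auto
  have end1: "sform (u1 s1, v1 s1 - ((s1 - s0) * \<omega> p) *\<^sub>R (vector_derivative v1 (at s1) - A p (u1 s1)))
      (u2 s1, v2 s1 - ((s1 - s0) * \<omega> p) *\<^sub>R (vector_derivative v2 (at s1) - A p (u2 s1))) =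
    sform (u1 s1, v1 s1) (u2 s1, v2 s1) - (s1 - s0) * (\<omega> p * B s1)"
    using A'[of p s1] p by (simp add: sform_def B_def M_simps right_diff_distrib)
  have \<xi>: "snd \<xi> = v1 s0 + ((s1 - s0) * \<omega> 0) *\<^sub>R (vector_derivative v1 (at s0) - A 0 (u1 s0))"
    and \<eta>: "snd \<eta> = v2 s0 + ((s1 - s0) * \<omega> 0) *\<^sub>R (vector_derivative v2 (at s0) - A 0 (u2 s0))"
    using y by auto
  have end0: "sform \<xi> \<eta> = sform (u1 s0, v1 s0) (u2 s0, v2 s0) + (s1 - s0) * (\<omega> 0 * B s0)"
    using A'[of 0 s0] unfolding sform_def \<xi> \<eta> y(2)[symmetric] y(4)[symmetric] fst_conv snd_conv
    by (simp add: B_def M_simps right_diff_distrib)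
  show ?thesis unfolding end1 end0 using main by (simp add: algebra_simps)
qed

section \<open>Symplecticity of one-step maps\<close>

lemma one_step_map_derivative:
  assumes "one_step_map Y R D Q \<Psi>" "y \<in> D"
  obtains L where "\<And>\<tau>. ((\<lambda>y'. Q y' \<tau>) has_derivative L \<tau>) (at y within D)"
proof -
  have "\<forall>\<tau>. \<exists>L. ((\<lambda>y'. Q y' \<tau>) has_derivative L) (at y within Y)"
    using assms unfolding one_step_map_def differentiable_def by blast
  then obtain L where "\<And>\<tau>. ((\<lambda>y'. Q y' \<tau>) has_derivative L \<tau>) (at y within Y)" by metis
  moreover have "at y within D = at y within Y"
    using assms unfolding one_step_map_def by (intro at_within_openin) auto
  ultimately show thesis by (intro that[of L]) simp
qed

lemma variation_Pair:
  assumes D: "openin (top_of_set (S \<times> S)) D" "y \<in> D" and \<xi>: "\<xi> \<in> S \<times> S"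
    and L: "\<And>\<tau>. ((\<lambda>y'. Q y' \<tau>) has_derivative L \<tau>) (at y within D)"
  shows "\<exists>r>0. (\<forall>\<epsilon>. \<bar>\<epsilon>\<bar> < r \<longrightarrow> y + \<epsilon> *\<^sub>R \<xi> \<in> D) \<and>
    (\<forall>\<tau>. ((\<lambda>\<epsilon>. fst (Q (y + \<epsilon> *\<^sub>R \<xi>) \<tau>)) has_vector_derivative fst (L \<tau> \<xi>)) (at 0)) \<and>
    (\<forall>\<tau>. ((\<lambda>\<epsilon>. snd (Q (y + \<epsilon> *\<^sub>R \<xi>) \<tau>)) has_vector_derivative snd (L \<tau> \<xi>)) (at 0))"
proof -
  obtain r where r: "r > 0" "\<And>\<epsilon>. \<bar>\<epsilon>\<bar> < r \<Longrightarrow> y + \<epsilon> *\<^sub>R \<xi> \<in> D"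
    using openin_curve[OF D subspace_Times[OF subspace subspace] \<xi>] by blast
  have x: "((\<lambda>\<epsilon>. y + \<epsilon> *\<^sub>R \<xi>) has_vector_derivative \<xi>) (at 0)"
    by (auto intro!: derivative_eq_intros simp: has_vector_derivative_def)
  have "((\<lambda>\<epsilon>. Q (y + \<epsilon> *\<^sub>R \<xi>) \<tau>) has_vector_derivative L \<tau> \<xi>) (at 0)" for \<tau>
    using has_vector_derivative_along_curve[OF x r(1), of D "\<lambda>y'. Q y' \<tau>" "L \<tau>"] r(2) L by simp
  from bounded_linear.has_vector_derivative[OF bounded_linear_fst this]
    bounded_linear.has_vector_derivative[OF bounded_linear_snd this]
  show ?thesis using r by blast
qed

lemma initial_variation:
  assumes "r > 0" "\<And>\<epsilon>. \<bar>\<epsilon>\<bar> < r \<Longrightarrow> x \<epsilon> = a + \<epsilon> *\<^sub>R b" "(x has_vector_derivative d) (at (0::real))"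
  shows "d = b"
proof -
  have "((\<lambda>\<epsilon>. a + \<epsilon> *\<^sub>R b) has_vector_derivative b) (at 0)"
    by (auto intro!: derivative_eq_intros simp: has_vector_derivative_def)
  moreover have "((\<lambda>\<epsilon>. a + \<epsilon> *\<^sub>R b) has_vector_derivative d) (at 0)"
    using has_vector_derivative_eventually_eq[OF assms(3,1,2)] .
  ultimately show ?thesis by (rule vector_derivative_unique_at[rotated])
qed

lemma k_variation:
  assumes "((\<lambda>x. k x s) has_derivative A) (at (x 0) within S)" "r > 0"
    "\<And>\<epsilon>. \<bar>\<epsilon>\<bar> < r \<Longrightarrow> x \<epsilon> \<in> S" "(x has_vector_derivative d) (at (0::real))"
    "((\<lambda>\<epsilon>. k (x \<epsilon>) s) has_vector_derivative e) (at 0)"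
  shows "e = A d"
  using has_vector_derivative_along_curve[OF assms(4,2,3,1)] assms(5) by (rule vector_derivative_unique_at[rotated])

text \<open>The derivative of the internal polynomial in a direction \<open>\<xi>\<close> of the state space is a pair of
  polynomials with initial value \<open>\<xi>\<close> that satisfies the linearised collocation equations. Applied
  to two directions, the invariance of the symplectic form along such pairs is the claim.\<close>
theorem gauss_one_step_map_symplectic:
  assumes p: "p \<ge> 1" and s: "s0 < s1" "{s0..s1} \<subseteq> J"
    and k: "\<And>x s. x \<in> S \<Longrightarrow> s \<in> J \<Longrightarrow>
      \<exists>A. ((\<lambda>x. k x s) has_derivative A) (at x within S) \<and> (\<forall>a\<in>S. \<forall>b\<in>S. M (A a) b = M a (A b))"
    and step: "one_step_map (S \<times> S) (gauss_rk_step (S \<times> S) p (\<lambda>s (u, v). (v, k u s)) s0 s1) D Q \<Psi>"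
    and y: "y \<in> D"
  shows "\<Psi> y \<in> S \<times> S \<and> (\<exists>\<Psi>'. (\<Psi> has_derivative \<Psi>') (at y within S \<times> S) \<and>
     (\<forall>\<xi>\<in>S \<times> S. \<forall>\<eta>\<in>S \<times> S. sform (\<Psi>' \<xi>) (\<Psi>' \<eta>) = sform \<xi> \<eta>))"
proof -
  define \<tau> where "\<tau> = (\<lambda>j. s0 + gauss_node p j * (s1 - s0))"
  have D: "openin (top_of_set (S \<times> S)) D" using step by (simp add: one_step_map_def)
  have R: "gauss_rk_step (S \<times> S) p (\<lambda>s (u, v). (v, k u s)) s0 s1 y' (Q y') (\<Psi> y')" if "y' \<in> D" for y'
    using step that by (simp add: one_step_map_def)
  have "s0 + gauss_node p j * (s1 - s0) = \<tau> j" for j by (simp add: \<tau>_def)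
  note st = gauss_stepD[OF R, unfolded this]
  obtain L where L: "\<And>\<tau>. ((\<lambda>y'. Q y' \<tau>) has_derivative L \<tau>) (at y within D)"
    using one_step_map_derivative[OF step y] by blast
  have \<tau>J: "\<tau> j \<in> J" if "j \<in> {1..p}" for j
  proof -
    have "\<tau> j \<in> {s0..s1}" unfolding \<tau>_def
      using gauss_node_bounds[OF that] s(1) by (intro slab_node_mem) auto
    then show ?thesis using s(2) by blast
  qed
  have "\<forall>j\<in>{1..p}. \<exists>A. ((\<lambda>x. k x (\<tau> j)) has_derivative A) (at (fst (Q y (\<tau> j))) within S) \<and> (\<forall>a\<in>S. \<forall>b\<in>S. M (A a) b = M a (A b))"
    using k \<tau>J S_mem[OF st(1)[OF y]] by blast
  then obtain A where A: "\<And>j. j \<in> {1..p} \<Longrightarrow> ((\<lambda>x. k x (\<tau> j)) has_derivative A j) (at (fst (Q y (\<tau> j))) within S)"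
    "\<And>j a b. j \<in> {1..p} \<Longrightarrow> a \<in> S \<Longrightarrow> b \<in> S \<Longrightarrow> M (A j a) b = M a (A j b)" by metis
  have var: "vec_poly S p (\<lambda>s. fst (L s \<xi>)) \<and> vec_poly S p (\<lambda>s. snd (L s \<xi>)) \<and> L s0 \<xi> = \<xi> \<and>
      (\<forall>j\<in>{1..p}. vector_derivative (\<lambda>s. fst (L s \<xi>)) (at (\<tau> j)) = snd (L (\<tau> j) \<xi>) \<and>
        vector_derivative (\<lambda>s. snd (L s \<xi>)) (at (\<tau> j)) = A j (fst (L (\<tau> j) \<xi>)))"
    if \<xi>: "\<xi> \<in> S \<times> S" for \<xi>
  proof -
    obtain r where r: "r > 0" and rD': "\<forall>\<epsilon>. \<bar>\<epsilon>\<bar> < r \<longrightarrow> y + \<epsilon> *\<^sub>R \<xi> \<in> D"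
      and du': "\<forall>\<tau>. ((\<lambda>\<epsilon>. fst (Q (y + \<epsilon> *\<^sub>R \<xi>) \<tau>)) has_vector_derivative fst (L \<tau> \<xi>)) (at 0)"
      and dv': "\<forall>\<tau>. ((\<lambda>\<epsilon>. snd (Q (y + \<epsilon> *\<^sub>R \<xi>) \<tau>)) has_vector_derivative snd (L \<tau> \<xi>)) (at 0)"
      using variation_Pair[where Q = Q and L = L, OF D y \<xi> L] by blast
    note rD = rD'[rule_format] and du = spec[OF du'] and dv = spec[OF dv']
    note vu = variation_vec_poly[OF r st(1)[OF rD] du]
    note vv = variation_vec_poly[OF r st(2)[OF rD] dv]
    have "fst (L s0 \<xi>) = fst \<xi>"
      by (rule initial_variation[OF r _ du[of s0], of "fst y"]) (simp add: st(3)[OF rD])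
    moreover have "snd (L s0 \<xi>) = snd \<xi>"
      by (rule initial_variation[OF r _ dv[of s0], of "snd y"]) (simp add: st(3)[OF rD])
    moreover have "vector_derivative (\<lambda>s. fst (L s \<xi>)) (at (\<tau> j)) = snd (L (\<tau> j) \<xi>)" if j: "j \<in> {1..p}" for j
      using has_vector_derivative_eventually_eq[OF vu(2)[of "\<tau> j"] r st(5)[OF rD j]] dv[of "\<tau> j"]
      by (rule vector_derivative_unique_at)
    moreover have "vector_derivative (\<lambda>s. snd (L s \<xi>)) (at (\<tau> j)) = A j (fst (L (\<tau> j) \<xi>))" if j: "j \<in> {1..p}" for j
    proof -
      have a: "((\<lambda>x. k x (\<tau> j)) has_derivative A j) (at (fst (Q (y + 0 *\<^sub>R \<xi>) (\<tau> j))) within S)" using A(1)[OF j] by simp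
      have b: "((\<lambda>\<epsilon>. k (fst (Q (y + \<epsilon> *\<^sub>R \<xi>) (\<tau> j))) (\<tau> j)) has_vector_derivative
          vector_derivative (\<lambda>s. snd (L s \<xi>)) (at (\<tau> j))) (at 0)"
        using has_vector_derivative_eventually_eq[OF vv(2)[of "\<tau> j"] r st(6)[OF rD j]] .
      have c: "fst (Q (y + \<epsilon> *\<^sub>R \<xi>) (\<tau> j)) \<in> S" if "\<bar>\<epsilon>\<bar> < r" for \<epsilon>
        using S_mem[OF st(1)[OF rD[OF that]]] .
      show ?thesis by (rule k_variation[where k = k, OF a r c du b])
    qed
    ultimately show ?thesis using vu(1) vv(1) by (auto simp: prod_eq_iff)
  qed
  have "sform (L s1 \<xi>) (L s1 \<eta>) = sform \<xi> \<eta>" if "\<xi> \<in> S \<times> S" "\<eta> \<in> S \<times> S" for \<xi> \<eta>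
  proof -
    have "sform (fst (L s1 \<xi>), snd (L s1 \<xi>)) (fst (L s1 \<eta>), snd (L s1 \<eta>)) =
        sform (fst (L s0 \<xi>), snd (L s0 \<xi>)) (fst (L s0 \<eta>), snd (L s0 \<eta>))"
      using var[OF that(1)] var[OF that(2)] A(2)
      by (intro gauss_sform_invariant[OF p _ _ _ _ _ _ _ \<tau>_def, of _ _ _ _ A]) auto
    then show ?thesis using var[OF that(1)] var[OF that(2)] by simp
  qed
  moreover have "(\<Psi> has_derivative L s1) (at y within D)"
    by (rule has_derivative_transform[OF y _ L[of s1]]) (rule st(4))
  ultimately show ?thesis
    using gauss_step_closed[OF R[OF y]] at_within_openin[OF D y] by auto
qed

theorem lobatto_one_step_map_symplectic:
  assumes p: "p \<ge> 1" and s: "s0 < s1" "{s0..s1} \<subseteq> J"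
    and kS: "\<And>x s. x \<in> S \<Longrightarrow> s \<in> J \<Longrightarrow> k x s \<in> S"
    and k: "\<And>x s. x \<in> S \<Longrightarrow> s \<in> J \<Longrightarrow>
      \<exists>A. ((\<lambda>x. k x s) has_derivative A) (at x within S) \<and> (\<forall>a\<in>S. \<forall>b\<in>S. M (A a) b = M a (A b))"
    and step: "one_step_map (S \<times> S) (lobatto_pair_step S S p (\<lambda>v s. v) k s0 s1) D Q \<Psi>"
    and y: "y \<in> D"
  shows "\<Psi> y \<in> S \<times> S \<and> (\<exists>\<Psi>'. (\<Psi> has_derivative \<Psi>') (at y within S \<times> S) \<and>
     (\<forall>\<xi>\<in>S \<times> S. \<forall>\<eta>\<in>S \<times> S. sform (\<Psi>' \<xi>) (\<Psi>' \<eta>) = sform \<xi> \<eta>))"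
proof -
  define \<tau> where "\<tau> = (\<lambda>j. s0 + lobatto_node p j * (s1 - s0))"
  define \<omega> where "\<omega> = quad_weight {0..p} (lobatto_node p)"
  have \<tau>0: "\<tau> 0 = s0" and \<tau>p: "\<tau> p = s1" by (auto simp: \<tau>_def lobatto_node_0[OF p] lobatto_node_p[OF p])
  have D: "openin (top_of_set (S \<times> S)) D" using step by (simp add: one_step_map_def)
  have R: "lobatto_pair_step S S p (\<lambda>v s. v) k s0 s1 y' (Q y') (\<Psi> y')" if "y' \<in> D" for y'
    using step that by (simp add: one_step_map_def)
  have "s0 + lobatto_node p j * (s1 - s0) = \<tau> j" for j by (simp add: \<tau>_def)
  note st = lobatto_stepD[OF p s(1) R, unfolded this, folded \<omega>_def]
  obtain L where L: "\<And>\<tau>. ((\<lambda>y'. Q y' \<tau>) has_derivative L \<tau>) (at y within D)"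
    using one_step_map_derivative[OF step y] by blast
  have \<tau>J: "\<tau> j \<in> J" if "j \<in> {0..p}" for j
  proof -
    have "\<tau> j \<in> {s0..s1}" unfolding \<tau>_def
      using lobatto_node_bounds[OF p that] s(1) by (intro slab_node_mem) auto
    then show ?thesis using s(2) by blast
  qed
  have "\<forall>j\<in>{0..p}. \<exists>A. ((\<lambda>x. k x (\<tau> j)) has_derivative A) (at (fst (Q y (\<tau> j))) within S) \<and> (\<forall>a\<in>S. \<forall>b\<in>S. M (A a) b = M a (A b))"
    using k \<tau>J S_mem[OF st(1)[OF y]] by blast
  then obtain A where A: "\<And>j. j \<in> {0..p} \<Longrightarrow> ((\<lambda>x. k x (\<tau> j)) has_derivative A j) (at (fst (Q y (\<tau> j))) within S)"
    "\<And>j a b. j \<in> {0..p} \<Longrightarrow> a \<in> S \<Longrightarrow> b \<in> S \<Longrightarrow> M (A j a) b = M a (A j b)" by metis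
  let ?u = "\<lambda>\<xi> s. fst (L s \<xi>)" and ?v = "\<lambda>\<xi> s. snd (L s \<xi>)"
  have var: "vec_poly S p (?u \<xi>) \<and> vec_poly S (p - 1) (?v \<xi>) \<and> ?u \<xi> s0 = fst \<xi> \<and>
      (\<forall>s. vector_derivative (?u \<xi>) (at s) = ?v \<xi> s) \<and>
      ?v \<xi> s0 = snd \<xi> - ((s1 - s0) * \<omega> 0) *\<^sub>R (vector_derivative (?v \<xi>) (at s0) - A 0 (?u \<xi> s0)) \<and>
      (\<forall>j\<in>{1..<p}. vector_derivative (?v \<xi>) (at (\<tau> j)) = A j (?u \<xi> (\<tau> j)))"
    if \<xi>: "\<xi> \<in> S \<times> S" for \<xi>
  proof -
    obtain r where r: "r > 0" and rD': "\<forall>\<epsilon>. \<bar>\<epsilon>\<bar> < r \<longrightarrow> y + \<epsilon> *\<^sub>R \<xi> \<in> D"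
      and du': "\<forall>\<tau>. ((\<lambda>\<epsilon>. fst (Q (y + \<epsilon> *\<^sub>R \<xi>) \<tau>)) has_vector_derivative ?u \<xi> \<tau>) (at 0)"
      and dv': "\<forall>\<tau>. ((\<lambda>\<epsilon>. snd (Q (y + \<epsilon> *\<^sub>R \<xi>) \<tau>)) has_vector_derivative ?v \<xi> \<tau>) (at 0)"
      using variation_Pair[where Q = Q and L = L, OF D y \<xi> L] by blast
    note rD = rD'[rule_format] and du = spec[OF du'] and dv = spec[OF dv']
    note vu = variation_vec_poly[OF r st(1)[OF rD] du]
    note vv = variation_vec_poly[OF r st(2)[OF rD] dv]
    have dk: "((\<lambda>\<epsilon>. k (fst (Q (y + \<epsilon> *\<^sub>R \<xi>) (\<tau> j))) (\<tau> j)) has_vector_derivative A j (?u \<xi> (\<tau> j))) (at 0)"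
      if j: "j \<in> {0..p}" for j
      by (rule has_vector_derivative_along_curve[OF du[of "\<tau> j"] r, where D = S])
        (use A(1)[OF j] S_mem[OF st(1)[OF rD]] in auto)
    have "?u \<xi> s0 = fst \<xi>"
      by (rule initial_variation[OF r _ du[of s0], of "fst y"]) (simp add: st(3)[OF rD])
    moreover have "vector_derivative (?u \<xi>) (at s) = ?v \<xi> s" for s
      using has_vector_derivative_eventually_eq[OF vu(2)[of s] r st(5)[OF rD]] dv[of s]
      by (rule vector_derivative_unique_at)
    moreover have "vector_derivative (?v \<xi>) (at (\<tau> j)) = A j (?u \<xi> (\<tau> j))" if j: "j \<in> {1..<p}" for j
      using has_vector_derivative_eventually_eq[OF vv(2)[of "\<tau> j"] r st(8)[OF rD j]] dk[of j] j
      by (auto intro: vector_derivative_unique_at)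
    moreover have "?v \<xi> s0 + ((s1 - s0) * \<omega> 0) *\<^sub>R (vector_derivative (?v \<xi>) (at s0) - A 0 (?u \<xi> s0)) = snd \<xi>"
    proof (rule initial_variation[OF r, of _ "snd y"])
      show "((\<lambda>\<epsilon>. snd (Q (y + \<epsilon> *\<^sub>R \<xi>) s0) + ((s1 - s0) * \<omega> 0) *\<^sub>R
          (vector_derivative (\<lambda>s. snd (Q (y + \<epsilon> *\<^sub>R \<xi>) s)) (at s0) - k (fst (Q (y + \<epsilon> *\<^sub>R \<xi>) s0)) s0)) has_vector_derivative
          ?v \<xi> s0 + ((s1 - s0) * \<omega> 0) *\<^sub>R (vector_derivative (?v \<xi>) (at s0) - A 0 (?u \<xi> s0))) (at 0)"
        using dk[of 0] vv(2)[of s0] dv[of s0] unfolding \<tau>0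
        by (intro has_vector_derivative_add bounded_linear.has_vector_derivative[OF bounded_linear_scaleR_right]
          has_vector_derivative_diff) auto
      show "snd (Q (y + \<epsilon> *\<^sub>R \<xi>) s0) + ((s1 - s0) * \<omega> 0) *\<^sub>R
          (vector_derivative (\<lambda>s. snd (Q (y + \<epsilon> *\<^sub>R \<xi>) s)) (at s0) - k (fst (Q (y + \<epsilon> *\<^sub>R \<xi>) s0)) s0) =
          snd y + \<epsilon> *\<^sub>R snd \<xi>" if "\<bar>\<epsilon>\<bar> < r" for \<epsilon>
        using st(6)[OF rD[OF that]] by simp
    qed
    ultimately show ?thesis using vu(1) vv(1) by (auto simp: algebra_simps)
  qed
  \<comment> \<open>the time derivative of \<open>v\<close> at \<open>s1\<close> as a linear combination of values of \<open>v\<close>, which are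
    differentiable in the initial value\<close>
  let ?l = "lagrange_poly {0..p - 1} real"
  have I: "finite {0..p - 1}" "inj_on real {0..p - 1}" "p - 1 < card {0..p - 1}" by auto
  define \<Psi>' where "\<Psi>' \<xi> = (?u \<xi> s1, ?v \<xi> s1 - ((s1 - s0) * \<omega> p) *\<^sub>R
      ((\<Sum>j\<in>{0..p - 1}. poly (pderiv (?l j)) s1 *\<^sub>R ?v \<xi> (real j)) - A p (?u \<xi> s1)))" for \<xi>
  have \<Psi>'_eq: "\<Psi>' \<xi> = (?u \<xi> s1, ?v \<xi> s1 - ((s1 - s0) * \<omega> p) *\<^sub>R (vector_derivative (?v \<xi>) (at s1) - A p (?u \<xi> s1)))"
    if "\<xi> \<in> S \<times> S" for \<xi>
    using vector_derivative_lagrange[OF _ I, of S "?v \<xi>" s1] var[OF that] unfolding \<Psi>'_def by simp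
  have "sform (\<Psi>' \<xi>) (\<Psi>' \<eta>) = sform \<xi> \<eta>" if "\<xi> \<in> S \<times> S" "\<eta> \<in> S \<times> S" for \<xi> \<eta>
    unfolding \<Psi>'_eq[OF that(1)] \<Psi>'_eq[OF that(2)] using var[OF that(1)] var[OF that(2)] A(2)
    by (intro lobatto_sform_invariant[OF p _ _ _ _ _ _ _ _ \<tau>_def \<omega>_def]) auto
  moreover have "(\<Psi> has_derivative \<Psi>') (at y within D)"
  proof (rule has_derivative_transform[OF y])
    show "\<Psi> y' = (fst (Q y' s1), snd (Q y' s1) - ((s1 - s0) * \<omega> p) *\<^sub>R
        ((\<Sum>j\<in>{0..p - 1}. poly (pderiv (?l j)) s1 *\<^sub>R snd (Q y' (real j))) - k (fst (Q y' s1)) s1))" if "y' \<in> D" for y'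
      using vector_derivative_lagrange[OF st(2)[OF that] I, of s1] st(4,7)[OF that] by (simp add: prod_eq_iff)
    have "(\<lambda>y'. fst (Q y' s1)) ` D \<subseteq> S" using S_mem[OF st(1)] by auto
    from has_derivative_in_compose[OF has_derivative_fst[OF L[of s1]] has_derivative_subset[OF A(1)[of p, unfolded \<tau>p] this]]
    have dk: "((\<lambda>y'. k (fst (Q y' s1)) s1) has_derivative (\<lambda>\<xi>. A p (?u \<xi> s1))) (at y within D)" by simp
    show "((\<lambda>y'. (fst (Q y' s1), snd (Q y' s1) - ((s1 - s0) * \<omega> p) *\<^sub>R
        ((\<Sum>j\<in>{0..p - 1}. poly (pderiv (?l j)) s1 *\<^sub>R snd (Q y' (real j))) - k (fst (Q y' s1)) s1)))
        has_derivative \<Psi>') (at y within D)"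
      unfolding \<Psi>'_def
      by (intro has_derivative_Pair has_derivative_diff has_derivative_scaleR_right has_derivative_sum
          has_derivative_fst has_derivative_snd L dk)
  qed
  moreover have "\<Psi> y \<in> S \<times> S"
    using s by (intro lobatto_step_closed[OF R[OF y]] kS) auto
  ultimately show ?thesis using at_within_openin[OF D y] by auto
qed

end

section \<open>Fixed points of contractions that depend on a parameter\<close>

text \<open>A Lipschitz bound in one direction carries over to the derivative in this direction.\<close>
lemma has_derivative_norm_le:
  fixes f :: "'a::real_normed_vector \<Rightarrow> 'b::real_normed_vector"
  assumes f: "(f has_derivative f') (at x)" and r: "r > 0" and "C \<ge> 0"
    and C: "\<And>t. \<bar>t\<bar> < r \<Longrightarrow> norm (f (x + t *\<^sub>R h) - f x) \<le> C * norm (t *\<^sub>R h)"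
  shows "norm (f' h) \<le> C * norm h"
proof (cases "h = 0")
  case True
  then show ?thesis using linear_0[OF bounded_linear.linear[OF has_derivative_bounded_linear[OF f]]] by simp
next
  case False
  show ?thesis
  proof (rule field_le_epsilon)
    fix e :: real assume e: "e > 0"
    define e' where "e' = e / norm h"
    have e': "e' > 0" using e False by (simp add: e'_def)
    obtain d where d: "d > 0" "\<And>y. norm (y - x) < d \<Longrightarrow> norm (f y - f x - f' (y - x)) \<le> e' * norm (y - x)"
      using f e' unfolding has_derivative_at_alt by blast
    define t where "t = min (r / 2) (d / (2 * norm h))"
    have t: "t > 0" "\<bar>t\<bar> < r" "norm (t *\<^sub>R h) < d"
    proof -
      show "t > 0" using r d(1) False by (simp add: t_def)
      then show "\<bar>t\<bar> < r" using r by (simp add: t_def min_def split: if_splits)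
      have "t * norm h \<le> d / (2 * norm h) * norm h" using False by (intro mult_right_mono) (auto simp: t_def)
      then show "norm (t *\<^sub>R h) < d" using \<open>t > 0\<close> d(1) False by simp
    qed
    have "f' (t *\<^sub>R h) = t *\<^sub>R f' h" using linear_scale[OF bounded_linear.linear[OF has_derivative_bounded_linear[OF f]]] .
    then have "t * norm (f' h) = norm (f' (t *\<^sub>R h))" using t(1) by simp
    also have "\<dots> \<le> norm (f (x + t *\<^sub>R h) - f x) + norm (f (x + t *\<^sub>R h) - f x - f' (t *\<^sub>R h))"
      using norm_triangle_ineq4[of "f (x + t *\<^sub>R h) - f x" "f (x + t *\<^sub>R h) - f x - f' (t *\<^sub>R h)"] by simp
    also have "\<dots> \<le> C * norm (t *\<^sub>R h) + e' * norm (t *\<^sub>R h)"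
      using C[OF t(2)] d(2)[of "x + t *\<^sub>R h"] t(3) by (intro add_mono) auto
    also have "\<dots> = t * (C * norm h + e)" using t(1) False by (simp add: e'_def algebra_simps)
    finally show "norm (f' h) \<le> C * norm h + e" using t(1) by simp
  qed
qed

text \<open>The operator \<open>Z\<close> is the inverse of the identity minus \<open>A\<close>; its values are fixed points.\<close>
lemma linear_contraction_inverse:
  fixes A :: "'x::{real_normed_vector,complete_space} \<Rightarrow> 'x"
  assumes A: "linear A" and C: "\<And>z. norm (A z) \<le> 1/2 * norm z"
  obtains Z where "bounded_linear Z" "\<And>b. Z b = A (Z b) + b"
proof -
  have "\<exists>!z\<in>UNIV. A z + b = z" for b
  proof (rule Banach_fix[of UNIV "1/2"])
    show "dist (A x + b) (A y + b) \<le> 1/2 * dist x y" for x y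
      using C[of "x - y"] linear_diff[OF A, of x y] by (simp add: dist_norm)
  qed (auto simp: complete_UNIV)
  then have ex: "\<exists>!z. A z + b = z" for b by simp
  define Z where "Z b = (THE z. A z + b = z)" for b
  have Z: "A (Z b) + b = Z b" for b unfolding Z_def by (rule theI'[OF ex])
  have uniq: "z = Z b" if "A z + b = z" for z b using ex[of b] Z[of b] that by blast
  have "bounded_linear Z"
  proof (rule bounded_linear_intro)
    show "Z (a + b) = Z a + Z b" for a b
    proof (rule uniq[symmetric])
      have "A (Z a + Z b) + (a + b) = (A (Z a) + a) + (A (Z b) + b)" by (simp add: linear_add[OF A])
      then show "A (Z a + Z b) + (a + b) = Z a + Z b" by (simp only: Z)
    qed
    show "Z (r *\<^sub>R a) = r *\<^sub>R Z a" for r a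
    proof (rule uniq[symmetric])
      have "A (r *\<^sub>R Z a) + r *\<^sub>R a = r *\<^sub>R (A (Z a) + a)" by (simp add: linear_scale[OF A] scaleR_add_right)
      then show "A (r *\<^sub>R Z a) + r *\<^sub>R a = r *\<^sub>R Z a" by (simp only: Z)
    qed
    show "norm (Z b) \<le> norm b * 2" for b
      using norm_triangle_ineq[of "A (Z b)" b] C[of "Z b"] Z[of b] by simp
  qed
  then show thesis using that Z by metis
qed

text \<open>Banach's theorem gives the fixed points. They depend on the parameter in a Lipschitz manner, and
  the expansion of \<open>\<Phi>\<close> at a fixed point then shows that the derivative of \<open>X\<close> in direction \<open>\<eta>\<close>
  solves $L\eta = \partial_y\Phi\,\eta + \partial_x\Phi\,L\eta$, where the partial derivative
  $\partial_x\Phi$ has norm at most $1/2$. The contraction property is needed on a ball larger than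
  the one that contains the fixed points, to bound this derivative at its boundary.\<close>
lemma parametrized_fixed_point:
  fixes \<Phi> :: "'p::real_normed_vector \<Rightarrow> 'x::{real_normed_vector,complete_space} \<Rightarrow> 'x"
  assumes P: "open P" and B: "B \<ge> 0"
    and maps: "\<And>y x. y \<in> P \<Longrightarrow> norm x \<le> B + 1 \<Longrightarrow> norm (\<Phi> y x) \<le> B"
    and contr: "\<And>y x x'. y \<in> P \<Longrightarrow> norm x \<le> B + 1 \<Longrightarrow> norm x' \<le> B + 1 \<Longrightarrow> norm (\<Phi> y x - \<Phi> y x') \<le> 1/2 * norm (x - x')"
    and diff: "\<And>y x. y \<in> P \<Longrightarrow> norm x \<le> B \<Longrightarrow> (\<lambda>p. \<Phi> (fst p) (snd p)) differentiable (at (y, x))"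
  shows "\<exists>X. \<forall>y\<in>P. norm (X y) \<le> B \<and> \<Phi> y (X y) = X y \<and> X differentiable (at y)"
proof -
  have "\<exists>!x\<in>cball 0 B. \<Phi> y x = x" if y: "y \<in> P" for y
  proof (rule Banach_fix)
    show "dist (\<Phi> y x) (\<Phi> y x') \<le> 1/2 * dist x x'" if "x \<in> cball 0 B" "x' \<in> cball 0 B" for x x'
      using contr[OF y, of x x'] that by (simp add: dist_norm)
    show "\<Phi> y ` cball 0 B \<subseteq> cball 0 B" using maps[OF y] by auto
  qed (use B in \<open>auto simp: complete_eq_closed\<close>)
  then have "\<forall>y\<in>P. \<exists>x. norm x \<le> B \<and> \<Phi> y x = x" by (metis mem_cball_0)
  then obtain X where X: "\<And>y. y \<in> P \<Longrightarrow> norm (X y) \<le> B" "\<And>y. y \<in> P \<Longrightarrow> \<Phi> y (X y) = X y"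
    by metis
  have "X differentiable (at y)" if y: "y \<in> P" for y
  proof -
    let ?x = "X y"
    obtain D where D: "((\<lambda>p. \<Phi> (fst p) (snd p)) has_derivative D) (at (y, ?x))"
      using diff[OF y X(1)[OF y]] unfolding differentiable_def by blast
    have bD: "bounded_linear D" using D by (rule has_derivative_bounded_linear)
    then have lD: "linear D" by (rule bounded_linear.linear)
    obtain K where K: "K \<ge> 0" "\<And>p. norm (D p) \<le> norm p * K" using bounded_linear.nonneg_bounded[OF bD] by blast
    define A where "A = (\<lambda>z. D (0, z))"
    have lA: "linear A"
      using linear_compose[of "\<lambda>z. (0, z)" D] lD by (simp add: A_def o_def linear_iff)
    have A: "norm (A z) \<le> 1/2 * norm z" for z
    proof (cases "z = 0")
      case False
      have "norm (D (0, z)) \<le> 1/2 * norm (0 :: 'p, z)"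
      proof (rule has_derivative_norm_le[OF D])
        show "0 < 1 / norm z" using False by simp
        fix t :: real assume "\<bar>t\<bar> < 1 / norm z"
        then have t: "\<bar>t\<bar> * norm z \<le> 1" using False by (simp add: field_simps)
        then have "norm (?x + t *\<^sub>R z) \<le> B + 1"
          using norm_triangle_ineq[of ?x "t *\<^sub>R z"] X(1)[OF y] by simp
        then show "norm (\<Phi> (fst ((y, ?x) + t *\<^sub>R (0, z))) (snd ((y, ?x) + t *\<^sub>R (0, z))) - \<Phi> (fst (y, ?x)) (snd (y, ?x)))
            \<le> 1/2 * norm (t *\<^sub>R (0 :: 'p, z))"
          using contr[OF y, of "?x + t *\<^sub>R z" ?x] X(1)[OF y] by (simp add: norm_Pair)
      qed simp
      then show ?thesis by (simp add: A_def norm_Pair)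
    qed (simp add: linear_0[OF lA])
    obtain Z where Z: "bounded_linear Z" "\<And>b. Z b = A (Z b) + b"
      using linear_contraction_inverse[OF lA A] by metis
    define L where "L = (\<lambda>\<eta>. Z (D (\<eta>, 0)))"
    have "bounded_linear (\<lambda>\<eta> :: 'p. (\<eta>, 0 :: 'x))"
      by (intro bounded_linear_Pair bounded_linear_ident bounded_linear_zero)
    then have bL: "bounded_linear L"
      unfolding L_def using bounded_linear_compose[OF Z(1) bounded_linear_compose[OF bD]] by blast
    have D_split: "D (a, b) = D (a, 0) + A b" for a b
      using linear_add[OF lD, of "(a, 0)" "(0, b)"] by (simp add: A_def)
    \<comment> \<open>a Lipschitz estimate for the fixed point\<close>
    obtain d1 where d1: "d1 > 0" "\<And>p. norm (p - (y, ?x)) < d1 \<Longrightarrow>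
        norm (\<Phi> (fst p) (snd p) - \<Phi> y ?x - D (p - (y, ?x))) \<le> 1 * norm (p - (y, ?x))"
      using D zero_less_one unfolding has_derivative_at_alt fst_conv snd_conv by blast
    have lip: "norm (X y' - ?x) \<le> 2 * (K + 1) * norm (y' - y)" if y': "y' \<in> P" "norm (y' - y) < d1" for y'
    proof -
      have "norm (\<Phi> y' ?x - \<Phi> y ?x) \<le> norm (\<Phi> y' ?x - \<Phi> y ?x - D (y' - y, 0)) + norm (D (y' - y, 0))"
        using norm_triangle_ineq[of "\<Phi> y' ?x - \<Phi> y ?x - D (y' - y, 0)" "D (y' - y, 0)"] by simp
      also have "\<dots> \<le> norm (y' - y) + norm (y' - y) * K"
        using d1(2)[of "(y', ?x)"] K(2)[of "(y' - y, 0)"] y' by (intro add_mono) (auto simp: norm_Pair)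
      finally have 1: "norm (\<Phi> y' ?x - \<Phi> y ?x) \<le> (K + 1) * norm (y' - y)" by (simp add: algebra_simps)
      have "X y' - ?x = (\<Phi> y' (X y') - \<Phi> y' ?x) + (\<Phi> y' ?x - \<Phi> y ?x)" using X(2)[OF y] X(2)[OF y'(1)] by simp
      then have "norm (X y' - ?x) \<le> norm (\<Phi> y' (X y') - \<Phi> y' ?x) + norm (\<Phi> y' ?x - \<Phi> y ?x)"
        by (metis norm_triangle_ineq)
      also have "norm (\<Phi> y' (X y') - \<Phi> y' ?x) \<le> 1/2 * norm (X y' - ?x)"
        using contr[OF y'(1), of "X y'" ?x] X(1)[OF y] X(1)[OF y'(1)] by simp
      finally show ?thesis using 1 by (simp add: algebra_simps)
    qed
    define M where "M = 1 + 2 * (K + 1)"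
    have M: "M > 0" using K(1) by (simp add: M_def)
    have "(X has_derivative L) (at y)"
      unfolding has_derivative_at_alt
    proof (intro conjI allI impI bL)
      fix e :: real assume e: "e > 0"
      define e' where "e' = e / (2 * M)"
      have e': "e' > 0" using e M by (simp add: e'_def)
      obtain d2 where d2: "d2 > 0" "\<And>p. norm (p - (y, ?x)) < d2 \<Longrightarrow>
          norm (\<Phi> (fst p) (snd p) - \<Phi> y ?x - D (p - (y, ?x))) \<le> e' * norm (p - (y, ?x))"
        using D e' unfolding has_derivative_at_alt fst_conv snd_conv by blast
      obtain d3 where d3: "d3 > 0" "ball y d3 \<subseteq> P" using P y open_contains_ball by blast
      define d where "d = min (min d1 d3) (d2 / M)"
      show "\<exists>d>0. \<forall>y'. norm (y' - y) < d \<longrightarrow> norm (X y' - X y - L (y' - y)) \<le> e * norm (y' - y)"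
      proof (intro exI conjI allI impI)
        show "d > 0" using d1 d2 d3 M by (simp add: d_def)
        fix y' assume y': "norm (y' - y) < d"
        have y'P: "y' \<in> P" using y' d3 by (auto simp: d_def dist_norm norm_minus_commute)
        let ?\<Delta> = "X y' - ?x" and ?\<eta> = "y' - y"
        have "norm (?\<eta>, ?\<Delta>) \<le> norm ?\<eta> + norm ?\<Delta>" using norm_Pair_le by blast
        also have "\<dots> \<le> M * norm ?\<eta>" using lip[OF y'P] y' by (simp add: d_def M_def algebra_simps)
        finally have n: "norm (?\<eta>, ?\<Delta>) \<le> M * norm ?\<eta>" .
        also have "\<dots> < d2" using y' M by (simp add: d_def field_simps)
        finally have n2: "norm ((y', X y') - (y, ?x)) < d2" by simp
        define R where "R = ?\<Delta> - D (?\<eta>, ?\<Delta>)"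
        have "norm R \<le> e' * norm (?\<eta>, ?\<Delta>)"
          using d2(2)[OF n2] X(2)[OF y] X(2)[OF y'P] by (simp add: R_def)
        also have "\<dots> \<le> e' * (M * norm ?\<eta>)" using n e' by (intro mult_left_mono) auto
        finally have R: "norm R \<le> e / 2 * norm ?\<eta>" using M by (simp add: e'_def)
        have "A (L ?\<eta>) = L ?\<eta> - D (?\<eta>, 0)"
          unfolding L_def using Z(2)[of "D (?\<eta>, 0)"] by (metis add_diff_cancel_right')
        then have "?\<Delta> - L ?\<eta> = A (?\<Delta> - L ?\<eta>) + R"
          unfolding R_def D_split[of ?\<eta> ?\<Delta>] linear_diff[OF lA, of ?\<Delta>] by simp
        then have "norm (?\<Delta> - L ?\<eta>) \<le> norm (A (?\<Delta> - L ?\<eta>)) + norm R" by (metis norm_triangle_ineq)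
        then show "norm (X y' - X y - L (y' - y)) \<le> e * norm (y' - y)"
          using A[of "?\<Delta> - L ?\<eta>"] R by simp
      qed
    qed
    then show ?thesis unfolding differentiable_def by blast
  qed
  then show ?thesis using X by blast
qed

section \<open>Solvability of the stage equations\<close>

text \<open>A finite family of stages is encoded as one element of a Banach space, a bounded continuous
  function whose value at the integer \<open>l\<close> is the stage \<open>l\<close>. The hat functions have disjoint
  supports, so the norm of the sum is the maximum of the norms of the stages.\<close>
definition stage_embed :: "nat \<Rightarrow> 'v::real_normed_vector \<Rightarrow> (real \<Rightarrow>\<^sub>C 'v)" where
  "stage_embed l v = Bcontfun (\<lambda>x. max 0 (1 - 2 * \<bar>x - real l\<bar>) *\<^sub>R v)"

lemma apply_stage_embed: "apply_bcontfun (stage_embed l v) x = max 0 (1 - 2 * \<bar>x - real l\<bar>) *\<^sub>R v"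
proof -
  have "(\<lambda>x. max 0 (1 - 2 * \<bar>x - real l\<bar>) *\<^sub>R v) \<in> bcontfun"
  proof (rule bcontfun_normI)
    show "norm (max 0 (1 - 2 * \<bar>x - real l\<bar>) *\<^sub>R v) \<le> 1 * norm v" for x
      unfolding norm_scaleR by (intro mult_right_mono) auto
  qed (intro continuous_intros)
  then show ?thesis by (simp add: stage_embed_def Bcontfun_inverse)
qed

lemma norm_sum_stage_embed:
  assumes I: "finite I" and b: "b \<ge> 0" "\<And>l. l \<in> I \<Longrightarrow> norm (f l) \<le> b"
  shows "norm (\<Sum>l\<in>I. stage_embed l (f l)) \<le> b"
proof (rule norm_bound)
  fix x :: real
  have eval: "apply_bcontfun (\<Sum>l\<in>I. stage_embed l (f l)) x = (\<Sum>l\<in>I. max 0 (1 - 2 * \<bar>x - real l\<bar>) *\<^sub>R f l)"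
    using I by (induction I rule: finite_induct) (auto simp: apply_stage_embed)
  show "norm (apply_bcontfun (\<Sum>l\<in>I. stage_embed l (f l)) x) \<le> b"
  proof (cases "\<exists>l\<in>I. \<bar>x - real l\<bar> < 1/2")
    case True
    then obtain l where l: "l \<in> I" "\<bar>x - real l\<bar> < 1/2" by blast
    have "max 0 (1 - 2 * \<bar>x - real i\<bar>) *\<^sub>R f i = 0" if "i \<in> I - {l}" for i
    proof -
      have "\<bar>real i - real l\<bar> \<ge> 1" using that by (cases "i < l") auto
      then have "\<bar>x - real i\<bar> \<ge> 1/2" using l(2) by linarith
      then show ?thesis by simp
    qed
    then have "(\<Sum>i\<in>I - {l}. max 0 (1 - 2 * \<bar>x - real i\<bar>) *\<^sub>R f i) = 0" by (intro sum.neutral) blast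
    then have "(\<Sum>i\<in>I. max 0 (1 - 2 * \<bar>x - real i\<bar>) *\<^sub>R f i) = max 0 (1 - 2 * \<bar>x - real l\<bar>) *\<^sub>R f l"
      using sum.remove[OF I l(1), of "\<lambda>i. max 0 (1 - 2 * \<bar>x - real i\<bar>) *\<^sub>R f i"] by simp
    moreover have "max 0 (1 - 2 * \<bar>x - real l\<bar>) * norm (f l) \<le> 1 * b" using b l(1) by (intro mult_mono) auto
    ultimately show ?thesis unfolding eval by simp
  next
    case False
    then have "max 0 (1 - 2 * \<bar>x - real i\<bar>) = 0" if "i \<in> I" for i using that by fastforce
    then show ?thesis unfolding eval using b(1) by simp
  qed
qed

lemma bounded_linear_stage_embed: "bounded_linear (stage_embed l)"
proof (rule bounded_linear_intro[where K = 1])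
  show "norm (stage_embed l v) \<le> norm v * 1" for v :: 'a
    using norm_sum_stage_embed[of "{l}" "norm v" "\<lambda>_. v"] by simp
qed (auto intro!: bcontfun_eqI simp: apply_stage_embed scaleR_add_right)

lemma bounded_linear_stage: "bounded_linear (\<lambda>K :: real \<Rightarrow>\<^sub>C 'v::real_normed_vector. apply_bcontfun K x)"
  by (rule bounded_linear_intro[where K = 1]) (auto simp: norm_bounded)

lemma apply_sum_stage_embed:
  assumes "finite I" "i \<in> I"
  shows "apply_bcontfun (\<Sum>l\<in>I. stage_embed l (f l)) (real i) = f i"
proof -
  have "apply_bcontfun (\<Sum>l\<in>I. stage_embed l (f l)) (real i) = (\<Sum>l\<in>I. apply_bcontfun (stage_embed l (f l)) (real i))"
    using bounded_linear.linear[OF bounded_linear_stage] by (rule linear_sum)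
  also have "\<dots> = (\<Sum>l\<in>I. if i = l then f l else 0)"
  proof (rule sum.cong)
    fix l
    have "1 - 2 * \<bar>real i - real l\<bar> \<le> 0" if "i \<noteq> l" using that by (cases "i < l") auto
    then show "apply_bcontfun (stage_embed l (f l)) (real i) = (if i = l then f l else 0)"
      by (auto simp: apply_stage_embed)
  qed simp
  finally show ?thesis using assms by (simp add: sum.delta)
qed

text \<open>Because of the factor $h^2$ the stage equations are a contraction on a ball for small \<open>h\<close>. The
  bound on \<open>h\<close> is the same for all times \<open>s0\<close> and all states near \<open>y\<close>, as the bounds on \<open>k\<close> are
  uniform in time.\<close>
lemma stage_equations_solvable:
  fixes k :: "'v::{real_normed_vector,complete_space} \<Rightarrow> real \<Rightarrow> 'v" and y :: "'v \<times> 'v"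
  assumes I: "finite (I :: nat set)" and c: "\<And>l. l \<in> I \<Longrightarrow> 0 \<le> c l \<and> c l \<le> 1"
    and diff: "\<And>x s. s \<in> J \<Longrightarrow> (\<lambda>x. k x s) differentiable (at x)"
    and lip: "\<And>\<rho>. \<exists>C\<ge>0. \<forall>s\<in>J. \<forall>x x'. norm x \<le> \<rho> \<longrightarrow> norm x' \<le> \<rho> \<longrightarrow>
      norm (k x s) \<le> C \<and> norm (k x s - k x' s) \<le> C * norm (x - x')"
  shows "\<exists>h0>0. \<forall>s0 s1. s0 < s1 \<and> {s0..s1} \<subseteq> J \<and> s1 - s0 < h0 \<longrightarrow>
    (\<exists>K. \<forall>y'\<in>ball y 1. \<forall>l\<in>I. (\<lambda>y'. K y' l) differentiable (at y') \<and>
      K y' l = k (fst y' + (c l * (s1 - s0)) *\<^sub>R snd y' + (\<Sum>m\<in>I. ((s1 - s0)\<^sup>2 * \<beta> l m) *\<^sub>R K y' m)) (s0 + c l * (s1 - s0)))"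
proof -
  define \<rho>0 where "\<rho>0 = norm y + 1"
  have \<rho>0: "norm (fst y') \<le> \<rho>0 \<and> norm (snd y') \<le> \<rho>0" if "y' \<in> ball y 1" for y'
  proof -
    have "norm y' \<le> norm y + norm (y' - y)" using norm_triangle_ineq[of y "y' - y"] by simp
    then have "norm y' \<le> \<rho>0" using that by (simp add: \<rho>0_def dist_norm norm_minus_commute)
    then show ?thesis using norm_fst_le[of "fst y'" "snd y'"] norm_snd_le[of "snd y'" "fst y'"] by simp
  qed
  obtain C where C: "C \<ge> 0" "\<And>s x x'. s \<in> J \<Longrightarrow> norm x \<le> \<rho>0 + 2 \<Longrightarrow> norm x' \<le> \<rho>0 + 2 \<Longrightarrow>
      norm (k x s) \<le> C \<and> norm (k x s - k x' s) \<le> C * norm (x - x')"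
    using lip[of "\<rho>0 + 2"] by blast
  define b where "b = (\<Sum>l\<in>I. \<Sum>m\<in>I. \<bar>\<beta> l m\<bar>)"
  have b0: "b \<ge> 0" unfolding b_def by (intro sum_nonneg) auto
  have b: "(\<Sum>m\<in>I. \<bar>\<beta> l m\<bar>) \<le> b" if "l \<in> I" for l
    unfolding b_def using I that by (intro member_le_sum[of l I "\<lambda>l. \<Sum>m\<in>I. \<bar>\<beta> l m\<bar>"]) (auto intro: sum_nonneg)
  \<comment> \<open>for \<open>h \<le> 1 / q\<close> the stage arguments stay in the ball of radius \<open>\<rho>0 + 2\<close>, and the
    Lipschitz constant \<open>h\<^sup>2 * b * C\<close> of the equations is at most one half\<close>
  define q where "q = \<rho>0 + 2 * (b * (C + 1)) + 1"
  have q: "q \<ge> 1" "\<rho>0 \<le> q" "2 * (b * (C + 1)) \<le> q" using b0 C(1) by (auto simp: q_def \<rho>0_def)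
  show ?thesis
  proof (intro exI[of _ "1 / q"] conjI allI impI)
    show "1 / q > 0" using q by simp
    fix s0 s1 :: real assume s: "s0 < s1 \<and> {s0..s1} \<subseteq> J \<and> s1 - s0 < 1 / q"
    define h where "h = s1 - s0"
    have h: "h > 0" "h * q \<le> 1" using s q by (auto simp: h_def field_simps)
    have "h * 1 \<le> h * q" using h q by (intro mult_left_mono) auto
    then have h1: "h \<le> 1" using h(2) by linarith
    have "h * \<rho>0 \<le> h * q" using h q by (intro mult_left_mono) auto
    then have h\<rho>: "h * \<rho>0 \<le> 1" using h(2) by linarith
    have "h\<^sup>2 \<le> h" using h h1 by (simp add: power2_eq_square mult_le_one)
    then have "h\<^sup>2 * (2 * (b * (C + 1))) \<le> h * (2 * (b * (C + 1)))" using b0 C(1) by (intro mult_right_mono) auto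
    also have "\<dots> \<le> h * q" using q(3) h by (intro mult_left_mono) auto
    also note h(2)
    finally have "h\<^sup>2 * (2 * (b * (C + 1))) \<le> 1" .
    moreover have "h\<^sup>2 * (2 * (b * (C + 1))) = 2 * (h\<^sup>2 * b * (C + 1))" by (simp only: mult_ac)
    ultimately have hb: "h\<^sup>2 * b * (C + 1) \<le> 1/2" by linarith
    have "h\<^sup>2 * b * C \<le> h\<^sup>2 * b * (C + 1)" using b0 by (intro mult_left_mono) auto
    then have hbC: "h\<^sup>2 * b * C \<le> 1/2" using hb by simp
    define arg where "arg l y' K = fst y' + (c l * h) *\<^sub>R snd y' + (\<Sum>m\<in>I. (h\<^sup>2 * \<beta> l m) *\<^sub>R apply_bcontfun K (real m))"
      for l and y' :: "'v \<times> 'v" and K :: "real \<Rightarrow>\<^sub>C 'v"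
    have sumK: "norm (\<Sum>m\<in>I. (h\<^sup>2 * \<beta> l m) *\<^sub>R apply_bcontfun K (real m)) \<le> h\<^sup>2 * b * norm K" if l: "l \<in> I" for l and K :: "real \<Rightarrow>\<^sub>C 'v"
    proof -
      have "norm (\<Sum>m\<in>I. (h\<^sup>2 * \<beta> l m) *\<^sub>R apply_bcontfun K (real m)) \<le> (\<Sum>m\<in>I. h\<^sup>2 * \<bar>\<beta> l m\<bar> * norm K)"
        by (intro order_trans[OF norm_sum] sum_mono) (auto simp: abs_mult intro!: mult_left_mono norm_bounded)
      also have "\<dots> = h\<^sup>2 * (\<Sum>m\<in>I. \<bar>\<beta> l m\<bar>) * norm K" by (simp add: sum_distrib_left sum_distrib_right mult_ac)
      also have "\<dots> \<le> h\<^sup>2 * b * norm K" using b[OF l] by (intro mult_right_mono mult_left_mono) auto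
      finally show ?thesis .
    qed
    have arg_norm: "norm (arg l y' K) \<le> \<rho>0 + 2" if y': "y' \<in> ball y 1" and K: "norm K \<le> C + 1" and l: "l \<in> I" for l y' K
    proof -
      have "c l * norm (snd y') \<le> 1 * \<rho>0" using c[OF l] \<rho>0[OF y'] by (intro mult_mono) auto
      then have "h * (c l * norm (snd y')) \<le> h * \<rho>0" using h by (intro mult_left_mono) auto
      then have "norm ((c l * h) *\<^sub>R snd y') \<le> h * \<rho>0" using c[OF l] h by (simp add: abs_mult mult_ac)
      moreover have "h\<^sup>2 * b * norm K \<le> h\<^sup>2 * b * (C + 1)" using K b0 by (intro mult_left_mono) auto
      ultimately show ?thesis unfolding arg_def
        using \<rho>0[OF y'] sumK[OF l, of K] h\<rho> hb
        by (intro order_trans[OF norm_triangle_ineq] order_trans[OF add_mono[OF norm_triangle_ineq order_refl]]) linarith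
    qed
    define \<Phi> where "\<Phi> y' K = (\<Sum>l\<in>I. stage_embed l (k (arg l y' K) (s0 + c l * h)))" for y' K
    have \<tau>: "s0 + c l * h \<in> J" if "l \<in> I" for l
      using slab_node_mem[of s0 s1 "c l"] c[OF that] s by (auto simp: h_def)
    have "\<exists>X. \<forall>y'\<in>ball y 1. norm (X y') \<le> C \<and> \<Phi> y' (X y') = X y' \<and> X differentiable (at y')"
    proof (rule parametrized_fixed_point[where \<Phi> = \<Phi>])
      show "norm (\<Phi> y' K) \<le> C" if "y' \<in> ball y 1" "norm K \<le> C + 1" for y' K
        unfolding \<Phi>_def using C(2)[OF \<tau> arg_norm[OF that] arg_norm[OF that]] C(1)
        by (intro norm_sum_stage_embed I) auto
      show "norm (\<Phi> y' K - \<Phi> y' K') \<le> 1/2 * norm (K - K')"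
        if y': "y' \<in> ball y 1" "norm K \<le> C + 1" "norm K' \<le> C + 1" for y' K K'
      proof -
        have "\<Phi> y' K - \<Phi> y' K' = (\<Sum>i\<in>I. stage_embed i (k (arg i y' K) (s0 + c i * h) - k (arg i y' K') (s0 + c i * h)))"
          unfolding \<Phi>_def sum_subtractf[symmetric]
          by (simp add: linear_diff[OF bounded_linear.linear[OF bounded_linear_stage_embed]])
        also have "norm \<dots> \<le> 1/2 * norm (K - K')"
        proof (intro norm_sum_stage_embed I)
          fix i assume i: "i \<in> I"
          have "norm (k (arg i y' K) (s0 + c i * h) - k (arg i y' K') (s0 + c i * h)) \<le> C * norm (arg i y' K - arg i y' K')"
            using C(2)[OF \<tau>[OF i] arg_norm[OF y'(1,2) i] arg_norm[OF y'(1,3) i]] by simp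
          also have "arg i y' K - arg i y' K' = (\<Sum>m\<in>I. (h\<^sup>2 * \<beta> i m) *\<^sub>R apply_bcontfun (K - K') (real m))"
            by (simp add: arg_def scaleR_diff_right sum_subtractf)
          also have "C * norm (\<Sum>m\<in>I. (h\<^sup>2 * \<beta> i m) *\<^sub>R apply_bcontfun (K - K') (real m)) \<le> C * (h\<^sup>2 * b * norm (K - K'))"
            using C(1) by (intro mult_left_mono sumK[OF i])
          also have "\<dots> = h\<^sup>2 * b * C * norm (K - K')" by simp
          also have "\<dots> \<le> 1/2 * norm (K - K')" using hbC by (intro mult_right_mono) auto
          finally show "norm (k (arg i y' K) (s0 + c i * h) - k (arg i y' K') (s0 + c i * h)) \<le> 1/2 * norm (K - K')" .
        qed simp
        finally show ?thesis .
      qed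
      show "(\<lambda>p. \<Phi> (fst p) (snd p)) differentiable (at (y', K))" if "y' \<in> ball y 1" for y' K
        unfolding \<Phi>_def
      proof (intro differentiable_sum I ballI)
        fix l assume l: "l \<in> I"
        have a: "(\<lambda>p. arg l (fst p) (snd p)) differentiable (at (y', K))"
          unfolding arg_def
        proof (intro differentiable_add differentiable_sum I bounded_linear_imp_differentiable ballI)
          show "bounded_linear (\<lambda>p :: ('v \<times> 'v) \<times> (real \<Rightarrow>\<^sub>C 'v). fst (fst p))"
            by (intro bounded_linear_fst_comp bounded_linear_fst)
          show "bounded_linear (\<lambda>p :: ('v \<times> 'v) \<times> (real \<Rightarrow>\<^sub>C 'v). (c l * h) *\<^sub>R snd (fst p))"
            by (intro bounded_linear_compose[OF bounded_linear_scaleR_right] bounded_linear_snd_comp bounded_linear_fst)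
          show "bounded_linear (\<lambda>p :: ('v \<times> 'v) \<times> (real \<Rightarrow>\<^sub>C 'v). (h\<^sup>2 * \<beta> l m) *\<^sub>R apply_bcontfun (snd p) (real m))" for m
            by (intro bounded_linear_compose[OF bounded_linear_scaleR_right]
              bounded_linear_compose[OF bounded_linear_stage] bounded_linear_snd)
        qed
        have "((\<lambda>x. k x (s0 + c l * h)) \<circ> (\<lambda>p. arg l (fst p) (snd p))) differentiable (at (y', K))"
          by (rule differentiable_chain_at[OF a diff[OF \<tau>[OF l]]])
        from differentiable_chain_at[OF this bounded_linear_imp_differentiable[OF bounded_linear_stage_embed]]
        show "(\<lambda>p. stage_embed l (k (arg l (fst p) (snd p)) (s0 + c l * h))) differentiable (at (y', K))"
          by (simp add: o_def)
      qed
    qed (use C in auto)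
    then obtain X where X: "\<And>y'. y' \<in> ball y 1 \<Longrightarrow> \<Phi> y' (X y') = X y'" "\<And>y'. y' \<in> ball y 1 \<Longrightarrow> X differentiable (at y')"
      by blast
    show "\<exists>K. \<forall>y'\<in>ball y 1. \<forall>l\<in>I. (\<lambda>y'. K y' l) differentiable (at y') \<and>
      K y' l = k (fst y' + (c l * (s1 - s0)) *\<^sub>R snd y' + (\<Sum>m\<in>I. ((s1 - s0)\<^sup>2 * \<beta> l m) *\<^sub>R K y' m)) (s0 + c l * (s1 - s0))"
    proof (intro exI[of _ "\<lambda>y' l. apply_bcontfun (X y') (real l)"] ballI conjI)
      fix y' l assume y': "y' \<in> ball y 1" and l: "l \<in> I"
      show "(\<lambda>y'. apply_bcontfun (X y') (real l)) differentiable (at y')"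
        using differentiable_chain_at[OF X(2)[OF y'] bounded_linear_imp_differentiable[OF bounded_linear_stage[of "real l"]]]
        by (simp add: o_def)
      have "apply_bcontfun (X y') (real l) = apply_bcontfun (\<Phi> y' (X y')) (real l)" using X(1)[OF y'] by simp
      also have "\<dots> = k (arg l y' (X y')) (s0 + c l * h)" using l by (simp add: \<Phi>_def apply_sum_stage_embed[OF I])
      finally show "apply_bcontfun (X y') (real l) = k (fst y' + (c l * (s1 - s0)) *\<^sub>R snd y' +
          (\<Sum>m\<in>I. ((s1 - s0)\<^sup>2 * \<beta> l m) *\<^sub>R apply_bcontfun (X y') (real m))) (s0 + c l * (s1 - s0))"
        by (simp add: arg_def h_def)
    qed
  qed
qed

section \<open>Existence of one-step maps\<close>

definition slab_poly :: "real \<Rightarrow> real \<Rightarrow> real poly \<Rightarrow> real poly" where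
  "slab_poly s0 h P = pcompose P [:- s0 / h, 1 / h:]"

lemma poly_slab_poly: "poly (slab_poly s0 h P) s = poly P ((s - s0) / h)"
  by (simp add: slab_poly_def poly_pcompose diff_divide_distrib)

lemma degree_slab_poly: "degree (slab_poly s0 h P) \<le> degree P"
  unfolding slab_poly_def by (rule order_trans[OF degree_pcompose_le]) auto

lemma poly_pderiv_slab_poly: "poly (pderiv (slab_poly s0 h P)) s = poly (pderiv P) ((s - s0) / h) / h"
  by (simp add: slab_poly_def pderiv_pcompose poly_pcompose pderiv_pCons diff_divide_distrib)

context galerkin_space
begin

definition stage_poly :: "nat set \<Rightarrow> (nat \<Rightarrow> real poly) \<Rightarrow> real \<Rightarrow> real \<Rightarrow> (nat \<Rightarrow> 'v) \<Rightarrow> real \<Rightarrow> 'v" where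
  "stage_poly I \<gamma> s0 h K s = (\<Sum>l\<in>I. poly (slab_poly s0 h (\<gamma> l)) s *\<^sub>R K l)"

lemma vec_poly_stage_poly:
  assumes "\<And>l. l \<in> I \<Longrightarrow> degree (\<gamma> l) \<le> m" "\<And>l. l \<in> I \<Longrightarrow> K l \<in> S"
  shows "vec_poly S m (stage_poly I \<gamma> s0 h K)"
  unfolding stage_poly_def[abs_def] using assms order_trans[OF degree_slab_poly]
  by (intro vec_poly_sum vec_poly_scaleR subspace) blast+

lemma stage_poly_derivative:
  "(stage_poly I \<gamma> s0 h K has_vector_derivative (1 / h) *\<^sub>R stage_poly I (\<lambda>l. pderiv (\<gamma> l)) s0 h K s) (at s)"
proof -
  have "((\<lambda>s. \<Sum>l\<in>I. poly (slab_poly s0 h (\<gamma> l)) s *\<^sub>R K l) has_vector_derivative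
      (\<Sum>l\<in>I. poly (pderiv (slab_poly s0 h (\<gamma> l))) s *\<^sub>R K l)) (at s)"
  proof (rule has_vector_derivative_sum)
    show "((\<lambda>s. poly (slab_poly s0 h (\<gamma> l)) s *\<^sub>R K l) has_vector_derivative
      poly (pderiv (slab_poly s0 h (\<gamma> l))) s *\<^sub>R K l) (at s)" for l
      using has_vector_derivative_scaleR[OF poly_DERIV[of "slab_poly s0 h (\<gamma> l)" s] has_vector_derivative_const[of "K l"]]
      by simp
  qed
  then show ?thesis
    by (simp add: stage_poly_def[abs_def] poly_pderiv_slab_poly poly_slab_poly scaleR_sum_right)
qed

text \<open>Both methods have steps of this form, with stages \<open>K l\<close> equal to the accelerations at the nodes: the factors
  $h$ and $h^2$ make the polynomials \<open>\<gamma>\<close> and \<open>\<beta>\<close> on $[0,1]$ independent of the step size, and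
  $\dot u = v$ holds where $\beta_l' = \gamma_l$.\<close>
definition stage_u :: "nat set \<Rightarrow> (nat \<Rightarrow> real poly) \<Rightarrow> real \<Rightarrow> real \<Rightarrow> 'v \<times> 'v \<Rightarrow> (nat \<Rightarrow> 'v) \<Rightarrow> real \<Rightarrow> 'v" where
  "stage_u I \<beta> s0 h y K s = fst y + poly [:- s0, 1:] s *\<^sub>R snd y + h\<^sup>2 *\<^sub>R stage_poly I \<beta> s0 h K s"

definition stage_v :: "nat set \<Rightarrow> (nat \<Rightarrow> real poly) \<Rightarrow> real \<Rightarrow> real \<Rightarrow> 'v \<times> 'v \<Rightarrow> (nat \<Rightarrow> 'v) \<Rightarrow> real \<Rightarrow> 'v" where
  "stage_v I \<gamma> s0 h y K s = snd y + h *\<^sub>R stage_poly I \<gamma> s0 h K s"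

lemma vec_poly_const_scaleR: "vec_poly S m q \<Longrightarrow> vec_poly S m (\<lambda>s. a *\<^sub>R q s)"
  unfolding vec_poly_def
  by (elim exE conjE, rule_tac x = "\<lambda>i. a *\<^sub>R aa i" in exI) (auto simp: scaleR_sum_right mult.commute subspace_scale[OF subspace])

lemma vec_poly_stage:
  assumes y: "y \<in> S \<times> S" and K: "\<And>l. l \<in> I \<Longrightarrow> K l \<in> S"
  shows "m \<ge> 1 \<Longrightarrow> (\<And>l. l \<in> I \<Longrightarrow> degree (\<beta> l) \<le> m) \<Longrightarrow> vec_poly S m (stage_u I \<beta> s0 h y K)"
    and "(\<And>l. l \<in> I \<Longrightarrow> degree (\<gamma> l) \<le> m) \<Longrightarrow> vec_poly S m (stage_v I \<gamma> s0 h y K)"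
proof -
  have y': "fst y \<in> S" "snd y \<in> S" using y by auto
  show "vec_poly S m (stage_u I \<beta> s0 h y K)" if "m \<ge> 1" "\<And>l. l \<in> I \<Longrightarrow> degree (\<beta> l) \<le> m"
    unfolding stage_u_def[abs_def] using that K y'
    by (intro vec_poly_add vec_poly_const vec_poly_scaleR vec_poly_const_scaleR vec_poly_stage_poly subspace) auto
  show "vec_poly S m (stage_v I \<gamma> s0 h y K)" if "\<And>l. l \<in> I \<Longrightarrow> degree (\<gamma> l) \<le> m"
    unfolding stage_v_def[abs_def] using that K y'
    by (intro vec_poly_add vec_poly_const vec_poly_const_scaleR vec_poly_stage_poly subspace) auto
qed

lemma stage_derivative:
  assumes "h \<noteq> 0"
  shows "(stage_u I \<beta> s0 h y K has_vector_derivative snd y + h *\<^sub>R stage_poly I (\<lambda>l. pderiv (\<beta> l)) s0 h K s) (at s)"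
    and "(stage_v I \<gamma> s0 h y K has_vector_derivative stage_poly I (\<lambda>l. pderiv (\<gamma> l)) s0 h K s) (at s)"
proof -
  have "((\<lambda>s. poly [:- s0, 1:] s *\<^sub>R snd y) has_vector_derivative snd y) (at s)"
    using has_vector_derivative_scaleR[OF poly_DERIV[of "[:- s0, 1:]" s] has_vector_derivative_const[of "snd y"]]
    by (simp add: pderiv_pCons)
  from has_vector_derivative_add[OF has_vector_derivative_add[OF has_vector_derivative_const[of "fst y"] this]
      bounded_linear.has_vector_derivative[OF bounded_linear_scaleR_right[of "h\<^sup>2"] stage_poly_derivative[of I \<beta> s0 h K s]]]
  show "(stage_u I \<beta> s0 h y K has_vector_derivative snd y + h *\<^sub>R stage_poly I (\<lambda>l. pderiv (\<beta> l)) s0 h K s) (at s)"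
    unfolding stage_u_def[abs_def] using assms by (simp add: power2_eq_square)
  from has_vector_derivative_add[OF has_vector_derivative_const[of "snd y"]
      bounded_linear.has_vector_derivative[OF bounded_linear_scaleR_right[of h] stage_poly_derivative[of I \<gamma> s0 h K s]]]
  show "(stage_v I \<gamma> s0 h y K has_vector_derivative stage_poly I (\<lambda>l. pderiv (\<gamma> l)) s0 h K s) (at s)"
    unfolding stage_v_def[abs_def] using assms by simp
qed

lemma stage_poly_node:
  assumes "h \<noteq> 0"
  shows "stage_poly I \<gamma> s0 h K (s0 + x * h) = (\<Sum>l\<in>I. poly (\<gamma> l) x *\<^sub>R K l)"
  using assms by (simp add: stage_poly_def poly_slab_poly)

lemma stage_differentiable:
  assumes I: "finite I" and K: "\<And>l. l \<in> I \<Longrightarrow> (\<lambda>y. K y l) differentiable (at y)"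
  shows "(\<lambda>y. (stage_u I \<beta> s0 h y (K y) s, stage_v I \<gamma> s0 h y (K y) s)) differentiable (at y within Y)"
proof -
  have b: "(\<lambda>y :: 'v \<times> 'v. fst y) differentiable (at y)" "(\<lambda>y :: 'v \<times> 'v. snd y) differentiable (at y)"
    by (auto intro!: bounded_linear_imp_differentiable bounded_linear_fst bounded_linear_snd)
  have sc: "(\<lambda>y. a *\<^sub>R f y) differentiable (at y)" if "f differentiable (at y)" for a and f :: "'v \<times> 'v \<Rightarrow> 'v"
    using that unfolding differentiable_def by (metis has_derivative_scaleR_right)
  have st: "(\<lambda>y. stage_poly I \<gamma> s0 h (K y) s) differentiable (at y)" for \<gamma>
    unfolding stage_poly_def using K by (intro differentiable_sum I sc) auto
  have u: "(\<lambda>y. stage_u I \<beta> s0 h y (K y) s) differentiable (at y)"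
    unfolding stage_u_def by (intro differentiable_add sc st b)
  have v: "(\<lambda>y. stage_v I \<gamma> s0 h y (K y) s) differentiable (at y)"
    unfolding stage_v_def by (intro differentiable_add sc st b)
  from u v have "(\<lambda>y. (stage_u I \<beta> s0 h y (K y) s, stage_v I \<gamma> s0 h y (K y) s)) differentiable (at y)"
    unfolding differentiable_def by (metis has_derivative_Pair)
  then show ?thesis by (rule differentiable_at_withinI)
qed

end

lemma antiderivative_from_zero:
  "\<exists>F :: real poly. pderiv F = f \<and> poly F 0 = 0 \<and> degree F \<le> Suc (degree f)"
proof -
  obtain G where G: "pderiv G = f" using poly_antiderivative by blast
  let ?F = "G - [:poly G 0:]"
  have "pderiv ?F = f" using G by (simp add: pderiv_diff pderiv_pCons)
  moreover have "degree ?F \<le> Suc (degree f)"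
    using degree_pderiv[of ?F] \<open>pderiv ?F = f\<close> by simp
  ultimately show ?thesis by (intro exI[of _ ?F]) simp
qed

text \<open>The acceleration \<open>k\<close> is determined on \<open>S\<close> only. Its extension \<open>kx\<close> to the whole Banach space, with
  values in \<open>S\<close>, makes derivatives and contractions meaningful on the type, and the stages lie in
  \<open>S\<close> all the same.\<close>
locale galerkin_flow = galerkin_space S M E
  for S :: "'v::{real_normed_vector,complete_space} set" and M E +
  fixes k :: "'v \<Rightarrow> real \<Rightarrow> 'v" and kx :: "'v \<Rightarrow> real \<Rightarrow> 'v" and J :: "real set"
  assumes kx_S: "s \<in> J \<Longrightarrow> kx x s \<in> S"
    and k_eq: "x \<in> S \<Longrightarrow> s \<in> J \<Longrightarrow> k x s = kx x s"
    and kx_diff: "s \<in> J \<Longrightarrow> (\<lambda>x. kx x s) differentiable (at x)"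
    and kx_lip: "\<exists>C\<ge>0. \<forall>s\<in>J. \<forall>x x'. norm x \<le> \<rho> \<longrightarrow> norm x' \<le> \<rho> \<longrightarrow>
      norm (kx x s) \<le> C \<and> norm (kx x s - kx x' s) \<le> C * norm (x - x')"
begin

text \<open>A method need only turn a solution of its stage equations into a step. The internal polynomials
  depend linearly on the initial value and the stages, and hence differentiably on the initial
  value.\<close>
lemma one_step_map_exists:
  assumes I: "finite I" and c: "\<And>l. l \<in> I \<Longrightarrow> 0 \<le> c l \<and> c l \<le> 1"
    and y: "y \<in> S \<times> S"
    and step: "\<And>s0 s1 y' K. s0 < s1 \<Longrightarrow> {s0..s1} \<subseteq> J \<Longrightarrow> y' \<in> S \<times> S \<Longrightarrow> (\<And>l. l \<in> I \<Longrightarrow> K l \<in> S) \<Longrightarrow>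
      (\<And>l. l \<in> I \<Longrightarrow> K l = k (stage_u I \<beta> s0 (s1 - s0) y' K (s0 + c l * (s1 - s0))) (s0 + c l * (s1 - s0))) \<Longrightarrow>
      \<exists>y1. R s0 s1 y' (\<lambda>s. (stage_u I \<beta> s0 (s1 - s0) y' K s, stage_v I \<gamma> s0 (s1 - s0) y' K s)) y1"
  shows "\<exists>h>0. \<exists>D. y \<in> D \<and> (\<forall>s0 s1. s0 < s1 \<and> {s0..s1} \<subseteq> J \<and> s1 - s0 < h \<longrightarrow>
    (\<exists>Q \<Psi>. one_step_map (S \<times> S) (R s0 s1) D Q \<Psi>))"
proof -
  let ?arg = "\<lambda>s0 s1 y' K l. fst y' + (c l * (s1 - s0)) *\<^sub>R snd y' + (\<Sum>m\<in>I. ((s1 - s0)\<^sup>2 * poly (\<beta> m) (c l)) *\<^sub>R K m)"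
  have "\<exists>h0>0. \<forall>s0 s1. s0 < s1 \<and> {s0..s1} \<subseteq> J \<and> s1 - s0 < h0 \<longrightarrow>
    (\<exists>K. \<forall>y'\<in>ball y 1. \<forall>l\<in>I. (\<lambda>y'. K y' l) differentiable (at y') \<and>
      K y' l = kx (?arg s0 s1 y' (K y') l) (s0 + c l * (s1 - s0)))"
    by (rule stage_equations_solvable[where \<beta> = "\<lambda>l m. poly (\<beta> m) (c l)"]) (use I c kx_diff kx_lip in auto)
  then obtain h0 where h0: "h0 > 0" "\<And>s0 s1. s0 < s1 \<and> {s0..s1} \<subseteq> J \<and> s1 - s0 < h0 \<Longrightarrow>
    \<exists>K. \<forall>y'\<in>ball y 1. \<forall>l\<in>I. (\<lambda>y'. K y' l) differentiable (at y') \<and>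
      K y' l = kx (?arg s0 s1 y' (K y') l) (s0 + c l * (s1 - s0))"
    by blast
  define D where "D = ball y 1 \<inter> (S \<times> S)"
  show ?thesis
  proof (intro exI[of _ h0] conjI exI[of _ D] allI impI)
    show "y \<in> D" using y by (simp add: D_def)
    fix s0 s1 assume s: "s0 < s1 \<and> {s0..s1} \<subseteq> J \<and> s1 - s0 < h0"
    let ?h = "s1 - s0"
    obtain K where K: "\<And>y' l. y' \<in> ball y 1 \<Longrightarrow> l \<in> I \<Longrightarrow> (\<lambda>y'. K y' l) differentiable (at y')"
      "\<And>y' l. y' \<in> ball y 1 \<Longrightarrow> l \<in> I \<Longrightarrow> K y' l = kx (?arg s0 s1 y' (K y') l) (s0 + c l * ?h)"
      using h0(2)[OF s] by blast
    define Q where "Q y' s = (stage_u I \<beta> s0 ?h y' (K y') s, stage_v I \<gamma> s0 ?h y' (K y') s)" for y' s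
    have \<tau>: "s0 + c l * ?h \<in> J" if "l \<in> I" for l
      using slab_node_mem[of s0 s1 "c l"] c[OF that] s by auto
    have "\<exists>y1. R s0 s1 y' (Q y') y1" if y': "y' \<in> D" for y'
    proof -
      have b: "y' \<in> ball y 1" "y' \<in> S \<times> S" using y' by (auto simp: D_def)
      have KS: "K y' l \<in> S" if "l \<in> I" for l using K(2)[OF b(1) that] kx_S[OF \<tau>[OF that]] by simp
      have su: "stage_u I \<beta> s0 ?h y' (K y') (s0 + c l * ?h) = ?arg s0 s1 y' (K y') l" for l
        using s by (simp add: stage_u_def stage_poly_node scaleR_sum_right)
      have "?arg s0 s1 y' (K y') l \<in> S" for l
        using b(2) KS by (intro subspace_add subspace_sum subspace_scale subspace) auto
      then have "K y' l = k (stage_u I \<beta> s0 ?h y' (K y') (s0 + c l * ?h)) (s0 + c l * ?h)" if "l \<in> I" for l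
        unfolding su using K(2)[OF b(1) that] k_eq[OF _ \<tau>[OF that]] that by simp
      then show ?thesis unfolding Q_def[abs_def] using s b(2) KS by (intro step) auto
    qed
    then obtain \<Psi> where \<Psi>: "\<And>y'. y' \<in> D \<Longrightarrow> R s0 s1 y' (Q y') (\<Psi> y')" by metis
    have "one_step_map (S \<times> S) (R s0 s1) D Q \<Psi>"
      unfolding one_step_map_def
    proof (intro conjI ballI allI \<Psi>)
      show "openin (top_of_set (S \<times> S)) D" unfolding D_def by (metis Int_commute open_ball openin_open_Int)
      show "(\<lambda>y'. Q y' \<tau>) differentiable (at y' within S \<times> S)" if "y' \<in> D" for y' \<tau>
        unfolding Q_def using that K(1) by (intro stage_differentiable I) (auto simp: D_def)
    qed
    then show "\<exists>Q \<Psi>. one_step_map (S \<times> S) (R s0 s1) D Q \<Psi>" by blast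
  qed (use h0 in auto)
qed

text \<open>The derivative of \<open>v\<close> is the interpolant of the stages, so \<open>\<gamma>\<close> consists of the antiderivatives of
  the Lagrange polynomials. The derivative of \<open>u\<close> agrees with \<open>v\<close> at the nodes only: \<open>\<beta>\<close> consists of
  the antiderivatives of the interpolants of \<open>\<gamma>\<close>, which keeps the degree at \<open>p\<close>.\<close>
theorem gauss_one_step_map_exists:
  assumes p: "p \<ge> 1" and y: "y \<in> S \<times> S"
  shows "\<exists>h>0. \<exists>D. y \<in> D \<and> (\<forall>s0 s1. s0 < s1 \<and> {s0..s1} \<subseteq> J \<and> s1 - s0 < h \<longrightarrow>
    (\<exists>Q \<Psi>. one_step_map (S \<times> S) (gauss_rk_step (S \<times> S) p (\<lambda>s (u, v). (v, k u s)) s0 s1) D Q \<Psi>))"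
proof -
  let ?I = "{1..p}" and ?c = "gauss_node p"
  let ?l = "lagrange_poly ?I ?c"
  have fin: "finite ?I" and inj: "inj_on ?c ?I" and c: "\<And>l. l \<in> ?I \<Longrightarrow> 0 \<le> ?c l \<and> ?c l \<le> 1"
    using inj_on_gauss_node gauss_node_bounds by (auto simp: less_imp_le)
  have "\<exists>F :: real poly. pderiv F = ?l j \<and> poly F 0 = 0 \<and> degree F \<le> Suc (degree (?l j))" for j
    by (rule antiderivative_from_zero)
  then obtain \<gamma> where \<gamma>: "\<And>j. pderiv (\<gamma> j) = ?l j" "\<And>j. poly (\<gamma> j) 0 = 0" "\<And>j. degree (\<gamma> j) \<le> Suc (degree (?l j))"
    by metis
  have d\<gamma>: "degree (\<gamma> j) \<le> p" if "j \<in> ?I" for j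
    using order_trans[OF \<gamma>(3)[of j]] degree_lagrange_poly[OF fin that, of ?c] p by simp
  define \<beta> where "\<beta> l = (\<Sum>j\<in>?I. smult (poly (\<gamma> l) (?c j)) (\<gamma> j))" for l
  have d\<beta>: "degree (\<beta> l) \<le> p" for l unfolding \<beta>_def
    using d\<gamma> by (intro degree_sum_le fin) (auto intro: order_trans[OF degree_smult_le])
  have p\<beta>: "poly (\<beta> l) 0 = 0" for l by (simp add: \<beta>_def poly_sum \<gamma>(2))
  have d'\<beta>: "poly (pderiv (\<beta> l)) (?c j) = poly (\<gamma> l) (?c j)" if "j \<in> ?I" for l j
  proof -
    have "poly (pderiv (\<beta> l)) (?c j) = (\<Sum>i\<in>?I. poly (\<gamma> l) (?c i) * poly (?l i) (?c j))"
      unfolding \<beta>_def pderiv_sum' by (simp add: pderiv_smult \<gamma>(1) poly_sum)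
    also have "\<dots> = (\<Sum>i\<in>?I. if i = j then poly (\<gamma> l) (?c j) else 0)"
      using lagrange_poly_node[OF fin inj that] by (intro sum.cong) auto
    finally show ?thesis using that by simp
  qed
  show ?thesis
  proof (rule one_step_map_exists[OF fin c y, where \<beta> = \<beta> and \<gamma> = \<gamma>])
    fix s0 s1 y' K
    assume s: "s0 < s1" "{s0..s1} \<subseteq> J" and y': "y' \<in> S \<times> S" and KS: "\<And>l. l \<in> ?I \<Longrightarrow> K l \<in> S"
      and K: "\<And>l. l \<in> ?I \<Longrightarrow> K l = k (stage_u ?I \<beta> s0 (s1 - s0) y' K (s0 + ?c l * (s1 - s0))) (s0 + ?c l * (s1 - s0))"
    let ?u = "stage_u ?I \<beta> s0 (s1 - s0) y' K" and ?v = "stage_v ?I \<gamma> s0 (s1 - s0) y' K"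
    have h: "s1 - s0 \<noteq> 0" using s by simp
    have node0: "stage_poly ?I f s0 (s1 - s0) K s0 = (\<Sum>l\<in>?I. poly (f l) 0 *\<^sub>R K l)" for f
      using stage_poly_node[OF h, of ?I f s0 K 0] by simp
    have "gauss_rk_step (S \<times> S) p (\<lambda>s (u, v). (v, k u s)) s0 s1 y' (\<lambda>s. (?u s, ?v s)) (?u s1, ?v s1)"
      unfolding gauss_rk_step_def Let_def
    proof (intro conjI ballI)
      show "vec_poly (S \<times> S) p (\<lambda>s. (?u s, ?v s))"
      proof -
        have "vec_poly S p ?u" by (rule vec_poly_stage(1)[OF y']) (use KS p d\<beta> in auto)
        moreover have "vec_poly S p ?v" by (rule vec_poly_stage(2)[OF y']) (use KS d\<gamma> in auto)
        ultimately show ?thesis using subspace_0[OF subspace] by (simp add: vec_poly_Times)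
      qed
      show "(?u s0, ?v s0) = y'" unfolding stage_u_def stage_v_def node0 by (simp add: p\<beta> \<gamma>(2))
      fix j assume j: "j \<in> ?I"
      let ?\<tau> = "s0 + ?c j * (s1 - s0)"
      have "stage_poly ?I (\<lambda>l. pderiv (\<gamma> l)) s0 (s1 - s0) K ?\<tau> = K j"
        unfolding stage_poly_node[OF h] \<gamma>(1)
        using j lagrange_poly_node[OF fin inj j] by (simp add: if_distrib[of "\<lambda>x. x *\<^sub>R _"] cong: if_cong)
      moreover have "snd y' + (s1 - s0) *\<^sub>R stage_poly ?I (\<lambda>l. pderiv (\<beta> l)) s0 (s1 - s0) K ?\<tau> = ?v ?\<tau>"
        unfolding stage_v_def stage_poly_node[OF h] d'\<beta>[OF j] by simp
      ultimately show "((\<lambda>s. (?u s, ?v s)) has_vector_derivative (case (?u ?\<tau>, ?v ?\<tau>) of (u, v) \<Rightarrow> (v, k u ?\<tau>))) (at ?\<tau>)"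
        using has_vector_derivative_Pair[OF stage_derivative(1)[OF h, of ?I \<beta> s0 y' K ?\<tau>] stage_derivative(2)[OF h, of ?I \<gamma> s0 y' K ?\<tau>]]
          K[OF j] by simp
    qed simp
    then show "\<exists>y1. gauss_rk_step (S \<times> S) p (\<lambda>s (u, v). (v, k u s)) s0 s1 y' (\<lambda>s. (?u s, ?v s)) y1" by blast
  qed
qed

text \<open>The derivative of \<open>v\<close> interpolates the stages at the interior nodes only. The stage at \<open>s0\<close> enters
  through the initial value of \<open>v\<close>, and the one at \<open>s1\<close> through the end velocity of the step, so its
  polynomial is zero. Since $\dot u = v$ holds identically, \<open>\<beta>\<close> is the antiderivative of \<open>\<gamma>\<close>.\<close>
theorem lobatto_one_step_map_exists:
  assumes p: "p \<ge> 1" and y: "y \<in> S \<times> S"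
  shows "\<exists>h>0. \<exists>D. y \<in> D \<and> (\<forall>s0 s1. s0 < s1 \<and> {s0..s1} \<subseteq> J \<and> s1 - s0 < h \<longrightarrow>
    (\<exists>Q \<Psi>. one_step_map (S \<times> S) (lobatto_pair_step S S p (\<lambda>v s. v) k s0 s1) D Q \<Psi>))"
proof -
  let ?I = "{0..p}" and ?I' = "{1..<p}" and ?c = "lobatto_node p"
  let ?l = "lagrange_poly ?I' ?c"
  define \<omega>0 where "\<omega>0 = quad_weight ?I ?c 0"
  have inj: "inj_on ?c ?I'" using inj_on_lobatto_node[OF p] by (rule inj_on_subset) auto
  have c: "\<And>l. l \<in> ?I \<Longrightarrow> 0 \<le> ?c l \<and> ?c l \<le> 1" using lobatto_node_bounds[OF p] by auto
  have "\<exists>F :: real poly. pderiv F = ?l j \<and> poly F 0 = 0 \<and> degree F \<le> Suc (degree (?l j))" for j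
    by (rule antiderivative_from_zero)
  then obtain \<Gamma> where \<Gamma>: "\<And>j. pderiv (\<Gamma> j) = ?l j" "\<And>j. poly (\<Gamma> j) 0 = 0" "\<And>j. degree (\<Gamma> j) \<le> Suc (degree (?l j))"
    by metis
  \<comment> \<open>the constants realise the modified initial value of \<open>v\<close>\<close>
  define \<gamma> where "\<gamma> l = (if l = 0 then [:\<omega>0:] else if l = p then 0 else \<Gamma> l - [:\<omega>0 * poly (?l l) 0:])" for l
  have d\<gamma>: "degree (\<gamma> l) \<le> p - 1" if "l \<in> ?I" for l
  proof (cases "l \<in> ?I'")
    case True
    have "degree (?l l) \<le> p - 1 - 1" using degree_lagrange_poly[of ?I' l ?c] True by simp
    then have "degree (\<Gamma> l) \<le> p - 1" using \<Gamma>(3)[of l] True by auto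
    then show ?thesis using True by (auto simp: \<gamma>_def intro!: degree_diff_le)
  qed (use that in \<open>auto simp: \<gamma>_def\<close>)
  have "\<exists>F :: real poly. pderiv F = \<gamma> j \<and> poly F 0 = 0 \<and> degree F \<le> Suc (degree (\<gamma> j))" for j
    by (rule antiderivative_from_zero)
  then obtain \<beta> where \<beta>: "\<And>j. pderiv (\<beta> j) = \<gamma> j" "\<And>j. poly (\<beta> j) 0 = 0" "\<And>j. degree (\<beta> j) \<le> Suc (degree (\<gamma> j))"
    by metis
  have d\<beta>: "degree (\<beta> l) \<le> p + 1" if "l \<in> ?I" for l using \<beta>(3)[of l] d\<gamma>[OF that] by simp
  have split: "(\<Sum>l\<in>?I. poly (pderiv (\<gamma> l)) x *\<^sub>R K l) = (\<Sum>l\<in>?I'. poly (?l l) x *\<^sub>R K l)" for x and K :: "nat \<Rightarrow> 'v"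
    by (rule sum.mono_neutral_cong_right) (auto simp: \<gamma>_def pderiv_diff pderiv_pCons \<Gamma>(1))
  show ?thesis
  proof (rule one_step_map_exists[OF _ c y, where \<beta> = \<beta> and \<gamma> = \<gamma>])
    fix s0 s1 y' K
    assume s: "s0 < s1" "{s0..s1} \<subseteq> J" and y': "y' \<in> S \<times> S" and KS: "\<And>l. l \<in> ?I \<Longrightarrow> K l \<in> S"
      and K: "\<And>l. l \<in> ?I \<Longrightarrow> K l = k (stage_u ?I \<beta> s0 (s1 - s0) y' K (s0 + ?c l * (s1 - s0))) (s0 + ?c l * (s1 - s0))"
    let ?u = "stage_u ?I \<beta> s0 (s1 - s0) y' K" and ?v = "stage_v ?I \<gamma> s0 (s1 - s0) y' K"
    have h: "s1 - s0 \<noteq> 0" using s by simp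
    have node0: "stage_poly ?I f s0 (s1 - s0) K s0 = (\<Sum>l\<in>?I. poly (f l) 0 *\<^sub>R K l)" for f
      using stage_poly_node[OF h, of ?I f s0 K 0] by simp
    have u0: "?u s0 = fst y'" by (simp add: stage_u_def node0 \<beta>(2))
    have uv: "(?u has_vector_derivative ?v s) (at s)" for s
      using stage_derivative(1)[OF h, of ?I \<beta> s0 y' K s] by (simp add: stage_v_def \<beta>(1))
    have K0: "K 0 = k (?u s0) s0" using K[of 0] by (simp add: lobatto_node_0[OF p])
    have v': "vector_derivative ?v (at s0) = (\<Sum>l\<in>?I'. poly (?l l) 0 *\<^sub>R K l)"
      using vector_derivative_at[OF stage_derivative(2)[OF h, of ?I \<gamma> s0 y' K s0]] by (simp add: node0 split)
    have "(\<Sum>l\<in>?I. poly (\<gamma> l) 0 *\<^sub>R K l) = (\<Sum>l\<in>insert 0 ?I'. poly (\<gamma> l) 0 *\<^sub>R K l)"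
      by (rule sum.mono_neutral_right) (auto simp: \<gamma>_def)
    also have "\<dots> = \<omega>0 *\<^sub>R K 0 + (\<Sum>l\<in>?I'. poly (\<gamma> l) 0 *\<^sub>R K l)" by (simp add: \<gamma>_def)
    also have "(\<Sum>l\<in>?I'. poly (\<gamma> l) 0 *\<^sub>R K l) = (\<Sum>l\<in>?I'. - (\<omega>0 *\<^sub>R (poly (?l l) 0 *\<^sub>R K l)))"
      by (rule sum.cong) (auto simp: \<gamma>_def \<Gamma>(2))
    finally have "(\<Sum>l\<in>?I. poly (\<gamma> l) 0 *\<^sub>R K l) = \<omega>0 *\<^sub>R (K 0 - (\<Sum>l\<in>?I'. poly (?l l) 0 *\<^sub>R K l))"
      by (simp add: scaleR_diff_right scaleR_sum_right sum_negf del: scaleR_scaleR)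
    then have v0: "?v s0 = snd y' - ((s1 - s0) * \<omega>0) *\<^sub>R (vector_derivative ?v (at s0) - k (?u s0) s0)"
      unfolding v' stage_v_def node0 K0[symmetric] by (simp add: scaleR_diff_right)
    have "lobatto_pair_step S S p (\<lambda>v s. v) k s0 s1 y' (\<lambda>s. (?u s, ?v s))
        (?u s1, ?v s1 - ((s1 - s0) * quad_weight ?I ?c p) *\<^sub>R (vector_derivative ?v (at s1) - k (?u s1) s1))"
      unfolding lobatto_pair_step_def Let_def fst_conv snd_conv
    proof (intro conjI ballI)
      show "vec_poly S (p + 1) ?u" by (rule vec_poly_stage(1)[OF y']) (use KS d\<beta> in auto)
      show "vec_poly S (p - 1) ?v" by (rule vec_poly_stage(2)[OF y']) (use KS d\<gamma> in auto)
      fix j assume j: "j \<in> ?I'"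
      let ?\<tau> = "s0 + ?c j * (s1 - s0)"
      have "stage_poly ?I (\<lambda>l. pderiv (\<gamma> l)) s0 (s1 - s0) K ?\<tau> = K j"
        unfolding stage_poly_node[OF h] split
        using j lagrange_poly_node[OF _ inj j] by (simp add: if_distrib[of "\<lambda>x. x *\<^sub>R _"] cong: if_cong)
      then show "(?v has_vector_derivative k (?u ?\<tau>) ?\<tau>) (at ?\<tau>)"
        using stage_derivative(2)[OF h, of ?I \<gamma> s0 y' K ?\<tau>] K[of j] j by simp
    qed (use u0 uv v0 in \<open>auto simp: \<omega>0_def\<close>)
    then show "\<exists>y1. lobatto_pair_step S S p (\<lambda>v s. v) k s0 s1 y' (\<lambda>s. (?u s, ?v s)) y1" by blast
  qed simp
qed

end

section \<open>Functions with vanishing box integrals\<close>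

text \<open>The boxes are stable under intersection and generate the Borel sets, so the integral over every
  Borel set vanishes. The integral over the whole space, which is not a box, is needed for
  complements.\<close>
lemma AE_zero_if_box_integrals_zero:
  fixes g :: "'a::euclidean_space \<Rightarrow> real"
  assumes g: "integrable lebesgue g"
    and box: "\<And>a b. (LINT x:box a b|lebesgue. g x) = 0" and total: "(LINT x|lebesgue. g x) = 0"
  shows "AE x in lebesgue. g x = 0"
proof -
  have gm: "g \<in> borel_measurable lebesgue" using g by (rule borel_measurable_integrable)
  obtain g' where g': "g' \<in> borel_measurable lborel" "AE x in lborel. g x = g' x"
    using completion_ex_borel_measurable_real[OF gm] by blast
  have ae: "AE x in lebesgue. g x = g' x" using g'(2) by (rule AE_completion)
  have g'm: "g' \<in> borel_measurable lebesgue" using g'(1) by (rule measurable_completion)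
  have "integrable lebesgue g'" using integrable_cong_AE[OF gm g'm ae] g by simp
  then have ig': "integrable lborel g'" using g'(1) by (simp add: integrable_completion)
  have eq: "(LINT x:A|lborel. g' x) = (LINT x:A|lebesgue. g x)" if A: "A \<in> sets borel" for A
  proof -
    have [measurable]: "A \<in> sets lborel" "A \<in> sets lebesgue" using A by auto
    note [measurable] = g'(1) g'm gm
    have "(LINT x:A|lborel. g' x) = (LINT x:A|lebesgue. g' x)"
      unfolding set_lebesgue_integral_def by (rule integral_completion[symmetric]) measurable
    also have "\<dots> = (LINT x:A|lebesgue. g x)"
      unfolding set_lebesgue_integral_def using ae by (intro integral_cong_AE) auto
    finally show ?thesis .
  qed
  have sintA: "set_integrable lborel A g'" if "A \<in> sets borel" for A
    unfolding set_integrable_def using ig' that by (intro integrable_mult_indicator) auto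
  have z: "(LINT x:A|lborel. g' x) = 0" if "A \<in> sets borel" for A
  proof -
    have st: "Int_stable (range (\<lambda>(a, b). box a b :: 'a set))"
      unfolding Int_stable_def by (auto simp: box_Int_box)
    have A: "A \<in> sigma_sets UNIV (range (\<lambda>(a, b). box a b :: 'a set))"
      using that by (simp add: borel_eq_box)
    have sub: "range (\<lambda>(a, b). box a b :: 'a set) \<subseteq> Pow UNIV" by simp
    show ?thesis using st sub A
    proof (induction rule: sigma_sets_induct_disjoint)
      case (basic A)
      then show ?case using box by (auto simp: eq)
    next
      case empty
      then show ?case by (simp add: set_lebesgue_integral_def)
    next
      case (compl A)
      have A: "A \<in> sets borel" using compl by (simp add: borel_eq_box)
      have "(LINT x:UNIV|lborel. g' x) = 0" using total by (subst eq) (auto simp: set_lebesgue_integral_def)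
      moreover have "(LINT x:UNIV|lborel. g' x) = (LINT x:A|lborel. g' x) + (LINT x:UNIV - A|lborel. g' x)"
        using sintA[OF A] sintA[of "UNIV - A"] A set_integral_Un[of A "UNIV - A" lborel g'] by (auto simp: Un_absorb1)
      ultimately show ?case using compl by simp
    next
      case (union A)
      have "A i \<in> sets borel" for i using union by (auto simp: borel_eq_box)
      then have "(LINT x:(\<Union>i. A i)|lborel. g' x) = (\<Sum>i. (LINT x:A i|lborel. g' x))"
        using union(1) by (intro lebesgue_integral_countable_add sintA) (auto simp: disjoint_family_on_def)
      then show ?case using union by simp
    qed
  qed
  have "AE x in lborel. g' x = 0"
  proof (rule density_unique_real[OF ig'])
    show "(LINT x:A|lborel. g' x) = (LINT x:A|lborel. 0)" if "A \<in> sets lborel" for A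
      using z[of A] that by (simp add: set_lebesgue_integral_def)
  qed simp
  then have "AE x in lebesgue. g' x = 0" by (rule AE_completion)
  then show ?thesis using ae by eventually_elim simp
qed

section \<open>Smooth bump functions\<close>

text \<open>The functions $P(1/x) e^{-1/x}$, extended by zero, are closed under differentiation, with
  $y^2(P(y)-P'(y))$ in place of $P(y)$. Hence all of them are smooth.\<close>
definition flat_fun :: "real poly \<Rightarrow> real \<Rightarrow> real" where
  "flat_fun P x = (if x \<le> 0 then 0 else poly P (1 / x) * exp (- (1 / x)))"

definition flat_deriv :: "real poly \<Rightarrow> real poly" where
  "flat_deriv P = [:0, 0, 1:] * (P - pderiv P)"

lemma poly_times_exp_tendsto_0: "((\<lambda>y. poly P y * exp (- y)) \<longlongrightarrow> (0::real)) at_top"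
proof -
  have "((\<lambda>y. \<Sum>i\<le>degree P. coeff P i * (y ^ i / exp y)) \<longlongrightarrow> (\<Sum>i\<le>degree P. coeff P i * 0)) at_top"
    by (intro tendsto_sum tendsto_mult tendsto_const tendsto_power_div_exp_0)
  moreover have "(\<lambda>y. poly P y * exp (- y)) = (\<lambda>y. \<Sum>i\<le>degree P. coeff P i * (y ^ i / exp y))"
    by (simp add: poly_altdef sum_distrib_right exp_minus divide_inverse mult.assoc)
  ultimately show ?thesis by simp
qed

lemma flat_fun_tendsto_0: "((\<lambda>x. poly P (1 / x) * exp (- (1 / x))) \<longlongrightarrow> (0::real)) (at_right 0)"
  using filterlim_compose[OF poly_times_exp_tendsto_0 filterlim_inverse_at_top_right, of P]
  by (simp add: inverse_eq_divide)

lemma flat_fun_deriv: "(flat_fun P has_real_derivative flat_fun (flat_deriv P) x) (at x)"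
proof -
  consider "x < 0" | "x = 0" | "x > 0" by linarith
  then show ?thesis
  proof cases
    case 1
    have "((\<lambda>_. 0) has_real_derivative 0) (at x)" by simp
    then have "(flat_fun P has_real_derivative 0) (at x)"
      by (rule has_field_derivative_transform_within_open[where S = "{..<0}"]) (use 1 in \<open>auto simp: flat_fun_def\<close>)
    then show ?thesis using 1 by (simp add: flat_fun_def)
  next
    case 2
    have "((\<lambda>h. (flat_fun P (0 + h) - flat_fun P 0) / h) \<longlongrightarrow> 0) (at 0)"
    proof (rule filterlim_split_at)
      have "\<forall>\<^sub>F h in at_left 0. (flat_fun P (0 + h) - flat_fun P 0) / h = 0"
        unfolding eventually_at_left_field by (auto simp: flat_fun_def intro: exI[of _ "-1"])
      then show "((\<lambda>h. (flat_fun P (0 + h) - flat_fun P 0) / h) \<longlongrightarrow> 0) (at_left 0)"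
        by (rule tendsto_eventually)
      have "\<forall>\<^sub>F h in at_right 0. poly ([:0, 1:] * P) (1 / h) * exp (- (1 / h)) = (flat_fun P (0 + h) - flat_fun P 0) / h"
        unfolding eventually_at_right_field by (auto simp: flat_fun_def field_simps intro: exI[of _ 1])
      from Lim_transform_eventually[OF flat_fun_tendsto_0 this]
      show "((\<lambda>h. (flat_fun P (0 + h) - flat_fun P 0) / h) \<longlongrightarrow> 0) (at_right 0)" .
    qed
    then show ?thesis using 2 by (simp add: DERIV_def flat_fun_def)
  next
    case 3
    have "((\<lambda>x. poly P (1 / x) * exp (- (1 / x))) has_real_derivative
        poly P (1 / x) * (exp (- (1 / x)) * (1 / x\<^sup>2)) + poly (pderiv P) (1 / x) * (- 1 / x\<^sup>2) * exp (- (1 / x))) (at x)"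
    proof (rule DERIV_mult')
      have i: "((\<lambda>x. 1 / x) has_real_derivative - 1 / x\<^sup>2) (at x)"
        using 3 by (auto intro!: derivative_eq_intros simp: power2_eq_square)
      show "((\<lambda>x. poly P (1 / x)) has_real_derivative poly (pderiv P) (1 / x) * (- 1 / x\<^sup>2)) (at x)"
        by (rule DERIV_chain2[OF poly_DERIV i])
      have "((\<lambda>x. - (1 / x)) has_real_derivative 1 / x\<^sup>2) (at x)" using DERIV_minus[OF i] by simp
      from DERIV_chain2[OF DERIV_exp this]
      show "((\<lambda>x. exp (- (1 / x))) has_real_derivative exp (- (1 / x)) * (1 / x\<^sup>2)) (at x)" .
    qed
    moreover have "poly P (1 / x) * (exp (- (1 / x)) * (1 / x\<^sup>2)) + poly (pderiv P) (1 / x) * (- 1 / x\<^sup>2) * exp (- (1 / x)) =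
        flat_fun (flat_deriv P) x"
      using 3 by (simp add: flat_fun_def flat_deriv_def field_simps power2_eq_square)
    ultimately have "((\<lambda>x. poly P (1 / x) * exp (- (1 / x))) has_real_derivative flat_fun (flat_deriv P) x) (at x)" by simp
    then show ?thesis
      by (rule has_field_derivative_transform_within_open[where S = "{0<..}"]) (use 3 in \<open>auto simp: flat_fun_def\<close>)
  qed
qed

lemma C_k_const: "C_k k (\<lambda>x. c)"
proof (induction k arbitrary: c)
  case (Suc k)
  have "frechet_derivative (\<lambda>x::'a. c) (at x) = (\<lambda>h. 0)" for x
    using frechet_derivative_at[OF has_derivative_const] by metis
  then show ?case using Suc by simp
qed simp

lemma C_k_Suc_iff:
  assumes "\<And>x. (\<phi> has_derivative \<phi>' x) (at x)"
  shows "C_k (Suc k) \<phi> \<longleftrightarrow> (\<forall>b\<in>Basis. C_k k (\<lambda>x. \<phi>' x b))"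
proof -
  have "frechet_derivative \<phi> (at x) = \<phi>' x" for x using frechet_derivative_at[OF assms] by simp
  then show ?thesis using assms by (auto simp: differentiable_def)
qed

lemma C_k_SucD:
  assumes "C_k (Suc k) \<phi>"
  shows "(\<phi> has_derivative frechet_derivative \<phi> (at x)) (at x)" "b \<in> Basis \<Longrightarrow> C_k k (\<lambda>x. frechet_derivative \<phi> (at x) b)"
  using assms frechet_derivative_works by auto

lemma C_k_mono: "C_k (Suc k) \<phi> \<Longrightarrow> C_k k \<phi>"
proof (induction k arbitrary: \<phi>)
  case 0
  then have "\<forall>x. \<phi> differentiable (at x)" by simp
  then show ?case by (simp add: continuous_at_imp_continuous_on differentiable_imp_continuous_within)
next
  case (Suc k)
  have "C_k (Suc (Suc k)) \<phi> \<Longrightarrow> b \<in> Basis \<Longrightarrow> C_k (Suc k) (\<lambda>x. frechet_derivative \<phi> (at x) b)" for b by (rule C_k_SucD)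
  then have "b \<in> Basis \<Longrightarrow> C_k k (\<lambda>x. frechet_derivative \<phi> (at x) b)" for b using Suc by blast
  then show ?case by (subst C_k_Suc_iff[OF C_k_SucD(1)[OF Suc.prems]]) blast
qed

lemma C_k_add: "C_k k \<phi> \<Longrightarrow> C_k k \<psi> \<Longrightarrow> C_k k (\<lambda>x. \<phi> x + \<psi> x)"
proof (induction k arbitrary: \<phi> \<psi>)
  case (Suc k)
  show ?case
    unfolding C_k_Suc_iff[OF has_derivative_add[OF C_k_SucD(1)[OF Suc.prems(1)] C_k_SucD(1)[OF Suc.prems(2)]]]
    using C_k_SucD(2)[OF Suc.prems(1)] C_k_SucD(2)[OF Suc.prems(2)] Suc.IH by blast
qed (simp add: continuous_on_add)

lemma C_k_mult: "C_k k \<phi> \<Longrightarrow> C_k k \<psi> \<Longrightarrow> C_k k (\<lambda>x. \<phi> x * \<psi> x)"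
proof (induction k arbitrary: \<phi> \<psi>)
  case (Suc k)
  show ?case
    unfolding C_k_Suc_iff[OF has_derivative_mult[OF C_k_SucD(1)[OF Suc.prems(1)] C_k_SucD(1)[OF Suc.prems(2)]]]
  proof
    fix b :: 'a assume b: "b \<in> Basis"
    show "C_k k (\<lambda>x. \<phi> x * frechet_derivative \<psi> (at x) b + frechet_derivative \<phi> (at x) b * \<psi> x)"
      using C_k_SucD(2)[OF Suc.prems(1) b] C_k_SucD(2)[OF Suc.prems(2) b] C_k_mono[OF Suc.prems(1)] C_k_mono[OF Suc.prems(2)]
      by (intro C_k_add Suc.IH)
  qed
qed (simp add: continuous_on_mult)

lemma C_k_prod:
  assumes "\<And>i. i \<in> I \<Longrightarrow> C_k k (f i)"
  shows "C_k k (\<lambda>x. \<Prod>i\<in>I. f i x)"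
  using assms by (induction I rule: infinite_finite_induct) (auto intro!: C_k_mult C_k_const)

lemma C_k_flat_ridge: "C_k k (\<lambda>x::'a::euclidean_space. flat_fun P (x \<bullet> v + c))"
proof (induction k arbitrary: P)
  case 0
  have "continuous_on UNIV (flat_fun P)"
    using flat_fun_deriv[of P] DERIV_continuous_on has_field_derivative_at_within by blast
  then have "continuous_on UNIV (\<lambda>x::'a. flat_fun P (x \<bullet> v + c))"
    by (rule continuous_on_compose2) (auto intro!: continuous_intros)
  then show ?case by simp
next
  case (Suc k)
  have "((\<lambda>x::'a. flat_fun P (x \<bullet> v + c)) has_derivative (\<lambda>h. flat_fun (flat_deriv P) (x \<bullet> v + c) * (h \<bullet> v))) (at x)" for x
  proof -
    have "((\<lambda>x::'a. x \<bullet> v + c) has_derivative (\<lambda>h. h \<bullet> v)) (at x)" by (auto intro!: derivative_eq_intros)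
    from has_derivative_compose[OF this flat_fun_deriv[unfolded has_field_derivative_def]]
    show ?thesis by simp
  qed
  then show ?case by (subst C_k_Suc_iff) (auto intro!: C_k_mult[OF Suc.IH C_k_const])
qed

text \<open>A product of ridge functions in the coordinate directions, positive exactly in the box if \<open>n > 0\<close>. As \<open>n\<close>
  grows, the functions converge to the indicator of the box.\<close>
definition box_bump :: "nat \<Rightarrow> 'a::euclidean_space \<Rightarrow> 'a \<Rightarrow> 'a \<Rightarrow> real" where
  "box_bump n a b x = (\<Prod>e\<in>Basis. flat_fun 1 (x \<bullet> (real n *\<^sub>R e) + - (real n * (a \<bullet> e))) *
     flat_fun 1 (x \<bullet> (- real n *\<^sub>R e) + real n * (b \<bullet> e)))"

lemma flat_fun_1_bounds: "0 \<le> flat_fun 1 x" "flat_fun 1 x \<le> 1" "flat_fun 1 x \<noteq> 0 \<longleftrightarrow> x > 0"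
  by (auto simp: flat_fun_def)

lemma box_bump_bounds: "0 \<le> box_bump n a b x" "box_bump n a b x \<le> 1"
  unfolding box_bump_def using flat_fun_1_bounds(1,2)
  by (auto intro!: prod_nonneg prod_le_1 mult_le_one)

lemma box_bump_support:
  assumes "n > 0"
  shows "{x. box_bump n a b x \<noteq> 0} = box a b"
proof -
  have "box_bump n a b x \<noteq> 0 \<longleftrightarrow> (\<forall>e\<in>Basis. real n * (x \<bullet> e) - real n * (a \<bullet> e) > 0 \<and> real n * (b \<bullet> e) - real n * (x \<bullet> e) > 0)" for x
    unfolding box_bump_def by (simp add: flat_fun_1_bounds(3))
  then show ?thesis using assms by (auto simp: box_def)
qed

lemma test_function_box_bump:
  assumes "n > 0" "cbox a b \<subseteq> \<Omega>"
  shows "test_function \<Omega> (box_bump n a b)"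
proof -
  have "C_k k (box_bump n a b)" for k
    unfolding box_bump_def[abs_def] by (intro C_k_prod C_k_mult C_k_flat_ridge)
  moreover have "closure (box a b) \<subseteq> cbox a b" by (rule closure_minimal[OF box_subset_cbox closed_cbox])
  moreover have "compact (closure (box a b))" by (simp add: bounded_box)
  ultimately show ?thesis unfolding test_function_def box_bump_support[OF assms(1)] using assms(2) by blast
qed

lemma flat_fun_1_scaled_tendsto:
  assumes "t > 0"
  shows "(\<lambda>n. flat_fun 1 (real n * t)) \<longlonglongrightarrow> 1"
proof -
  have "(\<lambda>n. exp (- ((1 / t) / real n))) \<longlonglongrightarrow> exp (- 0)"
    by (intro tendsto_exp tendsto_minus lim_const_over_n)
  moreover have "\<forall>\<^sub>F n in sequentially. exp (- ((1 / t) / real n)) = flat_fun 1 (real n * t)"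
    using eventually_gt_at_top[of 0] by eventually_elim (use assms in \<open>simp add: flat_fun_def mult_le_0_iff mult.commute\<close>)
  ultimately show ?thesis using Lim_transform_eventually by force
qed

lemma box_bump_tendsto: "(\<lambda>n. box_bump n a b x) \<longlonglongrightarrow> indicator (box a b) x"
proof (cases "x \<in> box a b")
  case True
  have "(\<lambda>n. \<Prod>e\<in>Basis. flat_fun 1 (real n * (x \<bullet> e - a \<bullet> e)) * flat_fun 1 (real n * (b \<bullet> e - x \<bullet> e))) \<longlonglongrightarrow> (\<Prod>e\<in>(Basis::'a set). 1 * 1)"
    using True by (intro tendsto_prod tendsto_mult flat_fun_1_scaled_tendsto) (auto simp: box_def)
  moreover have "box_bump n a b x = (\<Prod>e\<in>Basis. flat_fun 1 (real n * (x \<bullet> e - a \<bullet> e)) * flat_fun 1 (real n * (b \<bullet> e - x \<bullet> e)))" for n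
    unfolding box_bump_def by (simp add: right_diff_distrib)
  ultimately show ?thesis using True by simp
next
  case False
  have "\<forall>\<^sub>F n in sequentially. box_bump n a b x = 0"
    using eventually_gt_at_top[of 0] by eventually_elim (use False box_bump_support[of _ a b] in blast)
  then show ?thesis using False by (simp add: tendsto_eventually)
qed

section \<open>The fundamental lemma of the calculus of variations\<close>

text \<open>The bump functions converge boundedly to the indicators of boxes, so the integrals of \<open>D\<close> over
  all boxes in \<open>\<Omega>\<close> vanish by dominated convergence, and \<open>\<Omega>\<close> is a countable union of boxes.\<close>
lemma AE_zero_if_test_integrals_zero:
  fixes D :: "'a::euclidean_space \<Rightarrow> real"
  assumes \<Omega>: "open \<Omega>" and D: "set_integrable lebesgue \<Omega> D"
    and test: "\<And>\<phi>. test_function \<Omega> \<phi> \<Longrightarrow> (LINT x:\<Omega>|lebesgue. D x * \<phi> x) = 0"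
  shows "AE x in lebesgue. x \<in> \<Omega> \<longrightarrow> D x = 0"
proof -
  have box0: "(LINT x:box a b|lebesgue. D x) = 0" if ab: "cbox a b \<subseteq> \<Omega>" for a b
  proof -
    have sub: "box a b \<subseteq> \<Omega>" using ab box_subset_cbox by blast
    have "(\<lambda>n. LINT x|lebesgue. (indicator \<Omega> x *\<^sub>R D x) * box_bump (Suc n) a b x) \<longlonglongrightarrow>
        (LINT x|lebesgue. (indicator \<Omega> x *\<^sub>R D x) * indicator (box a b) x)"
    proof (rule integral_dominated_convergence)
      have i: "integrable lebesgue (\<lambda>x. indicator \<Omega> x *\<^sub>R D x)" using D by (simp add: set_integrable_def)
      then have m[measurable]: "(\<lambda>x. indicator \<Omega> x *\<^sub>R D x) \<in> borel_measurable lebesgue" by (rule borel_measurable_integrable)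
      show "integrable lebesgue (\<lambda>x. norm (indicator \<Omega> x *\<^sub>R D x))" using i by (rule integrable_norm)
      have bm: "box_bump n a b \<in> borel_measurable lebesgue" if "n > 0" for n
      proof -
        have "C_k 0 (box_bump n a b)" using test_function_box_bump[OF that ab] unfolding test_function_def by blast
        then have "box_bump n a b \<in> borel_measurable lborel" by (simp add: borel_measurable_continuous_onI)
        then show ?thesis by (rule measurable_completion)
      qed
      show "(\<lambda>x. (indicator \<Omega> x *\<^sub>R D x) * box_bump (Suc n) a b x) \<in> borel_measurable lebesgue" for n
        using bm[of "Suc n"] by (intro borel_measurable_times m) auto
      show "(\<lambda>x. (indicator \<Omega> x *\<^sub>R D x) * indicator (box a b) x) \<in> borel_measurable lebesgue"
        by (intro borel_measurable_times m borel_measurable_indicator) auto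
      show "AE x in lebesgue. (\<lambda>n. (indicator \<Omega> x *\<^sub>R D x) * box_bump (Suc n) a b x) \<longlonglongrightarrow> (indicator \<Omega> x *\<^sub>R D x) * indicator (box a b) x"
        using LIMSEQ_Suc[OF box_bump_tendsto] by (intro AE_I2 tendsto_mult tendsto_const)
      show "AE x in lebesgue. norm ((indicator \<Omega> x *\<^sub>R D x) * box_bump (Suc n) a b x) \<le> norm (indicator \<Omega> x *\<^sub>R D x)" for n
        using box_bump_bounds[of "Suc n" a b] by (intro AE_I2) (simp add: abs_mult mult_left_le)
    qed
    moreover have "(LINT x|lebesgue. (indicator \<Omega> x *\<^sub>R D x) * box_bump (Suc n) a b x) = 0" for n
      using test[OF test_function_box_bump[of "Suc n", OF _ ab]] by (simp add: set_lebesgue_integral_def mult.assoc)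
    moreover have "(LINT x|lebesgue. (indicator \<Omega> x *\<^sub>R D x) * indicator (box a b) x) = (LINT x:box a b|lebesgue. D x)"
      unfolding set_lebesgue_integral_def using sub by (intro Bochner_Integration.integral_cong) (auto simp: indicator_def)
    ultimately show ?thesis by (simp add: LIMSEQ_const_iff)
  qed
  have box_ae: "AE x in lebesgue. x \<in> cbox a b \<longrightarrow> D x = 0" if ab: "cbox a b \<subseteq> \<Omega>" for a b
  proof -
    have sub: "box a b \<subseteq> \<Omega>" using ab box_subset_cbox by blast
    have Db: "set_integrable lebesgue (box a b) D" by (rule set_integrable_subset[OF D _ sub]) auto
    have "AE x in lebesgue. indicator (box a b) x *\<^sub>R D x = 0"
    proof (rule AE_zero_if_box_integrals_zero)
      show "integrable lebesgue (\<lambda>x. indicator (box a b) x *\<^sub>R D x)" using Db by (simp add: set_integrable_def)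
      show "(LINT x|lebesgue. indicator (box a b) x *\<^sub>R D x) = 0" using box0[OF ab] by (simp add: set_lebesgue_integral_def)
      fix c d
      obtain p q where pq: "box a b \<inter> box c d = box p q" by (rule that) (rule box_Int_box)
      have "(LINT x:box c d|lebesgue. indicator (box a b) x *\<^sub>R D x) = (LINT x:box p q|lebesgue. D x)"
        unfolding set_lebesgue_integral_def pq[symmetric] by (intro Bochner_Integration.integral_cong) (auto simp: indicator_def)
      also have "\<dots> = 0"
      proof (cases "box p q = {}")
        case False
        then have "cbox p q = closure (box p q)" by (simp add: closure_box)
        also have "\<dots> \<subseteq> closure (box a b)" using pq by (intro closure_mono) blast
        also have "\<dots> \<subseteq> cbox a b" by (rule closure_minimal[OF box_subset_cbox closed_cbox])
        finally show ?thesis using ab by (intro box0) blast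
      qed (simp add: set_lebesgue_integral_def)
      finally show "(LINT x:box c d|lebesgue. indicator (box a b) x *\<^sub>R D x) = 0" .
    qed
    moreover have "AE x in lebesgue. x \<notin> cbox a b - box a b"
      using negligible_frontier_interval[of a b] by (intro AE_not_in) (simp add: negligible_iff_null_sets)
    ultimately show ?thesis by eventually_elim (auto simp: indicator_def split: if_splits)
  qed
  obtain \<D> where \<D>: "countable \<D>" "\<Union>\<D> = \<Omega>" "\<And>X. X \<in> \<D> \<Longrightarrow> \<exists>a b. X = cbox a b"
    using open_countable_Union_open_cbox[OF \<Omega>] by metis
  have "AE x in lebesgue. x \<in> X \<longrightarrow> D x = 0" if "X \<in> \<D>" for X
    using \<D>(2) \<D>(3)[OF that] that box_ae by blast
  then have "AE x in lebesgue. \<forall>X\<in>\<D>. x \<in> X \<longrightarrow> D x = 0" unfolding AE_ball_countable[OF \<D>(1)] by blast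
  then show ?thesis by eventually_elim (use \<D>(2) in blast)
qed

section \<open>Square-integrable functions\<close>

lemma set_borel_measurable_inner:
  fixes f g :: "'a::euclidean_space \<Rightarrow> 'b::euclidean_space"
  assumes "set_borel_measurable M A f" "set_borel_measurable M A g"
  shows "set_borel_measurable M A (\<lambda>x. f x \<bullet> g x)"
proof -
  have "(\<lambda>x. (indicator A x *\<^sub>R f x) \<bullet> (indicator A x *\<^sub>R g x)) \<in> borel_measurable M"
    using assms unfolding set_borel_measurable_def by (rule borel_measurable_inner)
  moreover have "(\<lambda>x. (indicator A x *\<^sub>R f x) \<bullet> (indicator A x *\<^sub>R g x)) = (\<lambda>x. indicator A x *\<^sub>R (f x \<bullet> g x))"
    by (auto simp: indicator_def)
  ultimately show ?thesis unfolding set_borel_measurable_def by simp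
qed

lemma in_L2_inner_integrable:
  fixes f g :: "'a::euclidean_space \<Rightarrow> 'b::euclidean_space"
  assumes "in_L2 \<Omega> f" "in_L2 \<Omega> g"
  shows "set_integrable lebesgue \<Omega> (\<lambda>x. f x \<bullet> g x)"
proof (rule set_integrable_bound)
  show "set_integrable lebesgue \<Omega> (\<lambda>x. (norm (f x))\<^sup>2 + (norm (g x))\<^sup>2)"
    using assms unfolding in_L2_def by (intro set_integral_add) auto
  show "set_borel_measurable lebesgue \<Omega> (\<lambda>x. f x \<bullet> g x)"
    using assms unfolding in_L2_def by (intro set_borel_measurable_inner) auto
  have "\<bar>f x \<bullet> g x\<bar> \<le> (norm (f x))\<^sup>2 + (norm (g x))\<^sup>2" for x
  proof -
    have "2 * (norm (f x) * norm (g x)) \<le> (norm (f x))\<^sup>2 + (norm (g x))\<^sup>2"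
      using sum_squares_bound[of "norm (f x)" "norm (g x)"] by simp
    moreover have "0 \<le> norm (f x) * norm (g x)" by simp
    ultimately show ?thesis using Cauchy_Schwarz_ineq2[of "f x" "g x"] by linarith
  qed
  then show "AE x in lebesgue. x \<in> \<Omega> \<longrightarrow> norm (f x \<bullet> g x) \<le> norm ((norm (f x))\<^sup>2 + (norm (g x))\<^sup>2)"
    by (intro AE_I2) (simp add: abs_of_nonneg)
qed

lemma in_L2_add:
  fixes f g :: "'a::euclidean_space \<Rightarrow> 'b::euclidean_space"
  assumes "in_L2 \<Omega> f" "in_L2 \<Omega> g"
  shows "in_L2 \<Omega> (\<lambda>x. f x + g x)"
proof -
  have m: "set_borel_measurable lebesgue \<Omega> (\<lambda>x. f x + g x)"
    using borel_measurable_add[of "\<lambda>x. indicator \<Omega> x *\<^sub>R f x" lebesgue "\<lambda>x. indicator \<Omega> x *\<^sub>R g x"] assms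
    unfolding in_L2_def set_borel_measurable_def by (simp only: scaleR_add_right)
  have "set_integrable lebesgue \<Omega> (\<lambda>x. (norm (f x))\<^sup>2 + 2 * (f x \<bullet> g x) + (norm (g x))\<^sup>2)"
    using assms in_L2_inner_integrable[OF assms] unfolding in_L2_def
    by (intro set_integral_add set_integrable_mult_right) auto
  moreover have "(norm (f x + g x))\<^sup>2 = (norm (f x))\<^sup>2 + 2 * (f x \<bullet> g x) + (norm (g x))\<^sup>2" for x
    by (simp add: power2_norm_eq_inner inner_add inner_commute)
  ultimately show ?thesis using m unfolding in_L2_def by simp
qed

lemma in_L2_scaleR:
  fixes f :: "'a::euclidean_space \<Rightarrow> 'b::euclidean_space"
  assumes "in_L2 \<Omega> f"
  shows "in_L2 \<Omega> (\<lambda>x. a *\<^sub>R f x)"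
proof -
  have "(\<lambda>x. a *\<^sub>R (indicator \<Omega> x *\<^sub>R f x)) \<in> borel_measurable lebesgue"
    using borel_measurable_scaleR[OF borel_measurable_const, of "\<lambda>x. indicator \<Omega> x *\<^sub>R f x" lebesgue a] assms
    unfolding in_L2_def set_borel_measurable_def by (simp only:)
  then have "set_borel_measurable lebesgue \<Omega> (\<lambda>x. a *\<^sub>R f x)"
    unfolding set_borel_measurable_def by (simp add: mult.commute)
  then show ?thesis using assms unfolding in_L2_def by (simp add: power_mult_distrib)
qed

lemma in_L2_bounded_mult:
  fixes f :: "'a::euclidean_space \<Rightarrow> 'b::euclidean_space" and c :: "'a \<Rightarrow> real"
  assumes f: "in_L2 \<Omega> f" and c: "set_borel_measurable lebesgue \<Omega> c" "\<And>x. x \<in> \<Omega> \<Longrightarrow> \<bar>c x\<bar> \<le> C"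
  shows "in_L2 \<Omega> (\<lambda>x. c x *\<^sub>R f x)"
proof -
  have "(\<lambda>x. (indicator \<Omega> x *\<^sub>R c x) *\<^sub>R (indicator \<Omega> x *\<^sub>R f x)) \<in> borel_measurable lebesgue"
    using borel_measurable_scaleR[of "\<lambda>x. indicator \<Omega> x *\<^sub>R c x" lebesgue "\<lambda>x. indicator \<Omega> x *\<^sub>R f x"] f c(1)
    unfolding in_L2_def set_borel_measurable_def by (simp only:)
  moreover have "(\<lambda>x. (indicator \<Omega> x *\<^sub>R c x) *\<^sub>R (indicator \<Omega> x *\<^sub>R f x)) = (\<lambda>x. indicator \<Omega> x *\<^sub>R (c x *\<^sub>R f x))"
    by (auto simp: indicator_def)
  ultimately have m: "set_borel_measurable lebesgue \<Omega> (\<lambda>x. c x *\<^sub>R f x)" unfolding set_borel_measurable_def by simp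
  have "set_integrable lebesgue \<Omega> (\<lambda>x. (norm (c x *\<^sub>R f x))\<^sup>2)"
  proof (rule set_integrable_bound)
    show "set_integrable lebesgue \<Omega> (\<lambda>x. C\<^sup>2 * (norm (f x))\<^sup>2)" using f unfolding in_L2_def by auto
    show "set_borel_measurable lebesgue \<Omega> (\<lambda>x. (norm (c x *\<^sub>R f x))\<^sup>2)"
      unfolding power2_norm_eq_inner by (intro set_borel_measurable_inner m)
    have "(\<bar>c x\<bar> * norm (f x))\<^sup>2 \<le> C\<^sup>2 * (norm (f x))\<^sup>2" if "x \<in> \<Omega>" for x
      unfolding power_mult_distrib using c(2)[OF that] by (intro mult_right_mono power_mono) auto
    then show "AE x in lebesgue. x \<in> \<Omega> \<longrightarrow> norm ((norm (c x *\<^sub>R f x))\<^sup>2) \<le> norm (C\<^sup>2 * (norm (f x))\<^sup>2)"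
      by (intro AE_I2) (simp add: abs_mult)
  qed
  then show ?thesis using m unfolding in_L2_def by simp
qed

lemma set_borel_measurable_continuous_lebesgue:
  fixes f :: "'a::euclidean_space \<Rightarrow> 'b::euclidean_space"
  assumes "open \<Omega>" "continuous_on \<Omega> f"
  shows "set_borel_measurable lebesgue \<Omega> f"
proof -
  have "(\<lambda>x. indicator \<Omega> x *\<^sub>R f x) \<in> borel_measurable lborel"
    using borel_measurable_continuous_on_indicator[OF _ assms(2)] assms(1) by simp
  then show ?thesis unfolding set_borel_measurable_def by (rule measurable_completion)
qed

lemma in_L2_continuous:
  fixes f :: "'a::euclidean_space \<Rightarrow> 'b::euclidean_space"
  assumes \<Omega>: "open \<Omega>" "bounded \<Omega>" and f: "continuous_on \<Omega> f" "\<And>x. x \<in> \<Omega> \<Longrightarrow> norm (f x) \<le> C"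
  shows "in_L2 \<Omega> f"
proof -
  have m: "set_borel_measurable lebesgue \<Omega> f" using \<Omega>(1) f(1) by (rule set_borel_measurable_continuous_lebesgue)
  have "set_integrable lebesgue \<Omega> (\<lambda>x. (norm (f x))\<^sup>2)"
  proof (rule set_integrable_bound)
    have "\<Omega> \<in> lmeasurable" using \<Omega> by (simp add: bounded_set_imp_lmeasurable)
    then show "set_integrable lebesgue \<Omega> (\<lambda>x. C\<^sup>2)" unfolding set_integrable_def
      by (intro integrable_scaleR_left integrable_real_indicator) (auto simp: fmeasurable_def)
    show "set_borel_measurable lebesgue \<Omega> (\<lambda>x. (norm (f x))\<^sup>2)"
      unfolding power2_norm_eq_inner by (intro set_borel_measurable_inner m)
    show "AE x in lebesgue. x \<in> \<Omega> \<longrightarrow> norm ((norm (f x))\<^sup>2) \<le> norm (C\<^sup>2)"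
      using f(2) by (intro AE_I2) (auto intro: power_mono)
  qed
  then show ?thesis using m unfolding in_L2_def by simp
qed

lemma in_L2_bcontfun:
  fixes w :: "'a::euclidean_space \<Rightarrow>\<^sub>C real"
  assumes "open \<Omega>" "bounded \<Omega>"
  shows "in_L2 \<Omega> (apply_bcontfun w)"
  using assms norm_bounded[of w] by (intro in_L2_continuous[where C = "norm w"]) auto

lemma L2_inner_add_left:
  fixes f :: "'a::euclidean_space \<Rightarrow> 'b::euclidean_space"
  shows "in_L2 A f \<Longrightarrow> in_L2 A g \<Longrightarrow> in_L2 A h \<Longrightarrow> L2_inner A (\<lambda>x. f x + g x) h = L2_inner A f h + L2_inner A g h"
  unfolding L2_inner_def using set_integral_add(2)[OF in_L2_inner_integrable in_L2_inner_integrable]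
  by (simp add: inner_add_left)

lemma L2_inner_scaleR_left: "L2_inner A (\<lambda>x. a *\<^sub>R f x) h = a * L2_inner A f h"
  unfolding L2_inner_def by simp

lemma L2_inner_commute: "L2_inner A f h = L2_inner A h f"
  unfolding L2_inner_def by (simp add: inner_commute)

lemma L2_inner_cong_AE:
  fixes f :: "'a::euclidean_space \<Rightarrow> 'b::euclidean_space"
  assumes "in_L2 A f" "in_L2 A g" "in_L2 A h" "AE x in lebesgue. x \<in> A \<longrightarrow> f x = g x"
  shows "L2_inner A f h = L2_inner A g h"
  unfolding L2_inner_def set_lebesgue_integral_def
proof (rule integral_cong_AE)
  show "AE x in lebesgue. indicator A x *\<^sub>R (f x \<bullet> h x) = indicator A x *\<^sub>R (g x \<bullet> h x)"
    using assms(4) by eventually_elim (auto simp: indicator_def)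
qed (use set_borel_measurable_inner assms in \<open>auto simp: in_L2_def set_borel_measurable_def\<close>)

section \<open>Uniqueness and linearity of weak gradients\<close>

lemma test_function_bounded:
  fixes \<phi> :: "'a::euclidean_space \<Rightarrow> real"
  assumes "bounded \<Omega>" "test_function \<Omega> \<phi>"
  shows "\<exists>C. \<forall>x\<in>\<Omega>. \<bar>\<phi> x\<bar> \<le> C" "continuous_on UNIV \<phi>"
    "b \<in> Basis \<Longrightarrow> \<exists>C. \<forall>x\<in>\<Omega>. \<bar>frechet_derivative \<phi> (at x) b\<bar> \<le> C"
    "b \<in> Basis \<Longrightarrow> continuous_on UNIV (\<lambda>x. frechet_derivative \<phi> (at x) b)"
proof -
  have bd: "\<exists>C. \<forall>x\<in>\<Omega>. \<bar>f x\<bar> \<le> C" if "continuous_on UNIV f" for f :: "'a \<Rightarrow> real"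
  proof -
    have "compact (f ` closure \<Omega>)"
      using that assms(1) by (intro compact_continuous_image) (auto intro: continuous_on_subset)
    then have "bounded (f ` closure \<Omega>)" by (rule compact_imp_bounded)
    then obtain C where "\<forall>y\<in>f ` closure \<Omega>. norm y \<le> C" by (auto simp: bounded_iff)
    then show ?thesis using closure_subset[of \<Omega>] by (intro exI[of _ C]) auto
  qed
  have 1: "C_k 0 \<phi>" "C_k 1 \<phi>" using assms(2) unfolding test_function_def by blast+
  then show c: "continuous_on UNIV \<phi>" by simp
  show "b \<in> Basis \<Longrightarrow> continuous_on UNIV (\<lambda>x. frechet_derivative \<phi> (at x) b)" using 1(2) by simp
  then show "b \<in> Basis \<Longrightarrow> \<exists>C. \<forall>x\<in>\<Omega>. \<bar>frechet_derivative \<phi> (at x) b\<bar> \<le> C" by (rule bd)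
  show "\<exists>C. \<forall>x\<in>\<Omega>. \<bar>\<phi> x\<bar> \<le> C" using c by (rule bd)
qed

lemma in_L2_test:
  fixes \<phi> :: "'a::euclidean_space \<Rightarrow> real"
  assumes "open \<Omega>" "bounded \<Omega>" "test_function \<Omega> \<phi>"
  shows "in_L2 \<Omega> \<phi>" "b \<in> Basis \<Longrightarrow> in_L2 \<Omega> (\<lambda>x. frechet_derivative \<phi> (at x) b)"
proof -
  obtain C where "\<forall>x\<in>\<Omega>. \<bar>\<phi> x\<bar> \<le> C" using test_function_bounded(1)[OF assms(2,3)] by blast
  then show "in_L2 \<Omega> \<phi>" using test_function_bounded(2)[OF assms(2,3)] assms
    by (intro in_L2_continuous[where C = C]) (auto intro: continuous_on_subset)
  assume b: "b \<in> Basis"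
  obtain C where "\<forall>x\<in>\<Omega>. \<bar>frechet_derivative \<phi> (at x) b\<bar> \<le> C" using test_function_bounded(3)[OF assms(2,3) b] by blast
  then show "in_L2 \<Omega> (\<lambda>x. frechet_derivative \<phi> (at x) b)" using test_function_bounded(4)[OF assms(2,3) b] assms
    by (intro in_L2_continuous[where C = C]) (auto intro: continuous_on_subset)
qed

lemma in_L2_component:
  fixes G :: "'a::euclidean_space \<Rightarrow> 'a"
  assumes "in_L2 \<Omega> G" "b \<in> Basis"
  shows "in_L2 \<Omega> (\<lambda>x. G x \<bullet> b)"
proof -
  have "(\<lambda>x. (indicator \<Omega> x *\<^sub>R G x) \<bullet> b) \<in> borel_measurable lebesgue"
    using borel_measurable_inner[OF _ borel_measurable_const, of "\<lambda>x. indicator \<Omega> x *\<^sub>R G x" lebesgue b] assms(1)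
    unfolding in_L2_def set_borel_measurable_def by (simp only:)
  then have m: "set_borel_measurable lebesgue \<Omega> (\<lambda>x. G x \<bullet> b)" unfolding set_borel_measurable_def by simp
  have "set_integrable lebesgue \<Omega> (\<lambda>x. (norm (G x \<bullet> b))\<^sup>2)"
  proof (rule set_integrable_bound)
    show "set_integrable lebesgue \<Omega> (\<lambda>x. (norm (G x))\<^sup>2)" using assms(1) by (simp add: in_L2_def)
    show "set_borel_measurable lebesgue \<Omega> (\<lambda>x. (norm (G x \<bullet> b))\<^sup>2)"
      unfolding power2_norm_eq_inner by (intro set_borel_measurable_inner m)
    show "AE x in lebesgue. x \<in> \<Omega> \<longrightarrow> norm ((norm (G x \<bullet> b))\<^sup>2) \<le> norm ((norm (G x))\<^sup>2)"
    proof (intro AE_I2 impI)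
      fix x
      have "(G x \<bullet> b)\<^sup>2 \<le> (norm (G x))\<^sup>2"
        by (rule abs_le_square_iff[THEN iffD1]) (use Basis_le_norm[OF assms(2), of "G x"] in simp)
      then show "norm ((norm (G x \<bullet> b))\<^sup>2) \<le> norm ((norm (G x))\<^sup>2)"
        unfolding real_norm_def power2_abs abs_power2 .
    qed
  qed
  then show ?thesis using m unfolding in_L2_def by simp
qed

lemma has_weak_grad_unique:
  fixes u :: "'a::euclidean_space \<Rightarrow> real"
  assumes \<Omega>: "open \<Omega>" "bounded \<Omega>" and G: "has_weak_grad \<Omega> u G" and H: "has_weak_grad \<Omega> u H"
  shows "AE x in lebesgue. x \<in> \<Omega> \<longrightarrow> G x = H x"
proof -
  have L: "in_L2 \<Omega> G" "in_L2 \<Omega> H" using G H by (auto simp: has_weak_grad_def)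
  have "AE x in lebesgue. x \<in> \<Omega> \<longrightarrow> G x \<bullet> b - H x \<bullet> b = 0" if b: "b \<in> Basis" for b
  proof (rule AE_zero_if_test_integrals_zero[OF \<Omega>(1)])
    have c: "in_L2 \<Omega> (\<lambda>x. 1 :: real)" using \<Omega> by (intro in_L2_continuous[where C = 1]) auto
    note Lb = in_L2_component[OF L(1) b] in_L2_component[OF L(2) b]
    show "set_integrable lebesgue \<Omega> (\<lambda>x. G x \<bullet> b - H x \<bullet> b)"
      using in_L2_inner_integrable[OF Lb(1) c] in_L2_inner_integrable[OF Lb(2) c] by auto
    fix \<phi> assume \<phi>: "test_function \<Omega> \<phi>"
    note i = in_L2_inner_integrable[OF Lb(1) in_L2_test(1)[OF \<Omega> \<phi>]] in_L2_inner_integrable[OF Lb(2) in_L2_test(1)[OF \<Omega> \<phi>]]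
    have "(LINT x:\<Omega>|lebesgue. u x * frechet_derivative \<phi> (at x) b) = - (LINT x:\<Omega>|lebesgue. (G x \<bullet> b) * \<phi> x)"
      "(LINT x:\<Omega>|lebesgue. u x * frechet_derivative \<phi> (at x) b) = - (LINT x:\<Omega>|lebesgue. (H x \<bullet> b) * \<phi> x)"
      using G H \<phi> b unfolding has_weak_grad_def by blast+
    then have "(LINT x:\<Omega>|lebesgue. (G x \<bullet> b) * \<phi> x) = (LINT x:\<Omega>|lebesgue. (H x \<bullet> b) * \<phi> x)" by simp
    then show "(LINT x:\<Omega>|lebesgue. (G x \<bullet> b - H x \<bullet> b) * \<phi> x) = 0"
      using set_integral_diff(2)[OF i] by (simp add: left_diff_distrib)
  qed
  then have "AE x in lebesgue. \<forall>b\<in>Basis. x \<in> \<Omega> \<longrightarrow> G x \<bullet> b - H x \<bullet> b = 0"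
    by (intro AE_finite_allI) auto
  then show ?thesis by eventually_elim (auto intro: euclidean_eqI)
qed

lemma has_weak_grad_linear:
  fixes u w :: "'a::euclidean_space \<Rightarrow> real"
  assumes \<Omega>: "open \<Omega>" "bounded \<Omega>" and L: "in_L2 \<Omega> u" "in_L2 \<Omega> w"
    and G: "has_weak_grad \<Omega> u G" and H: "has_weak_grad \<Omega> w H"
  shows "has_weak_grad \<Omega> (\<lambda>x. \<alpha> * u x + w x) (\<lambda>x. \<alpha> *\<^sub>R G x + H x)"
  unfolding has_weak_grad_def
proof (intro conjI allI impI ballI)
  have LG: "in_L2 \<Omega> G" "in_L2 \<Omega> H" using G H by (auto simp: has_weak_grad_def)
  then show "in_L2 \<Omega> (\<lambda>x. \<alpha> *\<^sub>R G x + H x)" by (intro in_L2_add in_L2_scaleR)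
  fix \<phi> and b :: 'a assume \<phi>: "test_function \<Omega> \<phi>" and b: "b \<in> Basis"
  let ?d = "\<lambda>x. frechet_derivative \<phi> (at x) b"
  note T = in_L2_test(1)[OF \<Omega> \<phi>] in_L2_test(2)[OF \<Omega> \<phi> b]
  note i = in_L2_inner_integrable[OF L(1) T(2), simplified] in_L2_inner_integrable[OF L(2) T(2), simplified]
    in_L2_inner_integrable[OF in_L2_component[OF LG(1) b] T(1), simplified]
    in_L2_inner_integrable[OF in_L2_component[OF LG(2) b] T(1), simplified]
  have "(LINT x:\<Omega>|lebesgue. (\<alpha> * u x + w x) * ?d x) = (LINT x:\<Omega>|lebesgue. \<alpha> * (u x * ?d x) + w x * ?d x)"
    by (simp add: distrib_right mult.assoc)
  also have "\<dots> = \<alpha> * (LINT x:\<Omega>|lebesgue. u x * ?d x) + (LINT x:\<Omega>|lebesgue. w x * ?d x)"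
    using set_integral_add(2)[OF set_integrable_mult_right[OF i(1)] i(2), of \<alpha>] by simp
  also have "\<dots> = - (\<alpha> * (LINT x:\<Omega>|lebesgue. (G x \<bullet> b) * \<phi> x) + (LINT x:\<Omega>|lebesgue. (H x \<bullet> b) * \<phi> x))"
    using G H \<phi> b unfolding has_weak_grad_def by simp
  also have "\<dots> = - (LINT x:\<Omega>|lebesgue. \<alpha> * ((G x \<bullet> b) * \<phi> x) + (H x \<bullet> b) * \<phi> x)"
    using set_integral_add(2)[OF set_integrable_mult_right[OF i(3)] i(4), of \<alpha>] by simp
  also have "\<dots> = - (LINT x:\<Omega>|lebesgue. ((\<alpha> *\<^sub>R G x + H x) \<bullet> b) * \<phi> x)"
    by (simp add: inner_add_left distrib_right mult.assoc)
  finally show "(LINT x:\<Omega>|lebesgue. (\<alpha> * u x + w x) * ?d x) = - (LINT x:\<Omega>|lebesgue. ((\<alpha> *\<^sub>R G x + H x) \<bullet> b) * \<phi> x)" .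
qed

lemma weak_grad_works: "w \<in> H1_0 \<Omega> \<Longrightarrow> has_weak_grad \<Omega> w (weak_grad \<Omega> w)"
proof -
  assume "w \<in> H1_0 \<Omega>"
  then obtain G where "has_weak_grad \<Omega> w G" unfolding H1_0_def by blast
  then show ?thesis unfolding weak_grad_def by (rule someI[of "has_weak_grad \<Omega> w"])
qed

text \<open>The chosen representatives are not linear in the function, but by uniqueness they are so up to a
  null set.\<close>
lemma weak_grad_linear:
  fixes u w :: "'a::euclidean_space \<Rightarrow> real"
  assumes \<Omega>: "open \<Omega>" "bounded \<Omega>" and H: "u \<in> H1_0 \<Omega>" "w \<in> H1_0 \<Omega>" "(\<lambda>x. \<alpha> * u x + w x) \<in> H1_0 \<Omega>"
  shows "AE x in lebesgue. x \<in> \<Omega> \<longrightarrow>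
    weak_grad \<Omega> (\<lambda>x. \<alpha> * u x + w x) x = \<alpha> *\<^sub>R weak_grad \<Omega> u x + weak_grad \<Omega> w x"
proof (rule has_weak_grad_unique[OF \<Omega> weak_grad_works[OF H(3)]])
  show "has_weak_grad \<Omega> (\<lambda>x. \<alpha> * u x + w x) (\<lambda>x. \<alpha> *\<^sub>R weak_grad \<Omega> u x + weak_grad \<Omega> w x)"
    using H by (intro has_weak_grad_linear \<Omega> weak_grad_works) (auto simp: H1_0_def)
qed

section \<open>The discrete space is finite-dimensional\<close>

text \<open>The functions \<open>m i\<close> need not lie in the image of \<open>S\<close>. By induction on \<open>I\<close>: the elements of \<open>S\<close>
  that have a representation without the index \<open>j\<close> form a subspace, and any single element outside
  of it completes this subspace to \<open>S\<close>.\<close>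
lemma finite_dim_by_representation:
  fixes S :: "'v::real_vector set" and ev :: "'v \<Rightarrow> 'x \<Rightarrow> real" and m :: "'i \<Rightarrow> 'x \<Rightarrow> real"
  assumes ev: "\<And>v w x. ev (v + w) x = ev v x + ev w x" "\<And>a v x. ev (a *\<^sub>R v) x = a * ev v x"
    and inj: "\<And>v. (\<And>x. ev v x = 0) \<Longrightarrow> v = 0"
    and "finite I" "subspace S" and rep: "\<And>w. w \<in> S \<Longrightarrow> \<exists>a. \<forall>x. ev w x = (\<Sum>i\<in>I. a i * m i x)"
  shows "\<exists>B. finite B \<and> B \<subseteq> S \<and> S \<subseteq> span B"
  using assms(4-6)
proof (induction I arbitrary: S rule: finite_induct)
  case empty
  then have "S \<subseteq> {0}" using inj by auto
  then show ?case by (intro exI[of _ "{}"]) auto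
next
  case (insert j I)
  define S' where "S' = {w \<in> S. \<exists>a. \<forall>x. ev w x = (\<Sum>i\<in>I. a i * m i x)}"
  have ev0: "ev 0 x = 0" for x using ev(2)[of 0 0 x] by simp
  have "subspace S'"
  proof (rule subspaceI)
    show "0 \<in> S'" unfolding S'_def using subspace_0[OF insert.prems(1)] by (auto intro!: exI[of _ "\<lambda>_. 0"] simp: ev0)
    show "v + w \<in> S'" if vw: "v \<in> S'" "w \<in> S'" for v w
    proof -
      obtain a b where "\<And>x. ev v x = (\<Sum>i\<in>I. a i * m i x)" "\<And>x. ev w x = (\<Sum>i\<in>I. b i * m i x)"
        using vw unfolding S'_def by blast
      then have "ev (v + w) x = (\<Sum>i\<in>I. (a i + b i) * m i x)" for x by (simp add: ev distrib_right sum.distrib)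
      moreover have "v + w \<in> S" using vw subspace_add[OF insert.prems(1)] by (simp add: S'_def)
      ultimately show ?thesis unfolding S'_def mem_Collect_eq by (intro conjI exI[of _ "\<lambda>i. a i + b i"]) auto
    qed
    show "c *\<^sub>R v \<in> S'" if v: "v \<in> S'" for c v
    proof -
      obtain a where "\<And>x. ev v x = (\<Sum>i\<in>I. a i * m i x)" using v unfolding S'_def by blast
      then have "ev (c *\<^sub>R v) x = (\<Sum>i\<in>I. (c * a i) * m i x)" for x by (simp add: ev sum_distrib_left mult.assoc)
      moreover have "c *\<^sub>R v \<in> S" using v subspace_scale[OF insert.prems(1)] by (simp add: S'_def)
      ultimately show ?thesis unfolding S'_def mem_Collect_eq by (intro conjI exI[of _ "\<lambda>i. c * a i"]) auto
    qed
  qed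
  moreover have "\<And>w. w \<in> S' \<Longrightarrow> \<exists>a. \<forall>x. ev w x = (\<Sum>i\<in>I. a i * m i x)" by (simp add: S'_def)
  ultimately obtain B where B: "finite B" "B \<subseteq> S'" "S' \<subseteq> span B" using insert.IH[of S'] by blast
  have BS: "B \<subseteq> S" using B(2) by (auto simp: S'_def)
  show ?case
  proof (cases "S \<subseteq> S'")
    case True
    then show ?thesis using B BS by blast
  next
    case False
    then obtain w0 where w0: "w0 \<in> S" "w0 \<notin> S'" by blast
    obtain a0 where a0: "\<And>x. ev w0 x = (\<Sum>i\<in>insert j I. a0 i * m i x)" using insert.prems(2)[OF w0(1)] by blast
    have "a0 j \<noteq> 0"
    proof
      assume "a0 j = 0"
      then have "\<And>x. ev w0 x = (\<Sum>i\<in>I. a0 i * m i x)" using a0 insert.hyps by simp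
      then show False using w0 unfolding S'_def mem_Collect_eq by metis
    qed
    have "w \<in> span (insert w0 B)" if w: "w \<in> S" for w
    proof -
      obtain a where a: "\<And>x. ev w x = (\<Sum>i\<in>insert j I. a i * m i x)" using insert.prems(2)[OF w] by blast
      define t where "t = a j / a0 j"
      have "ev (w + (- t) *\<^sub>R w0) x = (\<Sum>i\<in>I. (a i - t * a0 i) * m i x)" for x
        unfolding ev a a0 using insert.hyps \<open>a0 j \<noteq> 0\<close>
        by (simp add: t_def left_diff_distrib sum_subtractf sum_distrib_left sum_negf algebra_simps)
      moreover have "w + (- t) *\<^sub>R w0 \<in> S" using w w0(1) insert.prems(1) by (intro subspace_add subspace_scale)
      ultimately have "w + (- t) *\<^sub>R w0 \<in> S'" unfolding S'_def mem_Collect_eq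
        by (intro conjI exI[of _ "\<lambda>i. a i - t * a0 i"]) auto
      then have 1: "w + (- t) *\<^sub>R w0 \<in> span (insert w0 B)" using B(3) span_mono[of B "insert w0 B"] by blast
      have "w0 \<in> span (insert w0 B)" by (intro span_base) simp
      from span_add[OF 1 span_scale[OF this, of t]] show ?thesis by simp
    qed
    then show ?thesis using B(1) BS w0(1) by (intro exI[of _ "insert w0 B"]) auto
  qed
qed

text \<open>The monomials on the single cells, cut off in a way that makes the cells disjoint, represent all
  elements, although they are not continuous.\<close>
lemma pw_polynomials_finite_dim:
  fixes S :: "('a::euclidean_space \<Rightarrow>\<^sub>C real) set"
  assumes \<T>: "finite \<T>" "\<Union>\<T> = closure \<Omega>" and S: "subspace S" "S \<subseteq> pw_polynomials \<Omega> \<T> p"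
  shows "\<exists>B. finite B \<and> B \<subseteq> S \<and> S \<subseteq> span B"
proof -
  define A where "A = {\<alpha> \<in> (Basis :: 'a set) \<rightarrow>\<^sub>E {..p}. (\<Sum>b\<in>Basis. \<alpha> b) \<le> p}"
  have finA: "finite A" unfolding A_def by (rule finite_subset[of _ "(Basis :: 'a set) \<rightarrow>\<^sub>E {..p}"]) (auto intro: finite_PiE)
  \<comment> \<open>every point of the domain is assigned to one cell that contains it\<close>
  have "\<forall>x\<in>\<Omega>. \<exists>K\<in>\<T>. x \<in> K" using \<T>(2) closure_subset[of \<Omega>] by blast
  then obtain \<kappa> where \<kappa>: "\<And>x. x \<in> \<Omega> \<Longrightarrow> \<kappa> x \<in> \<T> \<and> x \<in> \<kappa> x" by metis
  define m where "m i x = (if x \<in> \<Omega> \<and> \<kappa> x = fst i then \<Prod>b\<in>Basis. (x \<bullet> b) ^ snd i b else 0)"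
    for i :: "'a set \<times> ('a \<Rightarrow> nat)" and x :: 'a
  show ?thesis
  proof (rule finite_dim_by_representation[where ev = apply_bcontfun and I = "\<T> \<times> A" and m = m])
    fix w assume "w \<in> S"
    then have w0: "\<And>x. x \<notin> \<Omega> \<Longrightarrow> apply_bcontfun w x = 0"
      and "\<forall>K\<in>\<T>. \<exists>P\<in>polys_le p. \<forall>x\<in>K. apply_bcontfun w x = P x"
      using S(2) unfolding pw_polynomials_def by blast+
    then have "\<forall>K\<in>\<T>. \<exists>a. \<forall>x\<in>K. apply_bcontfun w x = (\<Sum>\<alpha>\<in>A. a \<alpha> * (\<Prod>b\<in>Basis. (x \<bullet> b) ^ \<alpha> b))"
      unfolding polys_le_def A_def by fastforce
    then obtain a where a: "\<And>K x. K \<in> \<T> \<Longrightarrow> x \<in> K \<Longrightarrow> apply_bcontfun w x = (\<Sum>\<alpha>\<in>A. a K \<alpha> * (\<Prod>b\<in>Basis. (x \<bullet> b) ^ \<alpha> b))"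
      by metis
    have "apply_bcontfun w x = (\<Sum>i\<in>\<T> \<times> A. a (fst i) (snd i) * m i x)" for x
    proof (cases "x \<in> \<Omega>")
      case True
      have "(\<Sum>i\<in>\<T> \<times> A. a (fst i) (snd i) * m i x) = (\<Sum>K\<in>\<T>. \<Sum>\<alpha>\<in>A. a K \<alpha> * m (K, \<alpha>) x)"
        by (simp add: sum.cartesian_product split_beta)
      also have "\<dots> = (\<Sum>K\<in>\<T>. if K = \<kappa> x then (\<Sum>\<alpha>\<in>A. a K \<alpha> * (\<Prod>b\<in>Basis. (x \<bullet> b) ^ \<alpha> b)) else 0)"
        using True by (intro sum.cong) (auto simp: m_def)
      also have "\<dots> = (\<Sum>\<alpha>\<in>A. a (\<kappa> x) \<alpha> * (\<Prod>b\<in>Basis. (x \<bullet> b) ^ \<alpha> b))"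
        using \<T>(1) \<kappa>[OF True] by simp
      also have "\<dots> = apply_bcontfun w x" using a[of "\<kappa> x" x] \<kappa>[OF True] by simp
      finally show ?thesis by simp
    qed (simp add: w0 m_def)
    then show "\<exists>c. \<forall>x. apply_bcontfun w x = (\<Sum>i\<in>\<T> \<times> A. c i * m i x)"
      by (intro exI[of _ "\<lambda>i. a (fst i) (snd i)"] allI)
  qed (use \<T>(1) finA S(1) in \<open>auto intro: bcontfun_eqI\<close>)
qed

text \<open>The Gram--Schmidt process for a form that is positive definite on a subspace only.\<close>
lemma orthonormal_basis_exists:
  fixes M :: "'v::real_normed_vector \<Rightarrow> 'v \<Rightarrow> real"
  assumes M: "bounded_bilinear M" and sym: "\<And>x y. M x y = M y x" and S: "subspace S"
    and pos: "\<And>x. x \<in> S \<Longrightarrow> x \<noteq> 0 \<Longrightarrow> M x x > 0"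
    and B: "finite B" "B \<subseteq> S"
  shows "\<exists>E. finite E \<and> E \<subseteq> S \<and> B \<subseteq> span E \<and> (\<forall>e\<in>E. \<forall>e'\<in>E. M e e' = (if e = e' then 1 else 0))"
  using B
proof (induction B rule: finite_induct)
  case empty
  then show ?case by (intro exI[of _ "{}"]) auto
next
  case (insert b B)
  interpret bounded_bilinear M by (rule M)
  obtain E where E: "finite E" "E \<subseteq> S" "B \<subseteq> span E" "\<forall>e\<in>E. \<forall>e'\<in>E. M e e' = (if e = e' then 1 else 0)"
    using insert by auto
  define r where "r = b - (\<Sum>e\<in>E. M b e *\<^sub>R e)"
  have sE: "(\<Sum>e\<in>E. M b e *\<^sub>R e) \<in> span E" by (intro span_sum span_scale span_base)
  have rS: "r \<in> S" unfolding r_def using insert.prems E(2) S by (intro subspace_diff subspace_sum subspace_scale) auto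
  show ?case
  proof (cases "r = 0")
    case True
    then have "b \<in> span E" using sE by (simp add: r_def)
    then show ?thesis using E by blast
  next
    case False
    define e0 where "e0 = (1 / sqrt (M r r)) *\<^sub>R r"
    have Mr: "M r r > 0" using pos[OF rS False] .
    have re: "M r e = 0" if "e \<in> E" for e
    proof -
      have "(\<Sum>e'\<in>E. M b e' * M e' e) = (\<Sum>e'\<in>E. if e' = e then M b e else 0)"
        using E(4) that by (intro sum.cong) auto
      then show ?thesis using that E(1) by (simp add: r_def diff_left sum_left scaleR_left)
    qed
    have e0: "M e0 e = 0" "M e e0 = 0" if "e \<in> E" for e
      using re[OF that] sym[of e r] by (simp_all add: e0_def scaleR_left scaleR_right)
    have e00: "M e0 e0 = 1" using Mr by (simp add: e0_def scaleR_left scaleR_right)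
    have "r = sqrt (M r r) *\<^sub>R e0" using Mr by (simp add: e0_def)
    then have "b = sqrt (M r r) *\<^sub>R e0 + (\<Sum>e\<in>E. M b e *\<^sub>R e)" by (simp add: r_def algebra_simps)
    moreover have "(\<Sum>e\<in>E. M b e *\<^sub>R e) \<in> span (insert e0 E)" using sE span_mono[of E "insert e0 E"] by blast
    then have "sqrt (M r r) *\<^sub>R e0 + (\<Sum>e\<in>E. M b e *\<^sub>R e) \<in> span (insert e0 E)"
      by (intro span_add span_scale) (auto intro: span_base)
    ultimately have "b \<in> span (insert e0 E)" by simp
    moreover have "B \<subseteq> span (insert e0 E)" using E(3) span_mono[of E "insert e0 E"] by blast
    moreover have "e0 \<in> S" unfolding e0_def using rS S by (intro subspace_scale)
    moreover have "e0 \<notin> E" using e0 e00 by force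
    ultimately show ?thesis using E e0 e00 by (intro exI[of _ "insert e0 E"]) auto
  qed
qed

lemma orthonormal_expansion:
  fixes M :: "'v::real_normed_vector \<Rightarrow> 'v \<Rightarrow> real"
  assumes M: "bounded_bilinear M" and E: "finite E" "\<forall>e\<in>E. \<forall>e'\<in>E. M e e' = (if e = e' then 1 else 0)"
    and x: "x \<in> span E"
  shows "x = (\<Sum>e\<in>E. M x e *\<^sub>R e)"
proof -
  interpret bounded_bilinear M by (rule M)
  obtain a where a: "x = (\<Sum>e\<in>E. a e *\<^sub>R e)" using x E(1) by (auto simp: span_finite)
  have "M x e = a e" if "e \<in> E" for e
  proof -
    have "M x e = (\<Sum>e'\<in>E. if e' = e then a e else 0)" unfolding a sum_left scaleR_left
      using E(2) that by (intro sum.cong) auto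
    then show ?thesis using E(1) that by simp
  qed
  then have "(\<Sum>e\<in>E. M x e *\<^sub>R e) = (\<Sum>e\<in>E. a e *\<^sub>R e)" by (intro sum.cong) auto
  then show ?thesis using a by simp
qed

section \<open>The mass form and the Nemytskii operator\<close>

definition mass :: "'a::euclidean_space set \<Rightarrow> ('a \<Rightarrow>\<^sub>C real) \<Rightarrow> ('a \<Rightarrow>\<^sub>C real) \<Rightarrow> real" where
  "mass \<Omega> u w = L2_inner \<Omega> (apply_bcontfun u) (apply_bcontfun w)"

lemma mass_commute: "mass \<Omega> u w = mass \<Omega> w u"
  unfolding mass_def by (rule L2_inner_commute)

lemma bounded_bilinear_mass:
  assumes \<Omega>: "open \<Omega>" "bounded \<Omega>"
  shows "bounded_bilinear (mass \<Omega>)"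
proof -
  note L = in_L2_bcontfun[OF \<Omega>]
  have add: "mass \<Omega> (u + v) w = mass \<Omega> u w + mass \<Omega> v w" for u v w
    unfolding mass_def using L2_inner_add_left[OF L L L, of u v w] by simp
  have sc: "mass \<Omega> (a *\<^sub>R u) w = a * mass \<Omega> u w" for a u w
    unfolding mass_def using L2_inner_scaleR_left[of \<Omega> a "apply_bcontfun u" "apply_bcontfun w"] by simp
  have lm: "\<Omega> \<in> lmeasurable" using \<Omega> by (simp add: bounded_set_imp_lmeasurable)
  have bound: "\<bar>mass \<Omega> u w\<bar> \<le> norm u * norm w * measure lebesgue \<Omega>" for u w
  proof -
    have ic: "set_integrable lebesgue \<Omega> (\<lambda>x. norm u * norm w)" unfolding set_integrable_def using lm
      by (intro integrable_scaleR_left integrable_real_indicator) (auto simp: fmeasurable_def)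
    have "\<bar>mass \<Omega> u w\<bar> \<le> (LINT x|lebesgue. indicator \<Omega> x *\<^sub>R (norm u * norm w))"
      unfolding mass_def L2_inner_def set_lebesgue_integral_def real_norm_def[symmetric]
    proof (rule Bochner_Integration.integral_norm_bound_integral)
      show "integrable lebesgue (\<lambda>x. indicator \<Omega> x *\<^sub>R (apply_bcontfun u x \<bullet> apply_bcontfun w x))"
        using in_L2_inner_integrable[OF L L] unfolding set_integrable_def .
      show "integrable lebesgue (\<lambda>x. indicator \<Omega> x *\<^sub>R (norm u * norm w))" using ic unfolding set_integrable_def .
      have "\<bar>apply_bcontfun u x\<bar> * \<bar>apply_bcontfun w x\<bar> \<le> norm u * norm w" for x
        using norm_bounded[of u x] norm_bounded[of w x] by (intro mult_mono) auto
      then show "norm (indicator \<Omega> x *\<^sub>R (apply_bcontfun u x \<bullet> apply_bcontfun w x)) \<le> indicator \<Omega> x *\<^sub>R (norm u * norm w)" for x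
        by (simp add: indicator_def abs_mult)
    qed
    also have "\<dots> = norm u * norm w * measure lebesgue \<Omega>" by simp
    finally show ?thesis .
  qed
  show ?thesis
  proof
    show "mass \<Omega> (a + a') b = mass \<Omega> a b + mass \<Omega> a' b" "mass \<Omega> a (b + b') = mass \<Omega> a b + mass \<Omega> a b'" for a a' b b'
      using add mass_commute by metis+
    show "mass \<Omega> (r *\<^sub>R a) b = r *\<^sub>R mass \<Omega> a b" "mass \<Omega> a (r *\<^sub>R b) = r *\<^sub>R mass \<Omega> a b" for r a b
      using sc mass_commute by (metis real_scaleR_def)+
    show "\<exists>K. \<forall>a b. norm (mass \<Omega> a b) \<le> norm a * norm b * K"
      using bound by (intro exI[of _ "measure lebesgue \<Omega>"]) simp
  qed
qed

text \<open>The set where a continuous function does not vanish is open, so it is negligible only if it is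
  empty; that \<open>w\<close> vanishes outside of \<open>\<Omega>\<close> turns this into \<open>w = 0\<close>.\<close>
lemma mass_pos:
  assumes \<Omega>: "open \<Omega>" "bounded \<Omega>" and w: "\<And>x. x \<notin> \<Omega> \<Longrightarrow> apply_bcontfun w x = 0" and "w \<noteq> 0"
  shows "mass \<Omega> w w > 0"
proof -
  note L = in_L2_bcontfun[OF \<Omega>, of w]
  let ?f = "\<lambda>x. indicator \<Omega> x *\<^sub>R (apply_bcontfun w x \<bullet> apply_bcontfun w x)"
  have i: "integrable lebesgue ?f" using in_L2_inner_integrable[OF L L] unfolding set_integrable_def .
  have nn: "0 \<le> (LINT x|lebesgue. ?f x)" by (intro integral_nonneg_AE AE_I2) auto
  have "(LINT x|lebesgue. ?f x) \<noteq> 0"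
  proof
    assume "(LINT x|lebesgue. ?f x) = 0"
    then have "AE x in lebesgue. ?f x = 0"
      using i by (subst (asm) integral_nonneg_eq_0_iff_AE) auto
    then have ae: "AE x in lebesgue. x \<notin> {x. apply_bcontfun w x \<noteq> 0}"
      by eventually_elim (use w in \<open>auto simp: indicator_def split: if_splits\<close>)
    have op: "open {x. apply_bcontfun w x \<noteq> 0}"
      by (intro open_Collect_neq continuous_intros) auto
    then have "{x. apply_bcontfun w x \<noteq> 0} \<in> sets lebesgue" by simp
    then have "negligible {x. apply_bcontfun w x \<noteq> 0}"
      unfolding negligible_iff_null_sets using ae by (simp add: AE_iff_null_sets)
    with op have "{x. apply_bcontfun w x \<noteq> 0} = {}" using open_not_negligible by blast
    then show False using \<open>w \<noteq> 0\<close> by (auto intro: bcontfun_eqI)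
  qed
  with nn have "0 < (LINT x|lebesgue. ?f x)" by linarith
  then show ?thesis by (simp only: mass_def L2_inner_def set_lebesgue_integral_def)
qed

definition nemytskii :: "(real \<Rightarrow> real) \<Rightarrow> ('a::topological_space \<Rightarrow>\<^sub>C real) \<Rightarrow> ('a \<Rightarrow>\<^sub>C real)" where
  "nemytskii g u = Bcontfun (\<lambda>x. g (apply_bcontfun u x))"

lemma apply_nemytskii:
  assumes g: "continuous_on UNIV g"
  shows "apply_bcontfun (nemytskii g u) x = g (apply_bcontfun u x)"
proof -
  have "compact (g ` cball 0 (norm u))" using g by (intro compact_continuous_image) (auto intro: continuous_on_subset)
  then obtain C where C: "\<forall>y\<in>g ` cball 0 (norm u). norm y \<le> C" using compact_imp_bounded bounded_iff by metis
  have "(\<lambda>x. g (apply_bcontfun u x)) \<in> bcontfun"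
  proof (rule bcontfun_normI)
    show "continuous_on UNIV (\<lambda>x. g (apply_bcontfun u x))"
      by (rule continuous_on_compose2[OF g]) auto
    show "norm (g (apply_bcontfun u x)) \<le> C" for x
      using C norm_bounded[of u x] by auto
  qed
  then show ?thesis by (simp add: nemytskii_def Bcontfun_inverse)
qed

lemma real_mvt_bound:
  fixes g :: "real \<Rightarrow> real"
  assumes d: "\<And>x. (g has_real_derivative g' x) (at x)" and b: "\<And>x. x \<in> closed_segment a b \<Longrightarrow> \<bar>g' x - c\<bar> \<le> C"
  shows "\<bar>g b - g a - c * (b - a)\<bar> \<le> C * \<bar>b - a\<bar>"
proof -
  have "norm ((\<lambda>x. g x - c * x) b - (\<lambda>x. g x - c * x) a) \<le> C * norm (b - a)"
  proof (rule field_differentiable_bound[where S = "closed_segment a b" and f' = "\<lambda>x. g' x - c"])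
    show "((\<lambda>x. g x - c * x) has_field_derivative g' x - c) (at x within closed_segment a b)" for x
      by (rule has_field_derivative_at_within) (auto intro!: derivative_eq_intros d)
  qed (use b in auto)
  then show ?thesis by (simp add: algebra_simps)
qed

lemma nemytskii_lipschitz:
  assumes g: "\<And>x. (g has_real_derivative g' x) (at x)" and g': "continuous_on UNIV g'"
  shows "\<exists>C\<ge>0. \<forall>u v :: 'a::topological_space \<Rightarrow>\<^sub>C real. norm u \<le> \<rho> \<longrightarrow> norm v \<le> \<rho> \<longrightarrow>
    norm (nemytskii g u) \<le> C \<and> norm (nemytskii g u - nemytskii g v) \<le> C * norm (u - v)"
proof -
  have gc: "continuous_on UNIV g" using DERIV_continuous_on has_field_derivative_at_within[OF g] by blast
  have "compact (g ` cball 0 \<rho>)" using gc by (intro compact_continuous_image) (auto intro: continuous_on_subset)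
  then obtain C1 where C1: "\<forall>y\<in>g ` cball 0 \<rho>. norm y \<le> C1" using compact_imp_bounded bounded_iff by metis
  have "compact (g' ` cball 0 \<rho>)" using g' by (intro compact_continuous_image) (auto intro: continuous_on_subset)
  then obtain C2 where C2: "\<forall>y\<in>g' ` cball 0 \<rho>. norm y \<le> C2" using compact_imp_bounded bounded_iff by metis
  define C where "C = max 0 (max C1 C2)"
  show ?thesis
  proof (intro exI[of _ C] conjI allI impI)
    fix u v :: "'a \<Rightarrow>\<^sub>C real" assume uv: "norm u \<le> \<rho>" "norm v \<le> \<rho>"
    have m: "apply_bcontfun u x \<in> cball 0 \<rho>" "apply_bcontfun v x \<in> cball 0 \<rho>" for x
      using norm_bounded[of u x] norm_bounded[of v x] uv by auto
    show "norm (nemytskii g u) \<le> C"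
    proof (rule norm_bound)
      show "norm (apply_bcontfun (nemytskii g u) x) \<le> C" for x
        using C1 m(1)[of x] unfolding apply_nemytskii[OF gc] C_def by (auto simp: le_max_iff_disj)
    qed
    show "norm (nemytskii g u - nemytskii g v) \<le> C * norm (u - v)"
    proof (rule norm_bound)
      fix x
      have "\<bar>g (apply_bcontfun u x) - g (apply_bcontfun v x) - 0 * (apply_bcontfun u x - apply_bcontfun v x)\<bar>
          \<le> C * \<bar>apply_bcontfun u x - apply_bcontfun v x\<bar>"
      proof (rule real_mvt_bound[OF g])
        fix z assume "z \<in> closed_segment (apply_bcontfun v x) (apply_bcontfun u x)"
        then have "z \<in> cball 0 \<rho>" using closed_segment_subset[OF m(2) m(1) convex_cball] by blast
        then show "\<bar>g' z - 0\<bar> \<le> C" using C2 by (auto simp: C_def le_max_iff_disj)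
      qed
      also have "\<dots> \<le> C * norm (u - v)"
        using norm_bounded[of "u - v" x] by (intro mult_left_mono) (auto simp: C_def)
      finally show "norm (apply_bcontfun (nemytskii g u - nemytskii g v) x) \<le> C * norm (u - v)"
        by (simp add: apply_nemytskii[OF gc])
    qed
  qed (simp add: C_def)
qed

definition bmult :: "('a::topological_space \<Rightarrow>\<^sub>C real) \<Rightarrow> ('a \<Rightarrow>\<^sub>C real) \<Rightarrow> ('a \<Rightarrow>\<^sub>C real)" where
  "bmult u v = Bcontfun (\<lambda>x. apply_bcontfun u x * apply_bcontfun v x)"

lemma apply_bmult: "apply_bcontfun (bmult u v) x = apply_bcontfun u x * apply_bcontfun v x"
proof -
  have "(\<lambda>x. apply_bcontfun u x * apply_bcontfun v x) \<in> bcontfun"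
  proof (rule bcontfun_normI)
    show "norm (apply_bcontfun u x * apply_bcontfun v x) \<le> norm u * norm v" for x
      using norm_bounded[of u x] norm_bounded[of v x] by (auto simp: abs_mult intro: mult_mono)
  qed (auto intro!: continuous_intros)
  then show ?thesis by (simp add: bmult_def Bcontfun_inverse)
qed

text \<open>The mean value theorem applies at every point, and the uniform continuity of the derivative of
  \<open>g\<close> on a bounded interval makes the remainder small in the supremum norm.\<close>
lemma nemytskii_has_derivative:
  fixes u :: "'a::topological_space \<Rightarrow>\<^sub>C real"
  assumes g: "\<And>x. (g has_real_derivative g' x) (at x)" and g': "continuous_on UNIV g'"
  shows "(nemytskii g has_derivative bmult (nemytskii g' u)) (at u)"
  unfolding has_derivative_at_alt
proof (intro conjI allI impI)
  have gc: "continuous_on UNIV g" using DERIV_continuous_on has_field_derivative_at_within[OF g] by blast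
  show "bounded_linear (bmult (nemytskii g' u))"
  proof (rule bounded_linear_intro)
    show "norm (bmult (nemytskii g' u) h) \<le> norm h * norm (nemytskii g' u)" for h
    proof (rule norm_bound)
      show "norm (apply_bcontfun (bmult (nemytskii g' u) h) x) \<le> norm h * norm (nemytskii g' u)" for x
        using norm_bounded[of h x] norm_bounded[of "nemytskii g' u" x]
        by (auto simp: apply_bmult abs_mult mult.commute intro: mult_mono)
    qed
  qed (auto intro!: bcontfun_eqI simp: apply_bmult distrib_left)
  fix e :: real assume e: "e > 0"
  have "uniformly_continuous_on (cball 0 (norm u + 1)) g'"
    using g' by (intro compact_uniformly_continuous) (auto intro: continuous_on_subset)
  then obtain d where d: "d > 0" "\<And>a b. a \<in> cball 0 (norm u + 1) \<Longrightarrow> b \<in> cball 0 (norm u + 1) \<Longrightarrow> dist b a < d \<Longrightarrow> dist (g' b) (g' a) < e"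
    using e unfolding uniformly_continuous_on_def by metis
  show "\<exists>d>0. \<forall>v. norm (v - u) < d \<longrightarrow> norm (nemytskii g v - nemytskii g u - bmult (nemytskii g' u) (v - u)) \<le> e * norm (v - u)"
  proof (intro exI[of _ "min d 1"] conjI allI impI)
    fix v assume v: "norm (v - u) < min d 1"
    show "norm (nemytskii g v - nemytskii g u - bmult (nemytskii g' u) (v - u)) \<le> e * norm (v - u)"
    proof (rule norm_bound)
      fix x
      let ?a = "apply_bcontfun u x" and ?b = "apply_bcontfun v x"
      have ab: "\<bar>?b - ?a\<bar> \<le> norm (v - u)" using norm_bounded[of "v - u" x] by simp
      have a: "\<bar>?a\<bar> \<le> norm u" using norm_bounded[of u x] by simp
      have "\<bar>g ?b - g ?a - g' ?a * (?b - ?a)\<bar> \<le> e * \<bar>?b - ?a\<bar>"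
      proof (rule real_mvt_bound[OF g])
        fix z assume "z \<in> closed_segment ?a ?b"
        then have z: "\<bar>z - ?a\<bar> \<le> \<bar>?b - ?a\<bar>" by (auto simp: closed_segment_eq_real_ivl split: if_splits)
        have "z \<in> cball 0 (norm u + 1)" "?a \<in> cball 0 (norm u + 1)" "dist z ?a < d"
          using z ab a v by (auto simp: dist_real_def)
        then have "dist (g' z) (g' ?a) < e" using d(2) by blast
        then show "\<bar>g' z - g' ?a\<bar> \<le> e" by (simp add: dist_real_def)
      qed
      also have "\<dots> \<le> e * norm (v - u)" using ab e by (intro mult_left_mono) auto
      finally show "norm (apply_bcontfun (nemytskii g v - nemytskii g u - bmult (nemytskii g' u) (v - u)) x) \<le> e * norm (v - u)"
        by (simp add: apply_nemytskii[OF gc] apply_nemytskii[OF g'] apply_bmult)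
    qed
  qed (use d in auto)
qed

section \<open>Finite element spaces and the stiffness form\<close>

locale fem_space =
  fixes \<Omega> :: "'a::euclidean_space set" and c :: "'a \<Rightarrow> real" and S :: "('a \<Rightarrow>\<^sub>C real) set" and C :: real
  assumes \<Omega>: "open \<Omega>" "bounded \<Omega>"
    and c: "set_borel_measurable lebesgue \<Omega> c" "\<And>x. x \<in> \<Omega> \<Longrightarrow> \<bar>c x\<bar> \<le> C"
    and S_subspace: "subspace S" and S_H1: "\<And>w. w \<in> S \<Longrightarrow> apply_bcontfun w \<in> H1_0 \<Omega>"
    and S_zero: "\<And>w x. w \<in> S \<Longrightarrow> x \<notin> \<Omega> \<Longrightarrow> apply_bcontfun w x = 0"
    and S_dim: "\<exists>B. finite B \<and> B \<subseteq> S \<and> S \<subseteq> span B"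
begin

lemma galerkin_basis_exists: "\<exists>E. galerkin_space S (mass \<Omega>) E"
proof -
  obtain B where B: "finite B" "B \<subseteq> S" "S \<subseteq> span B" using S_dim by blast
  obtain E where E: "finite E" "E \<subseteq> S" "B \<subseteq> span E" "\<forall>e\<in>E. \<forall>e'\<in>E. mass \<Omega> e e' = (if e = e' then 1 else 0)"
    using orthonormal_basis_exists[OF bounded_bilinear_mass[OF \<Omega>] mass_commute S_subspace mass_pos[OF \<Omega>] B(1,2)] S_zero
    by blast
  have "S \<subseteq> span E" using B(3) span_minimal[OF E(3) subspace_span] by blast
  then have "galerkin_space S (mass \<Omega>) E"
    using orthonormal_expansion[OF bounded_bilinear_mass[OF \<Omega>] E(1,4)] S_subspace bounded_bilinear_mass[OF \<Omega>] mass_commute E(1,2)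
    unfolding galerkin_space_def by blast
  then show ?thesis by blast
qed

definition basis :: "('a \<Rightarrow>\<^sub>C real) set" where
  "basis = (SOME E. galerkin_space S (mass \<Omega>) E)"

sublocale galerkin_space S "mass \<Omega>" basis
  unfolding basis_def by (rule someI_ex[OF galerkin_basis_exists])

definition stiffness :: "('a \<Rightarrow>\<^sub>C real) \<Rightarrow> ('a \<Rightarrow>\<^sub>C real) \<Rightarrow> real" where
  "stiffness u w = L2_inner \<Omega> (\<lambda>x. (c x)\<^sup>2 *\<^sub>R weak_grad \<Omega> u x) (weak_grad \<Omega> w)"

lemma weak_grad_L2: "w \<in> S \<Longrightarrow> in_L2 \<Omega> (weak_grad \<Omega> w)"
  using weak_grad_works[OF S_H1] unfolding has_weak_grad_def by blast

lemma flux_L2: "w \<in> S \<Longrightarrow> in_L2 \<Omega> (\<lambda>x. (c x)\<^sup>2 *\<^sub>R weak_grad \<Omega> w x)"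
proof (rule in_L2_bounded_mult[where C = "C\<^sup>2"])
  show "set_borel_measurable lebesgue \<Omega> (\<lambda>x. (c x)\<^sup>2)"
    using set_borel_measurable_inner[OF c(1) c(1)] by (simp add: power2_eq_square)
  show "\<bar>(c x)\<^sup>2\<bar> \<le> C\<^sup>2" if "x \<in> \<Omega>" for x
    using power_mono[OF c(2)[OF that], of 2] by simp
qed (rule weak_grad_L2)

lemma stiffness_commute: "stiffness u w = stiffness w u"
  unfolding stiffness_def L2_inner_def by (simp add: inner_commute)

lemma stiffness_linear:
  assumes "u \<in> S" "v \<in> S" "w \<in> S"
  shows "stiffness (\<alpha> *\<^sub>R u + v) w = \<alpha> * stiffness u w + stiffness v w"
proof -
  have uvS: "\<alpha> *\<^sub>R u + v \<in> S" using assms S_subspace by (intro subspace_add subspace_scale)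
  have ev: "apply_bcontfun (\<alpha> *\<^sub>R u + v) = (\<lambda>x. \<alpha> * u x + v x)" by auto
  have ae: "AE x in lebesgue. x \<in> \<Omega> \<longrightarrow>
      (c x)\<^sup>2 *\<^sub>R weak_grad \<Omega> (\<alpha> *\<^sub>R u + v) x = \<alpha> *\<^sub>R ((c x)\<^sup>2 *\<^sub>R weak_grad \<Omega> u x) + (c x)\<^sup>2 *\<^sub>R weak_grad \<Omega> v x"
    using weak_grad_linear[OF \<Omega> S_H1[OF assms(1)] S_H1[OF assms(2)], of \<alpha>] S_H1[OF uvS] unfolding ev
    by (auto elim!: eventually_mono simp: scaleR_add_right mult.commute)
  have "stiffness (\<alpha> *\<^sub>R u + v) w =
      L2_inner \<Omega> (\<lambda>x. \<alpha> *\<^sub>R ((c x)\<^sup>2 *\<^sub>R weak_grad \<Omega> u x) + (c x)\<^sup>2 *\<^sub>R weak_grad \<Omega> v x) (weak_grad \<Omega> w)"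
    unfolding stiffness_def using ae assms uvS
    by (intro L2_inner_cong_AE flux_L2 weak_grad_L2 in_L2_add in_L2_scaleR) auto
  also have "\<dots> = \<alpha> * stiffness u w + stiffness v w"
    using L2_inner_add_left[OF in_L2_scaleR[OF flux_L2[OF assms(1)]] flux_L2[OF assms(2)] weak_grad_L2[OF assms(3)], of \<alpha>]
    unfolding stiffness_def L2_inner_scaleR_left .
  finally show ?thesis .
qed

lemma stiffness_scale: "u \<in> S \<Longrightarrow> w \<in> S \<Longrightarrow> stiffness (\<alpha> *\<^sub>R u) w = \<alpha> * stiffness u w"
  using stiffness_linear[of u 0 w \<alpha>] stiffness_linear[of u 0 w 0] stiffness_linear[of 0 0 w 1] subspace_0[OF S_subspace] by simp

text \<open>On \<open>S\<close> the stiffness form agrees with an expression in the mass form, which makes sense for all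
  bounded continuous functions \<open>u\<close>.\<close>
lemma stiffness_expansion:
  assumes "u \<in> S" "w \<in> S"
  shows "stiffness u w = (\<Sum>e\<in>basis. mass \<Omega> u e * stiffness e w)"
proof -
  have z: "stiffness 0 w = 0" using stiffness_scale[of 0 w 0] subspace_0[OF S_subspace] assms(2) by simp
  have "stiffness (\<Sum>e\<in>A. a e *\<^sub>R e) w = (\<Sum>e\<in>A. a e * stiffness e w)" if "finite A" "A \<subseteq> S" for A a
    using that
  proof (induction A rule: finite_induct)
    case (insert x A)
    then have "(\<Sum>e\<in>A. a e *\<^sub>R e) \<in> S" using S_subspace by (intro subspace_sum subspace_scale) auto
    then show ?case using insert stiffness_linear[of x "\<Sum>e\<in>A. a e *\<^sub>R e" w "a x"] assms(2) by simp
  qed (simp add: z)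
  from this[OF finite_E E_subset, of "mass \<Omega> u"] show ?thesis using expansion[OF assms(1)] by simp
qed

section \<open>The semi-discrete acceleration\<close>

definition load :: "('a \<Rightarrow> real) \<Rightarrow> ('a \<Rightarrow>\<^sub>C real) \<Rightarrow> real" where
  "load f w = L2_inner \<Omega> f (apply_bcontfun w)"

lemma load_linear:
  assumes "in_L2 \<Omega> f"
  shows "load f (v + w) = load f v + load f w" "load f (\<alpha> *\<^sub>R v) = \<alpha> * load f v"
proof -
  show "load f (v + w) = load f v + load f w"
    using L2_inner_add_left[OF in_L2_bcontfun[OF \<Omega>] in_L2_bcontfun[OF \<Omega>] assms, of v w]
    unfolding load_def by (simp add: L2_inner_commute[of _ f])
  show "load f (\<alpha> *\<^sub>R v) = \<alpha> * load f v"
    using L2_inner_scaleR_left[of \<Omega> \<alpha> "apply_bcontfun v" f] unfolding load_def by (simp add: L2_inner_commute[of _ f])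
qed

lemma semidisc_acc_eq:
  assumes u: "u \<in> S" and F: "in_L2 \<Omega> (F s)" and g: "in_L2 \<Omega> (\<lambda>x. g (apply_bcontfun u x))"
  defines "a \<equiv> \<Sum>e\<in>basis. (load (F s) e - stiffness u e - load (\<lambda>x. g (apply_bcontfun u x)) e) *\<^sub>R e"
  shows "semidisc_acc \<Omega> c g F S u s = a" "a \<in> S"
    "w \<in> S \<Longrightarrow> mass \<Omega> a w = load (F s) w - stiffness u w - load (\<lambda>x. g (apply_bcontfun u x)) w"
proof -
  let ?l = "\<lambda>w. load (F s) w - stiffness u w - load (\<lambda>x. g (apply_bcontfun u x)) w"
  have lin: "?l (v + w) = ?l v + ?l w" "?l (\<alpha> *\<^sub>R v) = \<alpha> * ?l v" if "v \<in> S" "w \<in> S" for v w \<alpha>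
    using stiffness_linear[of v w u 1] stiffness_scale[of v u \<alpha>] that u
    by (simp_all add: load_linear[OF F] load_linear[OF g] stiffness_commute[of u] right_diff_distrib)
  have r: "a \<in> S" "\<And>w. w \<in> S \<Longrightarrow> mass \<Omega> a w = ?l w"
    unfolding a_def using riesz[of ?l] lin by blast+
  then show "a \<in> S" "w \<in> S \<Longrightarrow> mass \<Omega> a w = ?l w" by auto
  show "semidisc_acc \<Omega> c g F S u s = a"
    unfolding semidisc_acc_def
  proof (rule the_equality)
    show "a \<in> S \<and> (\<forall>w\<in>S. L2_inner \<Omega> a w + L2_inner \<Omega> (\<lambda>x. (c x)\<^sup>2 *\<^sub>R weak_grad \<Omega> u x) (weak_grad \<Omega> w)
     + L2_inner \<Omega> (\<lambda>x. g (apply_bcontfun u x)) w = L2_inner \<Omega> (F s) w)"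
      using r by (simp add: mass_def stiffness_def load_def)
    fix b assume b: "b \<in> S \<and> (\<forall>w\<in>S. L2_inner \<Omega> b w + L2_inner \<Omega> (\<lambda>x. (c x)\<^sup>2 *\<^sub>R weak_grad \<Omega> u x) (weak_grad \<Omega> w)
     + L2_inner \<Omega> (\<lambda>x. g (apply_bcontfun u x)) w = L2_inner \<Omega> (F s) w)"
    have "mass \<Omega> (b - a) w = 0" if "w \<in> S" for w
    proof -
      have "mass \<Omega> b w = ?l w" using b that by (auto simp: mass_def stiffness_def load_def)
      then show ?thesis using r(2)[OF that] by (simp only: M_simps)
    qed
    then have "b - a = 0" using b r(1) S_subspace by (intro M_nondegenerate subspace_diff) auto
    then show "b = a" by simp
  qed
qed

definition stiffness_op :: "('a \<Rightarrow>\<^sub>C real) \<Rightarrow> ('a \<Rightarrow>\<^sub>C real)" where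
  "stiffness_op u = (\<Sum>e\<in>basis. (\<Sum>e'\<in>basis. mass \<Omega> u e' * stiffness e' e) *\<^sub>R e)"

definition projection :: "('a \<Rightarrow>\<^sub>C real) \<Rightarrow> ('a \<Rightarrow>\<^sub>C real)" where
  "projection u = (\<Sum>e\<in>basis. mass \<Omega> u e *\<^sub>R e)"

definition load_vector :: "('a \<Rightarrow> real) \<Rightarrow> ('a \<Rightarrow>\<^sub>C real)" where
  "load_vector f = (\<Sum>e\<in>basis. load f e *\<^sub>R e)"

lemma bounded_linear_mass: "bounded_linear (\<lambda>u. mass \<Omega> u e)"
  by (rule bounded_bilinear.bounded_linear_left[OF bilinear])

lemma bounded_linear_ops: "bounded_linear stiffness_op" "bounded_linear projection"
proof -
  have "bounded_linear (\<lambda>u. \<Sum>e'\<in>basis. mass \<Omega> u e' * stiffness e' e)" for e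
    by (intro bounded_linear_sum bounded_linear_compose[OF bounded_linear_mult_left bounded_linear_mass])
  then show "bounded_linear stiffness_op"
    unfolding stiffness_op_def[abs_def] by (rule bounded_linear_sum[OF bounded_linear_scaleR_const])
  show "bounded_linear projection"
    unfolding projection_def[abs_def] by (intro bounded_linear_sum bounded_linear_scaleR_const bounded_linear_mass)
qed

lemma ops_in_S: "stiffness_op u \<in> S" "projection u \<in> S" "load_vector f \<in> S"
  unfolding stiffness_op_def projection_def load_vector_def using E_subset S_subspace
  by (auto intro!: subspace_sum subspace_scale)

text \<open>For general \<open>u\<close> the stiffness term has no meaning by itself. Its linear extension vanishes on the
  orthogonal complement of \<open>S\<close>; the nonlinear term is defined for all \<open>u\<close>.\<close>
definition acc_ext :: "(real \<Rightarrow> real) \<Rightarrow> (real \<Rightarrow> 'a \<Rightarrow> real) \<Rightarrow> ('a \<Rightarrow>\<^sub>C real) \<Rightarrow> real \<Rightarrow> ('a \<Rightarrow>\<^sub>C real)" where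
  "acc_ext g F u s = load_vector (F s) - stiffness_op u - projection (nemytskii g u)"

lemma semidisc_acc_eq_ext:
  assumes u: "u \<in> S" and F: "in_L2 \<Omega> (F s)" and g: "continuous_on UNIV g"
  shows "semidisc_acc \<Omega> c g F S u s = acc_ext g F u s"
proof -
  have gu: "(\<lambda>x. g (apply_bcontfun u x)) = apply_bcontfun (nemytskii g u)"
    using apply_nemytskii[OF g, of u] by auto
  have L: "in_L2 \<Omega> (\<lambda>x. g (apply_bcontfun u x))" unfolding gu by (rule in_L2_bcontfun[OF \<Omega>])
  have ld: "load (\<lambda>x. g (apply_bcontfun u x)) e = mass \<Omega> (nemytskii g u) e" for e
    unfolding load_def gu mass_def ..
  have st: "(\<Sum>e'\<in>basis. mass \<Omega> u e' * stiffness e' e) = stiffness u e" if "e \<in> basis" for e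
    using stiffness_expansion[OF u, of e] E_subset that by auto
  show ?thesis
    unfolding semidisc_acc_eq(1)[where F = F and s = s and g = g, OF u F L] acc_ext_def load_vector_def stiffness_op_def projection_def sum_subtractf[symmetric]
    using ld by (intro sum.cong refl) (simp add: st scaleR_left_diff_distrib)
qed

lemma acc_ext_derivative:
  assumes "\<And>x. (g has_real_derivative g' x) (at x)" "continuous_on UNIV g'"
  shows "((\<lambda>u. acc_ext g F u s) has_derivative (\<lambda>h. - stiffness_op h - projection (bmult (nemytskii g' u) h))) (at u)"
proof -
  have "((\<lambda>u. load_vector (F s) - stiffness_op u - projection (nemytskii g u)) has_derivative
      (\<lambda>h. 0 - stiffness_op h - projection (bmult (nemytskii g' u) h))) (at u)"
    using nemytskii_has_derivative[OF assms]
    by (intro has_derivative_diff has_derivative_const bounded_linear_imp_has_derivative bounded_linear_ops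
      bounded_linear.has_derivative[OF bounded_linear_ops(2)])
  then show ?thesis by (simp add: acc_ext_def)
qed

text \<open>On \<open>S\<close> the first operator represents the stiffness form, which is symmetric, and the second one
  the form $\int_\Omega q\,a\,b$.\<close>
lemma acc_derivative_symmetric:
  assumes a: "a \<in> S" and b: "b \<in> S"
  shows "mass \<Omega> (- stiffness_op a - projection (bmult q a)) b = mass \<Omega> a (- stiffness_op b - projection (bmult q b))"
proof -
  have st: "mass \<Omega> (stiffness_op a) b = stiffness a b" if "a \<in> S" "b \<in> S" for a b
  proof -
    have "mass \<Omega> (\<Sum>e\<in>basis. stiffness a e *\<^sub>R e) b = stiffness a b"
      using stiffness_linear[of _ _ a 1] stiffness_scale[of _ a] that
      by (intro riesz(2)) (auto simp: stiffness_commute[of a])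
    moreover have "stiffness_op a = (\<Sum>e\<in>basis. stiffness a e *\<^sub>R e)" unfolding stiffness_op_def
      using stiffness_expansion[OF that(1)] E_subset by (intro sum.cong) auto
    ultimately show ?thesis by simp
  qed
  have pr: "mass \<Omega> (projection v) b = mass \<Omega> v b" if "b \<in> S" for v b
    unfolding projection_def using that by (intro riesz(2)) (auto simp: M_simps)
  have "mass \<Omega> (bmult q a) b = mass \<Omega> (bmult q b) a"
    unfolding mass_def L2_inner_def by (simp add: apply_bmult mult_ac)
  then show ?thesis
    using st[OF a b] st[OF b a] pr[OF a, of "bmult q b"] pr[OF b, of "bmult q a"]
    by (simp add: M_simps M_sym[of a] stiffness_commute[of b] bounded_bilinear.minus_left[OF bilinear])
qed

text \<open>Continuity in time bounds the norm of \<open>F\<close> near each time, and finitely many such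
  neighbourhoods cover the time interval.\<close>
lemma load_bounded:
  fixes F :: "real \<Rightarrow> 'a \<Rightarrow> real"
  assumes F: "\<And>s. s \<in> {0..T} \<Longrightarrow> in_L2 \<Omega> (F s)"
    and cont: "\<And>s. s \<in> {0..T} \<Longrightarrow> ((\<lambda>r. LINT x:\<Omega>|lebesgue. (F r x - F s x)\<^sup>2) \<longlongrightarrow> 0) (at s within {0..T})"
  shows "\<exists>C. \<forall>s\<in>{0..T}. norm (load_vector (F s)) \<le> C"
proof -
  let ?N = "\<lambda>f :: 'a \<Rightarrow> real. L2_inner \<Omega> f f"
  \<comment> \<open>the square norm of \<open>F\<close> is locally bounded in time\<close>
  have "\<exists>d>0. \<exists>C. \<forall>r\<in>{0..T}. dist r s < d \<longrightarrow> ?N (F r) \<le> C" if s: "s \<in> {0..T}" for s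
  proof -
    have "eventually (\<lambda>r. (LINT x:\<Omega>|lebesgue. (F r x - F s x)\<^sup>2) < 1) (at s within {0..T})"
      using order_tendstoD(2)[OF cont[OF s], of 1] by simp
    then obtain d where d: "d > 0" "\<And>r. r \<in> {0..T} \<Longrightarrow> r \<noteq> s \<Longrightarrow> dist r s < d \<Longrightarrow> (LINT x:\<Omega>|lebesgue. (F r x - F s x)\<^sup>2) < 1"
      unfolding eventually_at by blast
    have "?N (F r) \<le> 2 + 2 * ?N (F s)" if r: "r \<in> {0..T}" "dist r s < d" for r
    proof -
      have L: "in_L2 \<Omega> (\<lambda>x. F r x + (- 1) *\<^sub>R F s x)" by (intro in_L2_add in_L2_scaleR F r s)
      have "(LINT x:\<Omega>|lebesgue. (F r x - F s x)\<^sup>2) \<le> 1"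
        using d(2)[OF r(1) _ r(2)] by (cases "r = s") auto
      then have "?N (\<lambda>x. F r x + (- 1) *\<^sub>R F s x) \<le> 1"
        unfolding L2_inner_def by (simp add: power2_eq_square)
      moreover have "?N (F r) \<le> (LINT x:\<Omega>|lebesgue. 2 * ((F r x + (- 1) *\<^sub>R F s x) \<bullet> (F r x + (- 1) *\<^sub>R F s x)) + 2 * (F s x \<bullet> F s x))"
        unfolding L2_inner_def
      proof (rule set_integral_mono)
        show "set_integrable lebesgue \<Omega> (\<lambda>x. F r x \<bullet> F r x)" by (intro in_L2_inner_integrable F r)
        show "set_integrable lebesgue \<Omega> (\<lambda>x. 2 * ((F r x + (- 1) *\<^sub>R F s x) \<bullet> (F r x + (- 1) *\<^sub>R F s x)) + 2 * (F s x \<bullet> F s x))"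
          by (intro set_integral_add set_integrable_mult_right in_L2_inner_integrable F s L)
        show "F r x \<bullet> F r x \<le> 2 * ((F r x + (- 1) *\<^sub>R F s x) \<bullet> (F r x + (- 1) *\<^sub>R F s x)) + 2 * (F s x \<bullet> F s x)" for x
          using zero_le_power2[of "F r x - 2 * F s x"] by (simp add: power2_eq_square algebra_simps)
      qed
      moreover have "\<dots> = 2 * ?N (\<lambda>x. F r x + (- 1) *\<^sub>R F s x) + 2 * ?N (F s)"
        unfolding L2_inner_def
        using set_integral_add(2)[OF set_integrable_mult_right[OF in_L2_inner_integrable[OF L L]]
          set_integrable_mult_right[OF in_L2_inner_integrable[OF F[OF s] F[OF s]]], of 2 2] by simp
      ultimately show ?thesis by linarith
    qed
    then show ?thesis using d(1) by blast
  qed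
  then obtain d C where dC: "\<And>s. s \<in> {0..T} \<Longrightarrow> d s > 0" "\<And>s r. s \<in> {0..T} \<Longrightarrow> r \<in> {0..T} \<Longrightarrow> dist r s < d s \<Longrightarrow> ?N (F r) \<le> C s"
    by metis
  have "{0..T} \<subseteq> (\<Union>s\<in>{0..T}. ball s (d s))" using dC(1) by (auto intro!: bexI)
  then obtain K where K: "K \<subseteq> {0..T}" "finite K" "{0..T} \<subseteq> (\<Union>s\<in>K. ball s (d s))"
    using compactE_image[OF compact_Icc, of "{0..T}" "\<lambda>s. ball s (d s)"] by (metis open_ball)
  define C0 where "C0 = (\<Sum>s\<in>K. \<bar>C s\<bar>)"
  have N: "?N (F r) \<le> C0" if r: "r \<in> {0..T}" for r
  proof -
    obtain s where s: "s \<in> K" "dist r s < d s" using K(3) r by (force simp: dist_commute)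
    have "?N (F r) \<le> \<bar>C s\<bar>" using dC(2)[of s r] s K(1) r by force
    also have "\<dots> \<le> C0" unfolding C0_def using s K(2) by (intro member_le_sum) auto
    finally show ?thesis .
  qed
  have "\<bar>load (F r) e\<bar> \<le> C0 + mass \<Omega> e e" if r: "r \<in> {0..T}" for r e
  proof -
    note L = F[OF r] in_L2_bcontfun[OF \<Omega>, of e]
    have pm: "load (F r) e \<le> ?N (F r) + mass \<Omega> e e" "- load (F r) e \<le> ?N (F r) + mass \<Omega> e e"
    proof -
      have i: "set_integrable lebesgue \<Omega> (\<lambda>x. F r x \<bullet> F r x + apply_bcontfun e x \<bullet> apply_bcontfun e x)"
        by (intro set_integral_add in_L2_inner_integrable L)
      have eq: "(LINT x:\<Omega>|lebesgue. F r x \<bullet> F r x + apply_bcontfun e x \<bullet> apply_bcontfun e x) = ?N (F r) + mass \<Omega> e e"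
        unfolding L2_inner_def mass_def by (intro set_integral_add in_L2_inner_integrable L)
      have y: "\<bar>a * b\<bar> \<le> a * a + b * b" for a b :: real
      proof -
        have "2 * \<bar>a * b\<bar> \<le> a * a + b * b"
          using sum_squares_bound[of "\<bar>a\<bar>" "\<bar>b\<bar>"] by (simp add: abs_mult power2_eq_square mult.assoc)
        then show ?thesis by simp
      qed
      have "(LINT x:\<Omega>|lebesgue. F r x \<bullet> apply_bcontfun e x) \<le> (LINT x:\<Omega>|lebesgue. F r x \<bullet> F r x + apply_bcontfun e x \<bullet> apply_bcontfun e x)"
        using y abs_le_D1 by (intro set_integral_mono in_L2_inner_integrable L i) auto
      then show "load (F r) e \<le> ?N (F r) + mass \<Omega> e e" unfolding eq load_def L2_inner_def .
      have "(LINT x:\<Omega>|lebesgue. - (F r x \<bullet> apply_bcontfun e x)) \<le> (LINT x:\<Omega>|lebesgue. F r x \<bullet> F r x + apply_bcontfun e x \<bullet> apply_bcontfun e x)"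
        using y abs_le_D2 in_L2_inner_integrable[OF L] by (intro set_integral_mono i) (auto simp: set_integrable_def)
      then show "- load (F r) e \<le> ?N (F r) + mass \<Omega> e e" unfolding eq load_def L2_inner_def
        by (simp add: set_lebesgue_integral_def)
    qed
    then show ?thesis using N[OF r] by linarith
  qed
  then have "norm (load_vector (F r)) \<le> (\<Sum>e\<in>basis. (C0 + mass \<Omega> e e) * norm e)" if "r \<in> {0..T}" for r
    unfolding load_vector_def using that
    by (intro order_trans[OF norm_sum] sum_mono) (auto intro!: mult_right_mono)
  then show ?thesis by blast
qed

lemma galerkin_flow_semidisc:
  assumes g: "\<And>x. (g has_real_derivative g' x) (at x)" "continuous_on UNIV g'"
    and F: "\<And>s. s \<in> {0..T} \<Longrightarrow> in_L2 \<Omega> (F s)"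
      "\<And>s. s \<in> {0..T} \<Longrightarrow> ((\<lambda>r. LINT x:\<Omega>|lebesgue. (F r x - F s x)\<^sup>2) \<longlongrightarrow> 0) (at s within {0..T})"
  shows "galerkin_flow S (mass \<Omega>) basis (semidisc_acc \<Omega> c g F S) (acc_ext g F) {0..T}"
proof
  have gc: "continuous_on UNIV g" using DERIV_continuous_on has_field_derivative_at_within[OF g(1)] by blast
  show "acc_ext g F x s \<in> S" for x s
    unfolding acc_ext_def by (intro subspace_diff S_subspace ops_in_S)
  show "semidisc_acc \<Omega> c g F S x s = acc_ext g F x s" if "x \<in> S" "s \<in> {0..T}" for x s
    using that by (intro semidisc_acc_eq_ext F gc)
  show "(\<lambda>x. acc_ext g F x s) differentiable (at x)" for x s
    using acc_ext_derivative[OF g] unfolding differentiable_def by blast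
  fix \<rho> :: real
  obtain C1 where C1: "\<And>s. s \<in> {0..T} \<Longrightarrow> norm (load_vector (F s)) \<le> C1" using load_bounded[OF F] by blast
  obtain K1 where K1: "K1 \<ge> 0" "\<And>x. norm (stiffness_op x) \<le> norm x * K1" using bounded_linear.nonneg_bounded[OF bounded_linear_ops(1)] by blast
  obtain K2 where K2: "K2 \<ge> 0" "\<And>x. norm (projection x) \<le> norm x * K2" using bounded_linear.nonneg_bounded[OF bounded_linear_ops(2)] by blast
  obtain C2 where C2: "C2 \<ge> 0" "\<And>u v :: 'a \<Rightarrow>\<^sub>C real. norm u \<le> \<rho> \<Longrightarrow> norm v \<le> \<rho> \<Longrightarrow>
      norm (nemytskii g u) \<le> C2 \<and> norm (nemytskii g u - nemytskii g v) \<le> C2 * norm (u - v)"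
    using nemytskii_lipschitz[OF g, of \<rho>] by blast
  define C' where "C' = \<bar>C1\<bar> + \<bar>\<rho>\<bar> * K1 + C2 * K2 + K1"
  show "\<exists>C\<ge>0. \<forall>s\<in>{0..T}. \<forall>x x'. norm x \<le> \<rho> \<longrightarrow> norm x' \<le> \<rho> \<longrightarrow>
      norm (acc_ext g F x s) \<le> C \<and> norm (acc_ext g F x s - acc_ext g F x' s) \<le> C * norm (x - x')"
  proof (intro exI[of _ C'] conjI ballI allI impI)
    show "C' \<ge> 0" using K1(1) K2(1) C2(1) by (simp add: C'_def)
    fix s and x x' :: "'a \<Rightarrow>\<^sub>C real" assume s: "s \<in> {0..T}" and x: "norm x \<le> \<rho>" "norm x' \<le> \<rho>"
    have "norm (acc_ext g F x s) \<le> norm (load_vector (F s)) + norm (stiffness_op x) + norm (projection (nemytskii g x))"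
      unfolding acc_ext_def by (intro order_trans[OF norm_triangle_ineq4] add_mono norm_triangle_ineq4 order_refl)
    also have "\<dots> \<le> \<bar>C1\<bar> + \<bar>\<rho>\<bar> * K1 + C2 * K2"
    proof (intro add_mono)
      show "norm (load_vector (F s)) \<le> \<bar>C1\<bar>" using C1[OF s] by simp
      show "norm (stiffness_op x) \<le> \<bar>\<rho>\<bar> * K1" using x(1) K1(1) by (intro order_trans[OF K1(2)] mult_right_mono) auto
      show "norm (projection (nemytskii g x)) \<le> C2 * K2" using C2(2)[OF x(1) x(1)] K2(1) by (intro order_trans[OF K2(2)] mult_right_mono) auto
    qed
    also have "\<dots> \<le> C'" using K1(1) by (simp add: C'_def)
    finally show "norm (acc_ext g F x s) \<le> C'" .
    have "acc_ext g F x s - acc_ext g F x' s = - stiffness_op (x - x') - projection (nemytskii g x - nemytskii g x')"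
      unfolding acc_ext_def by (simp add: linear_diff[OF bounded_linear.linear[OF bounded_linear_ops(1)]]
        linear_diff[OF bounded_linear.linear[OF bounded_linear_ops(2)]])
    then have "norm (acc_ext g F x s - acc_ext g F x' s) \<le> norm (stiffness_op (x - x')) + norm (projection (nemytskii g x - nemytskii g x'))"
      using norm_triangle_ineq4[of "- stiffness_op (x - x')"] by simp
    also have "\<dots> \<le> norm (x - x') * K1 + C2 * norm (x - x') * K2"
      using C2(2)[OF x] K2(1) by (intro add_mono K1(2) order_trans[OF K2(2)] mult_right_mono) auto
    also have "\<dots> = (K1 + C2 * K2) * norm (x - x')" by (simp add: algebra_simps)
    also have "\<dots> \<le> C' * norm (x - x')" using K1(1) by (intro mult_right_mono) (auto simp: C'_def)
    finally show "norm (acc_ext g F x s - acc_ext g F x' s) \<le> C' * norm (x - x')" .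
  qed
qed

section \<open>The space-time form\<close>

lemma vec_poly_eval_continuous:
  assumes "vec_poly S m q"
  shows "continuous_on UNIV (\<lambda>p :: 'a \<times> real. apply_bcontfun (q (snd p)) (fst p))"
proof -
  obtain a where a: "\<And>s. q s = (\<Sum>i\<le>m. s ^ i *\<^sub>R a i)" using assms unfolding vec_poly_def by auto
  have lin: "linear (\<lambda>u :: 'a \<Rightarrow>\<^sub>C real. apply_bcontfun u x)" for x by (rule linearI) auto
  have "apply_bcontfun (q s) x = (\<Sum>i\<le>m. s ^ i * apply_bcontfun (a i) x)" for s x
    unfolding a linear_sum[OF lin] by simp
  moreover have "continuous_on UNIV (\<lambda>p :: 'a \<times> real. \<Sum>i\<le>m. snd p ^ i * apply_bcontfun (a i) (fst p))"
    by (intro continuous_intros continuous_on_compose2[OF continuous_on_apply_bcontfun]) auto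
  ultimately show ?thesis by simp
qed

text \<open>Integration over the space variable first turns the integrand into the mass form of two
  polynomials, which is a polynomial in time.\<close>
lemma slab_integral:
  assumes q: "vec_poly S m q" and r: "vec_poly S l r" and ab: "a < b"
  defines "f \<equiv> \<lambda>p. indicator (\<Omega> \<times> {a<..<b}) p *\<^sub>R (apply_bcontfun (q (snd p)) (fst p) * apply_bcontfun (r (snd p)) (fst p))"
  shows "integrable lborel f" "(LINT p|lborel. f p) = integral {a..b} (\<lambda>s. mass \<Omega> (q s) (r s))"
proof -
  have op: "open (\<Omega> \<times> {a<..<b})" using \<Omega>(1) by (intro open_Times) auto
  have bd: "bounded (\<Omega> \<times> {a<..<b})" using \<Omega>(2) by (intro bounded_Times) auto
  have cont: "continuous_on UNIV (\<lambda>p :: 'a \<times> real. apply_bcontfun (q (snd p)) (fst p) * apply_bcontfun (r (snd p)) (fst p))"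
    by (intro continuous_on_mult vec_poly_eval_continuous[OF q] vec_poly_eval_continuous[OF r])
  have "compact ((\<lambda>p :: 'a \<times> real. apply_bcontfun (q (snd p)) (fst p) * apply_bcontfun (r (snd p)) (fst p)) ` closure (\<Omega> \<times> {a<..<b}))"
    using bd cont by (intro compact_continuous_image) (auto intro: continuous_on_subset)
  from compact_imp_bounded[OF this] obtain C where
    C': "\<forall>y\<in>(\<lambda>p :: 'a \<times> real. apply_bcontfun (q (snd p)) (fst p) * apply_bcontfun (r (snd p)) (fst p)) ` closure (\<Omega> \<times> {a<..<b}). norm y \<le> C"
    unfolding bounded_iff by blast
  have C: "\<bar>apply_bcontfun (q (snd p)) (fst p) * apply_bcontfun (r (snd p)) (fst p)\<bar> \<le> C"
    if "p \<in> closure (\<Omega> \<times> {a<..<b})" for p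
    using bspec[OF C' imageI[OF that]] by simp
  have fm[measurable]: "f \<in> borel_measurable lborel"
    unfolding f_def using borel_measurable_continuous_on_indicator[OF _ continuous_on_subset[OF cont]] op by simp
  show int: "integrable lborel f"
  proof (rule Bochner_Integration.integrable_bound)
    have "\<Omega> \<times> {a<..<b} \<in> lmeasurable" using op bd by (simp add: bounded_set_imp_lmeasurable)
    then have "emeasure lborel (\<Omega> \<times> {a<..<b}) < \<infinity>" using op by (simp add: fmeasurable_def)
    then show "integrable lborel (\<lambda>p. indicator (\<Omega> \<times> {a<..<b}) p *\<^sub>R C)"
      using op by (intro integrable_scaleR_left integrable_real_indicator) auto
    have "norm (f p) \<le> norm (indicator (\<Omega> \<times> {a<..<b}) p *\<^sub>R C)" for p
      using C[of p] closure_subset[of "\<Omega> \<times> {a<..<b}"] by (auto simp: f_def indicator_def)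
    then show "AE p in lborel. norm (f p) \<le> norm (indicator (\<Omega> \<times> {a<..<b}) p *\<^sub>R C)" by simp
  qed fact
  have inner: "(LINT x|lborel. f (x, s)) = indicator {a<..<b} s * mass \<Omega> (q s) (r s)" for s
  proof -
    have m: "(\<lambda>x. indicator \<Omega> x *\<^sub>R (apply_bcontfun (q s) x \<bullet> apply_bcontfun (r s) x)) \<in> borel_measurable lborel"
      using borel_measurable_continuous_on_indicator[of \<Omega> "\<lambda>x. apply_bcontfun (q s) x \<bullet> apply_bcontfun (r s) x"] \<Omega>(1)
      by (auto intro!: continuous_intros)
    have "(LINT x|lborel. f (x, s)) = (LINT x|lborel. indicator {a<..<b} s * (indicator \<Omega> x *\<^sub>R (apply_bcontfun (q s) x \<bullet> apply_bcontfun (r s) x)))"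
      by (rule Bochner_Integration.integral_cong) (auto simp: f_def indicator_def)
    also have "\<dots> = indicator {a<..<b} s * mass \<Omega> (q s) (r s)"
      unfolding mass_def L2_inner_def set_lebesgue_integral_def integral_completion[OF m] by simp
    finally show ?thesis .
  qed
  have int2: "integrable (lborel \<Otimes>\<^sub>M lborel) (\<lambda>(x, s). f (x, s))" using int by (simp add: lborel_prod)
  obtain P where P: "\<And>s. mass \<Omega> (q s) (r s) = poly P s" using M_vec_poly[OF q r] by auto
  have si: "set_integrable lebesgue {a<..<b} (poly P)"
    by (rule set_integrable_subset[of lebesgue "{a..b}", OF absolutely_integrable_continuous_real])
      (auto intro!: continuous_on_poly continuous_on_id)
  have "(LINT p|lborel. f p) = (LINT p|(lborel \<Otimes>\<^sub>M lborel). f p)" by (simp add: lborel_prod)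
  also have "\<dots> = (LINT s|lborel. LINT x|lborel. f (x, s))"
    using lborel_pair.integral_snd[OF int2] by simp
  also have "\<dots> = (LINT s|lborel. indicator {a<..<b} s *\<^sub>R poly P s)" unfolding inner P by simp
  also have "\<dots> = (LINT s:{a<..<b}|lebesgue. poly P s)"
    unfolding set_lebesgue_integral_def
    by (rule integral_completion[symmetric])
      (use borel_measurable_continuous_on_indicator[of "{a<..<b}" "poly P"] continuous_on_poly[OF continuous_on_id, of "{a<..<b}" P] in simp)
  also have "\<dots> = integral {a<..<b} (poly P)" using set_lebesgue_integral_eq_integral(2)[OF si] .
  also have "\<dots> = integral {a..b} (poly P)" by (simp add: integral_open_interval_real)
  finally show "(LINT p|lborel. f p) = integral {a..b} (\<lambda>s. mass \<Omega> (q s) (r s))" by (simp add: P)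
qed

lemma vector_derivative_on_slab:
  assumes "\<forall>s\<in>{a..b}. U s = u s" "vec_poly S p u" "s \<in> {a<..<b}"
  shows "vector_derivative U (at s) = vector_derivative u (at s)"
proof -
  have "(u has_vector_derivative vector_derivative u (at s)) (at s)" by (rule vec_poly_deriv(2)[OF subspace assms(2)])
  then have "(U has_vector_derivative vector_derivative u (at s)) (at s)"
    by (rule has_vector_derivative_transform_within_open[where S = "{a<..<b}"]) (use assms in auto)
  then show ?thesis by (rule vector_derivative_at)
qed

text \<open>The mesh nodes, where the piecewise polynomials need not be differentiable, form a null set of
  times.\<close>
lemma spacetime_integral:
  assumes mesh: "time_mesh T N t" and T: "T > 0" and U: "pieces N t p U u" and W: "pieces N t p W w"
  shows "L2_inner (\<Omega> \<times> {0<..<T}) (\<lambda>(x, s). apply_bcontfun (vector_derivative U (at s)) x)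
      (\<lambda>(x, s). apply_bcontfun (vector_derivative W (at s)) x) =
    (\<Sum>n\<in>{1..N}. integral {t (n-1)..t n} (\<lambda>s. mass \<Omega> (vector_derivative (u n) (at s)) (vector_derivative (w n) (at s))))"
proof -
  define f where "f n p = indicator (\<Omega> \<times> {t (n-1)<..<t n}) p *\<^sub>R
      (apply_bcontfun (vector_derivative (u n) (at (snd p))) (fst p) * apply_bcontfun (vector_derivative (w n) (at (snd p))) (fst p))" for n p
  have uw: "vec_poly S p (u n)" "vec_poly S p (w n)" "\<forall>s\<in>{t (n-1)..t n}. U s = u n s" "\<forall>s\<in>{t (n-1)..t n}. W s = w n s"
    if "n \<in> {1..N}" for n
    using U W that unfolding pieces_def by auto
  have f: "integrable lborel (f n)" "(LINT p|lborel. f n p) =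
      integral {t (n-1)..t n} (\<lambda>s. mass \<Omega> (vector_derivative (u n) (at s)) (vector_derivative (w n) (at s)))"
    if n: "n \<in> {1..N}" for n
    unfolding f_def[abs_def] using slab_integral[OF vec_poly_deriv(1)[OF subspace uw(1)[OF n]] vec_poly_deriv(1)[OF subspace uw(2)[OF n]] time_mesh_step[OF mesh n]]
    by auto
  have t0: "t 0 = 0" "t N = T" using mesh by (auto simp: time_mesh_def)
  \<comment> \<open>the integrand is a sum over the open slabs outside a null set of times\<close>
  have pw: "indicator (\<Omega> \<times> {0<..<T}) (x, s) *\<^sub>R (apply_bcontfun (vector_derivative U (at s)) x \<bullet> apply_bcontfun (vector_derivative W (at s)) x) =
      (\<Sum>n\<in>{1..N}. f n (x, s))" if s: "s \<notin> t ` {..N}" for x s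
  proof (cases "x \<in> \<Omega> \<and> s \<in> {0<..<T}")
    case True
    then obtain n where n: "n \<in> {1..N}" "s \<in> {t (n-1)..t n}" using time_mesh_cover[OF mesh T, of s] by auto
    have "s \<noteq> t (n-1)" "s \<noteq> t n" using s n(1) by auto
    then have sn: "s \<in> {t (n-1)<..<t n}" using n(2) by auto
    have "f m (x, s) = 0" if "m \<in> {1..N} - {n}" for m
    proof -
      have "s \<notin> {t (m-1)<..<t m}"
      proof (cases "m < n")
        case True
        then have "t m \<le> t (n-1)" using n(1) by (intro time_mesh_mono[OF mesh]) auto
        then show ?thesis using sn by auto
      next
        case False
        then have "t n \<le> t (m-1)" using that n(1) by (intro time_mesh_mono[OF mesh]) auto
        then show ?thesis using sn by auto
      qed
      then show ?thesis by (simp add: f_def)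
    qed
    then have "(\<Sum>m\<in>{1..N} - {n}. f m (x, s)) = 0" by (intro sum.neutral) blast
    then have "(\<Sum>m\<in>{1..N}. f m (x, s)) = f n (x, s)" using sum.remove[of "{1..N}" n "\<lambda>m. f m (x, s)"] n(1) by simp
    also have "\<dots> = apply_bcontfun (vector_derivative U (at s)) x * apply_bcontfun (vector_derivative W (at s)) x"
      using vector_derivative_on_slab[OF uw(3)[OF n(1)] uw(1)[OF n(1)] sn]
        vector_derivative_on_slab[OF uw(4)[OF n(1)] uw(2)[OF n(1)] sn] sn True
      by (simp add: f_def)
    finally show ?thesis using True by simp
  next
    case False
    have "f m (x, s) = 0" if m: "m \<in> {1..N}" for m
      using False time_mesh_slab[OF mesh m] by (auto simp: f_def indicator_def)
    then show ?thesis using False by (auto simp: indicator_def)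
  qed
  have "finite (t ` {..N})" by simp
  then have nullA: "t ` {..N} \<in> null_sets lborel" by (rule finite_imp_null_set_lborel)
  have "UNIV \<times> t ` {..N} \<in> null_sets (lborel \<Otimes>\<^sub>M lborel :: ('a \<times> real) measure)"
  proof (rule null_setsI)
    show "emeasure (lborel \<Otimes>\<^sub>M lborel) (UNIV \<times> t ` {..N} :: ('a \<times> real) set) = 0"
      using nullA by (subst lborel.emeasure_pair_measure_Times) (auto simp: null_sets_def)
    show "(UNIV \<times> t ` {..N} :: ('a \<times> real) set) \<in> sets (lborel \<Otimes>\<^sub>M lborel)"
      using nullA by (intro pair_measureI) (auto simp: null_sets_def)
  qed
  then have "AE p in lborel. p \<notin> (UNIV \<times> t ` {..N} :: ('a \<times> real) set)"
    unfolding lborel_prod by (rule AE_not_in)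
  then have ae: "AE p in lebesgue. p \<notin> (UNIV \<times> t ` {..N} :: ('a \<times> real) set)" by (rule AE_completion)
  let ?g = "\<lambda>p. indicator (\<Omega> \<times> {0<..<T}) p *\<^sub>R ((case p of (x, s) \<Rightarrow> apply_bcontfun (vector_derivative U (at s)) x) \<bullet>
      (case p of (x, s) \<Rightarrow> apply_bcontfun (vector_derivative W (at s)) x))"
  have fm: "(\<lambda>p. \<Sum>n\<in>{1..N}. f n p) \<in> borel_measurable lborel"
    using f(1) by (intro borel_measurable_sum borel_measurable_integrable)
  have aeq: "AE p in lebesgue. (\<Sum>n\<in>{1..N}. f n p) = ?g p"
    using ae
  proof eventually_elim
    case (elim p)
    obtain x s where p: "p = (x, s)" by (cases p)
    then have "s \<notin> t ` {..N}" using elim by auto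
    from pw[OF this, of x] show ?case unfolding p prod.case by (rule sym)
  qed
  have "(LINT p|lebesgue. ?g p) = (LINT p|lebesgue. (\<Sum>n\<in>{1..N}. f n p))"
  proof (rule integral_cong_AE)
    show "(\<lambda>p. \<Sum>n\<in>{1..N}. f n p) \<in> borel_measurable lebesgue" using fm by (rule measurable_completion)
    then show "?g \<in> borel_measurable lebesgue"
      using aeq by (rule borel_measurable_AE)
    show "AE p in lebesgue. ?g p = (\<Sum>n\<in>{1..N}. f n p)" using aeq by eventually_elim simp
  qed
  also have "\<dots> = (LINT p|lborel. (\<Sum>n\<in>{1..N}. f n p))" by (rule integral_completion[OF fm])
  also have "\<dots> = (\<Sum>n\<in>{1..N}. LINT p|lborel. f n p)" using f(1) by (intro Bochner_Integration.integral_sum) auto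
  also have "\<dots> = (\<Sum>n\<in>{1..N}. integral {t (n-1)..t n} (\<lambda>s. mass \<Omega> (vector_derivative (u n) (at s)) (vector_derivative (w n) (at s))))"
    using f(2) by (intro sum.cong) auto
  finally show ?thesis unfolding L2_inner_def set_lebesgue_integral_def .
qed

text \<open>At a quadrature node \<open>U\<close> has values in \<open>S\<close>, so the acceleration tested with \<open>W\<close> is the load minus
  the stiffness and the nonlinear term. By linearity the three quadrature sums of the scheme become
  one.\<close>
theorem spacetime_scheme_iff:
  assumes mesh: "time_mesh T N t" and T: "T > 0"
    and nodes: "\<And>j. j \<in> I \<Longrightarrow> 0 \<le> nodes j \<and> nodes j \<le> 1"
    and F: "\<And>s. s \<in> {0..T} \<Longrightarrow> in_L2 \<Omega> (F s)"
    and g: "\<And>w. w \<in> S \<Longrightarrow> in_L2 \<Omega> (\<lambda>x. g (apply_bcontfun w x))"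
  shows "spacetime_scheme \<Omega> c g F S N t p u0 v0 I nodes U \<longleftrightarrow>
    galerkin_scheme (semidisc_acc \<Omega> c g F S) p I nodes N t u0 v0 U"
proof -
  have tN: "t N = T" using mesh by (simp add: time_mesh_def)
  let ?k = "semidisc_acc \<Omega> c g F S"
  let ?eq = "\<lambda>W. - L2_inner (\<Omega> \<times> {0<..<t N})
          (\<lambda>(x, s). apply_bcontfun (vector_derivative U (at s)) x)
          (\<lambda>(x, s). apply_bcontfun (vector_derivative W (at s)) x)
      + quad_inner \<Omega> N t I nodes (\<lambda>s x. (c x)\<^sup>2 *\<^sub>R weak_grad \<Omega> (U s) x) (\<lambda>s. weak_grad \<Omega> (W s))
      + quad_inner \<Omega> N t I nodes (\<lambda>s x. g (apply_bcontfun (U s) x)) (\<lambda>s. apply_bcontfun (W s))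
      = quad_inner \<Omega> N t I nodes F (\<lambda>s. apply_bcontfun (W s))
      + L2_inner \<Omega> (apply_bcontfun v0) (apply_bcontfun (W 0))"
  have eq: "?eq W \<longleftrightarrow> (\<Sum>n\<in>{1..N}. weak_form ?k I nodes (t (n-1)) (t n) (u n) (w n)) + mass \<Omega> v0 (W 0) = 0"
    if U: "pieces N t p U u" and W: "pieces N t p W w" for u w W
  proof -
    let ?\<tau> = "\<lambda>n j. t (n-1) + nodes j * (t n - t (n-1))"
    let ?Q = "\<lambda>f. \<Sum>n\<in>{1..N}. (t n - t (n-1)) * (\<Sum>j\<in>I. quad_weight I nodes j * f n j)"
    have k: "mass \<Omega> (?k (u n (?\<tau> n j)) (?\<tau> n j)) (w n (?\<tau> n j)) =
        load (F (?\<tau> n j)) (W (?\<tau> n j)) - stiffness (U (?\<tau> n j)) (W (?\<tau> n j)) - load (\<lambda>x. g (apply_bcontfun (U (?\<tau> n j)) x)) (W (?\<tau> n j))"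
      if n: "n \<in> {1..N}" and j: "j \<in> I" for n j
    proof -
      have \<tau>: "?\<tau> n j \<in> {t (n-1)..t n}" using nodes[OF j] time_mesh_step[OF mesh n] by (intro slab_node_mem) auto
      have \<tau>T: "?\<tau> n j \<in> {0..T}" using \<tau> time_mesh_slab[OF mesh n] by auto
      have e: "U (?\<tau> n j) = u n (?\<tau> n j)" "W (?\<tau> n j) = w n (?\<tau> n j)" "vec_poly S p (u n)" "vec_poly S p (w n)"
        using U W n \<tau> unfolding pieces_def by auto
      have uS: "u n (?\<tau> n j) \<in> S" "w n (?\<tau> n j) \<in> S" using S_mem[OF e(3)] S_mem[OF e(4)] by auto
      show ?thesis unfolding e(1,2)
        using semidisc_acc_eq(1)[where F = F and g = g and s = "?\<tau> n j", OF uS(1) F[OF \<tau>T] g[OF uS(1)]]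
          semidisc_acc_eq(3)[where F = F and g = g and s = "?\<tau> n j", OF uS(1) F[OF \<tau>T] g[OF uS(1)] uS(2)] by simp
    qed
    have "(\<Sum>n\<in>{1..N}. weak_form ?k I nodes (t (n-1)) (t n) (u n) (w n)) =
        (\<Sum>n\<in>{1..N}. integral {t (n-1)..t n} (\<lambda>s. mass \<Omega> (vector_derivative (u n) (at s)) (vector_derivative (w n) (at s)))) +
        ?Q (\<lambda>n j. mass \<Omega> (?k (u n (?\<tau> n j)) (?\<tau> n j)) (w n (?\<tau> n j)))"
      unfolding weak_form_def by (simp add: sum.distrib)
    also have "?Q (\<lambda>n j. mass \<Omega> (?k (u n (?\<tau> n j)) (?\<tau> n j)) (w n (?\<tau> n j))) =
        ?Q (\<lambda>n j. load (F (?\<tau> n j)) (W (?\<tau> n j)) - stiffness (U (?\<tau> n j)) (W (?\<tau> n j)) - load (\<lambda>x. g (apply_bcontfun (U (?\<tau> n j)) x)) (W (?\<tau> n j)))"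
      using k by (intro sum.cong arg_cong2[of _ _ _ _ "(*)"] refl) auto
    also have "\<dots> = ?Q (\<lambda>n j. load (F (?\<tau> n j)) (W (?\<tau> n j))) - ?Q (\<lambda>n j. stiffness (U (?\<tau> n j)) (W (?\<tau> n j))) -
        ?Q (\<lambda>n j. load (\<lambda>x. g (apply_bcontfun (U (?\<tau> n j)) x)) (W (?\<tau> n j)))"
      by (simp add: right_diff_distrib sum_subtractf)
    finally show ?thesis
      using spacetime_integral[OF mesh T U W] unfolding tN quad_inner_def load_def stiffness_def mass_def by linarith
  qed
  show ?thesis
  proof
    assume L: "spacetime_scheme \<Omega> c g F S N t p u0 v0 I nodes U"
    then obtain u where u: "pieces N t p U u"
      using tensor_time_space_iff[OF mesh T] unfolding spacetime_scheme_def tN pieces_def by blast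
    have "(\<Sum>n\<in>{1..N}. weak_form ?k I nodes (t (n-1)) (t n) (u n) (w n)) + mass \<Omega> v0 (W 0) = 0"
      if W: "W (t N) = 0" "pieces N t p W w" for W w
    proof -
      have "W \<in> tensor (t N) S (time_space0 N t p)"
        using tensor_time_space0_iff[OF mesh T, of W p] W unfolding tN pieces_def by blast
      then have "?eq W" using L unfolding spacetime_scheme_def by blast
      then show ?thesis using eq[OF u W(2)] by blast
    qed
    then show "galerkin_scheme ?k p I nodes N t u0 v0 U"
      unfolding galerkin_scheme_def using u L unfolding spacetime_scheme_def by blast
  next
    assume R: "galerkin_scheme ?k p I nodes N t u0 v0 U"
    then obtain u where u: "pieces N t p U u" "U 0 = u0" "\<And>W w. W (t N) = 0 \<Longrightarrow> pieces N t p W w \<Longrightarrow>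
        (\<Sum>n\<in>{1..N}. weak_form ?k I nodes (t (n-1)) (t n) (u n) (w n)) + mass \<Omega> v0 (W 0) = 0"
      unfolding galerkin_scheme_def by blast
    have "?eq W" if W: "W \<in> tensor (t N) S (time_space0 N t p)" for W
    proof -
      obtain w where w: "W (t N) = 0" "pieces N t p W w"
        using tensor_time_space0_iff[OF mesh T, of W p] W unfolding tN pieces_def by blast
      show ?thesis using eq[OF u(1) w(2)] u(3)[OF w] by blast
    qed
    moreover have "U \<in> tensor (t N) S (time_space N t p)"
      using tensor_time_space_iff[OF mesh T, of U p] u(1) unfolding tN pieces_def by blast
    ultimately show "spacetime_scheme \<Omega> c g F S N t p u0 v0 I nodes U"
      unfolding spacetime_scheme_def using u(2) by blast
  qed
qed

end

section \<open>Equivalence and symplecticity\<close>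

lemma fem_space_from_mesh:
  fixes \<Omega> :: "'a::euclidean_space set"
  assumes dom: "polytopal_lipschitz_domain \<Omega>"
    and c: "continuous_on (closure \<Omega>) c"
    and mesh: "conforming_simplicial_mesh \<Omega> \<T>"
    and S: "subspace S" "S \<subseteq> pw_polynomials \<Omega> \<T> px" "\<And>w. w \<in> S \<Longrightarrow> apply_bcontfun w \<in> H1_0 \<Omega>"
  shows "\<exists>C. fem_space \<Omega> c S C"
proof -
  have \<Omega>: "open \<Omega>" "bounded \<Omega>" using dom by (auto simp: polytopal_lipschitz_domain_def)
  have "compact (c ` closure \<Omega>)" using c \<Omega>(2) by (intro compact_continuous_image) auto
  from compact_imp_bounded[OF this] obtain C where C: "\<forall>y\<in>c ` closure \<Omega>. norm y \<le> C"
    unfolding bounded_iff by blast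
  have T: "finite \<T>" "\<Union>\<T> = closure \<Omega>"
    using mesh by (auto simp: conforming_simplicial_mesh_def triangulation_def)
  have "fem_space \<Omega> c S C"
  proof
    show "set_borel_measurable lebesgue \<Omega> c"
      using continuous_on_subset[OF c closure_subset] by (rule set_borel_measurable_continuous_lebesgue[OF \<Omega>(1)])
    show "\<bar>c x\<bar> \<le> C" if "x \<in> \<Omega>" for x using C that closure_subset[of \<Omega>] by auto
    show "apply_bcontfun w x = 0" if "w \<in> S" "x \<notin> \<Omega>" for w x
      using S(2) that unfolding pw_polynomials_def by blast
    show "\<exists>B. finite B \<and> B \<subseteq> S \<and> S \<subseteq> span B" by (rule pw_polynomials_finite_dim[OF T S(1,2)])
  qed (use \<Omega> S in auto)
  then show ?thesis by blast
qed

lemma (in fem_space) symplectic_form_eq: "symplectic_form \<Omega> = sform"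
  by (intro ext) (simp add: symplectic_form_def sform_def mass_def)

lemma (in fem_space) symplectic_methodI:
  assumes exists: "\<And>y. y \<in> S \<times> S \<Longrightarrow> \<exists>h>0. \<exists>D. y \<in> D \<and> (\<forall>s0 s1. s0 < s1 \<and> {s0..s1} \<subseteq> {0..T} \<and> s1 - s0 < h \<longrightarrow>
      (\<exists>Q \<Psi>. one_step_map (S \<times> S) (R s0 s1) D Q \<Psi>))"
    and invariant: "\<And>s0 s1 D Q \<Psi> y. s0 < s1 \<Longrightarrow> {s0..s1} \<subseteq> {0..T} \<Longrightarrow> one_step_map (S \<times> S) (R s0 s1) D Q \<Psi> \<Longrightarrow> y \<in> D \<Longrightarrow>
      \<Psi> y \<in> S \<times> S \<and> (\<exists>\<Psi>'. (\<Psi> has_derivative \<Psi>') (at y within S \<times> S) \<and>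
        (\<forall>\<xi>\<in>S \<times> S. \<forall>\<eta>\<in>S \<times> S. sform (\<Psi>' \<xi>) (\<Psi>' \<eta>) = sform \<xi> \<eta>))"
  shows "symplectic_method \<Omega> (S \<times> S) T R"
  unfolding symplectic_method_def
proof (intro conjI ballI allI impI)
  fix y assume y: "y \<in> S \<times> S"
  have "{s0..s1} \<subseteq> {0..T} \<longleftrightarrow> 0 \<le> s0 \<and> s1 \<le> T" if "s0 < s1" for s0 s1 :: real
    using that by auto
  then have "s0 < s1 \<and> {s0..s1} \<subseteq> {0..T} \<and> s1 - s0 < h \<longleftrightarrow> 0 \<le> s0 \<and> s0 < s1 \<and> s1 \<le> T \<and> s1 - s0 < h" for s0 s1 h
    by blast
  from exists[OF y, unfolded this]
  show "\<exists>h>0. \<exists>D. y \<in> D \<and> (\<forall>s0 s1. 0 \<le> s0 \<and> s0 < s1 \<and> s1 \<le> T \<and> s1 - s0 < h \<longrightarrow>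
        (\<exists>Q \<Psi>. one_step_map (S \<times> S) (R s0 s1) D Q \<Psi>))" .
next
  fix s0 s1 D Q \<Psi> assume "0 \<le> s0 \<and> s0 < s1 \<and> s1 \<le> T \<and> one_step_map (S \<times> S) (R s0 s1) D Q \<Psi>"
  then show "symplectic_map \<Omega> (S \<times> S) D \<Psi>"
    unfolding symplectic_map_def symplectic_form_eq using invariant[of s0 s1 D Q \<Psi>] by auto
qed

theorem theorem3p8:
  fixes \<Omega> :: "'a::euclidean_space set"
    and c U0 V0 :: "'a \<Rightarrow> real" and c0 T \<sigma> :: real
    and F :: "real \<Rightarrow> 'a \<Rightarrow> real" and g :: "real \<Rightarrow> real"
    and \<T> :: "'a set set" and px pt N :: nat and t :: "nat \<Rightarrow> real"
    and S :: "('a \<Rightarrow>\<^sub>C real) set" and U0h V0h :: "'a \<Rightarrow>\<^sub>C real"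
  assumes dim: "DIM('a) \<in> {1, 2, 3}"
    and dom: "polytopal_lipschitz_domain \<Omega>"
    and T: "T > 0"
    and c: "continuous_on (closure \<Omega>) c" "c0 > 0" "\<And>x. x \<in> \<Omega> \<Longrightarrow> c0 \<le> c x"
    and U0: "U0 \<in> H1_0 \<Omega>"
    and V0: "in_L2 \<Omega> V0"
    and F: "\<And>s. s \<in> {0..T} \<Longrightarrow> in_L2 \<Omega> (F s)"
      "\<And>s. s \<in> {0..T} \<Longrightarrow>
        ((\<lambda>r. LINT x:\<Omega>|lebesgue. (F r x - F s x)\<^sup>2) \<longlongrightarrow> 0) (at s within {0..T})"
    and g0: "g 0 = 0"
    and px: "px \<ge> 1" and pt: "pt \<ge> 1"
    and mesh: "conforming_simplicial_mesh \<Omega> \<T>" "shape_regular \<sigma> \<T>"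
    and S: "subspace S" "S \<subseteq> pw_polynomials \<Omega> \<T> px" "\<And>w. w \<in> S \<Longrightarrow> apply_bcontfun w \<in> H1_0 \<Omega>"
    and gS: "\<And>w. w \<in> S \<Longrightarrow> in_L2 \<Omega> (\<lambda>x. g (apply_bcontfun w x))"
    and tmesh: "time_mesh T N t"
    and U0h: "U0h \<in> S"
      "\<And>W. W \<in> S \<Longrightarrow> L2_inner \<Omega> (\<lambda>x. (c x)\<^sup>2 *\<^sub>R weak_grad \<Omega> U0h x) (weak_grad \<Omega> W) =
        L2_inner \<Omega> (\<lambda>x. (c x)\<^sup>2 *\<^sub>R weak_grad \<Omega> U0 x) (weak_grad \<Omega> W)"
    and V0h: "V0h \<in> S"
      "\<And>W. W \<in> S \<Longrightarrow> L2_inner \<Omega> (apply_bcontfun V0h) (apply_bcontfun W) =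
        L2_inner \<Omega> V0 (apply_bcontfun W)"
  shows "(\<forall>U. GLe_scheme \<Omega> c g F S N t pt U0h V0h U \<longleftrightarrow>
            (\<exists>y q. time_stepping (semidisc_gauss_step \<Omega> c g F S pt) N t (U0h, V0h) y q \<and>
              (\<forall>n\<in>{1..N}. \<forall>s\<in>{t (n-1)..t n}. U s = fst (q n s)))) \<and>
         (\<forall>U. GLo_scheme \<Omega> c g F S N t pt U0h V0h U \<longleftrightarrow>
            (\<exists>y q. time_stepping (semidisc_lobatto_step \<Omega> c g F S pt) N t (U0h, V0h) y q \<and>
              (\<forall>n\<in>{1..N}. \<forall>s\<in>{t (n-1)..t n}. U s = fst (q n s)))) \<and>
         ((\<forall>x. g differentiable (at x)) \<and> continuous_on UNIV (deriv g) \<longrightarrow>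
            symplectic_method \<Omega> (S \<times> S) T (semidisc_gauss_step \<Omega> c g F S pt) \<and>
            symplectic_method \<Omega> (S \<times> S) T (semidisc_lobatto_step \<Omega> c g F S pt))"
proof -
  obtain C where "fem_space \<Omega> c S C" using fem_space_from_mesh[OF dom c(1) mesh(1) S] by blast
  then interpret fem_space \<Omega> c S C .
  let ?k = "semidisc_acc \<Omega> c g F S"
  have kS: "?k x s \<in> S" if "x \<in> S" "s \<in> {0..T}" for x s
    using semidisc_acc_eq(1,2)[where F = F and g = g and s = s, OF that(1) F(1)[OF that(2)] gS[OF that(1)]] by simp
  have gauss: "GLe_scheme \<Omega> c g F S N t pt U0h V0h U \<longleftrightarrow>
      (\<exists>y q. time_stepping (semidisc_gauss_step \<Omega> c g F S pt) N t (U0h, V0h) y q \<and>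
        (\<forall>n\<in>{1..N}. \<forall>s\<in>{t (n-1)..t n}. U s = fst (q n s)))" for U
  proof -
    have "GLe_scheme \<Omega> c g F S N t pt U0h V0h U \<longleftrightarrow> galerkin_scheme ?k pt {1..pt} (gauss_node pt) N t U0h V0h U"
      unfolding GLe_scheme_def using gauss_node_bounds
      by (intro spacetime_scheme_iff[OF tmesh T]) (auto simp: less_imp_le intro: F(1) gS)
    then show ?thesis
      unfolding semidisc_gauss_step_def
      using gauss_scheme_iff_time_stepping[OF tmesh T U0h(1) V0h(1) pt, of ?k U] kS by simp
  qed
  have lobatto: "GLo_scheme \<Omega> c g F S N t pt U0h V0h U \<longleftrightarrow>
      (\<exists>y q. time_stepping (semidisc_lobatto_step \<Omega> c g F S pt) N t (U0h, V0h) y q \<and>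
        (\<forall>n\<in>{1..N}. \<forall>s\<in>{t (n-1)..t n}. U s = fst (q n s)))" for U
  proof -
    have "GLo_scheme \<Omega> c g F S N t pt U0h V0h U \<longleftrightarrow> galerkin_scheme ?k pt {0..pt} (lobatto_node pt) N t U0h V0h U"
      unfolding GLo_scheme_def using lobatto_node_bounds[OF pt]
      by (intro spacetime_scheme_iff[OF tmesh T]) (auto intro: F(1) gS)
    then show ?thesis
      unfolding semidisc_lobatto_step_def
      using lobatto_scheme_iff_time_stepping[OF tmesh T U0h(1) V0h(1) pt, of ?k U] kS by simp
  qed
  have "symplectic_method \<Omega> (S \<times> S) T (semidisc_gauss_step \<Omega> c g F S pt) \<and>
      symplectic_method \<Omega> (S \<times> S) T (semidisc_lobatto_step \<Omega> c g F S pt)"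
    if g: "\<forall>x. g differentiable (at x)" and g': "continuous_on UNIV (deriv g)"
  proof -
    have dg: "(g has_real_derivative deriv g x) (at x)" for x
      using g by (simp add: DERIV_deriv_iff_real_differentiable)
    have gc: "continuous_on UNIV g" using DERIV_continuous_on has_field_derivative_at_within[OF dg] by blast
    interpret galerkin_flow S "mass \<Omega>" basis ?k "acc_ext g F" "{0..T}"
      by (rule galerkin_flow_semidisc[OF dg g' F])
    have kd: "\<exists>A. ((\<lambda>x. ?k x s) has_derivative A) (at x within S) \<and> (\<forall>a\<in>S. \<forall>b\<in>S. mass \<Omega> (A a) b = mass \<Omega> a (A b))"
      if x: "x \<in> S" and s: "s \<in> {0..T}" for x s
    proof (intro exI conjI ballI)
      let ?A = "\<lambda>h. - stiffness_op h - projection (bmult (nemytskii (deriv g) x) h)"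
      show "((\<lambda>x. ?k x s) has_derivative ?A) (at x within S)"
        by (rule has_derivative_transform[OF x _ has_derivative_at_withinI[OF acc_ext_derivative[OF dg g']]])
          (rule k_eq[OF _ s])
      show "mass \<Omega> (?A a) b = mass \<Omega> a (?A b)" if "a \<in> S" "b \<in> S" for a b
        by (rule acc_derivative_symmetric[OF that])
    qed
    have "symplectic_method \<Omega> (S \<times> S) T (semidisc_gauss_step \<Omega> c g F S pt)"
      unfolding semidisc_gauss_step_def
    proof (rule symplectic_methodI)
      fix y assume "y \<in> S \<times> S"
      then show "\<exists>h>0. \<exists>D. y \<in> D \<and> (\<forall>s0 s1. s0 < s1 \<and> {s0..s1} \<subseteq> {0..T} \<and> s1 - s0 < h \<longrightarrow>
          (\<exists>Q \<Psi>. one_step_map (S \<times> S) (gauss_rk_step (S \<times> S) pt (\<lambda>s (u, v). (v, ?k u s)) s0 s1) D Q \<Psi>))"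
        by (rule gauss_one_step_map_exists[OF pt])
    qed (rule gauss_one_step_map_symplectic[OF pt _ _ kd])
    moreover have "symplectic_method \<Omega> (S \<times> S) T (semidisc_lobatto_step \<Omega> c g F S pt)"
      unfolding semidisc_lobatto_step_def
    proof (rule symplectic_methodI)
      fix y assume "y \<in> S \<times> S"
      then show "\<exists>h>0. \<exists>D. y \<in> D \<and> (\<forall>s0 s1. s0 < s1 \<and> {s0..s1} \<subseteq> {0..T} \<and> s1 - s0 < h \<longrightarrow>
          (\<exists>Q \<Psi>. one_step_map (S \<times> S) (lobatto_pair_step S S pt (\<lambda>v s. v) ?k s0 s1) D Q \<Psi>))"
        by (rule lobatto_one_step_map_exists[OF pt])
    qed (rule lobatto_one_step_map_symplectic[OF pt _ _ kS kd])
    ultimately show ?thesis ..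
  qed
  then show ?thesis using gauss lobatto by blast
qed

end
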